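(* Let $\mathcal{W}$ be a linear 3-web on a connected open subset $M\subset\mathbb{P}^2$ which admits another, distinct linearization. Let $x_0\in M$ be a reference point. (1) If the web curvature of $\mathcal{W}$ vanishes at $x_0$ up to order three, then the web curvature vanishes identically on $M$, and $\mathcal{W}$ is algebraic. (2) If one of the three foliations of $\mathcal{W}$ is a pencil, the same conclusion holds assuming only that the web curvature vanishes at $x_0$ up to order two. (3) If two of the three foliations of $\mathcal{W}$ are pencils, the same conclusion holds assuming only that the web curvature vanishes at $x_0$ up to order one.
   Context: Complex holomorphic category; $\mathbb{P}^2$ is the complex projective plane. A (planar) 3-web on a surface is a triple of pairwise transversal foliations by curves. A 3-web on an open subset of $\mathbb{P}^2$ is linear if every leaf is an open piece of a projective line. A linearization of a 3-web $\mathcal{W}$ on $M$ is an immersion $\varphi:M\to\mathbb{P}^2$ mapping every leaf into a line; two linearizations are equivalent if they differ by a projective transformation of $\mathbb{P}^2$, and distinct otherwise. Thus "$\mathcal{W}$ admits another distinct linearization" means there is a linearization of $\mathcal{W}$ which is not the restriction to $M$ of a projective transformation. Web curvature: locally choose holomorphic 1-forms $\omega^1,\omega^2,\omega^3$ with $\omega^i\wedge\omega^j\neq0$ for $i\neq j$, such that the leaves of the $i$-th foliation are the integral curves of $\omega^i=0$, normalized so that $\omega^1+\omega^2+\omega^3=0$; there is a unique 1-form $\rho$ with $d\omega^i+\rho\wedge\omega^i=0$ for $i=1,2,3$, and the web curvature $K$ is defined by $d\rho=K\,\omega^1\wedge\omega^2$. Under rescaling $\omega^i\mapsto\lambda\omega^i$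 one gets $K\mapsto\lambda^{-2}K$, so $K$ is a relative invariant. The web curvature vanishes at $x_0$ up to order $s$ if $K$ and all its partial derivatives of order $\le s$ (in local coordinates) vanish at $x_0$; this is independent of the normalization and of coordinates. A pencil is the foliation of an open subset of $\mathbb{P}^2$ by the lines through a fixed point. $\mathcal{W}$ is algebraic if it is (locally) the web obtained from a reduced plane cubic curve $\Gamma\subset(\mathbb{P}^2)^*$ by the dual construction: near a generic point $x$, the dual line of $x$ meets $\Gamma$ in three distinct points, and the three foliations have as leaves the lines corresponding to the points of the three local branches of $\Gamma$. *)

theory Defs
  imports "HOL-Analysis.Analysis"
begin

text \<open>Points of P^2 are the punctured complex lines through 0 in C^3.
  The dual plane is modelled by the same type: a point l of it stands for the
  line {p. incid p l}.\<close>

typedef P2 = "{S :: (complex^3) set. \<exists>v. v \<noteq> 0 \<and> S = {c *s v | c. c \<noteq> 0}}"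
  by (rule exI[where x="{c *s (1::complex^3) | c. c \<noteq> 0}"], rule CollectI,
      rule exI[where x="1::complex^3"]) (simp add: vec_eq_iff)

definition proj :: "complex^3 \<Rightarrow> P2" where
  "proj v = Abs_P2 {c *s v | c. c \<noteq> 0}"

definition rep :: "P2 \<Rightarrow> complex^3" where
  "rep p = (SOME v. v \<noteq> 0 \<and> proj v = p)"

definition bil :: "complex^3 \<Rightarrow> complex^3 \<Rightarrow> complex" where
  "bil v w = (\<Sum>i\<in>UNIV. v $ i * w $ i)"

definition incid :: "P2 \<Rightarrow> P2 \<Rightarrow> bool" where
  "incid p l \<longleftrightarrow> bil (rep p) (rep l) = 0"

definition ptrans :: "complex^3^3 \<Rightarrow> P2 \<Rightarrow> P2" where
  "ptrans A p = proj (A *v rep p)"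

definition chartvec :: "nat \<Rightarrow> complex \<times> complex \<Rightarrow> complex^3" where
  "chartvec k z = (if k = 0 then vector [1, fst z, snd z]
                   else if k = 1 then vector [fst z, 1, snd z]
                   else vector [fst z, snd z, 1])"

definition chart :: "nat \<Rightarrow> complex \<times> complex \<Rightarrow> P2" where
  "chart k z = proj (chartvec k z)"

definition chartinv :: "nat \<Rightarrow> P2 \<Rightarrow> complex \<times> complex" where
  "chartinv k p = (SOME z. chart k z = p)"

definition P2open :: "P2 set \<Rightarrow> bool" where
  "P2open M \<longleftrightarrow> (\<forall>k\<in>{0,1,2}. open (chart k -` M))"

definition P2connected :: "P2 set \<Rightarrow> bool" where
  "P2connected M \<longleftrightarrow> \<not> (\<exists>A B. P2open A \<and> P2open B \<and> A \<inter> M \<noteq> {} \<and> B \<inter> M \<noteq> {}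
      \<and> M \<subseteq> A \<union> B \<and> A \<inter> B \<inter> M = {})"

definition cscale :: "complex \<Rightarrow> complex \<times> complex \<Rightarrow> complex \<times> complex" where
  "cscale c w = (c * fst w, c * snd w)"

definition holo2 :: "(complex \<times> complex \<Rightarrow> complex) \<Rightarrow> (complex \<times> complex) set \<Rightarrow> bool" where
  "holo2 f U \<longleftrightarrow> open U \<and> (\<forall>z\<in>U. \<exists>f'. (f has_derivative f') (at z)
        \<and> (\<forall>c w. f' (cscale c w) = c * f' w))"

definition pdx :: "(complex \<times> complex \<Rightarrow> complex) \<Rightarrow> complex \<times> complex \<Rightarrow> complex" where
  "pdx f z = deriv (\<lambda>t. f (t, snd z)) (fst z)"

definition pdy :: "(complex \<times> complex \<Rightarrow> complex) \<Rightarrow> complex \<times> complex \<Rightarrow> complex" where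
  "pdy f z = deriv (\<lambda>t. f (fst z, t)) (snd z)"

definition pd :: "nat \<Rightarrow> nat \<Rightarrow> (complex \<times> complex \<Rightarrow> complex) \<Rightarrow> complex \<times> complex \<Rightarrow> complex" where
  "pd i j f = (pdx ^^ i) ((pdy ^^ j) f)"

definition local_rep :: "nat \<Rightarrow> nat \<Rightarrow> (P2 \<Rightarrow> P2) \<Rightarrow> complex \<times> complex \<Rightarrow> complex \<times> complex" where
  "local_rep k k' \<phi> = chartinv k' \<circ> \<phi> \<circ> chart k"

definition holo_map_on :: "P2 set \<Rightarrow> (P2 \<Rightarrow> P2) \<Rightarrow> bool" where
  "holo_map_on M \<phi> \<longleftrightarrow> (\<forall>p\<in>M. \<exists>k\<in>{0,1,2}. \<exists>k'\<in>{0,1,2}. \<exists>U.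
      p \<in> chart k ` U \<and> chart k ` U \<subseteq> M \<and> \<phi> ` chart k ` U \<subseteq> range (chart k')
      \<and> holo2 (fst \<circ> local_rep k k' \<phi>) U \<and> holo2 (snd \<circ> local_rep k k' \<phi>) U)"

definition holo_immersion_on :: "P2 set \<Rightarrow> (P2 \<Rightarrow> P2) \<Rightarrow> bool" where
  "holo_immersion_on M \<phi> \<longleftrightarrow> (\<forall>p\<in>M. \<exists>k\<in>{0,1,2}. \<exists>k'\<in>{0,1,2}. \<exists>U.
      p \<in> chart k ` U \<and> chart k ` U \<subseteq> M \<and> \<phi> ` chart k ` U \<subseteq> range (chart k')
      \<and> holo2 (fst \<circ> local_rep k k' \<phi>) U \<and> holo2 (snd \<circ> local_rep k k' \<phi>) U
      \<and> (\<forall>z\<in>U. pdx (fst \<circ> local_rep k k' \<phi>) z * pdy (snd \<circ> local_rep k k' \<phi>) z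
               - pdy (fst \<circ> local_rep k k' \<phi>) z * pdx (snd \<circ> local_rep k k' \<phi>) z \<noteq> 0))"

text \<open>A linear foliation on M is encoded by the map l assigning to each p the
  (dual point of the) line containing the leaf through p. The leaf through p is
  an open piece of l p, hence l is constant on l p near p.\<close>
definition lin_fol :: "P2 set \<Rightarrow> (P2 \<Rightarrow> P2) \<Rightarrow> bool" where
  "lin_fol M l \<longleftrightarrow> holo_map_on M l \<and> (\<forall>p\<in>M. incid p (l p))
     \<and> (\<forall>p\<in>M. \<exists>N. P2open N \<and> p \<in> N \<and> N \<subseteq> M \<and> (\<forall>q\<in>N. incid q (l p) \<longrightarrow> l q = l p))"

definition linear_3web :: "P2 set \<Rightarrow> (P2 \<Rightarrow> P2) \<Rightarrow> (P2 \<Rightarrow> P2) \<Rightarrow> (P2 \<Rightarrow> P2) \<Rightarrow> bool" where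
  "linear_3web M l1 l2 l3 \<longleftrightarrow> P2open M \<and> lin_fol M l1 \<and> lin_fol M l2 \<and> lin_fol M l3
     \<and> (\<forall>p\<in>M. l1 p \<noteq> l2 p \<and> l1 p \<noteq> l3 p \<and> l2 p \<noteq> l3 p)"

definition maps_leaves_to_lines :: "P2 set \<Rightarrow> (P2 \<Rightarrow> P2) \<Rightarrow> (P2 \<Rightarrow> P2) \<Rightarrow> bool" where
  "maps_leaves_to_lines M l \<phi> \<longleftrightarrow> (\<forall>p\<in>M. \<exists>N L. P2open N \<and> p \<in> N \<and> N \<subseteq> M
      \<and> (\<forall>q\<in>N. incid q (l p) \<longrightarrow> incid (\<phi> q) L))"

definition linearization :: "P2 set \<Rightarrow> (P2 \<Rightarrow> P2) \<Rightarrow> (P2 \<Rightarrow> P2) \<Rightarrow> (P2 \<Rightarrow> P2) \<Rightarrow> (P2 \<Rightarrow> P2) \<Rightarrow> bool" where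
  "linearization M l1 l2 l3 \<phi> \<longleftrightarrow> holo_immersion_on M \<phi>
     \<and> maps_leaves_to_lines M l1 \<phi> \<and> maps_leaves_to_lines M l2 \<phi> \<and> maps_leaves_to_lines M l3 \<phi>"

definition is_pencil :: "P2 set \<Rightarrow> (P2 \<Rightarrow> P2) \<Rightarrow> bool" where
  "is_pencil M l \<longleftrightarrow> (\<exists>c. \<forall>p\<in>M. incid c (l p))"

text \<open>Coefficients (w.r.t. dx, dy in chart k) of the differential of the affine
  function z \<mapsto> bil v (chartvec k z); its kernel is the direction of the line v.\<close>
definition lgrad :: "nat \<Rightarrow> complex^3 \<Rightarrow> complex \<times> complex" where
  "lgrad k v = (if k = 0 then (v $ 2, v $ 3) else if k = 1 then (v $ 1, v $ 3) else (v $ 1, v $ 2))"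

text \<open>The 1-form a dx + b dy defines, on U (chart k), the foliation l.\<close>
definition defines_fol :: "nat \<Rightarrow> (P2 \<Rightarrow> P2) \<Rightarrow> (complex \<times> complex) set
    \<Rightarrow> (complex \<times> complex \<Rightarrow> complex) \<Rightarrow> (complex \<times> complex \<Rightarrow> complex) \<Rightarrow> bool" where
  "defines_fol k l U a b \<longleftrightarrow> holo2 a U \<and> holo2 b U \<and> (\<forall>z\<in>U. (a z, b z) \<noteq> (0, 0)
     \<and> a z * snd (lgrad k (rep (l (chart k z)))) - b z * fst (lgrad k (rep (l (chart k z)))) = 0)"

text \<open>d(a dx + b dy) + (r dx + s dy) \<and> (a dx + b dy) = 0\<close>
definition structure_eq :: "(complex \<times> complex) set \<Rightarrow> (complex \<times> complex \<Rightarrow> complex) \<Rightarrow> (complex \<times> complex \<Rightarrow> complex)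
    \<Rightarrow> (complex \<times> complex \<Rightarrow> complex) \<Rightarrow> (complex \<times> complex \<Rightarrow> complex) \<Rightarrow> bool" where
  "structure_eq U a b r s \<longleftrightarrow> (\<forall>z\<in>U. pdx b z - pdy a z + (r z * b z - s z * a z) = 0)"

text \<open>The web curvature of (l1,l2,l3) vanishes at p up to order n: in an affine
  chart around p there are normalized forms (omega^1+omega^2+omega^3=0) defining the
  foliations, the connection form rho and the curvature K with
  d rho = K omega^1 \<and> omega^2, such that all partial derivatives of K of order \<le> n vanish at p.\<close>
definition wc_vanish :: "P2 set \<Rightarrow> (P2 \<Rightarrow> P2) \<Rightarrow> (P2 \<Rightarrow> P2) \<Rightarrow> (P2 \<Rightarrow> P2) \<Rightarrow> P2 \<Rightarrow> nat \<Rightarrow> bool" where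
  "wc_vanish M l1 l2 l3 p n \<longleftrightarrow> (\<exists>k\<in>{0,1,2}. \<exists>U a1 b1 a2 b2 a3 b3 r s K.
      p \<in> chart k ` U \<and> chart k ` U \<subseteq> M
      \<and> defines_fol k l1 U a1 b1 \<and> defines_fol k l2 U a2 b2 \<and> defines_fol k l3 U a3 b3
      \<and> (\<forall>z\<in>U. a1 z + a2 z + a3 z = 0 \<and> b1 z + b2 z + b3 z = 0)
      \<and> holo2 r U \<and> holo2 s U \<and> holo2 K U
      \<and> structure_eq U a1 b1 r s \<and> structure_eq U a2 b2 r s \<and> structure_eq U a3 b3 r s
      \<and> (\<forall>z\<in>U. pdx s z - pdy r z = K z * (a1 z * b2 z - b1 z * a2 z))
      \<and> (\<forall>i j. i + j \<le> n \<longrightarrow> pd i j K (chartinv k p) = 0))"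

definition cubic_form :: "(complex^3 \<Rightarrow> complex) \<Rightarrow> bool" where
  "cubic_form F \<longleftrightarrow> (\<exists>c :: 3 \<Rightarrow> 3 \<Rightarrow> 3 \<Rightarrow> complex.
      \<forall>v. F v = (\<Sum>i\<in>UNIV. \<Sum>j\<in>UNIV. \<Sum>k\<in>UNIV. c i j k * v $ i * v $ j * v $ k))"

text \<open>A cubic form is reduced iff it is nonzero and has no repeated factor; a
  repeated factor of a cubic must be linear.\<close>
definition reduced_cubic :: "(complex^3 \<Rightarrow> complex) \<Rightarrow> bool" where
  "reduced_cubic F \<longleftrightarrow> cubic_form F \<and> (\<exists>v. F v \<noteq> 0)
     \<and> \<not> (\<exists>L G. L \<noteq> 0 \<and> (\<forall>v. F v = (bil L v)^2 * bil G v))"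

definition algebraic_web :: "P2 set \<Rightarrow> (P2 \<Rightarrow> P2) \<Rightarrow> (P2 \<Rightarrow> P2) \<Rightarrow> (P2 \<Rightarrow> P2) \<Rightarrow> bool" where
  "algebraic_web M l1 l2 l3 \<longleftrightarrow> (\<exists>F. reduced_cubic F
     \<and> (\<forall>p\<in>M. F (rep (l1 p)) = 0 \<and> F (rep (l2 p)) = 0 \<and> F (rep (l3 p)) = 0))"

end

theory Submission
  imports Defs "HOL-Complex_Analysis.Complex_Analysis"
begin

text \<open>
  Let \<open>e1, e2\<close> be the frame dual to \<open>\<omega>1, \<omega>2\<close>, let \<open>Di\<close> denote covariant differentiation along \<open>ei\<close>
  with respect to the connection form \<open>\<rho>\<close>, and write \<open>K = 3k\<close>. A linearization \<open>(F, G)\<close> determines a function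
  \<open>a\<close> of weight one for which \<open>D1 D1 a\<close> and \<open>D2 D2 a\<close> are prescribed by the lower derivatives of \<open>a\<close> and
  by \<open>D2 D1 a\<close>. Integrability of this system is a third-order equation \<open>C(a) = 0\<close> on the curvature,
  linear in the jet of \<open>k\<close> up to terms of higher vanishing order. The web is linear, so
  the inclusion of \<open>M\<close> also yields such a solution \<open>a\<close>, next to the solution \<open>b\<close> of the other linearization;
  if \<open>a = b\<close> the two differ by a projective transformation.

  Otherwise compare lowest-order homogeneous parts at \<open>x0\<close> in the formal power series ring:
  the leading form of \<open>b - a\<close> has degree at most two, and the leading parts of \<open>C(a) = 0\<close> and
  \<open>C(b) - C(a) = 0\<close>, together with one further equation for each pencil, force the leading form of \<open>k\<close>
  to vanish as soon as its degree exceeds the stated order. Hence \<open>K = 0\<close> near \<open>x0\<close>.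

  If \<open>K = 0\<close>, a solution \<open>h\<close> of \<open>dh = - h \<rho>\<close> turns the product of the three forms, divided by the square of
  their Wronskian, into a binary cubic form that is constant along every straight line, so it is
  the restriction of a cubic form on the dual plane, and the three foliations lie on it
  (the Graf-Sauer theorem). By the identity theorem they do so on all of \<open>M\<close>. Conversely a web on a cubic
  has zero curvature everywhere. A cubic with a repeated line would confine \<open>M\<close> to two points.
\<close>

section \<open>Linearizations in a differential ring\<close>

text \<open>The orders three, two and one come from counting jets. Let the leading form of
  \<open>k\<close> have degree \<open>n\<close>. The compatibility condition has principal part
  \<open>dX (dX (dY k)) - dX (dY (dY k))\<close>, so all jets of degree \<open>n\<close> except the
  two pure ones coincide and three numbers remain. One pencil expresses \<open>D2 1 a\<close>
  through \<open>D1 1 a\<close>, so integrability appears already at second order in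
  \<open>k\<close>, with principal part \<open>dX (dX k) - dX (dY k)\<close>: two numbers remain.
  Two pencils give both first derivatives of \<open>a\<close>, principal part
  \<open>dX k - dY k\<close>, and one number. The difference \<open>l = b - a\<close> supplies the
  linear equations that remove these numbers. Its own leading form obeys
  \<open>dX (dX l) = 2 * dX (dY l) = dY (dY l)\<close>, whose polynomial solutions are spanned by 1,
  \<open>X\<close>, \<open>Y\<close> and \<open>X^2 + X*Y + Y^2\<close>; each type of leading form
  gives its own linear system. From \<open>n\<close> equal to 4, 3 and 2 on, these systems have
  enough equations. Formal series serve here because they form an integral domain containing 1/3 and
  because leading forms are read off jet by jet.\<close>

text \<open>\<open>E1, E2\<close> are the derivations along the dual frame and \<open>r1, r2\<close> the components of \<open>\<rho>\<close>;
  \<open>D1 w, D2 w\<close> act on relative invariants of weight \<open>w\<close>, and the factor 3 in \<open>K = 3k\<close> removes denominators.\<close>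

locale web_ring =
  fixes E1 E2 :: "'r::idom \<Rightarrow> 'r" and r1 r2 k third :: 'r
  assumes E1_add: "E1 (f + g) = E1 f + E1 g" and E1_mult: "E1 (f * g) = E1 f * g + f * E1 g"
    and E2_add: "E2 (f + g) = E2 f + E2 g" and E2_mult: "E2 (f * g) = E2 f * g + f * E2 g"
    and E_comm: "E1 (E2 f) - E2 (E1 f) = r1 * E2 f - r2 * E1 f"
    and curv: "E1 r2 - E2 r1 = 3 * k"
    and third: "3 * third = (1::'r)"
begin

lemma E_0 [simp]: "E1 0 = 0" "E2 0 = 0"
  using E1_add[of 0 0] E2_add[of 0 0] by (metis add_cancel_left_right add_0)+

lemma E_1 [simp]: "E1 1 = 0" "E2 1 = 0"
  using E1_mult[of 1 1] E2_mult[of 1 1] by (metis add_cancel_left_right mult_1 mult_1_right)+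

lemma E_minus: "E1 (- f) = - E1 f" "E2 (- f) = - E2 f"
  using E1_add[of f "- f"] E2_add[of f "- f"] by (auto simp: eq_neg_iff_add_eq_0 add.commute)

lemma E_diff: "E1 (f - g) = E1 f - E1 g" "E2 (f - g) = E2 f - E2 g"
  using E1_add[of f "- g"] E2_add[of f "- g"] by (auto simp: E_minus)

lemma E_of_nat [simp]: "E1 (of_nat n) = 0" "E2 (of_nat n) = 0"
  by (induction n) (auto simp: E1_add E2_add)

lemma E_numeral [simp]: "E1 (numeral n) = 0" "E2 (numeral n) = 0"
  using E_of_nat(1)[of "numeral n"] E_of_nat(2)[of "numeral n"] by (simp_all only: of_nat_numeral)

lemmas E_simps = E1_add E2_add E1_mult E2_mult E_minus E_diff

lemma three:
  fixes x :: 'r assumes "3 * x = 0" shows "x = 0"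
proof -
  have "x = third * (3 * x)"
    using arg_cong[OF third, of "\<lambda>y. y * x"] by (simp only: mult_1_left mult.assoc mult.left_commute)
  then show ?thesis using assms by simp
qed

lemma three_eq: "3 * (x - y) = 0 \<Longrightarrow> x = (y::'r)"
  using three[of "x - y"] by simp

definition D1 :: "'r \<Rightarrow> 'r \<Rightarrow> 'r" where "D1 w f = E1 f - w * r1 * f"
definition D2 :: "'r \<Rightarrow> 'r \<Rightarrow> 'r" where "D2 w f = E2 f - w * r2 * f"

lemma E_D: "E1 f = D1 w f + w * r1 * f" "E2 f = D2 w f + w * r2 * f"
  by (simp_all add: D1_def D2_def)

text \<open>The bracket term in \<open>E_comm\<close> is absorbed because each derivative raises the
  weight by one, hence the outer \<open>w + 1\<close>. What survives is the curvature, acting on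
  \<open>f\<close> in proportion to its weight.\<close>

lemma D_comm:
  assumes "E1 w = 0" "E2 w = 0"
  shows "D1 (w + 1) (D2 w f) - D2 (w + 1) (D1 w f) = - 3 * w * k * f"
proof -
  have "D1 (w + 1) (D2 w f) - D2 (w + 1) (D1 w f)
      = (E1 (E2 f) - E2 (E1 f)) - (r1 * E2 f - r2 * E1 f) - w * f * (E1 r2 - E2 r1)"
    by (simp add: D1_def D2_def E_simps assms) (simp add: algebra_simps)
  then show ?thesis by (simp add: E_comm curv)
qed

text \<open>The equations satisfied by the invariant \<open>a\<close> of a linearization.\<close>

definition lin_sol :: "'r \<Rightarrow> bool" where
  "lin_sol a \<longleftrightarrow>
     D1 2 (D1 1 a) = 2 * D2 2 (D1 1 a) - 3 * k * a + 3 * a * (D1 1 a - 2 * D2 1 a) - D1 2 k \<and>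
     D2 2 (D2 1 a) = 2 * D2 2 (D1 1 a) - 3 * k * a + 3 * a * (2 * D1 1 a - D2 1 a) - D2 2 k"

text \<open>The system prescribes all second covariant derivatives of \<open>a\<close> except
  \<open>h\<close>. Commuting derivatives on \<open>a1\<close> and on \<open>a2\<close> gives two
  linear equations for the derivatives \<open>h1\<close>, \<open>h2\<close> of \<open>h\<close>,
  with determinant 3, so the system closes at third order. The commutator on \<open>h\<close> is the
  remaining integrability condition; it contains no derivative of \<open>a\<close> beyond
  \<open>h\<close>.\<close>

lemma lin_sol_compat:
  fixes a :: 'r
  assumes "lin_sol a"
  defines "a1 \<equiv> D1 1 a" and "a2 \<equiv> D2 1 a"
  defines "h \<equiv> D2 2 a1" and "k1 \<equiv> D1 2 k" and "k2 \<equiv> D2 2 k"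
  shows "D1 4 (D1 3 k2) - D1 4 (D2 3 k2) + 3 * a * (D1 3 k1 - D1 3 k2 + D2 3 k2)
    + (12 * a1 - 6 * a2) * k1 + (12 * a2 - 6 * a1) * k2
    + k * (24 * h + 72 * a * (a1 - a2) - 45 * k * a - 27 * a ^ 3) + 3 * k * k1 - 18 * k * k2 = 0"
proof -
  define h1 h2 where "h1 = D1 3 h" and "h2 = D2 3 h"
  define k20 k11 k02 where "k20 = D1 3 k1" and "k11 = D1 3 k2" and "k02 = D2 3 k2"
  define k21 k12 where "k21 = D1 4 k11" and "k12 = D1 4 k02"
  define a11 where "a11 = 2 * h - 3 * k * a + 3 * a * (a1 - 2 * a2) - k1"
  define a22 where "a22 = 2 * h - 3 * k * a + 3 * a * (2 * a1 - a2) - k2"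
  have Da: "E1 a = a1 + r1 * a" "E2 a = a2 + r2 * a"
    using E_D[of a 1] by (simp_all add: a1_def a2_def)
  have a21: "D1 2 a2 = h - 3 * k * a"
    using D_comm[of 1 a] by (simp add: h_def a1_def a2_def algebra_simps)
  have a11: "D1 2 a1 = a11" and a22: "D2 2 a2 = a22"
    using assms(1) unfolding lin_sol_def a11_def a22_def a1_def a2_def h_def k1_def k2_def by auto
  have Da1: "E1 a1 = a11 + 2 * r1 * a1" "E2 a1 = h + 2 * r2 * a1"
    using E_D[of a1 2] a11 h_def by auto
  have Da2: "E1 a2 = h - 3 * k * a + 2 * r1 * a2" "E2 a2 = a22 + 2 * r2 * a2"
    using E_D[of a2 2] a21 a22 by auto
  have Dh: "E1 h = h1 + 3 * r1 * h" "E2 h = h2 + 3 * r2 * h"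
    using E_D[of h 3] by (auto simp: h1_def h2_def)
  have Dk: "E1 k = k1 + 2 * r1 * k" "E2 k = k2 + 2 * r2 * k"
    using E_D[of k 2] by (auto simp: k1_def k2_def)
  have k12': "D2 3 k1 = k11 + 6 * k * k"
    using D_comm[of 2 k] by (simp add: k1_def k2_def k11_def algebra_simps)
  have Dk1: "E1 k1 = k20 + 3 * r1 * k1" "E2 k1 = k11 + 6 * k * k + 3 * r2 * k1"
    using E_D[of k1 3] k12' by (auto simp: k20_def)
  have Dk2: "E1 k2 = k11 + 3 * r1 * k2" "E2 k2 = k02 + 3 * r2 * k2"
    using E_D[of k2 3] by (auto simp: k11_def k02_def)
  have k112: "D2 4 k11 = k12 + 9 * k * k2"
    using D_comm[of 3 k2] by (simp add: k11_def k02_def k12_def algebra_simps)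
  have Dk11: "E1 k11 = k21 + 4 * r1 * k11" "E2 k11 = k12 + 9 * k * k2 + 4 * r2 * k11"
    using E_D[of k11 4] k112 by (auto simp: k21_def)
  note R1 = Da Da1 Da2 Dh Dk Dk1 Dk2
  have "D1 3 h - D2 3 (D1 2 a1) = - 6 * k * a1"
    using D_comm[of 2 a1] by (simp add: h_def)
  then have "h1 - D2 3 a11 + 6 * k * a1 = 0" by (simp add: h1_def a11)
  then have e1: "h1 - 2 * h2 + 9*a*h - 3*a*k2 + 36*a^2*a1 - 18*a^2*a2 - 18*a^2*k - 3*a1*a2
      + 6*a1*k + 3*a2*k + 6*a2^2 + 6*k^2 + k11 = 0"
    unfolding D2_def a11_def by (simp add: E_simps R1 a11_def a22_def) (simp add: algebra_simps power2_eq_square)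
  have "D1 3 (D2 2 a2) - D2 3 (D1 2 a2) = - 6 * k * a2"
    using D_comm[of 2 a2] by simp
  then have "D1 3 a22 - D2 3 (h - 3 * k * a) + 6 * k * a2 = 0" by (simp add: a21 a22)
  then have e2: "2 * h1 - h2 + 9*a*h + 3*a*k2 - 9*a*k1 + 18*a^2*a1 - 36*a^2*a2 - 9*a^2*k - 3*a1*a2
      - 3*a1*k + 9*a2*k + 6*a1^2 - k11 = 0"
    unfolding D1_def D2_def a22_def by (simp add: E_simps R1 a11_def a22_def) (simp add: algebra_simps power2_eq_square)
  \<comment> \<open>The combinations 2 \<open>e2\<close> - \<open>e1\<close> and \<open>e2\<close> -
    2 \<open>e1\<close> isolate \<open>3 * h1\<close> and \<open>3 * h2\<close>.\<close>
  have "3 * (h1 - (- 3*a*h - 3*a*k2 + 6*a*k1 + 18*a^2*a2 + a1*a2 + 4*a1*k - 4*a1^2 - 5*a2*k + 2*a2^2 + 2*k^2 + k11)) = 0"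
    using e1 e2 by algebra
  then have h1: "h1 = - 3*a*h - 3*a*k2 + 6*a*k1 + 18*a^2*a2 + a1*a2 + 4*a1*k - 4*a1^2 - 5*a2*k + 2*a2^2 + 2*k^2 + k11"
    by (rule three_eq)
  have "3 * (h2 - (3*a*h - 3*a*k2 + 3*a*k1 + 18*a^2*a1 - 9*a^2*k - a1*a2 + 5*a1*k - 2*a1^2 - a2*k + 4*a2^2 + 4*k^2 + k11)) = 0"
    using e1 e2 by algebra
  then have h2: "h2 = 3*a*h - 3*a*k2 + 3*a*k1 + 18*a^2*a1 - 9*a^2*k - a1*a2 + 5*a1*k - 2*a1^2 - a2*k + 4*a2^2 + 4*k^2 + k11"
    by (rule three_eq)
  have "D1 4 h2 - D2 4 h1 + 9 * k * h = 0"
    using D_comm[of 3 h] by (simp add: h1_def h2_def)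
  then have "E1 h2 - 4 * r1 * h2 - (E2 h1 - 4 * r2 * h1) + 9 * k * h = 0"
    unfolding D1_def D2_def .
  then show ?thesis
    unfolding k20_def[symmetric] k11_def[symmetric] k02_def[symmetric] k21_def[symmetric] k12_def[symmetric]
    by (simp add: h1 h2 E_simps R1 Dk11 power2_eq_square power3_eq_cube a11_def a22_def) (simp add: algebra_simps)
qed

text \<open>An affine coordinate \<open>F\<close> of a linearization is affine for a torsion-free connection with straight
  leaves; \<open>t1, t2\<close> are its projective ambiguity and \<open>a\<close> is what remains.\<close>

definition affine_sol :: "'r \<Rightarrow> 'r \<Rightarrow> 'r \<Rightarrow> 'r \<Rightarrow> bool" where
  "affine_sol a t1 t2 F \<longleftrightarrow>
     D1 1 (E1 F) = (a + 2 * t1) * E1 F \<and>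
     D1 1 (E2 F) = (a + t2) * E1 F + (t1 - a) * E2 F \<and>
     D2 1 (E2 F) = (2 * t2 - a) * E2 F"

lemma D_comm_0: "D2 1 (E1 F) = D1 1 (E2 F)"
  using E_comm[of F] by (simp add: D1_def D2_def algebra_simps)

text \<open>\<open>c1\<close>, \<open>c2\<close>, \<open>c3\<close> say that the image curves along
  \<open>e1\<close>, \<open>e2\<close> and \<open>e1 - e2\<close> have acceleration parallel to
  velocity. Cramer's rule with the inverse Jacobian \<open>J\<close> turns second derivatives into
  connection coefficients. The first two conditions remove one coefficient each and the third is one
  linear relation among the other four, so three parameters \<open>a\<close>, \<open>t1\<close>,
  \<open>t2\<close> are left.\<close>

lemma linearization_affine_sol:
  assumes J: "J * (E1 F * E2 G - E2 F * E1 G) = 1"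
    and c1: "E1 F * E1 (E1 G) = E1 G * E1 (E1 F)"
    and c2: "E2 F * E2 (E2 G) = E2 G * E2 (E2 F)"
    and c3: "(E1 F - E2 F) * (E1 (E1 G - E2 G) - E2 (E1 G - E2 G))
           = (E1 G - E2 G) * (E1 (E1 F - E2 F) - E2 (E1 F - E2 F))"
  obtains a t1 t2 where "affine_sol a t1 t2 F" "affine_sol a t1 t2 G"
proof -
  define F1 F2 G1 G2 where "F1 = E1 F" and "F2 = E2 F" and "G1 = E1 G" and "G2 = E2 G"
  define F11 F12 F22 where "F11 = D1 1 F1" and "F12 = D1 1 F2" and "F22 = D2 1 F2"
  define G11 G12 G22 where "G11 = D1 1 G1" and "G12 = D1 1 G2" and "G22 = D2 1 G2"
  note fd = F1_def F2_def G1_def G2_def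
  have J': "J * (F1 * G2 - F2 * G1) = 1" using J by (simp add: fd)
  have F21: "D2 1 F1 = F12" and G21: "D2 1 G1 = G12"
    by (simp_all add: F12_def G12_def fd D_comm_0)
  have Fs: "E1 F1 = F11 + r1 * F1" "E1 F2 = F12 + r1 * F2" "E2 F1 = F12 + r2 * F1" "E2 F2 = F22 + r2 * F2"
    using F21 by (auto simp: F11_def F12_def F22_def D1_def D2_def algebra_simps)
  have Gs: "E1 G1 = G11 + r1 * G1" "E1 G2 = G12 + r1 * G2" "E2 G1 = G12 + r2 * G1" "E2 G2 = G22 + r2 * G2"
    using G21 by (auto simp: G11_def G12_def G22_def D1_def D2_def algebra_simps)
  have d1: "F1 * G11 = G1 * F11" using c1 unfolding fd[symmetric] Fs Gs by (simp add: algebra_simps)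
  have d2: "F2 * G22 = G2 * F22" using c2 unfolding fd[symmetric] Fs Gs by (simp add: algebra_simps)
  have d3: "(F1 - F2) * (G11 - 2 * G12 + G22) = (G1 - G2) * (F11 - 2 * F12 + F22)"
    using c3 unfolding fd[symmetric] E_diff Fs Gs by (simp add: algebra_simps)
  define x11 where "x11 = J * (F11 * G2 - F2 * G11)"
  define x12 where "x12 = J * (F12 * G2 - F2 * G12)"
  define y12 where "y12 = J * (F1 * G12 - F12 * G1)"
  define y22 where "y22 = J * (F1 * G22 - F22 * G1)"
  have "x11 * F1 = F11 * (J * (F1 * G2 - F2 * G1)) + J * F2 * (G1 * F11 - F1 * G11)"
    "x11 * G1 = G11 * (J * (F1 * G2 - F2 * G1)) + J * G2 * (G1 * F11 - F1 * G11)"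
    by (simp_all add: x11_def algebra_simps)
  then have s11: "F11 = x11 * F1" "G11 = x11 * G1" by (simp_all add: J' d1)
  have "x12 * F1 + y12 * F2 = F12 * (J * (F1 * G2 - F2 * G1))"
    "x12 * G1 + y12 * G2 = G12 * (J * (F1 * G2 - F2 * G1))"
    by (simp_all add: x12_def y12_def algebra_simps)
  then have s12: "F12 = x12 * F1 + y12 * F2" "G12 = x12 * G1 + y12 * G2" by (simp_all add: J')
  have "y22 * F2 = F22 * (J * (F1 * G2 - F2 * G1)) + J * F1 * (F2 * G22 - G2 * F22)"
    "y22 * G2 = G22 * (J * (F1 * G2 - F2 * G1)) + J * G1 * (F2 * G22 - G2 * F22)"
    by (simp_all add: y22_def algebra_simps)
  then have s22: "F22 = y22 * F2" "G22 = y22 * G2" by (simp_all add: J' d2)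
  \<comment> \<open>The acceleration along \<open>e1 - e2\<close> is a multiple of
    \<open>e1 - e2\<close>, so its two components add up to zero.\<close>
  have "(x11 - 2 * x12 - 2 * y12 + y22) * (F1 * G2 - F2 * G1)
      = (F1 - F2) * (x11 * G1 - 2 * (x12 * G1 + y12 * G2) + y22 * G2)
        - (G1 - G2) * (x11 * F1 - 2 * (x12 * F1 + y12 * F2) + y22 * F2)"
    by (simp add: algebra_simps)
  then have "(x11 - 2 * x12 - 2 * y12 + y22) * (J * (F1 * G2 - F2 * G1)) = 0"
    using d3 unfolding s11[symmetric] s12[symmetric] s22[symmetric] by (simp add: mult.left_commute)
  then have "x11 - 2 * x12 - 2 * y12 + y22 = 0" by (simp add: J')
  then have rel: "y22 = 2 * x12 - x11 + 2 * y12" by (simp add: algebra_simps)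
  \<comment> \<open>A projective change adds twice as much to \<open>x11\<close> as to
    \<open>y12\<close>, so \<open>x11 - 2 * y12\<close> is the part not affected by it.\<close>
  define a where "a = third * (x11 - 2 * y12)"
  have a3: "3 * a = x11 - 2 * y12"
    unfolding a_def mult.assoc[symmetric] third by simp
  define t1 t2 where "t1 = y12 + a" and "t2 = x12 - a"
  have e: "a + 2 * t1 = x11" "a + t2 = x12" "t1 - a = y12" "2 * t2 - a = y22"
  proof -
    have "a + 2 * (y12 + a) = 3 * a + 2 * y12" "2 * (x12 - a) - a = 2 * x12 - 3 * a"
      by (simp_all add: algebra_simps)
    then show "a + 2 * t1 = x11" "a + t2 = x12" "t1 - a = y12" "2 * t2 - a = y22"
      unfolding t1_def t2_def a3 rel by simp_all
  qed
  show ?thesis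
  proof (rule that)
    show "affine_sol a t1 t2 F" "affine_sol a t1 t2 G"
      unfolding affine_sol_def e fd[symmetric] F11_def[symmetric] F12_def[symmetric] F22_def[symmetric]
        G11_def[symmetric] G12_def[symmetric] G22_def[symmetric]
      using s11 s12 s22 by auto
  qed
qed

lemma affine_sol_E:
  assumes "affine_sol a t1 t2 F"
  shows "E1 (E1 F) = (a + 2 * t1 + r1) * E1 F"
    "E1 (E2 F) = (a + t2) * E1 F + (t1 - a + r1) * E2 F"
    "E2 (E1 F) = (a + t2 + r2) * E1 F + (t1 - a) * E2 F"
    "E2 (E2 F) = (2 * t2 - a + r2) * E2 F"
proof -
  have e: "E1 (E1 F) - 1 * r1 * E1 F = (a + 2 * t1) * E1 F"
    "E1 (E2 F) - 1 * r1 * E2 F = (a + t2) * E1 F + (t1 - a) * E2 F"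
    "E2 (E2 F) - 1 * r2 * E2 F = (2 * t2 - a) * E2 F"
    "E2 (E1 F) - 1 * r2 * E1 F = E1 (E2 F) - 1 * r1 * E2 F"
    using assms D_comm_0[of F] unfolding affine_sol_def D1_def D2_def by blast+
  show "E1 (E1 F) = (a + 2 * t1 + r1) * E1 F"
    "E1 (E2 F) = (a + t2) * E1 F + (t1 - a + r1) * E2 F"
    "E2 (E2 F) = (2 * t2 - a + r2) * E2 F"
    using e(1-3) by (simp_all add: algebra_simps)
  show "E2 (E1 F) = (a + t2 + r2) * E1 F + (t1 - a) * E2 F"
    using e(4) unfolding e(2) by (simp add: algebra_simps)
qed

lemma wronskian_cancel:
  assumes "J * (F1 * G2 - F2 * G1) = (1::'r)" "x * F1 + y * F2 = 0" "x * G1 + y * G2 = 0"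
  shows "x = 0" "y = 0"
proof -
  have "x * (J * (F1 * G2 - F2 * G1)) = J * (G2 * (x * F1 + y * F2) - F2 * (x * G1 + y * G2))"
    "y * (J * (F1 * G2 - F2 * G1)) = J * (F1 * (x * G1 + y * G2) - G1 * (x * F1 + y * F2))"
    by (simp_all add: algebra_simps)
  then show "x = 0" "y = 0" unfolding assms by simp_all
qed

text \<open>A torsion-free connection with affine coordinates is flat. The commutator relation on
  \<open>E1 F\<close> and \<open>E2 F\<close> is linear in the gradient; it holds for
  \<open>F\<close> and for \<open>G\<close>, whose Jacobian is invertible, so its coefficients
  vanish. The resulting four equations fix all first derivatives of \<open>t1\<close> and
  \<open>t2\<close>.\<close>

lemma affine_sol_flat:
  assumes F: "affine_sol a t1 t2 F" and G: "affine_sol a t1 t2 G"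
    and J: "J * (E1 F * E2 G - E2 F * E1 G) = 1"
  shows "D1 1 t1 = D1 1 a - (a - t1) * (2 * a + t1)"
    "D2 1 t2 = - D2 1 a + (a + t2) * (t2 - 2 * a)"
    "D1 1 t2 = D1 1 a - D2 1 a + (a + t2) * (t1 - a) - k"
    "D2 1 t1 = D1 1 a - D2 1 a + (a + t2) * (t1 - a) + k"
proof -
  define u1 u2 v1 v2 where "u1 = D1 1 t1" and "u2 = D2 1 t1" and "v1 = D1 1 t2" and "v2 = D2 1 t2"
  define a1 a2 where "a1 = D1 1 a" and "a2 = D2 1 a"
  have Es: "E1 t1 = u1 + r1 * t1" "E2 t1 = u2 + r2 * t1" "E1 t2 = v1 + r1 * t2" "E2 t2 = v2 + r2 * t2"
     "E1 a = a1 + r1 * a" "E2 a = a2 + r2 * a"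
    by (simp_all add: u1_def u2_def v1_def v2_def a1_def a2_def D1_def D2_def)
  have A: "(a1 - a2 + v1 - 2 * u2 + (a + t2) * (t1 - a) + 3 * k) * E1 P
        + (u1 - a1 + (a - t1) * (2 * a + t1)) * E2 P = 0" if P: "affine_sol a t1 t2 P" for P
  proof -
    have "(a1 - a2 + v1 - 2 * u2 + (a + t2) * (t1 - a) + 3 * k) * E1 P
        + (u1 - a1 + (a - t1) * (2 * a + t1)) * E2 P
       = (E1 (E2 (E1 P)) - E2 (E1 (E1 P)) - (r1 * E2 (E1 P) - r2 * E1 (E1 P)))
         - E1 P * (E1 r2 - E2 r1 - 3 * k)"
      by (simp add: affine_sol_E[OF P] E_simps Es) (simp add: algebra_simps)
    then show ?thesis by (simp add: E_comm curv)
  qed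
  have B: "(- a2 - v2 + (a + t2) * (t2 - 2 * a)) * E1 P
        + (a2 - a1 + 2 * v1 - u2 - (a + t2) * (t1 - a) + 3 * k) * E2 P = 0" if P: "affine_sol a t1 t2 P" for P
  proof -
    have "(- a2 - v2 + (a + t2) * (t2 - 2 * a)) * E1 P
        + (a2 - a1 + 2 * v1 - u2 - (a + t2) * (t1 - a) + 3 * k) * E2 P
       = (E1 (E2 (E2 P)) - E2 (E1 (E2 P)) - (r1 * E2 (E2 P) - r2 * E1 (E2 P)))
         - E2 P * (E1 r2 - E2 r1 - 3 * k)"
      by (simp add: affine_sol_E[OF P] E_simps Es) (simp add: algebra_simps)
    then show ?thesis by (simp add: E_comm curv)
  qed
  note wA = wronskian_cancel[OF J A[OF F] A[OF G]]
  note wB = wronskian_cancel[OF J B[OF F] B[OF G]]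
  \<comment> \<open>\<open>wA(1)\<close> and \<open>wB(2)\<close> contain the unknowns only as
    \<open>v1 - 2 * u2\<close> and \<open>2 * v1 - u2\<close>, again with determinant 3.\<close>
  have "3 * (v1 - (a1 - a2 + (a + t2) * (t1 - a) - k))
      = 2 * (a2 - a1 + 2 * v1 - u2 - (a + t2) * (t1 - a) + 3 * k)
        - (a1 - a2 + v1 - 2 * u2 + (a + t2) * (t1 - a) + 3 * k)"
    "3 * (u2 - (a1 - a2 + (a + t2) * (t1 - a) + k))
      = (a2 - a1 + 2 * v1 - u2 - (a + t2) * (t1 - a) + 3 * k)
        - 2 * (a1 - a2 + v1 - 2 * u2 + (a + t2) * (t1 - a) + 3 * k)"
    by (simp_all add: algebra_simps)
  then have s3: "3 * (v1 - (a1 - a2 + (a + t2) * (t1 - a) - k)) = 0"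
     "3 * (u2 - (a1 - a2 + (a + t2) * (t1 - a) + k)) = 0"
    unfolding wA(1) wB(2) by simp_all
  show "D1 1 t1 = D1 1 a - (a - t1) * (2 * a + t1)"
    using wA(2) unfolding u1_def[symmetric] a1_def[symmetric] by (simp add: algebra_simps)
  show "D2 1 t2 = - D2 1 a + (a + t2) * (t2 - 2 * a)"
    using wB(1) unfolding v2_def[symmetric] a2_def[symmetric] by (simp add: algebra_simps)
  show "D1 1 t2 = D1 1 a - D2 1 a + (a + t2) * (t1 - a) - k"
    "D2 1 t1 = D1 1 a - D2 1 a + (a + t2) * (t1 - a) + k"
    using three_eq[OF s3(1)] three_eq[OF s3(2)] unfolding u2_def v1_def a1_def a2_def by auto
qed

text \<open>All first derivatives of \<open>t1\<close> and \<open>t2\<close> are known, so the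
  commutator relation for each of them is a condition in which \<open>t1\<close> and
  \<open>t2\<close> themselves cancel. The one for \<open>t1\<close> prescribes
  \<open>D1 2 (D1 1 a)\<close>, the one for \<open>t2\<close> prescribes
  \<open>D2 2 (D2 1 a)\<close>.\<close>

lemma affine_sol_lin_sol:
  assumes F: "affine_sol a t1 t2 F" and G: "affine_sol a t1 t2 G"
    and J: "J * (E1 F * E2 G - E2 F * E1 G) = 1"
  shows "lin_sol a"
proof -
  define a1 a2 where "a1 = D1 1 a" and "a2 = D2 1 a"
  define h k1 k2 where "h = D2 2 a1" and "k1 = D1 2 k" and "k2 = D2 2 k"
  define a11 a22 where "a11 = D1 2 a1" and "a22 = D2 2 a2"
  note fl = affine_sol_flat[OF assms, folded a1_def a2_def]
  have a21: "D1 2 a2 = h - 3 * k * a"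
    using D_comm[of 1 a] by (simp add: h_def a1_def a2_def algebra_simps)
  have Es: "E1 a = a1 + r1 * a" "E2 a = a2 + r2 * a" "E1 k = k1 + 2 * r1 * k" "E2 k = k2 + 2 * r2 * k"
    "E1 a1 = a11 + 2 * r1 * a1" "E2 a1 = h + 2 * r2 * a1"
    "E1 a2 = h - 3 * k * a + 2 * r1 * a2" "E2 a2 = a22 + 2 * r2 * a2"
    using a21 by (simp_all add: a1_def a2_def k1_def k2_def a11_def h_def a22_def D1_def D2_def algebra_simps)
  have Et: "E1 t1 = a1 - (a - t1) * (2 * a + t1) + r1 * t1"
     "E2 t1 = a1 - a2 + (a + t2) * (t1 - a) + k + r2 * t1"
     "E1 t2 = a1 - a2 + (a + t2) * (t1 - a) - k + r1 * t2"
     "E2 t2 = - a2 + (a + t2) * (t2 - 2 * a) + r2 * t2"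
    using fl by (simp_all add: D1_def D2_def algebra_simps)
  have "a22 = 2 * h - 3 * k * a + 3 * a * (2 * a1 - a2) - k2"
  proof -
    have "(2 * h - 3 * k * a + 3 * a * (2 * a1 - a2) - k2) - a22
       = - (E1 (E2 t2) - E2 (E1 t2) - (r1 * E2 t2 - r2 * E1 t2)) + t2 * (E1 r2 - E2 r1 - 3 * k)"
      by (simp add: Et E_simps Es) (simp add: algebra_simps)
    then show ?thesis by (simp add: E_comm curv)
  qed
  moreover have "a11 = 2 * h - 3 * k * a + 3 * a * (a1 - 2 * a2) - k1"
  proof -
    have "(2 * h - 3 * k * a + 3 * a * (a1 - 2 * a2) - k1) - a11
       = - (E1 (E2 t1) - E2 (E1 t1) - (r1 * E2 t1 - r2 * E1 t1)) + t1 * (E1 r2 - E2 r1 - 3 * k)"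
      by (simp add: Et E_simps Es) (simp add: algebra_simps)
    then show ?thesis by (simp add: E_comm curv)
  qed
  ultimately show ?thesis
    unfolding lin_sol_def a11_def a22_def a1_def a2_def h_def k1_def k2_def by auto
qed

text \<open>The leaves of the first foliation are tangent to \<open>e2\<close>, so the vector
  \<open>(P, Q)\<close> pointing to the centre of the pencil is \<open>z\<close> times
  \<open>e2\<close>, and its derivative along \<open>e1\<close> is \<open>- c\<close> times
  \<open>e1\<close>. Comparing components expresses \<open>c\<close> and \<open>E1 z\<close> by the
  connection; differentiating the expression for \<open>c\<close> along \<open>e1\<close> leaves a
  multiple of \<open>z\<close>, which cancels.\<close>

lemma pencil1:
  assumes F: "affine_sol a t1 t2 F" and G: "affine_sol a t1 t2 G"
    and J: "J * (E1 F * E2 G - E2 F * E1 G) = 1"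
    and P: "P = z * E2 F" and Q: "Q = z * E2 G" and z: "z \<noteq> 0"
    and c: "E1 c = 0" "E1 P = - c * E1 F" "E1 Q = - c * E1 G"
  shows "k + D2 1 a - 2 * D1 1 a = 0"
proof -
  have A: "(c + z * (a + t2)) * E1 U + (E1 z + z * (t1 - a + r1)) * E2 U = 0"
    if U: "affine_sol a t1 t2 U" and "E1 (z * E2 U) = - c * E1 U" for U
    using that(2) unfolding E_simps affine_sol_E[OF U] by (simp add: algebra_simps)
  have eq: "c + z * (a + t2) = 0" "E1 z + z * (t1 - a + r1) = 0"
    using wronskian_cancel[OF J A[OF F] A[OF G]] c(2,3) P Q by auto
  have Ez: "E1 z = - z * (t1 - a + r1)" using eq(2) by (simp add: eq_neg_iff_add_eq_0)
  have Et: "E1 t2 = D1 1 a - D2 1 a + (a + t2) * (t1 - a) - k + r1 * t2"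
    using affine_sol_flat(3)[OF F G J] by (simp add: D1_def[of 1 t2] algebra_simps)
  have Ea: "E1 a = D1 1 a + r1 * a" by (simp add: D1_def)
  have "E1 (c + z * (a + t2)) = 0" by (simp add: eq)
  then have "z * (2 * D1 1 a - D2 1 a - k) = 0"
    unfolding E_simps Ez Et Ea c(1) by (simp add: algebra_simps)
  then have "2 * D1 1 a - D2 1 a - k = 0" using z by simp
  then show ?thesis by (simp add: algebra_simps)
qed

lemma pencil2:
  assumes F: "affine_sol a t1 t2 F" and G: "affine_sol a t1 t2 G"
    and J: "J * (E1 F * E2 G - E2 F * E1 G) = 1"
    and P: "P = z * E1 F" and Q: "Q = z * E1 G" and z: "z \<noteq> 0"
    and c: "E2 c = 0" "E2 P = - c * E2 F" "E2 Q = - c * E2 G"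
  shows "k + D1 1 a - 2 * D2 1 a = 0"
proof -
  have A: "(E2 z + z * (a + t2 + r2)) * E1 U + (c + z * (t1 - a)) * E2 U = 0"
    if U: "affine_sol a t1 t2 U" and "E2 (z * E1 U) = - c * E2 U" for U
    using that(2) unfolding E_simps affine_sol_E[OF U] by (simp add: algebra_simps)
  have eq: "c + z * (t1 - a) = 0" "E2 z + z * (a + t2 + r2) = 0"
    using wronskian_cancel[OF J A[OF F] A[OF G]] c(2,3) P Q by auto
  have Ez: "E2 z = - z * (a + t2 + r2)" using eq(2) by (simp add: eq_neg_iff_add_eq_0)
  have Et: "E2 t1 = D1 1 a - D2 1 a + (a + t2) * (t1 - a) + k + r2 * t1"
    using affine_sol_flat(4)[OF F G J] by (simp add: D2_def[of 1 t1] algebra_simps)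
  have Ea: "E2 a = D2 1 a + r2 * a" by (simp add: D2_def)
  have "E2 (c + z * (t1 - a)) = 0" by (simp add: eq)
  then have "z * (D1 1 a - 2 * D2 1 a + k) = 0"
    unfolding E_simps Ez Et Ea c(1) by (simp add: algebra_simps)
  then have "D1 1 a - 2 * D2 1 a + k = 0" using z by simp
  then show ?thesis by (simp add: algebra_simps)
qed

text \<open>The pencil equation makes \<open>a2\<close> a function of \<open>a1\<close> and
  \<open>k\<close>. Its derivative along \<open>e1\<close> ties \<open>h\<close> to the second
  derivative \<open>m\<close>, and the system then expresses both by lower terms. The commutator on
  \<open>a1\<close> thereby becomes a condition of second order on \<open>k\<close>.\<close>

lemma one_pencil_curvature:
  assumes a: "lin_sol a" and p: "k + D2 1 a - 2 * D1 1 a = 0"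
  shows "D1 3 (D1 2 k) - D2 3 (D1 2 k) =
    - 3 * a * D2 2 k - k * (9 * D1 1 a - 9 * a * a - 3 * (D1 1 a - D2 1 a))"
proof -
  define a1 a2 where "a1 = D1 1 a" and "a2 = D2 1 a"
  define h k1 k2 where "h = D2 2 a1" and "k1 = D1 2 k" and "k2 = D2 2 k"
  have a2: "a2 = 2 * a1 - k" using p by (simp add: a1_def a2_def algebra_simps)
  have a21: "D1 2 a2 = h - 3 * k * a"
    using D_comm[of 1 a] by (simp add: h_def a1_def a2_def algebra_simps)
  have a11: "D1 2 a1 = 2 * h - 3 * k * a + 3 * a * (a1 - 2 * a2) - k1"
    and a22: "D2 2 a2 = 2 * h - 3 * k * a + 3 * a * (2 * a1 - a2) - k2"
    using a unfolding lin_sol_def a1_def a2_def h_def k1_def k2_def by auto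
  have Ea: "E1 a = a1 + r1 * a" "E2 a = a2 + r2 * a"
    by (simp_all add: a1_def a2_def D1_def D2_def)
  have Ek: "E1 k = k1 + 2 * r1 * k" "E2 k = k2 + 2 * r2 * k"
    by (simp_all add: k1_def k2_def D1_def D2_def)
  define m where "m = D1 2 a1"
  have E1a1: "E1 a1 = m + 2 * r1 * a1" by (simp add: m_def D1_def)
  have "D1 2 a2 = 2 * m - k1"
    unfolding a2 D1_def by (simp add: E_simps E1a1 Ek) (simp add: algebra_simps)
  then have h: "h = 2 * m - k1 + 3 * k * a" using a21 by (simp add: algebra_simps)
  have "m = 2 * h - 3 * k * a + 3 * a * (a1 - 2 * a2) - k1" using a11 m_def by simp
  then have m3: "3 * m = 3 * k1 - 3 * k * a + 9 * a * a1 - 6 * a * k"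
    unfolding h a2 by (simp add: algebra_simps)
  have "3 * (m - (k1 + 3 * a * a1 - 3 * a * k)) = 0"
    using m3 by (simp add: algebra_simps)
  then have m: "m = k1 + 3 * a * a1 - 3 * a * k" by (rule three_eq)
  have Ea1: "E1 a1 = k1 + 3 * a * a1 - 3 * a * k + 2 * r1 * a1"
    "E2 a1 = k1 + 6 * a * a1 - 3 * a * k + 2 * r2 * a1"
  proof -
    show "E1 a1 = k1 + 3 * a * a1 - 3 * a * k + 2 * r1 * a1" using E1a1 m by simp
    have "E2 a1 = h + 2 * r2 * a1" by (simp add: h_def D2_def)
    then show "E2 a1 = k1 + 6 * a * a1 - 3 * a * k + 2 * r2 * a1"
      unfolding h m by (simp add: algebra_simps)
  qed
  define k20 k12 where "k20 = D1 3 k1" and "k12 = D2 3 k1"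
  have Ek1: "E1 k1 = k20 + 3 * r1 * k1" "E2 k1 = k12 + 3 * r2 * k1"
    by (simp_all add: k20_def k12_def D1_def D2_def)
  have "k20 - k12 - (- 3 * a * k2 - k * (9 * a1 - 9 * a * a - 3 * (a1 - a2)))
     = E1 (E2 a1) - E2 (E1 a1) - (r1 * E2 a1 - r2 * E1 a1) - 2 * a1 * (E1 r2 - E2 r1 - 3 * k)"
    by (simp add: Ea1 E_simps Ek Ek1 Ea a2) (simp add: algebra_simps)
  also have "\<dots> = 0" by (simp add: E_comm curv)
  finally show ?thesis
    unfolding k20_def[symmetric] k12_def[symmetric] k1_def[symmetric] k2_def[symmetric] a1_def[symmetric] a2_def[symmetric]
    by simp
qed

text \<open>Both pencil equations together force \<open>D1 1 a = k\<close> and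
  \<open>D2 1 a = k\<close>, so the commutator on \<open>a\<close> itself is already a condition on
  \<open>k\<close>, of first order.\<close>

lemma two_pencils_curvature:
  assumes p: "k + D2 1 a - 2 * D1 1 a = 0" "k + D1 1 a - 2 * D2 1 a = 0"
  shows "D1 2 k - D2 2 k = - 3 * a * k"
proof -
  have "3 * (D1 1 a - k) = 2 * k * 0 - (k + D1 1 a - 2 * D2 1 a) - 2 * (k + D2 1 a - 2 * D1 1 a)"
    "3 * (D2 1 a - k) = 2 * k * 0 - (k + D2 1 a - 2 * D1 1 a) - 2 * (k + D1 1 a - 2 * D2 1 a)"
    by (simp_all add: algebra_simps)
  then have "3 * (D1 1 a - k) = 0" "3 * (D2 1 a - k) = 0" unfolding p by simp_all
  then have a12: "D1 1 a = k" "D2 1 a = k" by (simp_all only: three_eq)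
  show ?thesis using D_comm[of 1 a] unfolding a12 by (simp add: algebra_simps)
qed

text \<open>Two connections with the same \<open>a\<close> differ by their projective parts only. As
  \<open>Fx\<close>, \<open>Fy\<close> are the partial derivatives of \<open>F\<close> in the affine
  coordinates \<open>x\<close>, \<open>y\<close>, the left-hand sides are the Hessian of
  \<open>F\<close>; it is the symmetrized product of the form \<open>s - t\<close> with the
  differential of \<open>F\<close>.\<close>

lemma affine_sol_eq_hessian:
  assumes "affine_sol a t1 t2 x" "affine_sol a t1 t2 y" "affine_sol a s1 s2 F"
    and "E1 F = E1 x * Fx + E1 y * Fy" "E2 F = E2 x * Fx + E2 y * Fy"
  shows "E1 x * E1 Fx + E1 y * E1 Fy = 2 * (s1 - t1) * E1 F"
    "E2 x * E1 Fx + E2 y * E1 Fy = (s2 - t2) * E1 F + (s1 - t1) * E2 F"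
    "E1 x * E2 Fx + E1 y * E2 Fy = (s2 - t2) * E1 F + (s1 - t1) * E2 F"
    "E2 x * E2 Fx + E2 y * E2 Fy = 2 * (s2 - t2) * E2 F"
  using affine_sol_E[OF assms(3)] unfolding assms(4,5) E_simps
    affine_sol_E[OF assms(1)] affine_sol_E[OF assms(2)]
  by (simp_all add: algebra_simps)

end

section \<open>Leading forms of power series in two variables\<close>

type_synonym ps2 = "complex fps fps"

definition dX :: "ps2 \<Rightarrow> ps2" where "dX f = Abs_fps (\<lambda>j. fps_deriv (fps_nth f j))"
definition dY :: "ps2 \<Rightarrow> ps2" where "dY f = fps_deriv f"
text \<open>The outer series is in \<open>Y\<close>, the inner one in \<open>X\<close>.\<close>
definition jet :: "nat \<Rightarrow> nat \<Rightarrow> ps2 \<Rightarrow> complex" where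
  "jet i j f = fact i * fact j * fps_nth (fps_nth f j) i"
definition cst :: "complex \<Rightarrow> ps2" where "cst c = fps_const (fps_const c)"
definition vX :: ps2 where "vX = fps_const fps_X"
definition vY :: ps2 where "vY = fps_X"
definition ord :: "nat \<Rightarrow> ps2 \<Rightarrow> bool" where "ord n f \<longleftrightarrow> (\<forall>i j. i + j < n \<longrightarrow> jet i j f = 0)"

lemma dX_add: "dX (f + g) = dX f + dX g"
  by (simp add: dX_def fps_eq_iff)
lemma dY_add: "dY (f + g) = dY f + dY g"
  by (simp add: dY_def)
lemma dY_mult: "dY (f * g) = dY f * g + f * dY g"
  by (simp add: dY_def)
lemma dX_mult: "dX (f * g) = dX f * g + f * dX g"
proof (rule fps_ext)
  fix n
  show "fps_nth (dX (f * g)) n = fps_nth (dX f * g + f * dX g) n"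
    by (simp add: dX_def fps_mult_nth fps_deriv_sum sum.distrib add.commute)
qed
lemma dXY: "dX (dY f) = dY (dX f)"
  by (simp add: dX_def dY_def fps_eq_iff)

lemma d_zero [simp]: "dX 0 = 0" "dY 0 = 0"
  by (simp_all add: dX_def dY_def fps_eq_iff)
lemma d_minus: "dX (- f) = - dX f" "dY (- f) = - dY f"
  by (simp_all add: dX_def dY_def fps_eq_iff)
lemma d_diff: "dX (f - g) = dX f - dX g" "dY (f - g) = dY f - dY g"
  by (simp_all add: dX_def dY_def fps_eq_iff)
lemma d_cst [simp]: "dX (cst c) = 0" "dY (cst c) = 0"
  by (simp_all add: dX_def dY_def cst_def fps_eq_iff)
lemma d_var [simp]: "dX vX = 1" "dY vX = 0" "dX vY = 0" "dY vY = 1"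
  by (auto simp: dX_def dY_def vX_def vY_def fps_eq_iff fps_X_def)

lemma jet_dX [simp]: "jet i j (dX f) = jet (Suc i) j f"
  by (simp add: jet_def dX_def algebra_simps)
lemma jet_dY [simp]: "jet i j (dY f) = jet i (Suc j) f"
proof -
  have "fps_nth (fps_nth (fps_deriv f) j) i = of_nat (Suc j) * fps_nth (fps_nth f (Suc j)) i"
    by (simp add: fps_of_nat[symmetric] del: fps_of_nat of_nat_Suc)
  then show ?thesis by (simp add: jet_def dY_def algebra_simps)
qed
lemma jet_add [simp]: "jet i j (f + g) = jet i j f + jet i j g"
  by (simp add: jet_def algebra_simps)
lemma jet_diff [simp]: "jet i j (f - g) = jet i j f - jet i j g"
  by (simp add: jet_def algebra_simps)
lemma jet_minus [simp]: "jet i j (- f) = - jet i j f"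
  by (simp add: jet_def)
lemma jet_zero [simp]: "jet i j 0 = 0"
  by (simp add: jet_def)
lemma jet_cst_mult [simp]: "jet i j (cst c * f) = c * jet i j f"
  by (simp add: jet_def cst_def)
lemma jet_cst [simp]: "jet i j (cst c) = (if i = 0 \<and> j = 0 then c else 0)"
  by (simp add: jet_def cst_def)
lemma jet_vX_mult [simp]: "jet i j (vX * f) = of_nat i * jet (i - 1) j f"
  by (cases i) (simp_all add: jet_def vX_def)
lemma jet_vY_mult [simp]: "jet i j (vY * f) = of_nat j * jet i (j - 1) f"
  by (cases j) (simp_all add: jet_def vY_def)
lemma jet_00_mult [simp]: "jet 0 0 (f * g) = jet 0 0 f * jet 0 0 g"
  by (simp add: jet_def)
lemma jet_00_1 [simp]: "jet 0 0 1 = 1"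
  by (simp add: jet_def)

lemma ps2_eqI: "(\<And>i j. jet i j f = jet i j g) \<Longrightarrow> f = g"
  by (simp add: jet_def fps_eq_iff)

lemma cst_add: "cst (a + b) = cst a + cst b" and cst_mult: "cst (a * b) = cst a * cst b"
  and cst_diff: "cst (a - b) = cst a - cst b" and cst_minus: "cst (- a) = - cst a"
  and cst_0 [simp]: "cst 0 = 0" and cst_1 [simp]: "cst 1 = 1"
  by (simp_all add: cst_def)

lemma cst_numeral: "cst (numeral n) = numeral n"
proof -
  have "cst (of_nat m) = of_nat m" for m by (induction m) (simp_all add: cst_add)
  from this[of "numeral n"] show ?thesis by simp
qed

lemma jet_numeral_mult [simp]: "jet i j (numeral n * f) = numeral n * jet i j f"
  by (metis cst_numeral jet_cst_mult)

lemma jet_mult_numeral [simp]: "jet i j (f * numeral n) = numeral n * jet i j f"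
  by (metis jet_numeral_mult mult.commute)

lemma ps2_const:
  assumes "dX f = 0" "dY f = 0"
  shows "f = cst (jet 0 0 f)"
proof (rule ps2_eqI)
  fix i j
  show "jet i j f = jet i j (cst (jet 0 0 f))"
    using jet_dX[of "i - 1" j f] jet_dY[of i "j - 1" f] assms by (cases i; cases j) auto
qed

lemma ps2_eq_antideriv:
  assumes "dX f = dX g" "dY f = dY g" "jet 0 0 f = jet 0 0 g"
  shows "f = g"
  using ps2_const[of "f - g"] assms by (simp add: d_diff)

lemma ord_mono: "ord n f \<Longrightarrow> m \<le> n \<Longrightarrow> ord m f"
  by (auto simp: ord_def)
lemma ord_0 [simp]: "ord 0 f"
  by (simp add: ord_def)
lemma ord_add: "ord n f \<Longrightarrow> ord n g \<Longrightarrow> ord n (f + g)"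
  by (auto simp: ord_def)
lemma ord_diff: "ord n f \<Longrightarrow> ord n g \<Longrightarrow> ord n (f - g)"
  by (auto simp: ord_def)
lemma ord_minus: "ord n f \<Longrightarrow> ord n (- f)"
  by (auto simp: ord_def)
lemma ord_coeff: "ord n f \<longleftrightarrow> (\<forall>i j. i + j < n \<longrightarrow> fps_nth (fps_nth f j) i = 0)"
  by (simp add: ord_def jet_def)

lemma ord_mult:
  assumes "ord p f" "ord q g" "m \<le> p + q"
  shows "ord m (f * g)"
  unfolding ord_coeff
proof (intro allI impI)
  fix i j assume ij: "i + j < m"
  have "fps_nth (fps_nth f u) v * fps_nth (fps_nth g (j - u)) (i - v) = 0" if "u \<le> j" "v \<le> i" for u v
  proof (cases "u + v < p")
    case True
    then show ?thesis using assms(1) by (auto simp: ord_coeff add.commute)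
  next
    case False
    then have "(i - v) + (j - u) < q" using ij assms(3) that by linarith
    then show ?thesis using assms(2) by (auto simp: ord_coeff)
  qed
  then show "fps_nth (fps_nth (f * g) j) i = 0"
    by (auto simp: fps_mult_nth fps_sum_nth intro!: sum.neutral)
qed

lemma ord_mult_left: "ord n g \<Longrightarrow> ord n (f * g)"
  by (rule ord_mult[of 0 _ n]) auto
lemma ord_mult_right: "ord n f \<Longrightarrow> ord n (f * g)"
  by (rule ord_mult[of n _ 0]) auto
lemma ord_dX: "ord n f \<Longrightarrow> m \<le> n - 1 \<Longrightarrow> ord m (dX f)"
  by (auto simp: ord_def)
lemma ord_dY: "ord n f \<Longrightarrow> m \<le> n - 1 \<Longrightarrow> ord m (dY f)"
  by (auto simp: ord_def)
lemma ord_Suc_0: "ord (Suc 0) f \<longleftrightarrow> jet 0 0 f = 0"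
  by (auto simp: ord_def)

text \<open>Reduces a vanishing order to those of the two partial derivatives. This is the induction
  step by which the identities between Taylor series are proved later.\<close>

lemma ord_SucI:
  assumes "jet 0 0 f = 0" "ord n (dX f)" "ord n (dY f)"
  shows "ord (Suc n) f"
  unfolding ord_def
proof (intro allI impI)
  fix i j assume "i + j < Suc n"
  then show "jet i j f = 0"
    using assms jet_dX[of "i - 1" j f] jet_dY[of i "j - 1" f]
    by (cases i; cases j) (auto simp: ord_def simp del: jet_dX jet_dY)
qed

lemma all_ord_eq_0: "(\<And>n. ord n f) \<Longrightarrow> f = 0"
  by (rule ps2_eqI) (simp add: ord_def, blast)

lemma ord_step_eq_0:
  assumes "ord m f" "\<And>n. m \<le> n \<Longrightarrow> ord n f \<Longrightarrow> ord (Suc n) f"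
  shows "f = 0"
proof (rule all_ord_eq_0)
  fix n
  have "ord (m + n) f" by (induction n) (use assms in auto)
  then show "ord n f" by (rule ord_mono) simp
qed

lemma ord_Suc_jets:
  assumes "ord n f" "\<And>j. j \<le> n \<Longrightarrow> jet (n - j) j f = 0"
  shows "ord (Suc n) f"
  unfolding ord_def
proof (intro allI impI)
  fix i j assume "i + j < Suc n"
  then consider "i + j < n" | "i = n - j" "j \<le> n" by linarith
  then show "jet i j f = 0" using assms by cases (auto simp: ord_def)
qed

lemma ord1_decomp:
  assumes "ord 1 f"
  shows "ord 2 (f - (cst (jet 1 0 f) * vX + cst (jet 0 1 f) * vY))"
  unfolding ord_def
proof (intro allI impI)
  fix i j :: nat assume "i + j < 2"
  then have "i = 0 \<and> j = 0 \<or> i = 1 \<and> j = 0 \<or> i = 0 \<and> j = 1" by auto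
  moreover have "jet 0 0 f = 0" using assms by (simp add: ord_def)
  ultimately show "jet i j (f - (cst (jet 1 0 f) * vX + cst (jet 0 1 f) * vY)) = 0"
    using jet_vX_mult[of 0 0 1] jet_vX_mult[of 1 0 1] jet_vX_mult[of 0 1 1]
      jet_vY_mult[of 0 0 1] jet_vY_mult[of 1 0 1] jet_vY_mult[of 0 1 1]
    by auto
qed

text \<open>The added assumptions say that at the base point the frame \<open>e1\<close>,
  \<open>e2\<close> is the coordinate frame: replacing \<open>E1\<close> by \<open>dX\<close> costs
  a term of order \<open>n\<close>, one more than a derivative of \<open>f\<close> has in general.
  So \<open>dX\<close> and \<open>dY\<close> compute leading forms.\<close>

locale web_series = web_ring E1 E2 r1 r2 k third
  for E1 E2 :: "ps2 \<Rightarrow> ps2" and r1 r2 k third :: ps2 +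
  assumes E1_lead: "ord n f \<Longrightarrow> ord n (E1 f - dX f)"
    and E2_lead: "ord n f \<Longrightarrow> ord n (E2 f - dY f)"
begin

lemma D_lead:
  assumes "ord n f"
  shows "ord n (D1 w f - dX f)" "ord n (D2 w f - dY f)"
proof -
  have "ord n ((E1 f - dX f) - w * r1 * f)" "ord n ((E2 f - dY f) - w * r2 * f)"
    using assms by (auto intro!: ord_diff E1_lead E2_lead ord_mult_left)
  then show "ord n (D1 w f - dX f)" "ord n (D2 w f - dY f)"
    by (simp_all add: D1_def D2_def algebra_simps)
qed

lemma ord_D:
  assumes "ord n f" "m \<le> n - 1"
  shows "ord m (D1 w f)" "ord m (D2 w f)"
proof -
  have "ord m (D1 w f - dX f)" "ord m (D2 w f - dY f)"
    using ord_mono[OF D_lead(1)[OF assms(1)], of m] ord_mono[OF D_lead(2)[OF assms(1)], of m] assms(2) by auto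
  then have "ord m ((D1 w f - dX f) + dX f)" "ord m ((D2 w f - dY f) + dY f)"
    using ord_add ord_dX[OF assms] ord_dY[OF assms] by blast+
  then show "ord m (D1 w f)" "ord m (D2 w f)" by simp_all
qed

lemma DD_lead:
  assumes f: "ord n f"
  shows "ord (n - 1) (D1 v (D1 w f) - dX (dX f))" "ord (n - 1) (D1 v (D2 w f) - dX (dY f))"
    "ord (n - 1) (D2 v (D1 w f) - dX (dY f))" "ord (n - 1) (D2 v (D2 w f) - dY (dY f))"
proof -
  note o = ord_D[OF f order.refl, of w] and l = D_lead[OF f, of w]
  have *: "ord (n - 1) (P - Q) \<Longrightarrow> ord (n - 1) (Q - R) \<Longrightarrow> ord (n - 1) (P - R)" for P Q R
    using ord_add[of "n - 1" "P - Q" "Q - R"] by simp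
  show "ord (n - 1) (D1 v (D1 w f) - dX (dX f))"
    by (rule *[OF D_lead(1)[OF o(1)]]) (use ord_dX[OF l(1) order.refl] in \<open>simp add: d_diff\<close>)
  show "ord (n - 1) (D1 v (D2 w f) - dX (dY f))"
    by (rule *[OF D_lead(1)[OF o(2)]]) (use ord_dX[OF l(2) order.refl] in \<open>simp add: d_diff\<close>)
  show "ord (n - 1) (D2 v (D1 w f) - dX (dY f))"
    by (rule *[OF D_lead(2)[OF o(1)]]) (use ord_dY[OF l(1) order.refl] in \<open>simp add: d_diff dXY\<close>)
  show "ord (n - 1) (D2 v (D2 w f) - dY (dY f))"
    by (rule *[OF D_lead(2)[OF o(2)]]) (use ord_dY[OF l(2) order.refl] in \<open>simp add: d_diff\<close>)
qed

lemma ord_DD: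
  assumes "ord n f" "m \<le> n - 2"
  shows "ord m (D1 v (D1 w f))" "ord m (D1 v (D2 w f))" "ord m (D2 v (D1 w f))" "ord m (D2 v (D2 w f))"
  using assms by (auto intro!: ord_D[OF ord_D(1)[OF assms(1) order.refl]] ord_D[OF ord_D(2)[OF assms(1) order.refl]])

text \<open>Apart from the two third derivatives of \<open>k\<close>, every term of the
  compatibility condition contains \<open>k\<close> or a derivative of it of order at most two,
  hence has order \<open>n - 2\<close>. So the leading form of \<open>k\<close> is killed by the
  principal part, and this identifies neighbouring mixed jets.\<close>

lemma compat_lead:
  assumes a: "lin_sol a" and k: "ord n k" and j: "1 \<le> j" "j \<le> n - 2"
  shows "jet (n - j) j k = jet (n - Suc j) (Suc j) k"
proof -
  have n: "3 \<le> n" using j by linarith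
  have *: "ord (n - 2) (D1 4 (D1 3 (D2 2 k)) - dX (dX (dY k)))"
    "ord (n - 2) (D1 4 (D2 3 (D2 2 k)) - dX (dY (dY k)))"
  proof -
    have st: "ord (n - 2) (P - Q) \<Longrightarrow> ord (n - 2) (Q - R) \<Longrightarrow> ord (n - 2) (P - R)" for P Q R
      using ord_add[of "n - 2" "P - Q" "Q - R"] by simp
    show "ord (n - 2) (D1 4 (D1 3 (D2 2 k)) - dX (dX (dY k)))"
      by (rule st[OF D_lead(1)[OF ord_DD(2)[OF k order.refl]]])
        (use ord_dX[OF DD_lead(2)[OF k], of "n - 2" 3 2] in \<open>simp add: d_diff\<close>)
    show "ord (n - 2) (D1 4 (D2 3 (D2 2 k)) - dX (dY (dY k)))"
      by (rule st[OF D_lead(1)[OF ord_DD(4)[OF k order.refl]]])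
        (use ord_dX[OF DD_lead(4)[OF k], of "n - 2" 3 2] in \<open>simp add: d_diff\<close>)
  qed
  define r where "r = 3 * a * (D1 3 (D1 2 k) - D1 3 (D2 2 k) + D2 3 (D2 2 k))
    + (12 * D1 1 a - 6 * D2 1 a) * D1 2 k + (12 * D2 1 a - 6 * D1 1 a) * D2 2 k
    + k * (24 * D2 2 (D1 1 a) + 72 * a * (D1 1 a - D2 1 a) - 45 * k * a - 27 * a ^ 3)
    + 3 * k * D1 2 k - 18 * k * D2 2 k"
  have r: "ord (n - 2) r"
  proof -
    have "ord (n - 2) (D1 3 (D1 2 k) - D1 3 (D2 2 k) + D2 3 (D2 2 k))"
      by (intro ord_add ord_diff ord_DD[OF k order.refl])
    moreover have "ord (n - 2) k" "ord (n - 2) (D1 2 k)" "ord (n - 2) (D2 2 k)"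
      using ord_mono[OF k, of "n - 2"] ord_D[OF k, of "n - 2" 2] by auto
    ultimately show ?thesis
      unfolding r_def by (simp only: ord_add ord_diff ord_mult_left ord_mult_right)
  qed
  have "D1 4 (D1 3 (D2 2 k)) - D1 4 (D2 3 (D2 2 k)) + r = 0"
    using lin_sol_compat[OF a] unfolding r_def by (simp add: algebra_simps)
  moreover have "dX (dX (dY k)) - dX (dY (dY k))
     = (D1 4 (D2 3 (D2 2 k)) - dX (dY (dY k))) - (D1 4 (D1 3 (D2 2 k)) - dX (dX (dY k))) - r
       + (D1 4 (D1 3 (D2 2 k)) - D1 4 (D2 3 (D2 2 k)) + r)"
    by simp
  ultimately have "ord (n - 2) (dX (dX (dY k)) - dX (dY (dY k)))"
    using ord_diff[OF ord_diff[OF *(2) *(1)] r] by (simp only: add_0_right)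
  then have "jet (n - 2 - j) (j - 1) (dX (dX (dY k)) - dX (dY (dY k))) = 0"
    using j n by (auto simp: ord_def simp del: jet_diff jet_dX jet_dY)
  moreover have "Suc (Suc (n - 2 - j)) = n - j" "Suc (n - 2 - j) = n - Suc j" "Suc (j - 1) = j"
    using j n by auto
  ultimately show ?thesis by simp
qed

text \<open>The third derivatives of \<open>k\<close> enter the compatibility condition with
  coefficients that do not depend on \<open>a\<close>, so they cancel in the difference for
  \<open>b\<close> and \<open>a\<close>. What remains is three times an equation of second order in
  \<open>k\<close>, each term of which contains \<open>l\<close> or one of its derivatives.\<close>

lemma difference_eqs:
  fixes a b :: ps2
  assumes a: "lin_sol a" and b: "lin_sol b"
  defines "l \<equiv> b - a"
  defines "l1 \<equiv> D1 1 l" and "l2 \<equiv> D2 1 l"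
  shows "D1 2 l1 = 2 * D2 2 l1 - 3 * k * l + 3 * (b * (l1 - 2 * l2) + l * (D1 1 a - 2 * D2 1 a))"
    "D2 2 l2 = 2 * D2 2 l1 - 3 * k * l + 3 * (b * (2 * l1 - l2) + l * (2 * D1 1 a - D2 1 a))"
    "l * (D1 3 (D1 2 k) - D1 3 (D2 2 k) + D2 3 (D2 2 k)) + (4 * l1 - 2 * l2) * D1 2 k + (4 * l2 - 2 * l1) * D2 2 k
     + k * (8 * D2 2 l1 + 24 * (b * (l1 - l2) + l * (D1 1 a - D2 1 a)) - 15 * k * l - 9 * l * (a^2 + a * b + b^2)) = 0"
proof -
  have Dl: "l1 = D1 1 b - D1 1 a" "l2 = D2 1 b - D2 1 a"
    by (simp_all add: l1_def l2_def l_def D1_def D2_def E_diff algebra_simps)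
  have DDl: "D1 2 l1 = D1 2 (D1 1 b) - D1 2 (D1 1 a)" "D2 2 l1 = D2 2 (D1 1 b) - D2 2 (D1 1 a)"
    "D2 2 l2 = D2 2 (D2 1 b) - D2 2 (D2 1 a)"
    unfolding Dl by (simp_all add: D1_def[of 2] D2_def[of 2] E_diff algebra_simps)
  note A = a[unfolded lin_sol_def] and B = b[unfolded lin_sol_def]
  show "D1 2 l1 = 2 * D2 2 l1 - 3 * k * l + 3 * (b * (l1 - 2 * l2) + l * (D1 1 a - 2 * D2 1 a))"
    unfolding DDl conjunct1[OF A] conjunct1[OF B] unfolding Dl l_def by (simp add: algebra_simps)
  show "D2 2 l2 = 2 * D2 2 l1 - 3 * k * l + 3 * (b * (2 * l1 - l2) + l * (2 * D1 1 a - D2 1 a))"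
    unfolding DDl conjunct2[OF A] conjunct2[OF B] unfolding Dl l_def by (simp add: algebra_simps)
  let ?X = "l * (D1 3 (D1 2 k) - D1 3 (D2 2 k) + D2 3 (D2 2 k)) + (4 * l1 - 2 * l2) * D1 2 k + (4 * l2 - 2 * l1) * D2 2 k
     + k * (8 * D2 2 l1 + 24 * (b * (l1 - l2) + l * (D1 1 a - D2 1 a)) - 15 * k * l - 9 * l * (a^2 + a * b + b^2))"
  define Ca where "Ca a = D1 4 (D1 3 (D2 2 k)) - D1 4 (D2 3 (D2 2 k)) + 3 * a * (D1 3 (D1 2 k) - D1 3 (D2 2 k) + D2 3 (D2 2 k))
    + (12 * D1 1 a - 6 * D2 1 a) * D1 2 k + (12 * D2 1 a - 6 * D1 1 a) * D2 2 k
    + k * (24 * D2 2 (D1 1 a) + 72 * a * (D1 1 a - D2 1 a) - 45 * k * a - 27 * a ^ 3) + 3 * k * D1 2 k - 18 * k * D2 2 k" for a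
  have "3 * (?X - 0) = Ca b - Ca a"
    unfolding Ca_def DDl unfolding Dl l_def by (simp add: algebra_simps power2_eq_square power3_eq_cube)
  also have "\<dots> = 0" using lin_sol_compat[OF a] lin_sol_compat[OF b] by (simp add: Ca_def)
  finally show "?X = 0" by (rule three_eq)
qed

text \<open>The displayed terms are those whose lowest degree is \<open>n + d - 2\<close>: two
  derivatives are distributed over \<open>k\<close> and \<open>l\<close>. All the rest, collected in
  \<open>R\<close>, either carries fewer derivatives or a factor measuring the defect between
  covariant and partial derivatives, and so has order at least \<open>n + d - 1\<close>.\<close>

lemma difference_lead:
  assumes a: "lin_sol a" and b: "lin_sol b" and k: "ord n k" and l: "ord d (b - a)" and n: "2 \<le> n"
  defines "l \<equiv> b - a"
  shows "ord (n + d - 1) (l * (dX (dX k) - dX (dY k) + dY (dY k))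
     + (4 * dX l - 2 * dY l) * dX k + (4 * dY l - 2 * dX l) * dY k + 8 * (k * dX (dY l)))"
proof -
  note l = l[folded l_def]
  define l1 l2 where "l1 = D1 1 l" and "l2 = D2 1 l"
  note eq = difference_eqs(3)[OF a b, folded l_def, folded l1_def l2_def]
  define m where "m = n + d - 1"
  define Q where "Q = (D1 3 (D1 2 k) - D1 3 (D2 2 k) + D2 3 (D2 2 k)) - (dX (dX k) - dX (dY k) + dY (dY k))"
  have "Q = (D1 3 (D1 2 k) - dX (dX k)) - (D1 3 (D2 2 k) - dX (dY k)) + (D2 3 (D2 2 k) - dY (dY k))"
    by (simp add: Q_def algebra_simps)
  then have Q: "ord (n - 1) Q" using DD_lead[OF k] by (simp add: ord_add ord_diff)
  have kd: "ord n (D1 2 k - dX k)" "ord n (D2 2 k - dY k)" and ld: "ord d (l1 - dX l)" "ord d (l2 - dY l)"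
    using D_lead[OF k] D_lead[OF l] by (auto simp: l1_def l2_def)
  have k1: "ord (n - 1) (D1 2 k)" "ord (n - 1) (D2 2 k)" using ord_D[OF k order.refl] by auto
  have l1: "ord (d - 1) l1" "ord (d - 1) l2" "ord (d - 1) (dX l)" "ord (d - 1) (dY l)"
    using ord_D[OF l order.refl] ord_dX[OF l order.refl] ord_dY[OF l order.refl] by (auto simp: l1_def l2_def)
  have lh: "ord (d - 1) (D2 2 l1 - dX (dY l))" using DD_lead(3)[OF l] by (simp add: l1_def)
  define R where "R = l * Q
    + ((4 * (l1 - dX l) - 2 * (l2 - dY l)) * D1 2 k + (4 * dX l - 2 * dY l) * (D1 2 k - dX k))
    + ((4 * (l2 - dY l) - 2 * (l1 - dX l)) * D2 2 k + (4 * dY l - 2 * dX l) * (D2 2 k - dY k))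
    + k * (8 * (D2 2 l1 - dX (dY l)) + 24 * (b * (l1 - l2) + l * (D1 1 a - D2 1 a)) - 15 * k * l - 9 * l * (a^2 + a * b + b^2))"
  have R: "ord m R"
  proof -
    have ld': "ord (d - 1) l" using l by (rule ord_mono) simp
    have "ord m (l * Q)" by (rule ord_mult[OF l Q]) (use n m_def in auto)
    moreover have "ord m ((4 * (l1 - dX l) - 2 * (l2 - dY l)) * D1 2 k)"
      by (rule ord_mult[OF _ k1(1), of d], intro ord_diff ord_mult_left ld) (use n m_def in auto)
    moreover have "ord m ((4 * dX l - 2 * dY l) * (D1 2 k - dX k))"
      by (rule ord_mult[OF _ kd(1), of "d - 1"], intro ord_diff ord_mult_left l1) (use n m_def in auto)
    moreover have "ord m ((4 * (l2 - dY l) - 2 * (l1 - dX l)) * D2 2 k)"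
      by (rule ord_mult[OF _ k1(2), of d], intro ord_diff ord_mult_left ld) (use n m_def in auto)
    moreover have "ord m ((4 * dY l - 2 * dX l) * (D2 2 k - dY k))"
      by (rule ord_mult[OF _ kd(2), of "d - 1"], intro ord_diff ord_mult_left l1) (use n m_def in auto)
    moreover have "ord m (k * (8 * (D2 2 l1 - dX (dY l)) + 24 * (b * (l1 - l2) + l * (D1 1 a - D2 1 a))
        - 15 * k * l - 9 * l * (a^2 + a * b + b^2)))"
    proof (rule ord_mult[OF k, of "d - 1"])
      show "ord (d - 1) (8 * (D2 2 l1 - dX (dY l)) + 24 * (b * (l1 - l2) + l * (D1 1 a - D2 1 a))
        - 15 * k * l - 9 * l * (a^2 + a * b + b^2))"
        by (intro ord_add ord_diff ord_mult_left[OF lh] ord_mult_left ord_mult_right l1 ld')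
    qed (use m_def in auto)
    ultimately show ?thesis unfolding R_def by (intro ord_add)
  qed
  have "l * (dX (dX k) - dX (dY k) + dY (dY k))
     + (4 * dX l - 2 * dY l) * dX k + (4 * dY l - 2 * dX l) * dY k + 8 * (k * dX (dY l)) = - R"
    using eq unfolding R_def Q_def by (simp add: algebra_simps)
  then show ?thesis using ord_minus[OF R] by (simp add: m_def)
qed

lemma difference_symbol:
  assumes a: "lin_sol a" and b: "lin_sol b" and l: "ord d (b - a)" and d: "1 \<le> d"
  defines "l \<equiv> b - a"
  shows "ord (d - 1) (dX (dX l) - 2 * dX (dY l))" "ord (d - 1) (dY (dY l) - 2 * dX (dY l))"
proof -
  note l = l[folded l_def]
  define l1 l2 where "l1 = D1 1 l" and "l2 = D2 1 l"
  note eq = difference_eqs(1,2)[OF a b, folded l_def, folded l1_def l2_def]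
  have l1: "ord (d - 1) l1" "ord (d - 1) l2" "ord (d - 1) l"
    using ord_D[OF l order.refl] ord_mono[OF l, of "d - 1"] by (auto simp: l1_def l2_def)
  note dd = DD_lead[OF l, of 2 1, folded l1_def l2_def]
  have "dX (dX l) - 2 * dX (dY l) = 2 * (D2 2 l1 - dX (dY l)) - (D1 2 l1 - dX (dX l))
     - 3 * k * l + 3 * (b * (l1 - 2 * l2) + l * (D1 1 a - 2 * D2 1 a))"
    using eq(1) by (simp add: algebra_simps)
  moreover have "ord (d - 1) \<dots>"
    by (intro ord_add ord_diff dd l1 ord_mult_left[OF dd(3)] ord_mult_left ord_mult_right)
  ultimately show "ord (d - 1) (dX (dX l) - 2 * dX (dY l))" by (simp only:)
  have "dY (dY l) - 2 * dX (dY l) = 2 * (D2 2 l1 - dX (dY l)) - (D2 2 l2 - dY (dY l))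
     - 3 * k * l + 3 * (b * (2 * l1 - l2) + l * (2 * D1 1 a - D2 1 a))"
    using eq(2) by (simp add: algebra_simps)
  moreover have "ord (d - 1) \<dots>"
    by (intro ord_add ord_diff dd l1 ord_mult_left[OF dd(3)] ord_mult_left ord_mult_right)
  ultimately show "ord (d - 1) (dY (dY l) - 2 * dX (dY l))" by (simp only:)
qed

text \<open>The symbol equations for \<open>l\<close> are of finite type. From degree three on, two
  neighbouring mixed jets are each twice the other, hence zero, and then the pure jets vanish too.
  In degree two the solutions are the multiples of \<open>X^2 + X*Y + Y^2\<close>, whose jets are 2,
  1, 2.\<close>

lemma difference_leading_form:
  assumes a: "lin_sol a" and b: "lin_sol b" and ne: "a \<noteq> b"
  defines "l \<equiv> b - a"
  shows "jet 0 0 l \<noteq> 0 \<or> (ord 1 l \<and> (jet 1 0 l \<noteq> 0 \<or> jet 0 1 l \<noteq> 0))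
    \<or> (ord 2 l \<and> jet 1 1 l \<noteq> 0 \<and> jet 2 0 l = 2 * jet 1 1 l \<and> jet 0 2 l = 2 * jet 1 1 l)"
proof (rule ccontr)
  assume neg: "\<not> ?thesis"
  have sym: "jet (Suc (Suc i)) j l = 2 * jet (Suc i) (Suc j) l \<and> jet i (Suc (Suc j)) l = 2 * jet (Suc i) (Suc j) l"
    if "ord d l" "i + j = d - 2" "2 \<le> d" for d i j
  proof -
    have "ord (d - 1) (dX (dX l) - 2 * dX (dY l))" "ord (d - 1) (dY (dY l) - 2 * dX (dY l))"
      using difference_symbol[OF a b, folded l_def, of d] that by auto
    then have "jet i j (dX (dX l) - 2 * dX (dY l)) = 0" "jet i j (dY (dY l) - 2 * dX (dY l)) = 0"
      using that by (auto simp: ord_def simp del: jet_diff)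
    then show ?thesis by simp
  qed
  have "jet 0 0 l = 0" using neg by blast
  then have o1: "ord 1 l" by (simp add: ord_def)
  then have "jet 1 0 l = 0" "jet 0 1 l = 0" using neg by blast+
  then have "ord (Suc 1) l"
    using o1 by (intro ord_Suc_jets) (auto simp: le_Suc_eq)
  then have o2: "ord 2 l" by (simp add: numeral_2_eq_2)
  have s2: "jet 2 0 l = 2 * jet 1 1 l" "jet 0 2 l = 2 * jet 1 1 l"
    using sym[OF o2, of 0 0] by (auto simp: numeral_2_eq_2)
  then have "jet 1 1 l = 0" using neg o2 by blast
  then have "ord (Suc 2) l"
    using s2 o2 by (intro ord_Suc_jets) (auto simp: le_Suc_eq numeral_2_eq_2)
  then have "l = 0"
  proof (rule ord_step_eq_0)
    fix d assume d: "Suc 2 \<le> d" "ord d l"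
    define e where "e = d - 3"
    have e: "d = Suc (Suc (Suc e))" using d by (simp add: e_def)
    show "ord (Suc d) l"
    proof (rule ord_Suc_jets[OF d(2)])
      fix j assume j: "j \<le> d"
      have S: "jet (Suc (Suc i)) j l = 2 * jet (Suc i) (Suc j) l"
        "jet i (Suc (Suc j)) l = 2 * jet (Suc i) (Suc j) l" if "i + j = Suc e" for i j
        using sym[OF d(2), of i j] that e by auto
      have int: "jet (Suc i) (Suc j) l = 0" if ij: "i + j = Suc e" for i j
      proof (cases i)
        case 0
        then have "j = Suc e" using ij by simp
        have "jet 1 (Suc (Suc e)) l = 2 * jet (Suc 1) (Suc e) l" using S(2)[of 1 e] by simp
        moreover have "jet (Suc 1) (Suc e) l = 2 * jet 1 (Suc (Suc e)) l" using S(1)[of 0 "Suc e"] by simp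
        ultimately show ?thesis using \<open>i = 0\<close> \<open>j = Suc e\<close> by simp
      next
        case (Suc i')
        have "jet (Suc (Suc i')) (Suc j) l = 2 * jet (Suc i') (Suc (Suc j)) l"
          using S(1)[of i' "Suc j"] Suc ij by simp
        moreover have "jet (Suc i') (Suc (Suc j)) l = 2 * jet (Suc (Suc i')) (Suc j) l"
          using S(2)[of "Suc i'" j] Suc ij by simp
        ultimately show ?thesis using Suc by simp
      qed
      show "jet (d - j) j l = 0"
      proof (cases j)
        case 0
        then show ?thesis using S(1)[of "Suc e" 0] int[of "Suc e" 0] e by simp
      next
        case (Suc j')
        show ?thesis
        proof (cases "d - j")
          case 0
          then have "j = d" using j by simp
          then show ?thesis using S(2)[of 0 "Suc e"] int[of 0 "Suc e"] e by simp
        next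
          case (Suc i')
          then show ?thesis using int[of i' j'] \<open>j = Suc j'\<close> e j by simp
        qed
      qed
    qed
  qed
  then show False using ne by (simp add: l_def)
qed

text \<open>Lowest-order part of the difference of the compatibility conditions for \<open>a\<close> and \<open>b\<close>.\<close>

lemma leading_eq_0:
  assumes a: "lin_sol a" and b: "lin_sol b" and k: "ord n k" and n: "2 \<le> n"
    and l: "jet 0 0 (b - a) \<noteq> 0" and ij: "i + j = n - 2"
  shows "jet (i + 2) j k - jet (i + 1) (j + 1) k + jet i (j + 2) k = 0"
proof -
  define l where "l = b - a"
  define \<Delta> where "\<Delta> = dX (dX k) - dX (dY k) + dY (dY k)"
  define c where "c = jet 0 0 l"
  have l': "ord 1 (l - cst c)" by (simp add: c_def ord_def)
  have kk: "ord (n - 1) (dX k)" "ord (n - 1) (dY k)" using ord_dX[OF k] ord_dY[OF k] by auto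
  have \<Delta>: "ord (n - 2) \<Delta>" unfolding \<Delta>_def using k by (auto simp: ord_def)
  have kn: "ord (n - 1) k" using k by (rule ord_mono) simp
  have "ord (n - 1) (l * \<Delta> + (4 * dX l - 2 * dY l) * dX k + (4 * dY l - 2 * dX l) * dY k + 8 * (k * dX (dY l)))"
    using difference_lead[OF a b k, of 0] n by (simp add: l_def \<Delta>_def)
  moreover have "ord (n - 1) ((l - cst c) * \<Delta> + (4 * dX l - 2 * dY l) * dX k + (4 * dY l - 2 * dX l) * dY k + 8 * (k * dX (dY l)))"
    by (intro ord_add ord_mult_left kk ord_mult[OF l' \<Delta>] ord_mult_right kn) (use n in auto)
  ultimately have "ord (n - 1) ((l * \<Delta> + (4 * dX l - 2 * dY l) * dX k + (4 * dY l - 2 * dX l) * dY k + 8 * (k * dX (dY l)))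
     - ((l - cst c) * \<Delta> + (4 * dX l - 2 * dY l) * dX k + (4 * dY l - 2 * dX l) * dY k + 8 * (k * dX (dY l))))"
    by (rule ord_diff)
  then have "ord (n - 1) (cst c * \<Delta>)" by (simp add: algebra_simps)
  then have "jet i j (cst c * \<Delta>) = 0" using ij n by (auto simp: ord_def simp del: jet_cst_mult)
  then have "jet i j \<Delta> = 0" using l by (simp add: c_def l_def)
  then show ?thesis by (simp add: \<Delta>_def)
qed

text \<open>Here \<open>l\<close> starts with \<open>l1 * X + l2 * Y\<close>. Multiplication by
  \<open>X\<close> lowers the first jet index and brings the factor \<open>i\<close>, so the
  truncated index \<open>i - 1\<close> is harmless for \<open>i = 0\<close>; likewise for
  \<open>Y\<close>. The term \<open>8 * (k * dX (dY l))\<close> has order \<open>n\<close> and does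
  not reach degree \<open>n - 1\<close>.\<close>

lemma leading_eq_1:
  assumes a: "lin_sol a" and b: "lin_sol b" and k: "ord n k" and n: "2 \<le> n"
    and l: "ord 1 (b - a)" and ij: "i + j = n - 1"
  defines "l1 \<equiv> jet 1 0 (b - a)" and "l2 \<equiv> jet 0 1 (b - a)"
  shows "of_nat i * l1 * (jet (i + 1) j k - jet i (j + 1) k + jet (i - 1) (j + 2) k)
     + of_nat j * l2 * (jet (i + 2) (j - 1) k - jet (i + 1) j k + jet i (j + 1) k)
     + (4 * l1 - 2 * l2) * jet (i + 1) j k + (4 * l2 - 2 * l1) * jet i (j + 1) k = 0"
proof -
  define l where "l = b - a"
  define \<Delta> where "\<Delta> = dX (dX k) - dX (dY k) + dY (dY k)"
  define l' where "l' = l - (cst l1 * vX + cst l2 * vY)"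
  have lo: "ord 2 l'" using ord1_decomp[OF l] by (simp add: l'_def l_def l1_def l2_def)
  have leq: "l = cst l1 * vX + cst l2 * vY + l'" by (simp add: l'_def)
  have dl: "dX l = cst l1 + dX l'" "dY l = cst l2 + dY l'"
    unfolding leq by (simp_all add: dX_add dY_add dX_mult dY_mult)
  have lo1: "ord 1 (dX l')" "ord 1 (dY l')" using ord_dX[OF lo] ord_dY[OF lo] by auto
  have kk: "ord (n - 1) (dX k)" "ord (n - 1) (dY k)" using ord_dX[OF k] ord_dY[OF k] by auto
  have \<Delta>: "ord (n - 2) \<Delta>" unfolding \<Delta>_def using k by (auto simp: ord_def)
  have A: "ord n (l * \<Delta> + (4 * dX l - 2 * dY l) * dX k + (4 * dY l - 2 * dX l) * dY k + 8 * (k * dX (dY l)))"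
    using difference_lead[OF a b k l n] by (simp add: l_def \<Delta>_def)
  have "ord n (l' * \<Delta>)" by (rule ord_mult[OF lo \<Delta>]) (use n in auto)
  moreover have "ord n ((4 * dX l' - 2 * dY l') * dX k)"
    by (rule ord_mult[OF _ kk(1), of 1], intro ord_diff ord_mult_left lo1) (use n in auto)
  moreover have "ord n ((4 * dY l' - 2 * dX l') * dY k)"
    by (rule ord_mult[OF _ kk(2), of 1], intro ord_diff ord_mult_left lo1) (use n in auto)
  ultimately have B: "ord n (l' * \<Delta> + (4 * dX l' - 2 * dY l') * dX k + (4 * dY l' - 2 * dX l') * dY k + 8 * (k * dX (dY l)))"
    using ord_mult_left[OF ord_mult_right[OF k]] by (intro ord_add)
  define P where "P = cst l1 * (vX * \<Delta>) + cst l2 * (vY * \<Delta>) + (4 * (cst l1 * dX k) - 2 * (cst l2 * dX k))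
    + (4 * (cst l2 * dY k) - 2 * (cst l1 * dY k))"
  have "P = (l * \<Delta> + (4 * dX l - 2 * dY l) * dX k + (4 * dY l - 2 * dX l) * dY k + 8 * (k * dX (dY l)))
    - (l' * \<Delta> + (4 * dX l' - 2 * dY l') * dX k + (4 * dY l' - 2 * dX l') * dY k + 8 * (k * dX (dY l)))"
    unfolding P_def dl by (simp add: l'_def algebra_simps)
  then have "ord n P" using ord_diff[OF A B] by simp
  then have "jet i j P = 0" using ij n by (auto simp: ord_def)
  moreover have "Suc (i - 1) = i" if "i \<noteq> 0" using that by simp
  moreover have "Suc (j - 1) = j" if "j \<noteq> 0" using that by simp
  ultimately show ?thesis
    unfolding P_def \<Delta>_def by (cases "i = 0"; cases "j = 0") (auto simp: algebra_simps eval_nat_numeral)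
qed

text \<open>Here \<open>l\<close> starts with a multiple of \<open>X^2 + X*Y + Y^2\<close>. Up to
  that multiple, \<open>4 * dX l - 2 * dY l\<close> is \<open>6 * X\<close> and
  \<open>4 * dY l - 2 * dX l\<close> is \<open>6 * Y\<close>, so the first-order terms are six times
  the Euler operator, which gives \<open>6 * of_nat n\<close>. The 8 comes from
  \<open>8 * (k * dX (dY l))\<close>.\<close>

lemma leading_eq_2:
  assumes a: "lin_sol a" and b: "lin_sol b" and k: "ord n k" and n: "2 \<le> n"
    and l: "ord 2 (b - a)" and ij: "i + j = n"
    and m: "jet 1 1 (b - a) \<noteq> 0" "jet 2 0 (b - a) = 2 * jet 1 1 (b - a)" "jet 0 2 (b - a) = 2 * jet 1 1 (b - a)"
  shows "of_nat i * of_nat (i - 1) * (jet i j k - jet (i - 1) (j + 1) k + jet (i - 2) (j + 2) k)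
     + of_nat i * of_nat j * (jet (i + 1) (j - 1) k - jet i j k + jet (i - 1) (j + 1) k)
     + of_nat j * of_nat (j - 1) * (jet (i + 2) (j - 2) k - jet (i + 1) (j - 1) k + jet i j k)
     + (6 * of_nat n + 8) * jet i j k = 0"
proof -
  define l where "l = b - a"
  define c where "c = jet 1 1 l"
  define \<Delta> where "\<Delta> = dX (dX k) - dX (dY k) + dY (dY k)"
  define q where "q = vX * vX + vX * vY + vY * vY"
  define l' where "l' = l - cst c * q"
  have jq: "jet u v q = of_nat u * jet (u - 1) v vX + of_nat u * jet (u - 1) v vY + of_nat v * jet u (v - 1) vY" for u v
    by (simp add: q_def)
  have jv: "jet u v vX = of_nat u * jet (u - 1) v 1" "jet u v vY = of_nat v * jet u (v - 1) 1" for u v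
    using jet_vX_mult[of u v 1] jet_vY_mult[of u v 1] by simp_all
  have j1: "jet u v 1 = (if u = 0 \<and> v = 0 then 1 else 0)" for u v using jet_cst[of u v 1] by simp
  have lo: "ord 3 l'"
    unfolding ord_def
  proof (intro allI impI)
    fix u v :: nat assume uv: "u + v < 3"
    show "jet u v l' = 0"
    proof (cases "u + v < 2")
      case True
      then have "jet u v l = 0" using l by (simp add: ord_def l_def)
      moreover have "jet u v q = 0" using True unfolding jq jv j1 by (cases u; cases v) auto
      ultimately show ?thesis by (simp add: l'_def)
    next
      case False
      then have "u = 2 \<and> v = 0 \<or> u = 1 \<and> v = 1 \<or> u = 0 \<and> v = 2" using uv by auto
      then show ?thesis using m by (auto simp: l'_def c_def l_def jq jv j1)
    qed
  qed
  have leq: "l = cst c * q + l'" by (simp add: l'_def)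
  have dq: "dX q = 2 * vX + vY" "dY q = vX + 2 * vY" by (simp_all add: q_def dX_add dY_add dX_mult dY_mult)
  have dl: "dX l = cst c * (2 * vX + vY) + dX l'" "dY l = cst c * (vX + 2 * vY) + dY l'"
    unfolding leq by (simp_all add: dX_add dY_add dX_mult dY_mult dq)
  have dxy: "dX (dY l) = cst c + dX (dY l')"
    unfolding dl(2) by (simp add: dX_add dX_mult) (simp flip: cst_numeral)
  have lo1: "ord 2 (dX l')" "ord 2 (dY l')" using ord_dX[OF lo] ord_dY[OF lo] by auto
  have lo2: "ord 1 (dX (dY l'))" using ord_dX[OF lo1(2)] by auto
  have kk: "ord (n - 1) (dX k)" "ord (n - 1) (dY k)" using ord_dX[OF k] ord_dY[OF k] by auto
  have \<Delta>: "ord (n - 2) \<Delta>" unfolding \<Delta>_def using k by (auto simp: ord_def)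
  have A: "ord (n + 1) (l * \<Delta> + (4 * dX l - 2 * dY l) * dX k + (4 * dY l - 2 * dX l) * dY k + 8 * (k * dX (dY l)))"
    using difference_lead[OF a b k l n] by (simp add: l_def \<Delta>_def)
  have "ord (n + 1) (l' * \<Delta>)" by (rule ord_mult[OF lo \<Delta>]) (use n in auto)
  moreover have "ord (n + 1) ((4 * dX l' - 2 * dY l') * dX k)"
    by (rule ord_mult[OF _ kk(1), of 2], intro ord_diff ord_mult_left lo1) (use n in auto)
  moreover have "ord (n + 1) ((4 * dY l' - 2 * dX l') * dY k)"
    by (rule ord_mult[OF _ kk(2), of 2], intro ord_diff ord_mult_left lo1) (use n in auto)
  moreover have "ord (n + 1) (8 * (k * dX (dY l')))" by (rule ord_mult_left, rule ord_mult[OF k lo2]) auto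
  ultimately have B: "ord (n + 1) (l' * \<Delta> + (4 * dX l' - 2 * dY l') * dX k + (4 * dY l' - 2 * dX l') * dY k + 8 * (k * dX (dY l')))"
    by (intro ord_add)
  define P where "P = vX * (vX * \<Delta>) + vX * (vY * \<Delta>) + vY * (vY * \<Delta>) + 6 * (vX * dX k) + 6 * (vY * dY k) + 8 * k"
  have "cst c * P = (l * \<Delta> + (4 * dX l - 2 * dY l) * dX k + (4 * dY l - 2 * dX l) * dY k + 8 * (k * dX (dY l)))
    - (l' * \<Delta> + (4 * dX l' - 2 * dY l') * dX k + (4 * dY l' - 2 * dX l') * dY k + 8 * (k * dX (dY l')))"
  proof -
    have "l * \<Delta> = cst c * (q * \<Delta>) + l' * \<Delta>" by (simp add: l'_def algebra_simps)
    then show ?thesis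
      unfolding P_def dxy unfolding dl by (simp add: q_def algebra_simps)
  qed
  then have "ord (n + 1) (cst c * P)" using ord_diff[OF A B] by simp
  then have "jet i j (cst c * P) = 0" using ij n by (auto simp: ord_def simp del: jet_cst_mult)
  then have P0: "jet i j P = 0" using m by (simp add: c_def l_def)
  have e: "of_nat i * (6 * jet i j k) + of_nat j * (6 * jet i j k) = 6 * of_nat n * jet i j k"
    using ij by (auto simp: algebra_simps)
  have "jet i j P = of_nat i * of_nat (i - 1) * (jet i j k - jet (i - 1) (j + 1) k + jet (i - 2) (j + 2) k)
     + of_nat i * of_nat j * (jet (i + 1) (j - 1) k - jet i j k + jet (i - 1) (j + 1) k)
     + of_nat j * of_nat (j - 1) * (jet (i + 2) (j - 2) k - jet (i + 1) (j - 1) k + jet i j k)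
     + (6 * of_nat n + 8) * jet i j k"
  proof -
    have i1: "i - 1 \<noteq> 0 \<Longrightarrow> Suc (i - 2) = i - 1 \<and> Suc (i - 1) = i" "i \<noteq> 0 \<Longrightarrow> Suc (i - 1) = i"
      "j - 1 \<noteq> 0 \<Longrightarrow> Suc (j - 2) = j - 1 \<and> Suc (j - 1) = j" "j \<noteq> 0 \<Longrightarrow> Suc (j - 1) = j"
      by auto
    have A: "jet i j (vX * (vX * \<Delta>)) = of_nat i * of_nat (i - 1) * (jet i j k - jet (i - 1) (j + 1) k + jet (i - 2) (j + 2) k)"
      using i1(1) unfolding \<Delta>_def by (cases "i - 1 = 0") (auto simp: numeral_2_eq_2)
    have B: "jet i j (vX * (vY * \<Delta>)) = of_nat i * of_nat j * (jet (i + 1) (j - 1) k - jet i j k + jet (i - 1) (j + 1) k)"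
      using i1(2,4) unfolding \<Delta>_def by (cases "i = 0"; cases "j = 0") auto
    have C: "jet i j (vY * (vY * \<Delta>)) = of_nat j * of_nat (j - 1) * (jet (i + 2) (j - 2) k - jet (i + 1) (j - 1) k + jet i j k)"
      using i1(3) unfolding \<Delta>_def by (cases "j - 1 = 0") (auto simp: numeral_2_eq_2)
    have D: "jet i j (6 * (vX * dX k)) + jet i j (6 * (vY * dY k)) = 6 * of_nat n * jet i j k"
      using e i1(2,4) by (cases "i = 0"; cases "j = 0") (auto simp: algebra_simps)
    show ?thesis unfolding P_def jet_add using A B C D by (simp add: algebra_simps)
  qed
  then show ?thesis using P0 by simp
qed

end

section \<open>Linear systems for the remaining jets of the curvature\<close>

lemma linear_system_generic:
  fixes l1 l2 x y g :: complex and N :: nat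
  assumes N: "3 \<le> N"
    and e0: "((of_nat N + 4) * l1 - 2 * l2) * x + (4 * l2 - 2 * l1) * g = 0"
    and e1: "l2 * x + g * ((of_nat N + 1) * l1 + 2 * l2) = 0"
    and e2: "((of_nat N + 4) * l2 - 2 * l1) * y + (4 * l1 - 2 * l2) * g = 0"
    and e3: "l1 * y + g * ((of_nat N + 1) * l2 + 2 * l1) = 0"
    and l: "l1 \<noteq> 0 \<or> l2 \<noteq> 0"
  shows "x = 0" "y = 0" "g = 0"
proof -
  define M where "M = (N + 4) * (N + 1)"
  have M: "28 \<le> M" using mult_le_mono[of 7 "N + 4" 4 "N + 1"] N by (simp add: M_def)
  have Mc: "(of_nat M :: complex) = (of_nat N + 4) * (of_nat N + 1)" by (simp add: M_def algebra_simps)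
  \<comment> \<open>Eliminating \<open>x\<close> from \<open>e0\<close>, \<open>e1\<close> and
    \<open>y\<close> from \<open>e2\<close>, \<open>e3\<close> leaves \<open>g\<close> times a
    binary quadratic form in \<open>l1\<close>, \<open>l2\<close>, and \<open>g\<close> times the
    same form with \<open>l1\<close> and \<open>l2\<close> exchanged.\<close>
  have "g * (of_nat M * l1^2 + 8 * l1 * l2 - 8 * l2^2) =
     ((of_nat N + 4) * l1 - 2 * l2) * (l2 * x + g * ((of_nat N + 1) * l1 + 2 * l2))
     - l2 * (((of_nat N + 4) * l1 - 2 * l2) * x + (4 * l2 - 2 * l1) * g)"
    "g * (of_nat M * l2^2 + 8 * l1 * l2 - 8 * l1^2) =
     ((of_nat N + 4) * l2 - 2 * l1) * (l1 * y + g * ((of_nat N + 1) * l2 + 2 * l1))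
     - l1 * (((of_nat N + 4) * l2 - 2 * l1) * y + (4 * l1 - 2 * l2) * g)"
    unfolding Mc by (simp_all add: algebra_simps power2_eq_square)
  then have G: "g * (of_nat M * l1^2 + 8 * l1 * l2 - 8 * l2^2) = 0"
    "g * (of_nat M * l2^2 + 8 * l1 * l2 - 8 * l1^2) = 0"
    unfolding e0 e1 e2 e3 by simp_all
  show g: "g = 0"
  proof (rule ccontr)
    assume "g \<noteq> 0"
    with G have P: "of_nat M * l1^2 + 8 * l1 * l2 - 8 * l2^2 = 0" "of_nat M * l2^2 + 8 * l1 * l2 - 8 * l1^2 = 0"
      by auto
    \<comment> \<open>The two quadratic forms differ by a multiple of \<open>l1^2 - l2^2\<close>. On
      \<open>l1 = l2\<close> and \<open>l1 = - l2\<close> they reduce to \<open>M * l2^2\<close> and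
      \<open>(M - 16) * l2^2\<close>, and \<open>M\<close> is at least 28.\<close>
    have "of_nat (M + 8) * ((l1 - l2) * (l1 + l2)) =
       (of_nat M * l1^2 + 8 * l1 * l2 - 8 * l2^2) - (of_nat M * l2^2 + 8 * l1 * l2 - 8 * l1^2)"
      by (simp add: algebra_simps power2_eq_square)
    then have "of_nat (M + 8) * ((l1 - l2) * (l1 + l2)) = 0" unfolding P by simp
    moreover have "(of_nat (M + 8) :: complex) \<noteq> 0" using of_nat_eq_0_iff[of "M + 8", where ?'a=complex] by (simp del: of_nat_add)
    ultimately have "(l1 - l2) * (l1 + l2) = 0" by (metis mult_eq_0_iff)
    then consider "l1 = l2" | "l1 = - l2" by (auto simp: eq_neg_iff_add_eq_0)
    then have "l2 = 0 \<and> l1 = 0"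
    proof cases
      case 1
      then have "of_nat M * l2^2 = 0" using P(1) by (simp add: power2_eq_square)
      then show ?thesis using 1 M by simp
    next
      case 2
      then have "(of_nat M - 16) * l2^2 = 0" using P(1) by (simp add: power2_eq_square algebra_simps)
      moreover have "(of_nat M - 16 :: complex) = of_nat (M - 16)" using M by simp
      ultimately show ?thesis using 2 M by (simp del: of_nat_diff)
    qed
    then show False using l by simp
  qed
  have N4: "(of_nat N + 4 :: complex) \<noteq> 0"
    using of_nat_eq_0_iff[of "N + 4", where ?'a=complex] by simp
  show "x = 0" using e0 e1 g l N4 by (cases "l2 = 0") auto
  show "y = 0" using e2 e3 g l N4 by (cases "l1 = 0") auto
qed

text \<open>A nonzero \<open>g\<close> turns \<open>e0\<close> into a proportion between
  \<open>l1\<close> and \<open>l2\<close>. Eliminating \<open>y\<close> from \<open>e2\<close> and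
  \<open>e3\<close> then leaves an equation in \<open>N\<close> alone, whose right-hand side has
  degree four in \<open>N\<close> and is too large for \<open>N \<ge> 2\<close>.\<close>

lemma linear_system_pencil:
  fixes l1 l2 y g :: complex and N :: nat
  assumes N: "2 \<le> N"
    and e0: "g * ((of_nat N + 2) * l1 + 2 * l2) = 0"
    and e2: "((of_nat N + 4) * l2 - 2 * l1) * y + (4 * l1 - 2 * l2) * g = 0"
    and e3: "l1 * y + g * ((of_nat N + 1) * l2 + 2 * l1) = 0"
    and l: "l1 \<noteq> 0 \<or> l2 \<noteq> 0"
  shows "y = 0" "g = 0"
proof -
  show g: "g = 0"
  proof (rule ccontr)
    assume g: "g \<noteq> 0"
    then have l2: "2 * l2 = - (of_nat N + 2) * l1"
    proof -
      have "(of_nat N + 2) * l1 + 2 * l2 = 0" using e0 g by simp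
      then show ?thesis by (simp add: eq_neg_iff_add_eq_0 algebra_simps)
    qed
    then have l1: "l1 \<noteq> 0" using l by auto
    have "g * ((4 * l1 - 2 * l2) * l1 - ((of_nat N + 4) * l2 - 2 * l1) * ((of_nat N + 1) * l2 + 2 * l1)) =
       l1 * (((of_nat N + 4) * l2 - 2 * l1) * y + (4 * l1 - 2 * l2) * g)
       - ((of_nat N + 4) * l2 - 2 * l1) * (l1 * y + g * ((of_nat N + 1) * l2 + 2 * l1))"
      by (simp add: algebra_simps)
    then have "(4 * l1 - 2 * l2) * l1 - ((of_nat N + 4) * l2 - 2 * l1) * ((of_nat N + 1) * l2 + 2 * l1) = 0"
      unfolding e2 e3 using g by simp
    \<comment> \<open>After multiplication by four \<open>l2\<close> occurs only as
      \<open>2 * l2\<close>, which can be replaced by its multiple of \<open>l1\<close>.\<close>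
    moreover have "4 * (4 * l1 - 2 * l2) * l1 - ((of_nat N + 4) * (2 * l2) - 4 * l1) * ((of_nat N + 1) * (2 * l2) + 4 * l1)
       = 4 * ((4 * l1 - 2 * l2) * l1 - ((of_nat N + 4) * l2 - 2 * l1) * ((of_nat N + 1) * l2 + 2 * l1))"
      by (simp add: algebra_simps)
    ultimately have "4 * (4 * l1 - 2 * l2) * l1 - ((of_nat N + 4) * (2 * l2) - 4 * l1) * ((of_nat N + 1) * (2 * l2) + 4 * l1) = 0"
      by simp
    then have "l1^2 * (4 * (of_nat N + 6) - ((of_nat N + 4) * (of_nat N + 2) + 4) * ((of_nat N + 1) * (of_nat N + 2) - 4)) = 0"
      unfolding l2 by (simp add: algebra_simps power2_eq_square)
    then have "4 * (of_nat N + 6) = ((of_nat N + 4) * (of_nat N + 2) + 4) * ((of_nat N + 1) * (of_nat N + 2) - 4 :: complex)"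
      using l1 by simp
    \<comment> \<open>Moving the subtrahend to the left makes both sides images of natural numbers,
      so the equation can be compared in \<open>nat\<close>.\<close>
    then have c: "4 * (of_nat N + 6) + 4 * ((of_nat N + 4) * (of_nat N + 2) + 4)
        = ((of_nat N + 4) * (of_nat N + 2) + 4) * ((of_nat N + 1) * (of_nat N + 2) :: complex)"
      by (simp add: algebra_simps)
    have "4 * (N + 6) + 4 * ((N + 4) * (N + 2) + 4) = ((N + 4) * (N + 2) + 4) * ((N + 1) * (N + 2))"
    proof -
      have "(of_nat (4 * (N + 6) + 4 * ((N + 4) * (N + 2) + 4)) :: complex)
         = of_nat (((N + 4) * (N + 2) + 4) * ((N + 1) * (N + 2)))"
        using c by (simp only: of_nat_add of_nat_mult of_nat_numeral of_nat_1)
      then show ?thesis by (simp only: of_nat_eq_iff)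
    qed
    moreover have "((N + 4) * (N + 2) + 4) * 12 \<le> ((N + 4) * (N + 2) + 4) * ((N + 1) * (N + 2))"
      using mult_le_mono[of 3 "N + 1" 4 "N + 2"] N by (intro mult_le_mono2) simp
    moreover have "4 * (N + 6) < ((N + 4) * (N + 2) + 4) * 8"
    proof -
      define t where "t = (N + 4) * (N + 2) + 4"
      have "N + 6 \<le> t" by (simp add: t_def)
      then have "4 * (N + 6) < t * 8" by presburger
      then show ?thesis by (simp only: t_def)
    qed
    ultimately show False by linarith
  qed
  have N4: "(of_nat N + 4 :: complex) \<noteq> 0"
    using of_nat_eq_0_iff[of "N + 4", where ?'a=complex] by simp
  show "y = 0" using e2 e3 g l N4 by (cases "l1 = 0") auto
qed

lemma linear_system_two_pencils:
  fixes l1 l2 g :: complex and N :: nat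
  assumes N: "1 \<le> N"
    and e0: "g * ((of_nat N + 2) * l1 + 2 * l2) = 0" and e1: "g * ((of_nat N + 2) * l2 + 2 * l1) = 0"
    and l: "l1 \<noteq> 0 \<or> l2 \<noteq> 0"
  shows "g = 0"
proof (rule ccontr)
  assume "g \<noteq> 0"
  then have e: "(of_nat N + 2) * l1 + 2 * l2 = 0" "(of_nat N + 2) * l2 + 2 * l1 = 0" using e0 e1 by auto
  have "of_nat N * (of_nat N + 4) * l1 = (of_nat N + 2) * ((of_nat N + 2) * l1 + 2 * l2) - 2 * ((of_nat N + 2) * l2 + 2 * l1)"
    "of_nat N * (of_nat N + 4) * l2 = (of_nat N + 2) * ((of_nat N + 2) * l2 + 2 * l1) - 2 * ((of_nat N + 2) * l1 + 2 * l2)"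
    by (simp_all add: algebra_simps)
  then have z: "of_nat N * (of_nat N + 4) * l1 = 0" "of_nat N * (of_nat N + 4) * l2 = 0" unfolding e by simp_all
  have "(of_nat N * (of_nat N + 4) :: complex) \<noteq> 0"
    using of_nat_eq_0_iff[of "N * (N + 4)", where ?'a=complex] N by simp
  then show False using z l by simp
qed

context web_series
begin

lemma leading_cases [case_names 1 2 3]:
  assumes a: "lin_sol a" and b: "lin_sol b" and ne: "a \<noteq> b"
  obtains "jet 0 0 (b - a) \<noteq> 0"
  | "ord 1 (b - a)" "jet 1 0 (b - a) \<noteq> 0 \<or> jet 0 1 (b - a) \<noteq> 0"
  | "ord 2 (b - a)" "jet 1 1 (b - a) \<noteq> 0" "jet 2 0 (b - a) = 2 * jet 1 1 (b - a)" "jet 0 2 (b - a) = 2 * jet 1 1 (b - a)"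
  using difference_leading_form[OF assms] by blast

text \<open>The leading form of \<open>k\<close> is encoded by \<open>x 0\<close>,
  \<open>x n\<close> and the common value \<open>g\<close> of the mixed jets. Each type of leading
  form of \<open>b - a\<close> gives enough equations among them. The bound \<open>4 \<le> n\<close>
  ensures that \<open>jet (n - 3) 3 k\<close>, which these equations contain, is still a mixed
  jet.\<close>

lemma curvature_jets_eq_0:
  assumes a: "lin_sol a" and b: "lin_sol b" and ne: "a \<noteq> b" and k: "ord n k" and n: "4 \<le> n"
  shows "ord (Suc n) k"
proof -
  define x where "x j = jet (n - j) j k" for j
  define g where "g = x 1"
  have st: "x j = x (Suc j)" if "1 \<le> j" "j \<le> n - 2" for j
    using compat_lead[OF a k that] by (simp add: x_def)
  have g: "x j = g" if "1 \<le> j" "j \<le> n - 1" for j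
    using that by (induction j rule: nat_induct_at_least) (use st in \<open>auto simp: g_def\<close>)
  have gs: "jet (n - 1) 1 k = g" "jet (n - 2) 2 k = g" "jet (n - 3) 3 k = g"
     "jet 1 (n - 1) k = g" "jet 2 (n - 2) k = g" "jet 3 (n - 3) k = g"
    using g[of 1] g[of 2] g[of 3] g[of "n - 1"] g[of "n - 2"] g[of "n - 3"] n
    by (auto simp: x_def numeral_eq_Suc)
  have "x 0 = 0 \<and> x n = 0 \<and> g = 0"
  proof (cases rule: leading_cases[OF a b ne])
    case l: 1
    note L = leading_eq_0[OF a b k _ l]
    show ?thesis
      using L[of "n - 2" 0] L[of "n - 3" 1] L[of 0 "n - 2"] n gs
      by (auto simp: x_def eval_nat_numeral Suc_diff_Suc)
  next
    case 2
    then have l: "ord 1 (b - a)" and l0: "jet 1 0 (b - a) \<noteq> 0 \<or> jet 0 1 (b - a) \<noteq> 0" by auto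
    define p q where "p = jet 1 0 (b - a)" and "q = jet 0 1 (b - a)"
    note L = leading_eq_1[OF a b k _ l, folded p_def q_def]
    note l0 = l0[folded p_def q_def]
    define N where "N = n - 1"
    have nN: "n = Suc N" "3 \<le> N" using n by (auto simp: N_def)
    \<comment> \<open>Writing \<open>N\<close> as a threefold successor lets the truncated
      differences in the jet indices be evaluated by rewriting.\<close>
    obtain N' where N': "N = Suc (Suc (Suc N'))" using nN by (metis Suc_le_D Suc_le_mono numeral_3_eq_3)
    have nN2: "2 \<le> n" using n by simp
    have e0: "((of_nat N + 4) * p - 2 * q) * x 0 + (4 * q - 2 * p) * g = 0"
      using L[of N 0] gs nN2 unfolding x_def nN N' by (auto simp: eval_nat_numeral algebra_simps)
    have e1: "q * x 0 + g * ((of_nat N + 1) * p + 2 * q) = 0"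
      using L[of "N - 1" 1] gs nN2 unfolding x_def nN N' by (auto simp: eval_nat_numeral algebra_simps)
    have e2: "((of_nat N + 4) * q - 2 * p) * x n + (4 * p - 2 * q) * g = 0"
      using L[of 0 N] gs nN2 unfolding x_def nN N' by (auto simp: eval_nat_numeral algebra_simps)
    have e3: "p * x n + g * ((of_nat N + 1) * q + 2 * p) = 0"
      using L[of 1 "N - 1"] gs nN2 unfolding x_def nN N' by (auto simp: eval_nat_numeral algebra_simps)
    note s = linear_system_generic[of N p q "x 0" g "x n"]
    show ?thesis using s[OF nN(2) e0 e1 e2 e3 l0] by auto
  next
    case 3
    then have l: "ord 2 (b - a)" "jet 1 1 (b - a) \<noteq> 0" "jet 2 0 (b - a) = 2 * jet 1 1 (b - a)" "jet 0 2 (b - a) = 2 * jet 1 1 (b - a)" by auto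
    note L = leading_eq_2[OF a b k _ l(1) _ l(2-4)]
    have ne: "(of_nat u :: complex) + (6 * of_nat n + 8) \<noteq> 0" for u
      using of_nat_eq_0_iff[of "u + (6 * n + 8)", where ?'a=complex] by simp
    have x0: "(of_nat (n * (n - 1)) + (6 * of_nat n + 8)) * x 0 = 0"
      using L[of n 0] gs n by (simp add: x_def algebra_simps numeral_2_eq_2)
    have xn: "(of_nat (n * (n - 1)) + (6 * of_nat n + 8)) * x n = 0"
      using L[of 0 n] gs n by (simp add: x_def algebra_simps numeral_2_eq_2)
    have x0': "x 0 = 0" using x0 ne[of "n * (n - 1)"] by (metis mult_eq_0_iff)
    have "(of_nat ((n - 1) * (n - 2)) + (6 * of_nat n + 8)) * g = 0"
    proof -
      define m where "m = n - 2"
      have m: "n = Suc (Suc m)" using n by (simp add: m_def)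
      show ?thesis
        using L[of "n - 1" 1] gs n x0'[unfolded x_def] unfolding m by (simp add: x_def algebra_simps eval_nat_numeral)
    qed
    then have "g = 0" using ne[of "(n - 1) * (n - 2)"] by (metis mult_eq_0_iff)
    then show ?thesis using x0' xn ne[of "n * (n - 1)"] by (metis mult_eq_0_iff)
  qed
  then have "x j = 0" if "j \<le> n" for j
    using g[of j] that by (cases "j = 0"; cases "j = n") auto
  then show ?thesis using ord_Suc_jets[OF k] by (simp add: x_def)
qed

text \<open>The second-order condition on \<open>k\<close> identifies all jets of degree
  \<open>n\<close> except the pure one in \<open>Y\<close>, so only \<open>g\<close> and
  \<open>x n\<close> have to be eliminated.\<close>

lemma curvature_jets_eq_0_pencil:
  assumes a: "lin_sol a" and b: "lin_sol b" and ne: "a \<noteq> b" and k: "ord n k" and n: "3 \<le> n"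
    and p: "k + D2 1 a - 2 * D1 1 a = 0"
  shows "ord (Suc n) k"
proof -
  define x where "x j = jet (n - j) j k" for j
  define g where "g = x 0"
  have o: "ord (n - 1) (dX (dX k) - dX (dY k))"
  proof -
    have "dX (dX k) - dX (dY k) = (D1 3 (D1 2 k) - D2 3 (D1 2 k)) - (D1 3 (D1 2 k) - dX (dX k)) + (D2 3 (D1 2 k) - dX (dY k))"
      by simp
    also have "\<dots> = (- 3 * a * D2 2 k - k * (9 * D1 1 a - 9 * a * a - 3 * (D1 1 a - D2 1 a)))
       - (D1 3 (D1 2 k) - dX (dX k)) + (D2 3 (D1 2 k) - dX (dY k))"
      unfolding one_pencil_curvature[OF a p] ..
    finally have e: "dX (dX k) - dX (dY k) = \<dots>" .
    show ?thesis unfolding e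
      by (intro ord_add ord_diff DD_lead[OF k] ord_mult_left ord_D[OF k] ord_mult_right ord_mono[OF k]) auto
  qed
  have st: "x j = x (Suc j)" if "j \<le> n - 2" for j
  proof -
    have "jet (n - 2 - j) j (dX (dX k) - dX (dY k)) = 0"
      using o that n by (auto simp: ord_def simp del: jet_diff jet_dX jet_dY)
    moreover have "Suc (Suc (n - 2 - j)) = n - j" "Suc (n - 2 - j) = n - Suc j" using that n by auto
    ultimately show ?thesis by (simp add: x_def)
  qed
  have g: "x j = g" if "j \<le> n - 1" for j
    using that by (induction j) (use st in \<open>auto simp: g_def\<close>)
  have gs: "jet n 0 k = g" "jet (n - 1) 1 k = g" "jet (n - 2) 2 k = g"
     "jet 1 (n - 1) k = g" "jet 2 (n - 2) k = g" "jet 3 (n - 3) k = g"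
    using g[of 0] g[of 1] g[of 2] g[of "n - 1"] g[of "n - 2"] g[of "n - 3"] n
    by (auto simp: x_def numeral_eq_Suc)
  have "x n = 0 \<and> g = 0"
  proof (cases rule: leading_cases[OF a b ne])
    case l: 1
    note L = leading_eq_0[OF a b k _ l]
    show ?thesis
      using L[of "n - 2" 0] L[of 0 "n - 2"] n gs
      by (auto simp: x_def eval_nat_numeral Suc_diff_Suc)
  next
    case 2
    then have l: "ord 1 (b - a)" and l0: "jet 1 0 (b - a) \<noteq> 0 \<or> jet 0 1 (b - a) \<noteq> 0" by auto
    define p q where "p = jet 1 0 (b - a)" and "q = jet 0 1 (b - a)"
    note L = leading_eq_1[OF a b k _ l, folded p_def q_def]
    note l0 = l0[folded p_def q_def]
    define N where "N = n - 1"
    have nN: "n = Suc N" "2 \<le> N" using n by (auto simp: N_def)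
    obtain N' where N': "N = Suc (Suc N')" using nN by (metis Suc_le_D Suc_le_mono numeral_2_eq_2)
    have nN2: "2 \<le> n" using n by simp
    have e0: "g * ((of_nat N + 2) * p + 2 * q) = 0"
      using L[of N 0] gs nN2 unfolding x_def nN N' by (auto simp: eval_nat_numeral algebra_simps)
    have e1: "((of_nat N + 4) * q - 2 * p) * x n + (4 * p - 2 * q) * g = 0"
      using L[of 0 N] gs nN2 unfolding x_def nN N' by (auto simp: eval_nat_numeral algebra_simps)
    have e2: "p * x n + g * ((of_nat N + 1) * q + 2 * p) = 0"
      using L[of 1 "N - 1"] gs nN2 unfolding x_def nN N' by (auto simp: eval_nat_numeral algebra_simps)
    note s = linear_system_pencil[of N g p q "x n"]
    show ?thesis using s[OF nN(2) e0 e1 e2 l0] by auto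
  next
    case 3
    then have l: "ord 2 (b - a)" "jet 1 1 (b - a) \<noteq> 0" "jet 2 0 (b - a) = 2 * jet 1 1 (b - a)" "jet 0 2 (b - a) = 2 * jet 1 1 (b - a)" by auto
    note L = leading_eq_2[OF a b k _ l(1) _ l(2-4)]
    have ne: "(of_nat u :: complex) + (6 * of_nat n + 8) \<noteq> 0" for u
      using of_nat_eq_0_iff[of "u + (6 * n + 8)", where ?'a=complex] by simp
    have x0: "(of_nat (n * (n - 1)) + (6 * of_nat n + 8)) * g = 0"
      using L[of n 0] gs n by (simp add: x_def algebra_simps numeral_2_eq_2)
    have xn: "(of_nat (n * (n - 1)) + (6 * of_nat n + 8)) * x n = 0"
      using L[of 0 n] gs n by (simp add: x_def algebra_simps numeral_2_eq_2)
    show ?thesis using x0 xn ne[of "n * (n - 1)"] by (metis mult_eq_0_iff)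
  qed
  then have "x j = 0" if "j \<le> n" for j
    using g[of j] that by (cases "j = n") auto
  then show ?thesis using ord_Suc_jets[OF k] by (simp add: x_def)
qed

text \<open>The first-order condition on \<open>k\<close> identifies all jets of degree
  \<open>n\<close>, so the single number \<open>g\<close> has to be eliminated.\<close>

lemma curvature_jets_eq_0_two_pencils:
  assumes a: "lin_sol a" and b: "lin_sol b" and ne: "a \<noteq> b" and k: "ord n k" and n: "2 \<le> n"
    and p: "k + D2 1 a - 2 * D1 1 a = 0" "k + D1 1 a - 2 * D2 1 a = 0"
  shows "ord (Suc n) k"
proof -
  define x where "x j = jet (n - j) j k" for j
  define g where "g = x 0"
  have o: "ord n (dX k - dY k)"
  proof -
    have "dX k - dY k = (D1 2 k - D2 2 k) - (D1 2 k - dX k) + (D2 2 k - dY k)"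
      by simp
    also have "\<dots> = - 3 * a * k - (D1 2 k - dX k) + (D2 2 k - dY k)"
      unfolding two_pencils_curvature[OF p] ..
    finally have e: "dX k - dY k = \<dots>" .
    show ?thesis unfolding e
      by (intro ord_add ord_diff D_lead[OF k] ord_mult_left k)
  qed
  have st: "x j = x (Suc j)" if "j \<le> n - 1" for j
  proof -
    have "jet (n - 1 - j) j (dX k - dY k) = 0"
      using o that n by (auto simp: ord_def simp del: jet_diff jet_dX jet_dY)
    moreover have "Suc (n - 1 - j) = n - j" using that n by auto
    ultimately show ?thesis by (simp add: x_def)
  qed
  have g: "x j = g" if "j \<le> n" for j
    using that by (induction j) (use st in \<open>auto simp: g_def\<close>)
  have gs: "jet n 0 k = g" "jet (n - 1) 1 k = g" "jet (n - 2) 2 k = g"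
     "jet 0 n k = g" "jet 1 (n - 1) k = g" "jet 2 (n - 2) k = g"
    using g[of 0] g[of 1] g[of 2] g[of n] g[of "n - 1"] g[of "n - 2"] n
    by (auto simp: x_def numeral_eq_Suc)
  have "g = 0"
  proof (cases rule: leading_cases[OF a b ne])
    case l: 1
    note L = leading_eq_0[OF a b k _ l]
    show ?thesis
      using L[of "n - 2" 0] n gs
      by (auto simp: x_def eval_nat_numeral Suc_diff_Suc)
  next
    case 2
    then have l: "ord 1 (b - a)" and l0: "jet 1 0 (b - a) \<noteq> 0 \<or> jet 0 1 (b - a) \<noteq> 0" by auto
    define p q where "p = jet 1 0 (b - a)" and "q = jet 0 1 (b - a)"
    note L = leading_eq_1[OF a b k _ l, folded p_def q_def]
    note l0 = l0[folded p_def q_def]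
    define N where "N = n - 1"
    have nN: "n = Suc N" "1 \<le> N" using n by (auto simp: N_def)
    obtain N' where N': "N = Suc N'" using nN by (metis Suc_le_D One_nat_def)
    have nN2: "2 \<le> n" using n by simp
    have e0: "g * ((of_nat N + 2) * p + 2 * q) = 0"
      using L[of N 0] gs nN2 unfolding x_def nN N' by (auto simp: eval_nat_numeral algebra_simps)
    have e1: "g * ((of_nat N + 2) * q + 2 * p) = 0"
      using L[of 0 N] gs nN2 unfolding x_def nN N' by (auto simp: eval_nat_numeral algebra_simps)
    note s = linear_system_two_pencils[of N g p q]
    show ?thesis using s[OF nN(2) e0 e1 l0] by auto
  next
    case 3
    then have l: "ord 2 (b - a)" "jet 1 1 (b - a) \<noteq> 0" "jet 2 0 (b - a) = 2 * jet 1 1 (b - a)" "jet 0 2 (b - a) = 2 * jet 1 1 (b - a)" by auto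
    note L = leading_eq_2[OF a b k _ l(1) _ l(2-4)]
    have ne: "(of_nat u :: complex) + (6 * of_nat n + 8) \<noteq> 0" for u
      using of_nat_eq_0_iff[of "u + (6 * n + 8)", where ?'a=complex] by simp
    have x0: "(of_nat (n * (n - 1)) + (6 * of_nat n + 8)) * g = 0"
      using L[of n 0] gs n by (simp add: x_def algebra_simps numeral_2_eq_2)
    then show ?thesis using ne[of "n * (n - 1)"] by (metis mult_eq_0_iff)
  qed
  then have "x j = 0" if "j \<le> n" for j
    using g[of j] that by auto
  then show ?thesis using ord_Suc_jets[OF k] by (simp add: x_def)
qed

theorem curvature_eq_0:
  assumes a: "lin_sol a" and b: "lin_sol b" and ne: "a \<noteq> b"
    and "ord 4 k \<or> (ord 3 k \<and> k + D2 1 a - 2 * D1 1 a = 0)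
       \<or> (ord 2 k \<and> k + D2 1 a - 2 * D1 1 a = 0 \<and> k + D1 1 a - 2 * D2 1 a = 0)"
  shows "k = 0"
  using assms(4)
proof (elim disjE conjE)
  assume "ord 4 k"
  then show ?thesis by (rule ord_step_eq_0) (rule curvature_jets_eq_0[OF a b ne])
next
  assume p: "k + D2 1 a - 2 * D1 1 a = 0" and "ord 3 k"
  from this(2) show ?thesis by (rule ord_step_eq_0) (rule curvature_jets_eq_0_pencil[OF a b ne _ _ p])
next
  assume p: "k + D2 1 a - 2 * D1 1 a = 0" "k + D1 1 a - 2 * D2 1 a = 0" and "ord 2 k"
  from this(3) show ?thesis by (rule ord_step_eq_0) (rule curvature_jets_eq_0_two_pencils[OF a b ne _ _ p])
qed

end

section \<open>Holomorphic functions of two variables\<close>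

abbreviation cderiv2 :: "(complex \<times> complex \<Rightarrow> complex) \<Rightarrow> complex \<Rightarrow> complex \<Rightarrow> complex \<times> complex \<Rightarrow> bool" where
  "cderiv2 f p q z \<equiv> (f has_derivative (\<lambda>w. fst w * p + snd w * q)) (at z)"

lemma cderiv2_slices:
  assumes "cderiv2 f p q z"
  shows "((\<lambda>t. f (t, snd z)) has_field_derivative p) (at (fst z))"
    "((\<lambda>t. f (fst z, t)) has_field_derivative q) (at (snd z))"
proof -
  have "((\<lambda>t. (t, snd z)) has_derivative (\<lambda>h. (h, 0))) (at (fst z))"
    by (auto intro!: derivative_eq_intros)
  from has_derivative_compose[OF this, of f "\<lambda>w. fst w * p + snd w * q"] assms
  show "((\<lambda>t. f (t, snd z)) has_field_derivative p) (at (fst z))"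
    by (simp add: has_field_derivative_def mult_commute_abs)
  have "((\<lambda>t. (fst z, t)) has_derivative (\<lambda>h. (0, h))) (at (snd z))"
    by (auto intro!: derivative_eq_intros)
  from has_derivative_compose[OF this, of f "\<lambda>w. fst w * p + snd w * q"] assms
  show "((\<lambda>t. f (fst z, t)) has_field_derivative q) (at (snd z))"
    by (simp add: has_field_derivative_def mult_commute_abs)
qed

lemma cderiv2_pd: "cderiv2 f p q z \<Longrightarrow> pdx f z = p" "cderiv2 f p q z \<Longrightarrow> pdy f z = q"
  using cderiv2_slices[of f p q z] by (auto simp: pdx_def pdy_def intro: DERIV_imp_deriv)

lemma holo2_open: "holo2 f U \<Longrightarrow> open U"
  by (simp add: holo2_def)

lemma holo2_cderiv2:
  assumes "holo2 f U" "z \<in> U"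
  shows "cderiv2 f (pdx f z) (pdy f z) z"
proof -
  obtain f' where f': "(f has_derivative f') (at z)" and l: "\<And>c w. f' (cscale c w) = c * f' w"
    using assms unfolding holo2_def by blast
  interpret bounded_linear f' using f' by (rule has_derivative_bounded_linear)
  have "f' w = fst w * f' (1, 0) + snd w * f' (0, 1)" for w
    using add[of "cscale (fst w) (1, 0)" "cscale (snd w) (0, 1)"] unfolding l by (simp add: cscale_def)
  then have "f' = (\<lambda>w. fst w * f' (1, 0) + snd w * f' (0, 1))" by (rule ext)
  then have c: "cderiv2 f (f' (1, 0)) (f' (0, 1)) z" using f' by simp
  show ?thesis using c unfolding cderiv2_pd[OF c] .
qed

lemma holo2I:
  assumes "open U" "\<And>z. z \<in> U \<Longrightarrow> \<exists>p q. cderiv2 f p q z"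
  shows "holo2 f U"
  unfolding holo2_def
proof (intro conjI assms(1) ballI)
  fix z assume "z \<in> U"
  then obtain p q where "cderiv2 f p q z" using assms(2) by blast
  then show "\<exists>f'. (f has_derivative f') (at z) \<and> (\<forall>c w. f' (cscale c w) = c * f' w)"
    by (intro exI conjI) (auto simp: cscale_def algebra_simps)
qed

lemma holo2_subset: "holo2 f U \<Longrightarrow> open V \<Longrightarrow> V \<subseteq> U \<Longrightarrow> holo2 f V"
  by (auto simp: holo2_def)

lemma pd_cong:
  assumes "open U" "z \<in> U" "\<And>w. w \<in> U \<Longrightarrow> f w = g w"
  shows "pdx f z = pdx g z" "pdy f z = pdy g z"
proof -
  have o: "open ((\<lambda>t. (t, snd z)) -` U)" "open ((\<lambda>t. (fst z, t)) -` U)"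
    using assms(1) by (auto intro!: open_vimage continuous_intros)
  have "eventually (\<lambda>t. t \<in> (\<lambda>t. (t, snd z)) -` U) (nhds (fst z))"
    "eventually (\<lambda>t. t \<in> (\<lambda>t. (fst z, t)) -` U) (nhds (snd z))"
    by (rule eventually_nhds_in_open[OF o(1)], use assms(2) in simp, rule eventually_nhds_in_open[OF o(2)], use assms(2) in simp)
  then have "\<forall>\<^sub>F t in nhds (fst z). f (t, snd z) = g (t, snd z)" "\<forall>\<^sub>F t in nhds (snd z). f (fst z, t) = g (fst z, t)"
    by (auto elim!: eventually_mono simp: assms(3))
  then show "pdx f z = pdx g z" "pdy f z = pdy g z"
    unfolding pdx_def pdy_def by (auto intro: deriv_cong_ev)
qed

lemma holo2_const [simp]: "open U \<Longrightarrow> holo2 (\<lambda>z. c) U"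
  and holo2_fst [simp]: "open U \<Longrightarrow> holo2 fst U"
  and holo2_snd [simp]: "open U \<Longrightarrow> holo2 snd U"
proof -
  assume U: "open U"
  have "cderiv2 (\<lambda>z. c) 0 0 z" "cderiv2 fst 1 0 z" "cderiv2 snd 0 1 z" for z
    by (auto intro!: derivative_eq_intros)
  then show "holo2 (\<lambda>z. c) U" "holo2 fst U" "holo2 snd U" using U holo2I by blast+
qed

lemma pd_const [simp]: "pdx (\<lambda>z. c) z = 0" "pdy (\<lambda>z. c) z = 0"
  by (simp_all add: pdx_def pdy_def)
lemma pd_var [simp]: "pdx fst z = 1" "pdy fst z = 0" "pdx snd z = 0" "pdy snd z = 1"
  by (simp_all add: pdx_def pdy_def)

lemma cderiv2_add: "cderiv2 f p q z \<Longrightarrow> cderiv2 g p' q' z \<Longrightarrow> cderiv2 (\<lambda>w. f w + g w) (p + p') (q + q') z"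
  by (drule (1) has_derivative_add) (simp add: algebra_simps)
lemma cderiv2_mult: "cderiv2 f p q z \<Longrightarrow> cderiv2 g p' q' z \<Longrightarrow> cderiv2 (\<lambda>w. f w * g w) (p * g z + f z * p') (q * g z + f z * q') z"
  by (drule (1) has_derivative_mult) (simp add: algebra_simps)

lemma holo2_pd_add:
  assumes f: "holo2 f U" and g: "holo2 g U"
  shows "holo2 (\<lambda>w. f w + g w) U"
    "z \<in> U \<Longrightarrow> pdx (\<lambda>w. f w + g w) z = pdx f z + pdx g z"
    "z \<in> U \<Longrightarrow> pdy (\<lambda>w. f w + g w) z = pdy f z + pdy g z"
proof -
  note * = cderiv2_add[OF holo2_cderiv2[OF f] holo2_cderiv2[OF g]]
  show "holo2 (\<lambda>w. f w + g w) U" by (rule holo2I) (use * holo2_open[OF f] in blast)+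
  show "z \<in> U \<Longrightarrow> pdx (\<lambda>w. f w + g w) z = pdx f z + pdx g z"
    "z \<in> U \<Longrightarrow> pdy (\<lambda>w. f w + g w) z = pdy f z + pdy g z" using cderiv2_pd[OF *] by auto
qed

lemma holo2_pd_mult:
  assumes f: "holo2 f U" and g: "holo2 g U"
  shows "holo2 (\<lambda>w. f w * g w) U"
    "z \<in> U \<Longrightarrow> pdx (\<lambda>w. f w * g w) z = pdx f z * g z + f z * pdx g z"
    "z \<in> U \<Longrightarrow> pdy (\<lambda>w. f w * g w) z = pdy f z * g z + f z * pdy g z"
proof -
  note * = cderiv2_mult[OF holo2_cderiv2[OF f] holo2_cderiv2[OF g]]
  show "holo2 (\<lambda>w. f w * g w) U" by (rule holo2I) (use * holo2_open[OF f] in blast)+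
  show "z \<in> U \<Longrightarrow> pdx (\<lambda>w. f w * g w) z = pdx f z * g z + f z * pdx g z"
    "z \<in> U \<Longrightarrow> pdy (\<lambda>w. f w * g w) z = pdy f z * g z + f z * pdy g z" using cderiv2_pd[OF *] by auto
qed

lemmas holo2_add = holo2_pd_add(1)
lemmas holo2_mult = holo2_pd_mult(1)

lemma holo2_minus: "holo2 f U \<Longrightarrow> holo2 (\<lambda>w. - f w) U"
  using holo2_mult[OF holo2_const[of U "-1"], of f] holo2_open[of f U] by simp
lemma holo2_diff: "holo2 f U \<Longrightarrow> holo2 g U \<Longrightarrow> holo2 (\<lambda>w. f w - g w) U"
  using holo2_add[OF _ holo2_minus, of f U g] by simp

lemma pd_minus: assumes "holo2 f U" "z \<in> U"
  shows "pdx (\<lambda>w. - f w) z = - pdx f z" "pdy (\<lambda>w. - f w) z = - pdy f z"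
  using holo2_pd_mult(2,3)[OF holo2_const[OF holo2_open[OF assms(1)], of "-1"] assms] by simp_all
lemma pd_diff: assumes "holo2 f U" "holo2 g U" "z \<in> U"
  shows "pdx (\<lambda>w. f w - g w) z = pdx f z - pdx g z" "pdy (\<lambda>w. f w - g w) z = pdy f z - pdy g z"
  using holo2_pd_add(2,3)[OF assms(1) holo2_minus[OF assms(2)] assms(3)] pd_minus[OF assms(2,3)] by simp_all

lemma holo2_sum: "finite I \<Longrightarrow> open U \<Longrightarrow> (\<And>i. i \<in> I \<Longrightarrow> holo2 (f i) U) \<Longrightarrow> holo2 (\<lambda>w. \<Sum>i\<in>I. f i w) U"
  by (induction I rule: finite_induct) (auto intro!: holo2_add)

lemma holo2_power: "holo2 f U \<Longrightarrow> holo2 (\<lambda>w. f w ^ n) U"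
  by (induction n) (auto intro!: holo2_mult dest: holo2_open)

lemma holo2_compose_pd:
  assumes f: "holo2 f V" and u: "holo2 u U" and v: "holo2 v U"
    and uv: "\<And>z. z \<in> U \<Longrightarrow> (u z, v z) \<in> V"
  shows "holo2 (\<lambda>z. f (u z, v z)) U"
    "z \<in> U \<Longrightarrow> pdx (\<lambda>z. f (u z, v z)) z = pdx f (u z, v z) * pdx u z + pdy f (u z, v z) * pdx v z"
    "z \<in> U \<Longrightarrow> pdy (\<lambda>z. f (u z, v z)) z = pdx f (u z, v z) * pdy u z + pdy f (u z, v z) * pdy v z"
proof -
  have *: "cderiv2 (\<lambda>z. f (u z, v z)) (pdx f (u z, v z) * pdx u z + pdy f (u z, v z) * pdx v z)
     (pdx f (u z, v z) * pdy u z + pdy f (u z, v z) * pdy v z) z" if z: "z \<in> U" for z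
  proof -
    have "((\<lambda>z. (u z, v z)) has_derivative (\<lambda>w. (fst w * pdx u z + snd w * pdy u z, fst w * pdx v z + snd w * pdy v z))) (at z)"
      by (rule has_derivative_Pair[OF holo2_cderiv2[OF u z] holo2_cderiv2[OF v z]])
    from has_derivative_compose[OF this holo2_cderiv2[OF f uv[OF z]]]
    show ?thesis by (simp add: algebra_simps)
  qed
  show "holo2 (\<lambda>z. f (u z, v z)) U" by (rule holo2I) (use * holo2_open[OF u] in blast)+
  show "z \<in> U \<Longrightarrow> pdx (\<lambda>z. f (u z, v z)) z = pdx f (u z, v z) * pdx u z + pdy f (u z, v z) * pdx v z"
    "z \<in> U \<Longrightarrow> pdy (\<lambda>z. f (u z, v z)) z = pdx f (u z, v z) * pdy u z + pdy f (u z, v z) * pdy v z"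
    using cderiv2_pd[OF *] by auto
qed

lemma holo2_inverse:
  assumes f: "holo2 f U" and nz: "\<And>z. z \<in> U \<Longrightarrow> f z \<noteq> 0"
  shows "holo2 (\<lambda>z. inverse (f z)) U"
proof (rule holo2I[OF holo2_open[OF f]])
  fix z assume z: "z \<in> U"
  have "((\<lambda>z. inverse (f z)) has_derivative (\<lambda>w. - (inverse (f z) * (fst w * pdx f z + snd w * pdy f z) * inverse (f z)))) (at z)"
    by (rule Deriv.has_derivative_inverse[OF nz[OF z] holo2_cderiv2[OF f z]])
  then have "cderiv2 (\<lambda>z. inverse (f z)) (- (inverse (f z) * pdx f z * inverse (f z))) (- (inverse (f z) * pdy f z * inverse (f z))) z"
    by (simp add: algebra_simps)
  then show "\<exists>p q. cderiv2 (\<lambda>z. inverse (f z)) p q z" by blast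
qed

lemma holo2_divide: "holo2 f U \<Longrightarrow> holo2 g U \<Longrightarrow> (\<And>z. z \<in> U \<Longrightarrow> g z \<noteq> 0) \<Longrightarrow> holo2 (\<lambda>z. f z / g z) U"
  unfolding divide_inverse by (intro holo2_mult holo2_inverse)

lemma holo2_continuous: "holo2 f U \<Longrightarrow> continuous_on U f"
  by (meson continuous_at_imp_continuous_on has_derivative_continuous holo2_cderiv2)

lemma holo2_slice_holomorphic:
  assumes "holo2 f U"
  shows "(\<lambda>t. f (t, y)) holomorphic_on ((\<lambda>t. (t, y)) -` U)" "(\<lambda>t. f (x, t)) holomorphic_on ((\<lambda>t. (x, t)) -` U)"
proof -
  show "(\<lambda>t. f (t, y)) holomorphic_on ((\<lambda>t. (t, y)) -` U)"
    unfolding holomorphic_on_def field_differentiable_def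
  proof (intro ballI exI)
    fix t assume "t \<in> (\<lambda>t. (t, y)) -` U"
    then show "((\<lambda>t. f (t, y)) has_field_derivative pdx f (t, y)) (at t within (\<lambda>t. (t, y)) -` U)"
      using cderiv2_slices(1)[OF holo2_cderiv2[OF assms], of "(t, y)"] by (simp add: has_field_derivative_at_within)
  qed
  show "(\<lambda>t. f (x, t)) holomorphic_on ((\<lambda>t. (x, t)) -` U)"
    unfolding holomorphic_on_def field_differentiable_def
  proof (intro ballI exI)
    fix t assume "t \<in> (\<lambda>t. (x, t)) -` U"
    then show "((\<lambda>t. f (x, t)) has_field_derivative pdy f (x, t)) (at t within (\<lambda>t. (x, t)) -` U)"
      using cderiv2_slices(2)[OF holo2_cderiv2[OF assms], of "(x, t)"] by (simp add: has_field_derivative_at_within)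
  qed
qed

text \<open>Exchanging the variables carries results about \<open>pdx\<close> over to
  \<open>pdy\<close>, so that the analysis is done for \<open>pdx\<close> only.\<close>

lemma holo2_swap:
  assumes "holo2 f U"
  shows "holo2 (f \<circ> prod.swap) (prod.swap -` U)"
proof -
  have o: "open (prod.swap -` U)"
    using holo2_open[OF assms] by (intro open_vimage) (auto simp: prod.swap_def intro!: continuous_intros)
  have "holo2 (\<lambda>z. f (snd z, fst z)) (prod.swap -` U)"
    using holo2_compose_pd(1)[OF assms, of snd "prod.swap -` U" fst] o by (auto simp: prod.swap_def)
  then show ?thesis by (simp add: comp_def prod.swap_def)
qed

lemma pd_swap: "pdx (f \<circ> prod.swap) z = pdy f (prod.swap z)" "pdy (f \<circ> prod.swap) z = pdx f (prod.swap z)"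
  by (simp_all add: pdx_def pdy_def)

lemma pdx_swap_swap: "pdx (f \<circ> prod.swap) \<circ> prod.swap = pdy f"
  by (rule ext) (simp add: pd_swap del: o_apply add: o_apply[of "pdx (f \<circ> prod.swap)"])

lemma polydisc_subset:
  assumes "open U" "z \<in> U"
  obtains r where "r > 0" "cball (fst z) r \<times> cball (snd z) r \<subseteq> U"
proof -
  obtain A B where AB: "open A" "open B" "z \<in> A \<times> B" "A \<times> B \<subseteq> U"
    by (rule open_prod_elim[OF assms])
  have "fst z \<in> A" "snd z \<in> B" using AB(3) by auto
  then obtain r s where "r > 0" "cball (fst z) r \<subseteq> A" "s > 0" "cball (snd z) s \<subseteq> B"
    using AB(1,2) unfolding open_contains_cball by blast
  moreover have "cball (fst z) (min r s) \<subseteq> cball (fst z) r" "cball (snd z) (min r s) \<subseteq> cball (snd z) s" by auto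
  ultimately have "min r s > 0" "cball (fst z) (min r s) \<times> cball (snd z) (min r s) \<subseteq> U"
    using AB(4) by (simp, blast)
  then show ?thesis using that by blast
qed

section \<open>Cauchy's formula and the regularity of partial derivatives\<close>

definition circ :: "complex \<Rightarrow> real \<Rightarrow> real \<Rightarrow> complex" where
  "circ x r t = x + of_real r * exp (2 * of_real pi * \<i> * of_real t)"

text \<open>The weight in Cauchy's formula for the first derivative when the circle is parametrized
  by the unit interval; the factor \<open>2 * pi * \<i>\<close> of the speed cancels the one in
  front of the contour integral.\<close>

definition cauchy_kernel :: "complex \<Rightarrow> real \<Rightarrow> complex \<Rightarrow> real \<Rightarrow> complex" where
  "cauchy_kernel x0 r x t = of_real r * exp (2 * of_real pi * \<i> * of_real t) / (circ x0 r t - x)\<^sup>2"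

lemma circ_sphere: "r > 0 \<Longrightarrow> dist x (circ x r t) = r"
  by (simp add: circ_def dist_norm norm_mult)

lemma circ_ne: "r > 0 \<Longrightarrow> x \<in> ball x0 r \<Longrightarrow> circ x0 r t \<noteq> x"
  using circ_sphere[of r x0 t] by auto

lemma cauchy_deriv_integral:
  assumes "continuous_on (cball x0 r) g" "g holomorphic_on ball x0 r" "x \<in> ball x0 r"
  shows "(g has_field_derivative integral (cbox 0 1) (\<lambda>t. g (circ x0 r t) * cauchy_kernel x0 r x t)) (at x)"
proof -
  have "contour_integral (circlepath x0 r) (\<lambda>u. g u / (u - x)\<^sup>2) =
     integral {0..1} (\<lambda>t. 2 * of_real pi * \<i> * (g (circ x0 r t) * cauchy_kernel x0 r x t))"
    unfolding contour_integral_integral vector_derivative_circlepath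
    by (simp add: circlepath circ_def cauchy_kernel_def mult_ac)
  also have "\<dots> = 2 * of_real pi * \<i> * integral {0..1} (\<lambda>t. g (circ x0 r t) * cauchy_kernel x0 r x t)"
    by (rule integral_mult_right)
  finally show ?thesis
    using Cauchy_derivative_integral_circlepath(2)[OF assms] by (simp add: field_simps)
qed

lemma continuous_cauchy_kernel:
  assumes "r > 0" and "\<And>z. z \<in> S \<Longrightarrow> h z \<in> ball x0 r" "continuous_on S h" "continuous_on S k"
  shows "continuous_on S (\<lambda>z. cauchy_kernel x0 r (h z) (k z))"
  unfolding cauchy_kernel_def circ_def
  using circ_ne[OF assms(1,2)] by (intro continuous_intros assms) (auto simp: circ_def)

lemma pdx_integral:
  assumes f: "holo2 f U" and sub: "cball x0 r \<times> cball y0 r \<subseteq> U" and r: "r > 0"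
    and x: "x \<in> ball x0 r" and y: "y \<in> cball y0 r"
  shows "pdx f (x, y) = integral (cbox 0 1) (\<lambda>t. f (circ x0 r t, y) * cauchy_kernel x0 r x t)"
proof -
  have "(\<lambda>t. f (t, y)) holomorphic_on ((\<lambda>t. (t, y)) -` U)" by (rule holo2_slice_holomorphic[OF f])
  moreover have "cball x0 r \<subseteq> (\<lambda>t. (t, y)) -` U" using y by (auto intro!: subsetD[OF sub])
  ultimately have h: "(\<lambda>t. f (t, y)) holomorphic_on cball x0 r" by (rule holomorphic_on_subset)
  from DERIV_imp_deriv[OF cauchy_deriv_integral[OF holomorphic_on_imp_continuous_on[OF h] holomorphic_on_subset[OF h] x]]
  show ?thesis by (auto simp: pdx_def)
qed

text \<open>On a small polydisc \<open>pdx f\<close> is a Cauchy integral that depends continuously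
  on both variables as parameters; hence joint continuity.\<close>

lemma pdx_continuous:
  assumes f: "holo2 f U" shows "continuous_on U (pdx f)"
proof -
  have "isCont (pdx f) z" if z: "z \<in> U" for z
  proof -
    obtain r where r: "r > 0" and sub: "cball (fst z) r \<times> cball (snd z) r \<subseteq> U"
      using polydisc_subset[OF holo2_open[OF f] z] by blast
    let ?S = "ball (fst z) r \<times> ball (snd z) r"
    have "continuous_on (?S \<times> cbox 0 1) (\<lambda>(w, t). f (circ (fst z) r t, snd w) * cauchy_kernel (fst z) r (fst w) t)"
      unfolding split_beta
    proof (rule continuous_on_mult)
      show "continuous_on (?S \<times> cbox 0 1) (\<lambda>p. f (circ (fst z) r (snd p), snd (fst p)))"
      proof (rule continuous_on_compose2[OF holo2_continuous[OF f]])
        show "continuous_on (?S \<times> cbox 0 1) (\<lambda>p. (circ (fst z) r (snd p), snd (fst p)))"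
          unfolding circ_def by (intro continuous_intros)
        show "(\<lambda>p. (circ (fst z) r (snd p), snd (fst p))) ` (?S \<times> cbox 0 1) \<subseteq> U"
          using sub circ_sphere[OF r, of "fst z"] by (force simp: subset_eq)
      qed
      show "continuous_on (?S \<times> cbox 0 1) (\<lambda>p. cauchy_kernel (fst z) r (fst (fst p)) (snd p))"
        by (rule continuous_cauchy_kernel[OF r]) (auto intro!: continuous_intros)
    qed
    then have "continuous_on ?S (\<lambda>w. integral (cbox 0 1) (\<lambda>t. f (circ (fst z) r t, snd w) * cauchy_kernel (fst z) r (fst w) t))"
      by (rule integral_continuous_on_param)
    moreover have "pdx f w = integral (cbox 0 1) (\<lambda>t. f (circ (fst z) r t, snd w) * cauchy_kernel (fst z) r (fst w) t)"
      if "w \<in> ?S" for w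
      using pdx_integral[OF f sub r, of "fst w" "snd w"] that by (auto simp: mem_Times_iff)
    ultimately have "continuous_on ?S (pdx f)" by (simp cong: continuous_on_cong_simp)
    moreover have "open ?S" "z \<in> ?S" using r by (auto simp: open_Times mem_Times_iff)
    ultimately show ?thesis by (meson continuous_on_eq_continuous_at)
  qed
  then show ?thesis by (rule continuous_at_imp_continuous_on[OF ballI])
qed

lemma pdy_continuous:
  assumes f: "holo2 f U" shows "continuous_on U (pdy f)"
proof -
  have "continuous_on (prod.swap -` U) (pdx (f \<circ> prod.swap))" by (rule pdx_continuous[OF holo2_swap[OF f]])
  then have "continuous_on U (pdx (f \<circ> prod.swap) \<circ> prod.swap)"
    by (rule continuous_on_compose2[of _ _ U prod.swap, folded comp_def[of _ prod.swap]])
      (auto simp: prod.swap_def intro!: continuous_intros)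
  then show ?thesis by (simp only: pdx_swap_swap)
qed

text \<open>The derivative of \<open>pdx f\<close> in \<open>x\<close> exists by one-variable
  theory, the one in \<open>y\<close> by differentiation under Cauchy's integral. The latter is
  jointly continuous, which suffices for total differentiability. The integral is kept in the
  statement so that it can be recognized as \<open>pdx (pdy f)\<close>, which yields the symmetry of
  mixed derivatives.\<close>

lemma pdx_cderiv2:
  assumes f: "holo2 f U" and z: "z \<in> U"
  shows "\<exists>p r. cderiv2 (pdx f) p (integral (cbox 0 1) (\<lambda>t. pdy f (circ (fst z) r t, snd z) * cauchy_kernel (fst z) r (fst z) t)) z
     \<and> r > 0 \<and> cball (fst z) r \<times> cball (snd z) r \<subseteq> U"
proof -
  obtain r where r: "r > 0" and sub: "cball (fst z) r \<times> cball (snd z) r \<subseteq> U"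
    using polydisc_subset[OF holo2_open[OF f] z] by blast
  define x0 y0 where "x0 = fst z" and "y0 = snd z"
  note sub = sub[folded x0_def y0_def]
  let ?X = "ball x0 r" and ?Y = "ball y0 r"
  define h where "h x y = integral (cbox 0 1) (\<lambda>t. pdy f (circ x0 r t, y) * cauchy_kernel x0 r x t)" for x y
  have cin: "(circ x0 r t, y) \<in> U" if "y \<in> ?Y" for t y
    using sub circ_sphere[OF r, of x0 t] that by (auto simp: subset_eq)
  have hcont: "continuous_on (?X \<times> ?Y) (\<lambda>w. h (fst w) (snd w))"
  proof -
    have "continuous_on ((?X \<times> ?Y) \<times> cbox 0 1) (\<lambda>(w, t). pdy f (circ x0 r t, snd w) * cauchy_kernel x0 r (fst w) t)"
      unfolding split_beta
    proof (rule continuous_on_mult)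
      show "continuous_on ((?X \<times> ?Y) \<times> cbox 0 1) (\<lambda>p. pdy f (circ x0 r (snd p), snd (fst p)))"
      proof (rule continuous_on_compose2[OF pdy_continuous[OF f]])
        show "continuous_on ((?X \<times> ?Y) \<times> cbox 0 1) (\<lambda>p. (circ x0 r (snd p), snd (fst p)))"
          unfolding circ_def by (intro continuous_intros)
        show "(\<lambda>p. (circ x0 r (snd p), snd (fst p))) ` ((?X \<times> ?Y) \<times> cbox 0 1) \<subseteq> U"
          using cin by force
      qed
      show "continuous_on ((?X \<times> ?Y) \<times> cbox 0 1) (\<lambda>p. cauchy_kernel x0 r (fst (fst p)) (snd p))"
        by (rule continuous_cauchy_kernel[OF r]) (auto intro!: continuous_intros)
    qed
    then show ?thesis unfolding h_def by (rule integral_continuous_on_param)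
  qed
  have dy: "((\<lambda>y. pdx f (x, y)) has_field_derivative h x y) (at y within ?Y)" if x: "x \<in> ?X" and y: "y \<in> ?Y" for x y
  proof -
    have "((\<lambda>y. integral (cbox 0 1) (\<lambda>t. f (circ x0 r t, y) * cauchy_kernel x0 r x t)) has_field_derivative
        integral (cbox 0 1) (\<lambda>t. pdy f (circ x0 r t, y) * cauchy_kernel x0 r x t)) (at y within ?Y)"
    proof (rule leibniz_rule_field_derivative[OF _ _ _ y convex_ball])
      fix y t assume y: "y \<in> ?Y"
      show "((\<lambda>y. f (circ x0 r t, y) * cauchy_kernel x0 r x t) has_field_derivative
        pdy f (circ x0 r t, y) * cauchy_kernel x0 r x t) (at y within ?Y)"
        using cderiv2_slices(2)[OF holo2_cderiv2[OF f cin[OF y, of t]]]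
        by (intro DERIV_cmult_right has_field_derivative_at_within[of _ _ _ ?Y]) simp
    next
      fix y assume y: "y \<in> ?Y"
      have "continuous_on (cbox 0 1) (\<lambda>t. f (circ x0 r t, y))"
        by (rule continuous_on_compose2[OF holo2_continuous[OF f]]) (use cin[OF y] in \<open>auto simp: circ_def intro!: continuous_intros\<close>)
      moreover have "continuous_on (cbox 0 1) (\<lambda>t. cauchy_kernel x0 r x t)"
        by (rule continuous_cauchy_kernel[OF r x]) (auto intro!: continuous_intros)
      ultimately show "(\<lambda>t. f (circ x0 r t, y) * cauchy_kernel x0 r x t) integrable_on cbox 0 1"
        by (intro integrable_continuous continuous_on_mult)
    next
      show "continuous_on (?Y \<times> cbox 0 1) (\<lambda>(y, t). pdy f (circ x0 r t, y) * cauchy_kernel x0 r x t)"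
        unfolding split_beta
      proof (rule continuous_on_mult)
        show "continuous_on (?Y \<times> cbox 0 1) (\<lambda>p. pdy f (circ x0 r (snd p), fst p))"
          by (rule continuous_on_compose2[OF pdy_continuous[OF f]])
            (use cin in \<open>auto simp: circ_def intro!: continuous_intros\<close>)
        show "continuous_on (?Y \<times> cbox 0 1) (\<lambda>p. cauchy_kernel x0 r x (snd p))"
          by (rule continuous_cauchy_kernel[OF r x]) (auto intro!: continuous_intros)
      qed
    qed
    then show ?thesis
      unfolding h_def
      by (rule has_field_derivative_transform_within[of _ _ _ _ 1])
        (use y pdx_integral[OF f sub r x] in \<open>auto\<close>)
  qed
  define p where "p = deriv (\<lambda>x. pdx f (x, y0)) x0"
  have xy: "x0 \<in> ?X" "y0 \<in> ?Y" using r by auto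
  have dx: "((\<lambda>x. pdx f (x, y0)) has_derivative (\<lambda>w. w * p)) (at x0 within ?X)"
  proof -
    have "(\<lambda>t. f (t, y0)) holomorphic_on ?X"
      by (rule holomorphic_on_subset[OF holo2_slice_holomorphic(1)[OF f]]) (use r in \<open>auto intro!: subsetD[OF sub]\<close>)
    then have "deriv (\<lambda>t. f (t, y0)) holomorphic_on ?X" by (rule holomorphic_deriv) simp
    then have "((\<lambda>x. pdx f (x, y0)) has_field_derivative p) (at x0)"
      unfolding p_def pdx_def by (simp add: holomorphic_derivI[OF _ open_ball xy(1)])
    then show ?thesis
      unfolding has_field_derivative_def mult_commute_abs[of p] by (rule has_derivative_at_withinI)
  qed
  have "((\<lambda>(x, y). pdx f (x, y)) has_derivative (\<lambda>(tx, ty). tx * p + blinfun_apply (blinfun_mult_right (h x0 y0)) ty)) (at (x0, y0) within ?X \<times> ?Y)"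
  proof (rule has_derivative_partialsI[where f = "\<lambda>x y. pdx f (x, y)" and fy = "\<lambda>x y. blinfun_mult_right (h x y)" and fx = "\<lambda>w. w * p", OF dx _ _ xy(2) convex_ball])
    show "((\<lambda>y. pdx f (x, y)) has_derivative blinfun_apply (blinfun_mult_right (h x y))) (at y within ?Y)"
      if "x \<in> ?X" "y \<in> ?Y" for x y
      using dy[OF that] by (simp add: has_field_derivative_def blinfun_mult_right.rep_eq)
    have "continuous_on (?X \<times> ?Y) (\<lambda>w. blinfun_mult_right (h (fst w) (snd w)))"
      by (rule bounded_linear.continuous_on[OF bounded_linear_blinfun_mult_right hcont])
    then show "continuous (at (x0, y0) within ?X \<times> ?Y) (\<lambda>(x, y). blinfun_mult_right (h x y))"
      unfolding case_prod_unfold continuous_on_eq_continuous_within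
      by (rule bspec) (use xy in auto)
  qed
  moreover have "at (x0, y0) within ?X \<times> ?Y = at (x0, y0)"
    using xy by (intro at_within_open) (auto simp: open_Times)
  ultimately have "cderiv2 (pdx f) p (h x0 y0) (x0, y0)"
    by (simp add: case_prod_unfold blinfun_mult_right.rep_eq mult.commute)
  then show ?thesis using r sub unfolding h_def x0_def y0_def by auto
qed

lemma holo2_pdx: "holo2 f U \<Longrightarrow> holo2 (pdx f) U"
  by (rule holo2I[OF holo2_open]) (use pdx_cderiv2 in blast)+

lemma holo2_pdy:
  assumes f: "holo2 f U" shows "holo2 (pdy f) U"
proof -
  have "holo2 (pdx (f \<circ> prod.swap) \<circ> prod.swap) (prod.swap -` (prod.swap -` U))"
    by (intro holo2_swap holo2_pdx f)
  then show ?thesis by (simp add: pdx_swap_swap vimage_def)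
qed

lemma pdxy_commute:
  assumes f: "holo2 f U" and z: "z \<in> U"
  shows "pdx (pdy f) z = pdy (pdx f) z"
proof -
  obtain p r where c: "cderiv2 (pdx f) p (integral (cbox 0 1) (\<lambda>t. pdy f (circ (fst z) r t, snd z) * cauchy_kernel (fst z) r (fst z) t)) z"
    and r: "r > 0" "cball (fst z) r \<times> cball (snd z) r \<subseteq> U"
    using pdx_cderiv2[OF assms] by blast
  have "pdx (pdy f) (fst z, snd z) = integral (cbox 0 1) (\<lambda>t. pdy f (circ (fst z) r t, snd z) * cauchy_kernel (fst z) r (fst z) t)"
    by (rule pdx_integral[OF holo2_pdy[OF f] r(2,1)]) (use r in auto)
  then show ?thesis using cderiv2_pd(2)[OF c] by simp
qed

lemma funpow_pd_slice:
  "(pdx ^^ i) g (x, y) = (deriv ^^ i) (\<lambda>t. g (t, y)) x"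
  "(pdy ^^ i) g (x, y) = (deriv ^^ i) (\<lambda>t. g (x, t)) y"
  by (induction i arbitrary: x y) (auto simp: pdx_def pdy_def)

lemma holo2_funpow_pdy: "holo2 f U \<Longrightarrow> holo2 ((pdy ^^ j) f) U"
  by (induction j) (auto intro: holo2_pdy)

text \<open>The one-variable identity theorem is applied twice: in \<open>x\<close> to each
  \<open>(pdy ^^ j) f\<close> on the horizontal slice through \<open>z\<close>, then in
  \<open>y\<close> to \<open>f\<close> on every vertical slice nearby.\<close>

lemma holo2_zero_near:
  assumes f: "holo2 f U" and z: "z \<in> U" and 0: "\<And>i j. pd i j f z = 0"
  obtains V where "open V" "z \<in> V" "V \<subseteq> U" "\<And>w. w \<in> V \<Longrightarrow> f w = 0"
proof -
  obtain r where r: "r > 0" and sub: "cball (fst z) r \<times> cball (snd z) r \<subseteq> U"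
    using polydisc_subset[OF holo2_open[OF f] z] by blast
  have y0: "(pdy ^^ j) f (x, snd z) = 0" if x: "x \<in> ball (fst z) r" for j x
  proof (rule holomorphic_fun_eq_0_on_ball[OF _ x])
    show "(\<lambda>x. (pdy ^^ j) f (x, snd z)) holomorphic_on ball (fst z) r"
      by (rule holomorphic_on_subset[OF holo2_slice_holomorphic(1)[OF holo2_funpow_pdy[OF f]]])
        (use r in \<open>auto intro!: subsetD[OF sub]\<close>)
    show "(deriv ^^ n) (\<lambda>x. (pdy ^^ j) f (x, snd z)) (fst z) = 0" for n
      using 0[of n j] unfolding pd_def funpow_pd_slice(1)[symmetric] by simp
  qed
  have "f (x, y) = 0" if x: "x \<in> ball (fst z) r" and y: "y \<in> ball (snd z) r" for x y
  proof (rule holomorphic_fun_eq_0_on_ball[OF _ y])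
    show "(\<lambda>y. f (x, y)) holomorphic_on ball (snd z) r"
      by (rule holomorphic_on_subset[OF holo2_slice_holomorphic(2)[OF f]])
        (use x in \<open>auto intro!: subsetD[OF sub]\<close>)
    show "(deriv ^^ n) (\<lambda>y. f (x, y)) (snd z) = 0" for n
      using y0[OF x, of n] unfolding funpow_pd_slice(2)[symmetric] by simp
  qed
  moreover have "ball (fst z) r \<times> ball (snd z) r \<subseteq> U"
    using sub by (meson Sigma_mono ball_subset_cball order_trans)
  ultimately show ?thesis
    using r by (intro that[of "ball (fst z) r \<times> ball (snd z) r"]) (auto simp: open_Times mem_Times_iff)
qed

text \<open>The complex line through \<open>v\<close> and \<open>w\<close> meets the convex set
  \<open>U\<close> in a convex, hence connected, set of parameters, so continuation in one variable
  reaches \<open>w\<close>.\<close>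

lemma holo2_identity:
  assumes f: "holo2 f U" and U: "convex U" and V: "open V" "V \<subseteq> U" "v \<in> V" "\<And>w. w \<in> V \<Longrightarrow> f w = 0" and w: "w \<in> U"
  shows "f w = 0"
proof -
  define g where "g t = (fst v + t * (fst w - fst v), snd v + t * (snd w - snd v))" for t :: complex
  have g: "continuous_on UNIV g" unfolding g_def by (intro continuous_intros)
  have oU: "open (g -` U)" "open (g -` V)" using g holo2_open[OF f] V(1) by (auto intro: open_vimage)
  have hol: "(\<lambda>t. f (g t)) holomorphic_on g -` U"
    unfolding holomorphic_on_def field_differentiable_def
  proof (intro ballI exI)
    fix t assume t: "t \<in> g -` U"
    have dg: "(g has_derivative (\<lambda>h. (h * (fst w - fst v), h * (snd w - snd v)))) (at t)"
      unfolding g_def by (auto intro!: derivative_eq_intros)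
    have gt: "g t \<in> U" using t by simp
    have "((\<lambda>t. f (g t)) has_derivative (\<lambda>h. fst (h * (fst w - fst v), h * (snd w - snd v)) * pdx f (g t)
        + snd (h * (fst w - fst v), h * (snd w - snd v)) * pdy f (g t))) (at t)"
      by (rule has_derivative_compose[OF dg holo2_cderiv2[OF f gt]])
    also have "(\<lambda>h. fst (h * (fst w - fst v), h * (snd w - snd v)) * pdx f (g t)
        + snd (h * (fst w - fst v), h * (snd w - snd v)) * pdy f (g t))
        = (*) ((fst w - fst v) * pdx f (g t) + (snd w - snd v) * pdy f (g t))"
      by (rule ext) (simp add: distrib_left distrib_right mult_ac)
    finally show "((\<lambda>t. f (g t)) has_field_derivative ((fst w - fst v) * pdx f (g t) + (snd w - snd v) * pdy f (g t))) (at t within g -` U)"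
      unfolding has_field_derivative_def by (rule has_derivative_at_withinI)
  qed
  have "convex (g -` U)"
  proof (rule convexI)
    fix s t and a b :: real assume st: "s \<in> g -` U" "t \<in> g -` U" and ab: "0 \<le> a" "0 \<le> b" "a + b = 1"
    have b: "b = 1 - a" using ab by simp
    have "g (a *\<^sub>R s + b *\<^sub>R t) = a *\<^sub>R g s + b *\<^sub>R g t"
      unfolding g_def b by (simp add: scaleR_conv_of_real algebra_simps)
    moreover have "a *\<^sub>R g s + b *\<^sub>R g t \<in> U" using U st ab by (auto simp: convex_def)
    ultimately show "a *\<^sub>R s + b *\<^sub>R t \<in> g -` U" by simp
  qed
  then have conn: "connected (g -` U)" by (rule convex_connected)
  have g01: "g 0 = v" "g 1 = w" by (simp_all add: g_def)
  have "f (g 1) = (\<lambda>t. 0) (1::complex)"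
    by (rule analytic_continuation_open[of "g -` V" "g -` U" "\<lambda>t. f (g t)" "\<lambda>t. 0"])
      (use oU conn V w g01 hol in auto)
  then show ?thesis by (simp add: g01)
qed

section \<open>Directional derivatives and Taylor series along a constant frame\<close>

definition dird :: "complex \<Rightarrow> complex \<Rightarrow> (complex \<times> complex \<Rightarrow> complex) \<Rightarrow> complex \<times> complex \<Rightarrow> complex" where
  "dird c d f z = c * pdx f z + d * pdy f z"

lemma holo2_dird: "holo2 f U \<Longrightarrow> holo2 (dird c d f) U"
  unfolding dird_def[abs_def]
  by (intro holo2_add holo2_mult holo2_const holo2_pdx holo2_pdy) (auto dest: holo2_open)

lemma dird_cong: "open U \<Longrightarrow> z \<in> U \<Longrightarrow> (\<And>w. w \<in> U \<Longrightarrow> f w = g w) \<Longrightarrow> dird c d f z = dird c d g z"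
  by (simp add: dird_def pd_cong[of U z f g])

lemma funpow_dird_cong:
  "open U \<Longrightarrow> z \<in> U \<Longrightarrow> (\<And>w. w \<in> U \<Longrightarrow> f w = g w) \<Longrightarrow> (dird c d ^^ n) f z = (dird c d ^^ n) g z"
  by (induction n arbitrary: z) (auto intro: dird_cong)

lemma holo2_funpow_dird: "holo2 f U \<Longrightarrow> holo2 ((dird c d ^^ n) f) U"
  by (induction n) (auto intro: holo2_dird)

lemma dird_add: "holo2 f U \<Longrightarrow> holo2 g U \<Longrightarrow> z \<in> U \<Longrightarrow> dird c d (\<lambda>w. f w + g w) z = dird c d f z + dird c d g z"
  by (simp add: dird_def holo2_pd_add algebra_simps)
lemma dird_mult: "holo2 f U \<Longrightarrow> holo2 g U \<Longrightarrow> z \<in> U \<Longrightarrow> dird c d (\<lambda>w. f w * g w) z = dird c d f z * g z + f z * dird c d g z"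
  by (simp add: dird_def holo2_pd_mult algebra_simps)
lemma dird_const [simp]: "dird c d (\<lambda>w. e) = (\<lambda>w. 0)"
  by (simp add: dird_def fun_eq_iff)

lemma dird_commute:
  assumes f: "holo2 f U" and z: "z \<in> U"
  shows "dird c d (dird c' d' f) z = dird c' d' (dird c d f) z"
proof -
  have o: "open U" using f by (rule holo2_open)
  have x: "pdx (\<lambda>z. a * pdx f z + b * pdy f z) z = a * pdx (pdx f) z + b * pdx (pdy f) z"
    and y: "pdy (\<lambda>z. a * pdx f z + b * pdy f z) z = a * pdy (pdx f) z + b * pdy (pdy f) z" for a b
    using f z o by (simp_all add: holo2_pd_add[of _ U] holo2_pd_mult[of _ U] holo2_pdx holo2_pdy)
  show ?thesis
    unfolding dird_def[abs_def] x y pdxy_commute[OF f z] by (simp add: algebra_simps)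
qed

lemma funpow_dird_commute:
  assumes f: "holo2 f U" and z: "z \<in> U"
  shows "(dird c d ^^ n) (dird c' d' f) z = dird c' d' ((dird c d ^^ n) f) z"
  using z
proof (induction n arbitrary: z)
  case (Suc n)
  have "(dird c d ^^ Suc n) (dird c' d' f) z = dird c d (dird c' d' ((dird c d ^^ n) f)) z"
    by (simp, rule dird_cong[OF holo2_open[OF f] Suc.prems Suc.IH])
  also have "\<dots> = dird c' d' (dird c d ((dird c d ^^ n) f)) z"
    by (rule dird_commute[OF holo2_funpow_dird[OF f] Suc.prems])
  finally show ?case by simp
qed simp

text \<open>Taylor expansion at \<open>z0\<close> along a constant frame \<open>(c1, d1), (c2, d2)\<close>; the matrix \<open>m\<close> is
  the inverse of that frame.\<close>

locale taylor =
  fixes z0 :: "complex \<times> complex" and U :: "(complex \<times> complex) set"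
    and c1 d1 c2 d2 m11 m12 m21 m22 :: complex
  assumes U: "open U" and z0: "z0 \<in> U"
    and m: "m11 * c1 + m12 * c2 = 1" "m11 * d1 + m12 * d2 = 0" "m21 * c1 + m22 * c2 = 0" "m21 * d1 + m22 * d2 = 1"
begin

definition T :: "(complex \<times> complex \<Rightarrow> complex) \<Rightarrow> ps2" where
  "T f = Abs_fps (\<lambda>j. Abs_fps (\<lambda>i. (dird c1 d1 ^^ i) ((dird c2 d2 ^^ j) f) z0 / (fact i * fact j)))"

lemma jet_T: "jet i j (T f) = (dird c1 d1 ^^ i) ((dird c2 d2 ^^ j) f) z0"
  by (simp add: jet_def T_def)

lemma T_cong: "(\<And>z. z \<in> U \<Longrightarrow> f z = g z) \<Longrightarrow> T f = T g"
  by (rule ps2_eqI, unfold jet_T, intro funpow_dird_cong[OF U z0] funpow_dird_cong[OF U])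

lemma T_dird:
  assumes f: "holo2 f U"
  shows "T (dird c1 d1 f) = dX (T f)" "T (dird c2 d2 f) = dY (T f)"
proof -
  show "T (dird c1 d1 f) = dX (T f)"
  proof (rule ps2_eqI)
    fix i j
    have "jet i j (T (dird c1 d1 f)) = (dird c1 d1 ^^ i) (dird c1 d1 ((dird c2 d2 ^^ j) f)) z0"
      unfolding jet_T by (rule funpow_dird_cong[OF U z0]) (rule funpow_dird_commute[OF f])
    then show "jet i j (T (dird c1 d1 f)) = jet i j (dX (T f))"
      by (simp add: jet_T funpow_swap1)
  qed
  show "T (dird c2 d2 f) = dY (T f)"
    by (rule ps2_eqI) (simp add: jet_T funpow_swap1)
qed

lemma T_00: "jet 0 0 (T f) = f z0"
  by (simp add: jet_T)

lemma T_const: "T (\<lambda>z. c) = cst c"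
proof -
  have "ord n (T (\<lambda>z. c) - cst c)" for n c
    by (induction n arbitrary: c)
      (auto intro!: ord_SucI simp: d_diff T_dird[symmetric] T_00 U simp flip: cst_0)
  then show ?thesis using all_ord_eq_0[of "T (\<lambda>z. c) - cst c"] by simp
qed

lemma T_add:
  assumes "holo2 f U" "holo2 g U"
  shows "T (\<lambda>z. f z + g z) = T f + T g"
proof -
  have "ord n (T (\<lambda>z. f z + g z) - (T f + T g))" if "holo2 f U" "holo2 g U" for n f g
    using that
  proof (induction n arbitrary: f g)
    case (Suc n)
    note h = Suc.prems
    have e: "T (dird c d (\<lambda>z. f z + g z)) = T (\<lambda>z. dird c d f z + dird c d g z)" for c d
      by (rule T_cong) (rule dird_add[OF h])
    have "dX (T (\<lambda>z. f z + g z) - (T f + T g)) = T (\<lambda>z. dird c1 d1 f z + dird c1 d1 g z) - (T (dird c1 d1 f) + T (dird c1 d1 g))"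
      "dY (T (\<lambda>z. f z + g z) - (T f + T g)) = T (\<lambda>z. dird c2 d2 f z + dird c2 d2 g z) - (T (dird c2 d2 f) + T (dird c2 d2 g))"
      unfolding T_dird[OF h(1)] T_dird[OF h(2)] e[symmetric] T_dird[OF holo2_add[OF h]]
      by (simp_all add: d_diff dX_add dY_add)
    then show ?case
      by (intro ord_SucI) (auto simp: T_00 intro!: Suc.IH holo2_dird h)
  qed simp
  from all_ord_eq_0[OF this[OF assms]] show ?thesis by simp
qed

text \<open>The defect \<open>T (\<lambda>z. f z * g z) - T f * T g\<close> vanishes at the base
  point, and by the product rule its two derivatives are sums of defects of the same kind. Induction
  on the order, with \<open>f\<close> and \<open>g\<close> arbitrary, makes it vanish to every order
  without a binomial formula for higher derivatives.\<close>

lemma T_mult: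
  assumes "holo2 f U" "holo2 g U"
  shows "T (\<lambda>z. f z * g z) = T f * T g"
proof -
  have "ord n (T (\<lambda>z. f z * g z) - T f * T g)" if "holo2 f U" "holo2 g U" for n f g
    using that
  proof (induction n arbitrary: f g)
    case (Suc n)
    note h = Suc.prems
    have e: "T (dird c d (\<lambda>z. f z * g z)) = T (\<lambda>z. dird c d f z * g z) + T (\<lambda>z. f z * dird c d g z)" for c d
      unfolding T_add[OF holo2_mult[OF holo2_dird[OF h(1)] h(2)] holo2_mult[OF h(1) holo2_dird[OF h(2)]], symmetric]
      by (rule T_cong) (rule dird_mult[OF h])
    have "dX (T (\<lambda>z. f z * g z) - T f * T g) = (T (\<lambda>z. dird c1 d1 f z * g z) - T (dird c1 d1 f) * T g)
        + (T (\<lambda>z. f z * dird c1 d1 g z) - T f * T (dird c1 d1 g))"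
      "dY (T (\<lambda>z. f z * g z) - T f * T g) = (T (\<lambda>z. dird c2 d2 f z * g z) - T (dird c2 d2 f) * T g)
        + (T (\<lambda>z. f z * dird c2 d2 g z) - T f * T (dird c2 d2 g))"
      using e[of c1 d1] e[of c2 d2] unfolding T_dird[OF h(1)] T_dird[OF h(2)] T_dird[OF holo2_mult[OF h]]
      by (simp_all add: d_diff dX_mult dY_mult)
    then show ?case
      by (intro ord_SucI) (auto simp: T_00 intro!: ord_add Suc.IH holo2_dird h)
  qed simp
  from all_ord_eq_0[OF this[OF assms]] show ?thesis by simp
qed

lemma T_minus: "holo2 f U \<Longrightarrow> T (\<lambda>z. - f z) = - T f"
  using T_mult[of "\<lambda>z. -1" f] U by (simp add: T_const cst_minus)
lemma T_diff: "holo2 f U \<Longrightarrow> holo2 g U \<Longrightarrow> T (\<lambda>z. f z - g z) = T f - T g"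
  using T_add[of f "\<lambda>z. - g z"] by (simp add: holo2_minus T_minus)

definition Tx :: "ps2 \<Rightarrow> ps2" where "Tx F = cst m11 * dX F + cst m12 * dY F"
definition Ty :: "ps2 \<Rightarrow> ps2" where "Ty F = cst m21 * dX F + cst m22 * dY F"

lemma T_pdx: assumes f: "holo2 f U" shows "T (pdx f) = Tx (T f)"
proof -
  have "pdx f z = m11 * dird c1 d1 f z + m12 * dird c2 d2 f z" for z
  proof -
    have "m11 * dird c1 d1 f z + m12 * dird c2 d2 f z = (m11 * c1 + m12 * c2) * pdx f z + (m11 * d1 + m12 * d2) * pdy f z"
      by (simp add: dird_def algebra_simps)
    then show ?thesis by (simp add: m)
  qed
  then have "T (pdx f) = T (\<lambda>z. m11 * dird c1 d1 f z + m12 * dird c2 d2 f z)" by (intro T_cong)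
  also have "\<dots> = Tx (T f)"
    using f U by (simp add: Tx_def T_add T_mult T_const T_dird holo2_mult holo2_dird)
  finally show ?thesis .
qed

lemma T_pdy: assumes f: "holo2 f U" shows "T (pdy f) = Ty (T f)"
proof -
  have "pdy f z = m21 * dird c1 d1 f z + m22 * dird c2 d2 f z" for z
  proof -
    have "m21 * dird c1 d1 f z + m22 * dird c2 d2 f z = (m21 * c1 + m22 * c2) * pdx f z + (m21 * d1 + m22 * d2) * pdy f z"
      by (simp add: dird_def algebra_simps)
    then show ?thesis by (simp add: m)
  qed
  then have "T (pdy f) = T (\<lambda>z. m21 * dird c1 d1 f z + m22 * dird c2 d2 f z)" by (intro T_cong)
  also have "\<dots> = Ty (T f)"
    using f U by (simp add: Ty_def T_add T_mult T_const T_dird holo2_mult holo2_dird)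
  finally show ?thesis .
qed

lemma Tx_simps: "Tx (F + G) = Tx F + Tx G" "Tx (F - G) = Tx F - Tx G" "Tx (- F) = - Tx F"
    "Tx (F * G) = Tx F * G + F * Tx G" "Tx (cst c) = 0" "Tx 0 = 0"
  by (simp_all add: Tx_def dX_add dY_add dX_mult dY_mult d_diff d_minus algebra_simps)
lemma Ty_simps: "Ty (F + G) = Ty F + Ty G" "Ty (F - G) = Ty F - Ty G" "Ty (- F) = - Ty F"
    "Ty (F * G) = Ty F * G + F * Ty G" "Ty (cst c) = 0" "Ty 0 = 0"
  by (simp_all add: Ty_def dX_add dY_add dX_mult dY_mult d_diff d_minus algebra_simps)
lemma Txy_commute: "Tx (Ty F) = Ty (Tx F)"
  by (simp add: Tx_def Ty_def dX_add dY_add dX_mult dY_mult dXY algebra_simps)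

lemma dX_Txy: "dX F = cst c1 * Tx F + cst d1 * Ty F" "dY F = cst c2 * Tx F + cst d2 * Ty F"
proof -
  have det: "(m11 * m22 - m12 * m21) * (c1 * d2 - d1 * c2) = 1"
    using m by algebra
  have i: "c1 * m11 + d1 * m21 = 1" "c1 * m12 + d1 * m22 = 0" "c2 * m11 + d2 * m21 = 0" "c2 * m12 + d2 * m22 = 1"
    using m det by algebra+
  have "cst c1 * Tx F + cst d1 * Ty F = cst (c1 * m11 + d1 * m21) * dX F + cst (c1 * m12 + d1 * m22) * dY F"
    "cst c2 * Tx F + cst d2 * Ty F = cst (c2 * m11 + d2 * m21) * dX F + cst (c2 * m12 + d2 * m22) * dY F"
    by (simp_all add: Tx_def Ty_def cst_add cst_mult algebra_simps)
  then show "dX F = cst c1 * Tx F + cst d1 * Ty F" "dY F = cst c2 * Tx F + cst d2 * Ty F"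
    by (simp_all add: i)
qed

lemma Txy_const:
  assumes "Tx F = 0" "Ty F = 0" shows "F = cst (jet 0 0 F)"
  by (rule ps2_const) (simp_all add: dX_Txy assms)

lemma Txy_eq:
  assumes "Tx F = Tx G" "Ty F = Ty G" "jet 0 0 F = jet 0 0 G" shows "F = G"
  by (rule ps2_eq_antideriv) (simp_all add: dX_Txy assms)

lemma ord_Txy_SucI:
  assumes "jet 0 0 F = 0" "ord n (Tx F)" "ord n (Ty F)"
  shows "ord (Suc n) F"
  using assms by (intro ord_SucI) (auto simp: dX_Txy intro!: ord_add ord_mult_left)

lemma T_eq_0_imp:
  assumes f: "holo2 f U" and "T f = 0"
  obtains V where "open V" "z0 \<in> V" "V \<subseteq> U" "\<And>z. z \<in> V \<Longrightarrow> f z = 0"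
proof -
  have "holo2 ((pdy ^^ j) f) U \<and> T ((pdy ^^ j) f) = 0" for j
    by (induction j) (auto simp: assms T_pdy Ty_simps holo2_pdy)
  then have "holo2 ((pdx ^^ i) ((pdy ^^ j) f)) U \<and> T ((pdx ^^ i) ((pdy ^^ j) f)) = 0" for i j
    by (induction i) (auto simp: T_pdx Tx_simps holo2_pdx)
  then have "pd i j f z0 = 0" for i j
    using T_00[of "(pdx ^^ i) ((pdy ^^ j) f)"] by (simp add: pd_def)
  then show ?thesis using holo2_zero_near[OF f z0] that by blast
qed

text \<open>The hypothesis differentiates along the axes, \<open>jet\<close> along the frame. The
  vanishing order does not see the difference: the induction passes to \<open>pdx f\<close> and
  \<open>pdy f\<close>, and the frame derivatives are combinations of \<open>Tx\<close> and
  \<open>Ty\<close>.\<close>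

lemma pd_zero_ord:
  assumes "holo2 f U" "\<And>i j. i + j \<le> n \<Longrightarrow> pd i j f z0 = 0"
  shows "ord (Suc n) (T f)"
  using assms
proof (induction n arbitrary: f)
  case 0
  then show ?case using 0(2)[of 0 0] by (simp add: ord_Suc_0 T_00 pd_def)
next
  case (Suc n)
  note f = Suc.prems(1)
  have comm: "(pdy ^^ j) (pdx f) z = pdx ((pdy ^^ j) f) z" if "z \<in> U" for j z
    using that
  proof (induction j arbitrary: z)
    case (Suc j)
    have "(pdy ^^ Suc j) (pdx f) z = pdy (pdx ((pdy ^^ j) f)) z"
      by (simp, rule pd_cong(2)[OF U Suc.prems Suc.IH])
    then show ?case using pdxy_commute[OF holo2_funpow_pdy[OF f] Suc.prems] by simp
  qed simp
  have cong: "z \<in> U \<Longrightarrow> (\<And>w. w \<in> U \<Longrightarrow> g w = h w) \<Longrightarrow> (pdx ^^ i) g z = (pdx ^^ i) h z" for g h i z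
    by (induction i arbitrary: z) (auto intro: pd_cong(1)[OF U])
  show ?case
  proof (rule ord_Txy_SucI)
    show "jet 0 0 (T f) = 0" using Suc.prems(2)[of 0 0] by (simp add: T_00 pd_def)
    show "ord (Suc n) (Tx (T f))"
      unfolding T_pdx[OF f, symmetric]
    proof (rule Suc.IH[OF holo2_pdx[OF f]])
      fix i j assume ij: "i + j \<le> n"
      have "pd i j (pdx f) z0 = (pdx ^^ i) (pdx ((pdy ^^ j) f)) z0"
        unfolding pd_def by (rule cong[OF z0 comm])
      also have "\<dots> = pd (Suc i) j f z0" by (simp add: pd_def funpow_swap1)
      finally show "pd i j (pdx f) z0 = 0" using Suc.prems(2)[of "Suc i" j] ij by simp
    qed
    show "ord (Suc n) (Ty (T f))"
      unfolding T_pdy[OF f, symmetric]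
    proof (rule Suc.IH[OF holo2_pdy[OF f]])
      fix i j assume ij: "i + j \<le> n"
      have "pd i j (pdy f) z0 = pd i (Suc j) f z0" by (simp add: pd_def funpow_swap1)
      then show "pd i j (pdy f) z0 = 0" using Suc.prems(2)[of i "Suc j"] ij by simp
    qed
  qed
qed

end

section \<open>Webs as power series\<close>

text \<open>The coefficient ring is kept general, with \<open>\<iota> n\<close> an inverse of
  \<open>n + 1\<close>, because the result is used once over the complex numbers and once over power
  series in \<open>X\<close>.\<close>

lemma fps_linear_ode:
  fixes Q :: "'a::comm_ring_1 fps" and \<iota> :: "nat \<Rightarrow> 'a"
  assumes "\<And>n. of_nat (Suc n) * \<iota> n = 1"
  shows "\<exists>h. fps_nth h 0 = u \<and> fps_deriv h = Q * h"
proof -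
  define P where "P f n r \<longleftrightarrow> r = (case n of 0 \<Rightarrow> u | Suc m \<Rightarrow> \<iota> m * (\<Sum>i\<in>{0..m}. fps_nth Q i * f (m - i)))"
    for f :: "nat \<Rightarrow> 'a" and n r
  \<comment> \<open>The recursion for a coefficient refers to all earlier ones, hence a choice along
    a well-founded relation.\<close>
  have "\<exists>f. \<forall>n. P f n (f n)"
  proof (rule dependent_wf_choice[of less_than])
    fix f g :: "nat \<Rightarrow> 'a" and n r assume fg: "\<And>z. (z, n) \<in> less_than \<Longrightarrow> f z = g z"
    show "P f n r = P g n r"
    proof (cases n)
      case (Suc m)
      then have "(\<Sum>i\<in>{0..m}. fps_nth Q i * f (m - i)) = (\<Sum>i\<in>{0..m}. fps_nth Q i * g (m - i))"
        using fg by (intro sum.cong) auto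
      then show ?thesis by (simp add: P_def Suc)
    qed (simp add: P_def)
  qed (auto simp: P_def)
  then obtain f where f: "\<And>n. P f n (f n)" by blast
  define h where "h = Abs_fps f"
  have "fps_nth (fps_deriv h) n = fps_nth (Q * h) n" for n
  proof -
    have "fps_nth (fps_deriv h) n = (of_nat (Suc n) * \<iota> n) * (\<Sum>i\<in>{0..n}. fps_nth Q i * f (n - i))"
      using f[of "Suc n"] by (simp add: P_def h_def mult.assoc)
    then show ?thesis by (simp only: assms fps_mult_nth) (simp add: h_def)
  qed
  then have "fps_deriv h = Q * h" by (simp add: fps_eq_iff)
  moreover have "fps_nth h 0 = u" using f[of 0] by (simp add: P_def h_def)
  ultimately show ?thesis by blast
qed

text \<open>The equation is solved in \<open>X\<close> on the axis \<open>Y = 0\<close> and then in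
  \<open>Y\<close> from there. The defect \<open>e\<close> of the first equation satisfies
  \<open>dY e = Q * e\<close> by closedness and vanishes on the axis, so it is zero.\<close>

lemma ps2_closed_exact:
  assumes cl: "dY P = dX Q"
  shows "\<exists>h. jet 0 0 h = 1 \<and> dX h = P * h \<and> dY h = Q * h"
proof -
  have "of_nat (Suc n) * (1 / of_nat (Suc n)) = (1::complex)" for n by (simp del: of_nat_Suc)
  then obtain u :: "complex fps" where u: "fps_nth u 0 = 1" "fps_deriv u = fps_nth P 0 * u"
    using fps_linear_ode[of "\<lambda>n. 1 / of_nat (Suc n)" 1 "fps_nth P 0"] by blast
  have "of_nat (Suc n) * fps_const (1 / of_nat (Suc n)) = (1::complex fps)" for n
    by (simp del: of_nat_Suc add: fps_of_nat[symmetric])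
  then obtain h :: ps2 where h: "fps_nth h 0 = u" "fps_deriv h = Q * h"
    using fps_linear_ode[of "\<lambda>n. fps_const (1 / of_nat (Suc n))" u Q] by blast
  define e where "e = dX h - P * h"
  have dYh: "dY h = Q * h" using h(2) by (simp add: dY_def)
  have "dY e = dX (Q * h) - (dX Q * h + P * (Q * h))"
    unfolding e_def by (simp add: d_diff dY_mult cl dXY[symmetric] dYh)
  also have "\<dots> = Q * e" by (simp add: e_def dX_mult algebra_simps)
  finally have de: "fps_deriv e = Q * e" by (simp add: dY_def)
  have e0: "fps_nth e 0 = 0" using u h by (simp add: e_def dX_def)
  have "fps_nth e n = 0" for n
  proof (induction n rule: less_induct)
    case (less n)
    show ?case
    proof (cases n)
      case (Suc m)
      have "fps_nth (fps_deriv e) m = (\<Sum>i=0..m. fps_nth Q i * fps_nth e (m - i))" unfolding de by (simp add: fps_mult_nth)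
      also have "\<dots> = 0" using less Suc by (intro sum.neutral) auto
      finally have "of_nat (Suc m) * fps_nth e (Suc m) = 0" by simp
      then have "fps_const (of_nat (Suc m)) * fps_nth e (Suc m) = 0" by (simp only: fps_of_nat)
      then show ?thesis using Suc by (simp del: of_nat_Suc)
    qed (simp add: e0)
  qed
  then have "e = 0" by (simp add: fps_eq_iff)
  moreover have "jet 0 0 h = 1" using u h by (simp add: jet_def)
  ultimately show ?thesis using dYh by (auto simp: e_def)
qed

lemma quartic_form_eq_0:
  fixes c0 c1 c2 c3 c4 :: ps2
  assumes "\<And>t. c0 + cst t * c1 + cst (t^2) * c2 + cst (t^3) * c3 + cst (t^4) * c4 = 0"
  shows "c0 = 0" "c1 = 0" "c2 = 0" "c3 = 0" "c4 = 0"
proof -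
  have j: "jet i j c0 = 0 \<and> jet i j c1 = 0 \<and> jet i j c2 = 0 \<and> jet i j c3 = 0 \<and> jet i j c4 = 0" for i j
  proof -
    have "poly [:jet i j c0, jet i j c1, jet i j c2, jet i j c3, jet i j c4:] t = 0" for t
    proof -
      have "jet i j c0 + t * jet i j c1 + t^2 * jet i j c2 + t^3 * jet i j c3 + t^4 * jet i j c4 = 0"
        using arg_cong[OF assms[of t], of "jet i j"] by simp
      then show ?thesis by (simp add: algebra_simps power2_eq_square power3_eq_cube power4_eq_xxxx)
    qed
    then have "[:jet i j c0, jet i j c1, jet i j c2, jet i j c3, jet i j c4:] = 0"
      using poly_all_0_iff_0 by blast
    then show ?thesis by simp
  qed
  show "c0 = 0" "c1 = 0" "c2 = 0" "c3 = 0" "c4 = 0" by (rule ps2_eqI, use j in simp)+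
qed

text \<open>\<open>A1\<close>, \<open>B1\<close> and \<open>A2\<close>, \<open>B2\<close> are the
  coefficients of the first two forms, \<open>R\<close>, \<open>S\<close> those of the connection
  form, and \<open>V\<close> is the inverse Wronskian. The assumptions \<open>straight1\<close> to
  \<open>straight3\<close> say that the slope of a leaf does not change along it.
  \<open>frame\<close> makes the Taylor frame the value of the dual frame at the base point.\<close>

locale web_data = taylor z0 U c1 d1 c2 d2 m11 m12 m21 m22
  for z0 U c1 d1 c2 d2 m11 m12 m21 m22 +
  fixes A1 B1 A2 B2 R S K V x y :: ps2
  assumes V: "V * (A1 * B2 - B1 * A2) = 1"
    and st1: "Tx B1 - Ty A1 + (R * B1 - S * A1) = 0" and st2: "Tx B2 - Ty A2 + (R * B2 - S * A2) = 0"
    and cv: "Tx S - Ty R = K * (A1 * B2 - B1 * A2)"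
    and straight1: "A1 * (B1 * Tx B1 - A1 * Ty B1) = B1 * (B1 * Tx A1 - A1 * Ty A1)"
    and straight2: "A2 * (B2 * Tx B2 - A2 * Ty B2) = B2 * (B2 * Tx A2 - A2 * Ty A2)"
    and straight3: "(A1 + A2) * ((B1 + B2) * Tx (B1 + B2) - (A1 + A2) * Ty (B1 + B2))
       = (B1 + B2) * ((B1 + B2) * Tx (A1 + A2) - (A1 + A2) * Ty (A1 + A2))"
    and frame: "jet 0 0 (V * B2) = c1" "jet 0 0 (V * A2) = - d1" "jet 0 0 (V * B1) = - c2" "jet 0 0 (V * A1) = d2"
    and xy: "Tx x = 1" "Ty x = 0" "Tx y = 0" "Ty y = 1"
begin

definition E1 where "E1 f = V * (B2 * Tx f - A2 * Ty f)"
definition E2 where "E2 f = V * (A1 * Ty f - B1 * Tx f)"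
definition "r1 = V * (B2 * R - A2 * S)"
definition "r2 = V * (A1 * S - B1 * R)"
definition "k = cst (1/3) * K"

lemma Txy_E: "Tx f = A1 * E1 f + A2 * E2 f" "Ty f = B1 * E1 f + B2 * E2 f"
proof -
  have "A1 * E1 f + A2 * E2 f = (V * (A1 * B2 - B1 * A2)) * Tx f"
    "B1 * E1 f + B2 * E2 f = (V * (A1 * B2 - B1 * A2)) * Ty f"
    by (simp_all add: E1_def E2_def algebra_simps)
  then show "Tx f = A1 * E1 f + A2 * E2 f" "Ty f = B1 * E1 f + B2 * E2 f" by (simp_all add: V)
qed

lemma Tx_1 [simp]: "Tx 1 = 0" "Ty 1 = 0"
  using Tx_simps(5)[of 1] Ty_simps(5)[of 1] by simp_all

lemma E_deriv:
  "E1 (f + g) = E1 f + E1 g" "E1 (f * g) = E1 f * g + f * E1 g"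
  "E2 (f + g) = E2 f + E2 g" "E2 (f * g) = E2 f * g + f * E2 g"
  by (simp_all add: E1_def E2_def Tx_simps Ty_simps algebra_simps)

lemma E_1 [simp]: "E1 1 = 0" "E2 1 = 0" by (simp_all add: E1_def E2_def)

lemma E_cst [simp]: "E1 (cst c) = 0" "E2 (cst c) = 0"
  by (simp_all add: E1_def E2_def Tx_simps Ty_simps)

lemma E_xy: "E1 x = V * B2" "E1 y = - (V * A2)" "E2 x = - (V * B1)" "E2 y = V * A1"
  by (simp_all add: E1_def E2_def xy)

lemma E_as: "E1 f = E1 x * Tx f + E1 y * Ty f" "E2 f = E2 x * Tx f + E2 y * Ty f"
  unfolding E_xy by (simp_all add: E1_def E2_def algebra_simps)

lemma V_xy: "E1 x * E2 y - E2 x * E1 y = V"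
proof -
  have "E1 x * E2 y - E2 x * E1 y = V * (V * (A1 * B2 - B1 * A2))"
    unfolding E_xy by (simp add: algebra_simps)
  then show ?thesis by (simp add: V)
qed

text \<open>A form with constant values on the frame satisfies
  \<open>d \<omega> (e1, e2) = - \<omega> [e1, e2]\<close>. Each structure equation therefore
  determines the value of its form on the bracket, and the two forms are independent.\<close>

lemma E_comm_components:
  "E1 (E2 x) - E2 (E1 x) = r1 * E2 x - r2 * E1 x" "E1 (E2 y) - E2 (E1 y) = r1 * E2 y - r2 * E1 y"
proof -
  define X where "X = E1 (E2 x) - E2 (E1 x) - (r1 * E2 x - r2 * E1 x)"
  define Y where "Y = E1 (E2 y) - E2 (E1 y) - (r1 * E2 y - r2 * E1 y)"
  have d: "A1 * E1 x + B1 * E1 y = 1" "A1 * E2 x + B1 * E2 y = 0" "A2 * E1 x + B2 * E1 y = 0" "A2 * E2 x + B2 * E2 y = 1"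
    unfolding E_xy using V by (simp_all add: algebra_simps)
  have ER: "r1 = R * E1 x + S * E1 y" "r2 = R * E2 x + S * E2 y"
    unfolding E_xy r1_def r2_def by (simp_all add: algebra_simps)
  have main: "A * X + B * Y = 0"
    if s: "Tx B - Ty A + (R * B - S * A) = 0" and c: "A * E1 x + B * E1 y = cst c1'" "A * E2 x + B * E2 y = cst c2'" for A B c1' c2'
  proof -
    have e1: "A * E1 (E2 x) + B * E1 (E2 y) = - (E1 A * E2 x + E1 B * E2 y)"
      using arg_cong[OF c(2), of E1] by (simp add: E_deriv eq_neg_iff_add_eq_0 algebra_simps)
    have e2: "A * E2 (E1 x) + B * E2 (E1 y) = - (E2 A * E1 x + E2 B * E1 y)"
      using arg_cong[OF c(1), of E2] by (simp add: E_deriv eq_neg_iff_add_eq_0 algebra_simps)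
    have "A * X + B * Y = (A * E1 (E2 x) + B * E1 (E2 y)) - (A * E2 (E1 x) + B * E2 (E1 y))
        - r1 * (A * E2 x + B * E2 y) + r2 * (A * E1 x + B * E1 y)"
      by (simp add: X_def Y_def algebra_simps)
    also have "\<dots> = - (E1 A * E2 x + E1 B * E2 y) + (E2 A * E1 x + E2 B * E1 y)
        - r1 * (A * E2 x + B * E2 y) + r2 * (A * E1 x + B * E1 y)"
      unfolding e1 e2 by simp
    also have "\<dots> = - ((Tx B - Ty A + (R * B - S * A)) * (E1 x * E2 y - E2 x * E1 y))"
      unfolding ER E_as(1)[of A] E_as(1)[of B] E_as(2)[of A] E_as(2)[of B] by (simp add: algebra_simps)
    finally show ?thesis by (simp add: s)
  qed
  have z: "A1 * X + B1 * Y = 0" "A2 * X + B2 * Y = 0"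
    using main[OF st1, of 1 0] main[OF st2, of 0 1] d by simp_all
  have "(V * (A1 * B2 - B1 * A2)) * X = V * (B2 * (A1 * X + B1 * Y) - B1 * (A2 * X + B2 * Y))"
    "(V * (A1 * B2 - B1 * A2)) * Y = V * (A1 * (A2 * X + B2 * Y) - A2 * (A1 * X + B1 * Y))"
    by (simp_all add: algebra_simps)
  then have "X = 0" "Y = 0" unfolding V z by simp_all
  then show "E1 (E2 x) - E2 (E1 x) = r1 * E2 x - r2 * E1 x" "E1 (E2 y) - E2 (E1 y) = r1 * E2 y - r2 * E1 y"
    by (simp_all add: X_def Y_def)
qed

text \<open>The bracket of two derivations is again first order, so its values on \<open>x\<close>
  and \<open>y\<close> determine it.\<close>

lemma E_comm: "E1 (E2 f) - E2 (E1 f) = r1 * E2 f - r2 * E1 f"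
proof -
  have "E1 (E2 f) - E2 (E1 f) = (E1 (E2 x) - E2 (E1 x)) * Tx f + (E1 (E2 y) - E2 (E1 y)) * Ty f
     + (E2 x * E1 (Tx f) + E2 y * E1 (Ty f) - E1 x * E2 (Tx f) - E1 y * E2 (Ty f))"
    by (subst E_as(2)[of f], subst E_as(1)[of f]) (simp add: E_deriv algebra_simps)
  also have "E2 x * E1 (Tx f) + E2 y * E1 (Ty f) - E1 x * E2 (Tx f) - E1 y * E2 (Ty f) = 0"
    unfolding E_as(1)[of "Tx f"] E_as(1)[of "Ty f"] E_as(2)[of "Tx f"] E_as(2)[of "Ty f"] Txy_commute
    by (simp add: algebra_simps)
  finally have "E1 (E2 f) - E2 (E1 f) = r1 * (E2 x * Tx f + E2 y * Ty f) - r2 * (E1 x * Tx f + E1 y * Ty f)"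
    unfolding E_comm_components by (simp add: algebra_simps)
  then show ?thesis unfolding E_as(1)[of f, symmetric] E_as(2)[of f, symmetric] .
qed

lemma ord_Txy: "ord n f \<Longrightarrow> ord (n - 1) (Tx f)" "ord n f \<Longrightarrow> ord (n - 1) (Ty f)"
  by (auto simp: Tx_def Ty_def intro!: ord_add ord_mult_left ord_dX ord_dY)

sublocale web_series E1 E2 r1 r2 k "cst (1/3)"
proof
  fix f g n
  show "E1 (f + g) = E1 f + E1 g" "E1 (f * g) = E1 f * g + f * E1 g"
    "E2 (f + g) = E2 f + E2 g" "E2 (f * g) = E2 f * g + f * E2 g" by (rule E_deriv)+
  show "E1 (E2 f) - E2 (E1 f) = r1 * E2 f - r2 * E1 f" by (rule E_comm)
  show "E1 r2 - E2 r1 = 3 * k"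
  proof -
    have ER: "r1 = R * E1 x + S * E1 y" "r2 = R * E2 x + S * E2 y"
      unfolding E_xy r1_def r2_def by (simp_all add: algebra_simps)
    have "E1 r2 - E2 r1 = R * (E1 (E2 x) - E2 (E1 x)) + S * (E1 (E2 y) - E2 (E1 y))
        + (E1 R * E2 x + E1 S * E2 y - E2 R * E1 x - E2 S * E1 y)"
      unfolding ER by (simp add: E_deriv algebra_simps)
    also have "\<dots> = (r1 * r2 - r2 * r1) + (Tx S - Ty R) * (E1 x * E2 y - E2 x * E1 y)"
      unfolding E_comm_components E_as(1)[of R] E_as(1)[of S] E_as(2)[of R] E_as(2)[of S] unfolding ER
      by (simp add: algebra_simps)
    also have "\<dots> = K * (V * (A1 * B2 - B1 * A2))" unfolding V_xy cv by (simp add: algebra_simps)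
    finally show ?thesis unfolding V k_def
      by (simp add: mult.assoc[symmetric] flip: cst_numeral cst_mult)
  qed
  show "3 * cst (1/3) = 1" by (simp flip: cst_numeral cst_mult)
  \<comment> \<open>These coefficients vanish at the base point and so make up for the degree lost
    by one derivative of \<open>f\<close>.\<close>
  have o: "ord 1 (V * B2 - cst c1)" "ord 1 (V * A2 + cst d1)" "ord 1 (V * B1 + cst c2)" "ord 1 (V * A1 - cst d2)"
    using frame by (auto simp: ord_Suc_0 simp del: jet_00_mult)
  show "ord n (E1 f - dX f)" if f: "ord n f"
  proof -
    have "E1 f - dX f = (V * B2 - cst c1) * Tx f - (V * A2 + cst d1) * Ty f"
      by (simp add: E1_def dX_Txy(1)[of f] algebra_simps)
    moreover have "ord n \<dots>"
      by (rule ord_diff; rule ord_mult[OF o(1) ord_Txy(1)[OF f]] ord_mult[OF o(2) ord_Txy(2)[OF f]]) simp_all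
    ultimately show ?thesis by simp
  qed
  show "ord n (E2 f - dY f)" if f: "ord n f"
  proof -
    have "E2 f - dY f = (V * A1 - cst d2) * Ty f - (V * B1 + cst c2) * Tx f"
      by (simp add: E2_def dX_Txy(2)[of f] algebra_simps)
    moreover have "ord n \<dots>"
      by (rule ord_diff; rule ord_mult[OF o(4) ord_Txy(2)[OF f]] ord_mult[OF o(3) ord_Txy(1)[OF f]]) simp_all
    ultimately show ?thesis by simp
  qed
qed

text \<open>In \<open>cubic\<close> the coefficients \<open>A\<close>, \<open>B\<close> are frozen,
  as when one differentiates twice along a fixed line. The second derivative along the field itself
  also differentiates \<open>A\<close> and \<open>B\<close>, but this contributes a multiple of
  \<open>A * M B - B * M A\<close>, which is zero by straightness. Rescaling the field by
  \<open>v\<close> multiplies the relation by \<open>v * v * v\<close>.\<close>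

lemma leaf_to_line:
  assumes st: "A * (B * Tx B - A * Ty B) = B * (B * Tx A - A * Ty A)"
    and cubic: "(B * Tx F - A * Ty F) * (B * B * Tx (Tx G) - 2 * A * B * Tx (Ty G) + A * A * Ty (Ty G))
       = (B * Tx G - A * Ty G) * (B * B * Tx (Tx F) - 2 * A * B * Tx (Ty F) + A * A * Ty (Ty F))"
    and L: "\<And>f. L f = v * (B * Tx f - A * Ty f)"
  shows "L F * L (L G) = L G * L (L F)"
proof -
  define M where "M f = B * Tx f - A * Ty f" for f
  have M2: "M (M f) = (B * B * Tx (Tx f) - 2 * A * B * Tx (Ty f) + A * A * Ty (Ty f)) + M B * Tx f - M A * Ty f" for f
    by (simp add: M_def Tx_simps Ty_simps Txy_commute algebra_simps)
  have L2: "L (L f) = v * (M v * M f + v * M (M f))" for f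
    by (simp add: L M_def Tx_simps Ty_simps algebra_simps)
  have "M F * M (M G) - M G * M (M F) = (M F * (B * B * Tx (Tx G) - 2 * A * B * Tx (Ty G) + A * A * Ty (Ty G))
      - M G * (B * B * Tx (Tx F) - 2 * A * B * Tx (Ty F) + A * A * Ty (Ty F)))
      + (Tx F * Ty G - Ty F * Tx G) * (A * M B - B * M A)"
    unfolding M2 by (simp add: M_def[of F] M_def[of G] algebra_simps)
  also have "\<dots> = 0" using cubic st by (simp add: M_def)
  finally have "M F * M (M G) - M G * M (M F) = 0" .
  moreover have "L F * L (L G) - L G * L (L F) = v * v * v * (M F * M (M G) - M G * M (M F))"
    unfolding L2 unfolding L M_def[symmetric] by (simp add: algebra_simps)
  ultimately show ?thesis by simp
qed

definition maps_lines :: "ps2 \<Rightarrow> ps2 \<Rightarrow> ps2 \<Rightarrow> ps2 \<Rightarrow> bool" where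
  "maps_lines A B F G \<longleftrightarrow>
    (B * Tx F - A * Ty F) * (B * B * Tx (Tx G) - 2 * A * B * Tx (Ty G) + A * A * Ty (Ty G))
       = (B * Tx G - A * Ty G) * (B * B * Tx (Tx F) - 2 * A * B * Tx (Ty F) + A * A * Ty (Ty F))"

lemma wronskian_E: "E1 F * E2 G - E2 F * E1 G = V * (Tx F * Ty G - Ty F * Tx G)"
proof -
  have "E1 F * E2 G - E2 F * E1 G = V * (V * (A1 * B2 - B1 * A2)) * (Tx F * Ty G - Ty F * Tx G)"
    by (simp add: E1_def E2_def algebra_simps)
  then show ?thesis by (simp add: V)
qed

lemma unit_wronskian_E:
  assumes "J * (Tx F * Ty G - Ty F * Tx G) = 1"
  shows "(J * (A1 * B2 - B1 * A2)) * (E1 F * E2 G - E2 F * E1 G) = 1"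
proof -
  have "(J * (A1 * B2 - B1 * A2)) * (E1 F * E2 G - E2 F * E1 G)
     = (V * (A1 * B2 - B1 * A2)) * (J * (Tx F * Ty G - Ty F * Tx G))"
    unfolding wronskian_E by (simp add: algebra_simps)
  then show ?thesis by (simp add: V assms)
qed

lemma maps_lines_affine_sol:
  assumes J: "J * (Tx F * Ty G - Ty F * Tx G) = 1"
    and l: "maps_lines A1 B1 F G" "maps_lines A2 B2 F G" "maps_lines (A1 + A2) (B1 + B2) F G"
  obtains a t1 t2 where "affine_sol a t1 t2 F" "affine_sol a t1 t2 G"
proof (rule linearization_affine_sol[OF unit_wronskian_E[OF J]])
  \<comment> \<open>The second form annihilates \<open>e1\<close>, so \<open>e1\<close> is tangent
    to the leaves of the second foliation; likewise \<open>e2\<close> to those of the first and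
    \<open>e1 - e2\<close> to those of the third.\<close>
  show "E1 F * E1 (E1 G) = E1 G * E1 (E1 F)"
    by (rule leaf_to_line[OF straight2 l(2)[unfolded maps_lines_def], of E1 V]) (simp add: E1_def)
  show "E2 F * E2 (E2 G) = E2 G * E2 (E2 F)"
    by (rule leaf_to_line[OF straight1 l(1)[unfolded maps_lines_def], of E2 "- V"]) (simp add: E2_def algebra_simps)
  have "(\<lambda>f. E1 f - E2 f) F * (\<lambda>f. E1 f - E2 f) ((\<lambda>f. E1 f - E2 f) G) = (\<lambda>f. E1 f - E2 f) G * (\<lambda>f. E1 f - E2 f) ((\<lambda>f. E1 f - E2 f) F)"
    by (rule leaf_to_line[OF straight3 l(3)[unfolded maps_lines_def], of _ V]) (simp add: E1_def E2_def algebra_simps)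
  then show "(E1 F - E2 F) * (E1 (E1 G - E2 G) - E2 (E1 G - E2 G)) = (E1 G - E2 G) * (E1 (E1 F - E2 F) - E2 (E1 F - E2 F))"
    by simp
qed (rule that)

text \<open>This is the linearization given by the inclusion of \<open>M\<close>: all second
  derivatives of \<open>x\<close> and \<open>y\<close> vanish, and with them both sides of
  \<open>maps_lines\<close>.\<close>

lemma coords_affine_sol:
  obtains a t1 t2 where "affine_sol a t1 t2 x" "affine_sol a t1 t2 y"
  by (rule maps_lines_affine_sol[of 1 x y]) (auto simp: xy maps_lines_def Tx_simps Ty_simps)

lemma coords_wronskian: "(A1 * B2 - B1 * A2) * (E1 x * E2 y - E2 x * E1 y) = 1"
  using unit_wronskian_E[of 1 x y] by (simp add: xy)

text \<open>With \<open>[p0 : p1 : p2]\<close> the centre, \<open>(P, Q)\<close> is a direction of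
  the line joining the point to it, also for a centre at infinity, where \<open>p0 = 0\<close>. The
  first form kills this vector, so it is a multiple of \<open>e2\<close>, the factor being its value
  under the second form.\<close>

lemma first_pencil:
  assumes a: "affine_sol a t1 t2 x" "affine_sol a t1 t2 y"
    and inc: "A1 * P + B1 * Q = 0" and PQ: "P = cst p1 - cst p0 * x" "Q = cst p2 - cst p0 * y"
    and ne: "p0 \<noteq> 0 \<or> p1 \<noteq> 0 \<or> p2 \<noteq> 0"
  shows "k + D2 1 a - 2 * D1 1 a = 0"
proof (rule pencil1[OF a coords_wronskian, of P "A2 * P + B2 * Q" Q "cst p0"])
  have "(A2 * P + B2 * Q) * E2 x = P * (V * (A1 * B2 - B1 * A2)) - V * B2 * (A1 * P + B1 * Q)"
    "(A2 * P + B2 * Q) * E2 y = Q * (V * (A1 * B2 - B1 * A2)) + V * A2 * (A1 * P + B1 * Q)"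
    unfolding E_xy by (simp_all add: algebra_simps)
  then show e: "P = (A2 * P + B2 * Q) * E2 x" "Q = (A2 * P + B2 * Q) * E2 y" by (simp_all add: V inc)
  show "A2 * P + B2 * Q \<noteq> 0"
  proof
    assume "A2 * P + B2 * Q = 0"
    then have 0: "P = 0" "Q = 0" using e by (metis mult_zero_left)+
    have "Tx P = - cst p0" unfolding PQ by (simp add: Tx_simps xy)
    then have "cst p0 = 0" using 0 by (simp add: Tx_simps)
    then have "p0 = 0" by (metis jet_cst cst_0)
    then have "cst p1 = 0" "cst p2 = 0" using 0 PQ by simp_all
    then have "p1 = 0" "p2 = 0" by (metis jet_cst cst_0)+
    then show False using ne \<open>p0 = 0\<close> by simp
  qed
  show "E1 (cst p0) = 0" "E1 P = - cst p0 * E1 x" "E1 Q = - cst p0 * E1 y"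
    unfolding PQ by (simp_all add: E_diff E_deriv)
qed

lemma second_pencil:
  assumes a: "affine_sol a t1 t2 x" "affine_sol a t1 t2 y"
    and inc: "A2 * P + B2 * Q = 0" and PQ: "P = cst p1 - cst p0 * x" "Q = cst p2 - cst p0 * y"
    and ne: "p0 \<noteq> 0 \<or> p1 \<noteq> 0 \<or> p2 \<noteq> 0"
  shows "k + D1 1 a - 2 * D2 1 a = 0"
proof (rule pencil2[OF a coords_wronskian, of P "A1 * P + B1 * Q" Q "cst p0"])
  have "(A1 * P + B1 * Q) * E1 x = P * (V * (A1 * B2 - B1 * A2)) + V * B1 * (A2 * P + B2 * Q)"
    "(A1 * P + B1 * Q) * E1 y = Q * (V * (A1 * B2 - B1 * A2)) - V * A1 * (A2 * P + B2 * Q)"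
    unfolding E_xy by (simp_all add: algebra_simps)
  then show e: "P = (A1 * P + B1 * Q) * E1 x" "Q = (A1 * P + B1 * Q) * E1 y" by (simp_all add: V inc)
  show "A1 * P + B1 * Q \<noteq> 0"
  proof
    assume "A1 * P + B1 * Q = 0"
    then have 0: "P = 0" "Q = 0" using e by (metis mult_zero_left)+
    have "Tx P = - cst p0" unfolding PQ by (simp add: Tx_simps xy)
    then have "cst p0 = 0" using 0 by (simp add: Tx_simps)
    then have "p0 = 0" by (metis jet_cst cst_0)
    then have "cst p1 = 0" "cst p2 = 0" using 0 PQ by simp_all
    then have "p1 = 0" "p2 = 0" by (metis jet_cst cst_0)+
    then show False using ne \<open>p0 = 0\<close> by simp
  qed
  show "E2 (cst p0) = 0" "E2 P = - cst p0 * E2 x" "E2 Q = - cst p0 * E2 y"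
    unfolding PQ by (simp_all add: E_diff E_deriv)
qed

text \<open>\<open>p\<close> and \<open>q\<close> are the components in \<open>dx\<close>,
  \<open>dy\<close> of the form \<open>s - t\<close>, so this is the Hessian relation moved from the
  frame to the coordinates.\<close>

lemma affine_sol_hessian:
  assumes a: "affine_sol a t1 t2 x" "affine_sol a t1 t2 y" and F: "affine_sol a s1 s2 F"
  defines "p \<equiv> A1 * (s1 - t1) + A2 * (s2 - t2)" and "q \<equiv> B1 * (s1 - t1) + B2 * (s2 - t2)"
  shows "Tx (Tx F) = 2 * p * Tx F" "Tx (Ty F) = p * Ty F + q * Tx F" "Ty (Ty F) = 2 * q * Ty F"
proof -
  note h = affine_sol_eq_hessian[OF a F E_as(1)[of F] E_as(2)[of F]]
  have d: "A1 * E1 x + A2 * E2 x = 1" "A1 * E1 y + A2 * E2 y = 0" "B1 * E1 x + B2 * E2 x = 0" "B1 * E1 y + B2 * E2 y = 1"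
    using Txy_E[of x] Txy_E[of y] by (simp_all add: xy)
  have e: "f = A1 * (E1 x * f + E1 y * g) + A2 * (E2 x * f + E2 y * g)"
    "g = B1 * (E1 x * f + E1 y * g) + B2 * (E2 x * f + E2 y * g)" for f g
  proof -
    have "A1 * (E1 x * f + E1 y * g) + A2 * (E2 x * f + E2 y * g) = (A1 * E1 x + A2 * E2 x) * f + (A1 * E1 y + A2 * E2 y) * g"
      "B1 * (E1 x * f + E1 y * g) + B2 * (E2 x * f + E2 y * g) = (B1 * E1 x + B2 * E2 x) * f + (B1 * E1 y + B2 * E2 y) * g"
      by (simp_all add: algebra_simps)
    then show "f = A1 * (E1 x * f + E1 y * g) + A2 * (E2 x * f + E2 y * g)"
      "g = B1 * (E1 x * f + E1 y * g) + B2 * (E2 x * f + E2 y * g)" by (simp_all add: d)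
  qed
  have e1: "E1 (Tx F) = A1 * (2 * (s1 - t1) * E1 F) + A2 * ((s2 - t2) * E1 F + (s1 - t1) * E2 F)"
    "E1 (Ty F) = B1 * (2 * (s1 - t1) * E1 F) + B2 * ((s2 - t2) * E1 F + (s1 - t1) * E2 F)"
    using e(1)[of "E1 (Tx F)" "E1 (Ty F)"] e(2)[of "E1 (Ty F)" "E1 (Tx F)"] unfolding h(1,2) .
  have e2: "E2 (Tx F) = A1 * ((s2 - t2) * E1 F + (s1 - t1) * E2 F) + A2 * (2 * (s2 - t2) * E2 F)"
    "E2 (Ty F) = B1 * ((s2 - t2) * E1 F + (s1 - t1) * E2 F) + B2 * (2 * (s2 - t2) * E2 F)"
    using e(1)[of "E2 (Tx F)" "E2 (Ty F)"] e(2)[of "E2 (Ty F)" "E2 (Tx F)"] unfolding h(3,4) .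
  show "Tx (Tx F) = 2 * p * Tx F" "Tx (Ty F) = p * Ty F + q * Tx F" "Ty (Ty F) = 2 * q * Ty F"
    unfolding Txy_E(1)[of "Tx F"] Txy_E(1)[of "Ty F"] Txy_E(2)[of "Ty F"] e1 e2
    unfolding Txy_E[of F] p_def q_def by (simp_all add: algebra_simps)
qed

text \<open>Integrability of the Hessian equations forces \<open>Tx p = p * p\<close>,
  \<open>Ty p = Tx q = p * q\<close> and \<open>Ty q = q * q\<close>. So \<open>p\<close> and
  \<open>q\<close> are the logarithmic derivatives of the inverse of the affine function
  \<open>g\<close>, and multiplication by \<open>g\<close> removes all second derivatives of
  \<open>F\<close> and \<open>G\<close>.\<close>

lemma equal_invariant_projective:
  assumes a: "affine_sol a t1 t2 x" "affine_sol a t1 t2 y"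
    and F: "affine_sol a s1 s2 F" "affine_sol a s1 s2 G" and J: "J * (Tx F * Ty G - Ty F * Tx G) = 1"
  defines "X \<equiv> x - cst (jet 0 0 x)" and "Y \<equiv> y - cst (jet 0 0 y)"
  obtains p0 q0 u1 u2 u3 v1 v2 v3 where
    "(1 - cst p0 * X - cst q0 * Y) * F = cst u1 + cst u2 * X + cst u3 * Y"
    "(1 - cst p0 * X - cst q0 * Y) * G = cst v1 + cst v2 * X + cst v3 * Y"
proof -
  define p q where "p = A1 * (s1 - t1) + A2 * (s2 - t2)" and "q = B1 * (s1 - t1) + B2 * (s2 - t2)"
  note hF = affine_sol_hessian[OF a F(1), folded p_def q_def]
  note hG = affine_sol_hessian[OF a F(2), folded p_def q_def]
  have wr: "u = 0 \<and> v = 0" if "u * Tx F + v * Ty F = 0" "u * Tx G + v * Ty G = 0" for u v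
    using wronskian_cancel[OF J that] by simp
  have rel1: "(2 * Ty p - Tx q - p * q) * Tx H + (p * p - Tx p) * Ty H = 0"
    and rel2: "(q * q - Ty q) * Tx H + (2 * Tx q - Ty p - p * q) * Ty H = 0"
    if h: "Tx (Tx H) = 2 * p * Tx H" "Tx (Ty H) = p * Ty H + q * Tx H" "Ty (Ty H) = 2 * q * Ty H" for H
  proof -
    have h': "Ty (Tx H) = p * Ty H + q * Tx H" using h(2) by (simp add: Txy_commute)
    have n2: "Tx 2 = 0" "Ty 2 = 0" using Tx_simps(5)[of 2] Ty_simps(5)[of 2] by (simp_all add: cst_numeral)
    have "Ty (Tx (Tx H)) = Tx (Ty (Tx H))" "Ty (Tx (Ty H)) = Tx (Ty (Ty H))" by (simp_all add: Txy_commute)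
    then have "Ty (2 * p * Tx H) = Tx (p * Ty H + q * Tx H)" "Ty (p * Ty H + q * Tx H) = Tx (2 * q * Ty H)"
      unfolding h h' .
    then show "(2 * Ty p - Tx q - p * q) * Tx H + (p * p - Tx p) * Ty H = 0"
      "(q * q - Ty q) * Tx H + (2 * Tx q - Ty p - p * q) * Ty H = 0"
      unfolding Tx_simps Ty_simps h h' n2 by (simp_all add: algebra_simps)
  qed
  have w1: "2 * Ty p - Tx q - p * q = 0 \<and> p * p - Tx p = 0"
    by (rule wr[OF rel1[OF hF] rel1[OF hG]])
  have w2: "q * q - Ty q = 0 \<and> 2 * Tx q - Ty p - p * q = 0"
    by (rule wr[OF rel2[OF hF] rel2[OF hG]])
  have px: "Tx p = p * p" and qy: "Ty q = q * q" using w1 w2 by auto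
  have "3 * (Ty p - p * q) = 2 * (2 * Ty p - Tx q - p * q) + (2 * Tx q - Ty p - p * q)"
    "3 * (Tx q - p * q) = 2 * (2 * Tx q - Ty p - p * q) + (2 * Ty p - Tx q - p * q)"
    by (simp_all add: algebra_simps)
  then have "3 * (Ty p - p * q) = 0" "3 * (Tx q - p * q) = 0" using w1 w2 by simp_all
  then have pq: "Ty p = p * q" "Tx q = p * q" by (simp_all only: three_eq)
  define p0 q0 where "p0 = jet 0 0 p" and "q0 = jet 0 0 q"
  define g where "g = 1 - cst p0 * X - cst q0 * Y"
  have dXY: "Tx X = 1" "Ty X = 0" "Tx Y = 0" "Ty Y = 1"
    by (simp_all add: X_def Y_def Tx_simps Ty_simps xy)
  have XY0: "jet 0 0 X = 0" "jet 0 0 Y = 0" by (simp_all add: X_def Y_def)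
  have dg: "Tx g = - cst p0" "Ty g = - cst q0" by (simp_all add: g_def Tx_simps Ty_simps dXY)
  have g0: "jet 0 0 g = 1" by (simp add: g_def XY0)
  \<comment> \<open>Both series vanish at the base point and solve a linear homogeneous system, so
    they are zero; this gives \<open>p * g = cst p0\<close> and
    \<open>q * g = cst q0\<close>.\<close>
  define u v where "u = p * g - cst p0" and "v = q * g - cst q0"
  have du: "Tx u = p * u" "Ty u = p * v" "Tx v = q * u" "Ty v = q * v"
    by (simp_all add: u_def v_def Tx_simps Ty_simps dg px pq qy algebra_simps)
  have "ord n u \<and> ord n v" for n
  proof (induction n)
    case (Suc n)
    then show ?case
      by (auto intro!: ord_Txy_SucI ord_mult_left simp: du) (simp_all add: u_def v_def g0 p0_def q0_def)
  qed simp
  then have uv: "u = 0" "v = 0" using all_ord_eq_0 by blast+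
  have aff: "\<exists>u1 u2 u3. g * H = cst u1 + cst u2 * X + cst u3 * Y"
    if h: "Tx (Tx H) = 2 * p * Tx H" "Tx (Ty H) = p * Ty H + q * Tx H" "Ty (Ty H) = 2 * q * Ty H" for H
  proof -
    have z: "p * g = cst p0" "q * g = cst q0" using uv by (simp_all add: u_def v_def)
    have h': "Ty (Tx H) = p * Ty H + q * Tx H" using h(2) by (simp add: Txy_commute)
    have "Tx (Tx (g * H)) = 2 * Tx H * (p * g - cst p0)" "Tx (Ty (g * H)) = Ty H * (p * g - cst p0) + Tx H * (q * g - cst q0)"
      "Ty (Tx (g * H)) = Ty H * (p * g - cst p0) + Tx H * (q * g - cst q0)" "Ty (Ty (g * H)) = 2 * Ty H * (q * g - cst q0)"
      by (simp_all add: Tx_simps Ty_simps dg h h' algebra_simps)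
    then have "Tx (Tx (g * H)) = 0" "Ty (Tx (g * H)) = 0" "Tx (Ty (g * H)) = 0" "Ty (Ty (g * H)) = 0"
      by (simp_all add: z)
    then obtain u2 u3 where u: "Tx (g * H) = cst u2" "Ty (g * H) = cst u3" using Txy_const by blast
    have "g * H = cst (jet 0 0 (g * H)) + cst u2 * X + cst u3 * Y"
      by (rule Txy_eq, unfold u) (simp_all add: Tx_simps(1,4,5) Ty_simps(1,4,5) dXY XY0)
    then show ?thesis by blast
  qed
  show ?thesis using aff[OF hF] aff[OF hG] that unfolding g_def by blast
qed

text \<open>\<open>l\<close> is an affine function and \<open>(\<beta>, - \<alpha>)\<close> points
  along its level lines. In this direction the connection coefficients from \<open>W\<close> and
  from the three factors of \<open>Q\<close> cancel, and only the covariant derivative of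
  \<open>h\<close>, taken with weight minus one, is left.\<close>

lemma transport_key:
  fixes h l :: ps2
  assumes a: "affine_sol a t1 t2 x" "affine_sol a t1 t2 y" and l: "l = cst \<alpha> * x + cst \<beta> * y"
  defines "W \<equiv> A1 * B2 - B1 * A2"
  defines "Q \<equiv> E1 l * E2 l * (E1 l - E2 l)"
  shows "cst \<beta> * Tx (h * W * Q) - cst \<alpha> * Ty (h * W * Q)
    = W * (W * Q * (E2 l * (E1 h + r1 * h) - E1 l * (E2 h + r2 * h)))"
proof -
  have la: "affine_sol a t1 t2 l"
    unfolding affine_sol_def l D1_def D2_def
    by (simp add: E_deriv affine_sol_E[OF a(1)] affine_sol_E[OF a(2)]) (simp add: algebra_simps)
  define l1 l2 where "l1 = E1 l" and "l2 = E2 l"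
  note le = affine_sol_E[OF la, folded l1_def l2_def]
  \<comment> \<open>The trace of the connection along \<open>e1\<close> is
    \<open>(a + 2 * t1) + (t1 - a)\<close>, whence \<open>3 * t1\<close>; \<open>2 * r1\<close>
    reflects the weight two of a determinant.\<close>
  have EV: "E1 V = (3 * t1 + 2 * r1) * V" "E2 V = (3 * t2 + 2 * r2) * V"
  proof -
    have "E1 (E1 x * E2 y - E2 x * E1 y) = (3 * t1 + 2 * r1) * (E1 x * E2 y - E2 x * E1 y)"
      "E2 (E1 x * E2 y - E2 x * E1 y) = (3 * t2 + 2 * r2) * (E1 x * E2 y - E2 x * E1 y)"
      by (simp_all add: E_diff E_deriv affine_sol_E[OF a(1)] affine_sol_E[OF a(2)]) (simp_all add: algebra_simps)
    then show "E1 V = (3 * t1 + 2 * r1) * V" "E2 V = (3 * t2 + 2 * r2) * V" unfolding V_xy .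
  qed
  have VW: "V * W = 1" by (simp add: V W_def)
  have EW: "E1 W = - (3 * t1 + 2 * r1) * W" "E2 W = - (3 * t2 + 2 * r2) * W"
  proof -
    have "E1 (V * W) = 0" "E2 (V * W) = 0" unfolding VW by simp_all
    then have "V * (E1 W + (3 * t1 + 2 * r1) * W) = 0" "V * (E2 W + (3 * t2 + 2 * r2) * W) = 0"
      unfolding E_deriv EV by (simp_all add: algebra_simps)
    moreover have "V \<noteq> 0" using VW by auto
    ultimately have "E1 W + (3 * t1 + 2 * r1) * W = 0" "E2 W + (3 * t2 + 2 * r2) * W = 0" by simp_all
    then show "E1 W = - (3 * t1 + 2 * r1) * W" "E2 W = - (3 * t2 + 2 * r2) * W"
      by (simp_all only: mult_minus_left eq_neg_iff_add_eq_0)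
  qed
  have ab: "cst \<alpha> = A1 * l1 + A2 * l2" "cst \<beta> = B1 * l1 + B2 * l2"
    using Txy_E[of l] by (simp_all add: l1_def l2_def l Tx_simps Ty_simps xy)
  have "cst \<beta> * Tx H - cst \<alpha> * Ty H = W * (l2 * E1 H - l1 * E2 H)" for H
    unfolding ab Txy_E[of H] W_def by (simp add: algebra_simps)
  moreover have "l2 * E1 (h * W * Q) - l1 * E2 (h * W * Q) = W * Q * (l2 * (E1 h + r1 * h) - l1 * (E2 h + r2 * h))"
    unfolding Q_def l1_def[symmetric] l2_def[symmetric]
    by (simp add: E_deriv E_diff EW le) (simp add: algebra_simps)
  ultimately show ?thesis by (simp add: l1_def l2_def)
qed

definition form3 :: "ps2 \<Rightarrow> ps2 \<Rightarrow> ps2 \<Rightarrow> ps2 \<Rightarrow> ps2 \<Rightarrow> ps2 \<Rightarrow> ps2" where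
  "form3 h0 h1 h2 h3 A B = h0 * A^3 + h1 * A^2 * B + h2 * A * B^2 + h3 * B^3"

text \<open>The five equations say that the cubic form is constant along every straight line.\<close>

definition transported :: "ps2 \<Rightarrow> ps2 \<Rightarrow> ps2 \<Rightarrow> ps2 \<Rightarrow> bool" where
  "transported h0 h1 h2 h3 \<longleftrightarrow> Ty h0 = 0 \<and> Tx h0 = Ty h1 \<and> Tx h1 = Ty h2 \<and> Tx h2 = Ty h3 \<and> Tx h3 = 0"

lemma flat_cubic:
  assumes K: "K = 0"
  obtains h0 h1 h2 h3 \<alpha> \<beta> where "transported h0 h1 h2 h3"
    "form3 h0 h1 h2 h3 A1 B1 = 0" "form3 h0 h1 h2 h3 A2 B2 = 0" "form3 h0 h1 h2 h3 (- A1 - A2) (- B1 - B2) = 0"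
    "jet 0 0 (form3 h0 h1 h2 h3 (cst \<alpha>) (cst \<beta>)) \<noteq> 0"
proof -
  obtain a t1 t2 where a: "affine_sol a t1 t2 x" "affine_sol a t1 t2 y" by (rule coords_affine_sol)
  define W where "W = A1 * B2 - B1 * A2"
  have "dY (- (cst c1 * R + cst d1 * S)) = dX (- (cst c2 * R + cst d2 * S))"
  proof -
    have "Tx S = Ty R" using cv K by simp
    then show ?thesis by (simp add: dX_Txy Tx_simps Ty_simps algebra_simps)
  qed
  then obtain h where h: "jet 0 0 h = 1" "dX h = - (cst c1 * R + cst d1 * S) * h" "dY h = - (cst c2 * R + cst d2 * S) * h"
    using ps2_closed_exact by blast
  have "Tx h = - (cst (m11 * c1 + m12 * c2) * R + cst (m11 * d1 + m12 * d2) * S) * h"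
    "Ty h = - (cst (m21 * c1 + m22 * c2) * R + cst (m21 * d1 + m22 * d2) * S) * h"
    unfolding Tx_def Ty_def h(2,3) cst_add cst_mult by (simp_all add: algebra_simps)
  then have hx: "Tx h = - R * h" "Ty h = - S * h" unfolding m by simp_all
  have hE: "E1 h + r1 * h = 0" "E2 h + r2 * h = 0"
    by (simp_all add: E1_def E2_def hx r1_def r2_def algebra_simps)
  define p1 q1 p2 q2 where "p1 = E1 x" and "q1 = E1 y" and "p2 = E2 x" and "q2 = E2 y"
  define h0 where "h0 = h * W * (p1 * p2 * (p1 - p2))"
  define h1 where "h1 = h * W * (p1 * p2 * (q1 - q2) + (p1 * q2 + q1 * p2) * (p1 - p2))"
  define h2 where "h2 = h * W * (q1 * q2 * (p1 - p2) + (p1 * q2 + q1 * p2) * (q1 - q2))"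
  define h3 where "h3 = h * W * (q1 * q2 * (q1 - q2))"
  have form: "form3 h0 h1 h2 h3 A B = h * W * ((A * p1 + B * q1) * (A * p2 + B * q2) * ((A * p1 + B * q1) - (A * p2 + B * q2)))" for A B
    by (simp add: form3_def h0_def h1_def h2_def h3_def power2_eq_square power3_eq_cube algebra_simps)
  have d: "A1 * p1 + B1 * q1 = 1" "A1 * p2 + B1 * q2 = 0" "A2 * p1 + B2 * q1 = 0" "A2 * p2 + B2 * q2 = 1"
    unfolding p1_def q1_def p2_def q2_def E_xy using V by (simp_all add: algebra_simps)
  have tr: "cst \<beta> * Tx (form3 h0 h1 h2 h3 (cst \<alpha>) (cst \<beta>)) - cst \<alpha> * Ty (form3 h0 h1 h2 h3 (cst \<alpha>) (cst \<beta>)) = 0" for \<alpha> \<beta>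
    using transport_key[OF a, of "cst \<alpha> * x + cst \<beta> * y" \<alpha> \<beta> h]
    by (simp add: form hE E_deriv p1_def q1_def p2_def q2_def W_def)
  have "transported h0 h1 h2 h3"
  proof -
    \<comment> \<open>With \<open>\<alpha> = 1\<close> and \<open>\<beta> = t\<close> the constancy
      along lines is a quartic in \<open>t\<close> whose five coefficients are the equations of
      \<open>transported\<close>.\<close>
    have "- Ty h0 + cst t * (Tx h0 - Ty h1) + cst (t^2) * (Tx h1 - Ty h2) + cst (t^3) * (Tx h2 - Ty h3) + cst (t^4) * Tx h3 = 0" for t
      using tr[of t 1] by (simp add: form3_def Tx_simps Ty_simps cst_mult power2_eq_square power3_eq_cube power4_eq_xxxx algebra_simps)
    from quartic_form_eq_0[OF this] show ?thesis by (simp add: transported_def)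
  qed
  moreover have "form3 h0 h1 h2 h3 A1 B1 = 0" "form3 h0 h1 h2 h3 A2 B2 = 0" unfolding form d by simp_all
  moreover have "form3 h0 h1 h2 h3 (- A1 - A2) (- B1 - B2) = 0"
  proof -
    have "(- A1 - A2) * p1 + (- B1 - B2) * q1 = - (A1 * p1 + B1 * q1) - (A2 * p1 + B2 * q1)"
      "(- A1 - A2) * p2 + (- B1 - B2) * q2 = - (A1 * p2 + B1 * q2) - (A2 * p2 + B2 * q2)"
      by (simp_all add: algebra_simps)
    then show ?thesis unfolding form by (simp add: d)
  qed
  \<comment> \<open>The covector is twice the first form plus the second, frozen at the base point.
    Its values there on \<open>e1\<close> and \<open>e2\<close> are 2 and 1, so the three factors
    are 2, 1 and 1.\<close>
  moreover have "jet 0 0 (form3 h0 h1 h2 h3 (cst (jet 0 0 (2 * A1 + A2))) (cst (jet 0 0 (2 * B1 + B2)))) \<noteq> 0"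
  proof -
    let ?\<alpha> = "cst (jet 0 0 (2 * A1 + A2))" and ?\<beta> = "cst (jet 0 0 (2 * B1 + B2))"
    have j: "jet 0 0 (?\<alpha> * p + ?\<beta> * q) = jet 0 0 (2 * (A1 * p + B1 * q) + (A2 * p + B2 * q))" for p q
      by (simp add: algebra_simps)
    have "jet 0 0 (?\<alpha> * p1 + ?\<beta> * q1) = 2" "jet 0 0 (?\<alpha> * p2 + ?\<beta> * q2) = 1"
      unfolding j d using jet_numeral_mult[of 0 0 "num.Bit0 num.One" 1] by (simp_all del: jet_numeral_mult)
    moreover have "jet 0 0 V * jet 0 0 W = 1" using arg_cong[OF V, of "jet 0 0"] by (simp add: W_def)
    ultimately show ?thesis unfolding form using h(1) by (auto simp del: jet_add)
  qed
  ultimately show ?thesis by (rule that)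
qed

text \<open>A binary cubic vanishing on the three forms is a multiple \<open>P\<close> of the
  product of the three linear factors. Constancy along lines, tested on two covectors independent at
  the base point, forces \<open>h = P * V\<close> to be covariantly constant. A nonzero
  \<open>h\<close> of weight minus one can be so only if the curvature is zero.\<close>

lemma cubic_flat:
  assumes t: "transported h0 h1 h2 h3"
    and z: "form3 h0 h1 h2 h3 A1 B1 = 0" "form3 h0 h1 h2 h3 A2 B2 = 0" "form3 h0 h1 h2 h3 (- A1 - A2) (- B1 - B2) = 0"
    and ne: "h0 \<noteq> 0 \<or> h1 \<noteq> 0 \<or> h2 \<noteq> 0 \<or> h3 \<noteq> 0"
  shows "K = 0"
proof -
  obtain a t1 t2 where a: "affine_sol a t1 t2 x" "affine_sol a t1 t2 y" by (rule coords_affine_sol)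
  define W where "W = A1 * B2 - B1 * A2"
  have VW: "V * W = 1" by (simp add: V W_def)
  define P where "P = 3 * h0 * A1^2 * A2 + h1 * (A1^2 * B2 + 2 * A1 * A2 * B1) + h2 * (2 * A1 * B1 * B2 + A2 * B1^2) + 3 * h3 * B1^2 * B2"
  have form: "form3 h0 h1 h2 h3 (l1 * A1 + l2 * A2) (l1 * B1 + l2 * B2) = P * (l1 * l2 * (l1 - l2))" for l1 l2
  proof -
    have "form3 h0 h1 h2 h3 (l1 * A1 + l2 * A2) (l1 * B1 + l2 * B2) - P * (l1 * l2 * (l1 - l2))
       = (l1^3 - l1 * l2^2) * form3 h0 h1 h2 h3 A1 B1 + (l2^3 - l1 * l2^2) * form3 h0 h1 h2 h3 A2 B2
         - l1 * l2^2 * form3 h0 h1 h2 h3 (- A1 - A2) (- B1 - B2)"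
      unfolding form3_def P_def by (simp add: power2_eq_square power3_eq_cube algebra_simps)
    then show ?thesis unfolding z by simp
  qed
  define h where "h = P * V"
  have hW: "h * W = P" by (simp add: h_def mult.assoc VW)
  define l where "l \<alpha> \<beta> = cst \<alpha> * x + cst \<beta> * y" for \<alpha> \<beta>
  define Q where "Q \<alpha> \<beta> = E1 (l \<alpha> \<beta>) * E2 (l \<alpha> \<beta>) * (E1 (l \<alpha> \<beta>) - E2 (l \<alpha> \<beta>))" for \<alpha> \<beta>
  have ab: "cst \<alpha> = E1 (l \<alpha> \<beta>) * A1 + E2 (l \<alpha> \<beta>) * A2" "cst \<beta> = E1 (l \<alpha> \<beta>) * B1 + E2 (l \<alpha> \<beta>) * B2" for \<alpha> \<beta>
    using Txy_E[of "l \<alpha> \<beta>"] by (simp_all add: l_def Tx_simps Ty_simps xy mult.commute)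
  have H: "form3 h0 h1 h2 h3 (cst \<alpha>) (cst \<beta>) = h * W * Q \<alpha> \<beta>" for \<alpha> \<beta>
    using form[of "E1 (l \<alpha> \<beta>)" "E2 (l \<alpha> \<beta>)"] unfolding ab[symmetric] hW Q_def .
  have tr: "cst \<beta> * Tx (form3 h0 h1 h2 h3 (cst \<alpha>) (cst \<beta>)) - cst \<alpha> * Ty (form3 h0 h1 h2 h3 (cst \<alpha>) (cst \<beta>)) = 0" for \<alpha> \<beta>
    using t unfolding transported_def form3_def
    by (simp add: Tx_simps Ty_simps power2_eq_square power3_eq_cube algebra_simps)
  have key: "E2 (l \<alpha> \<beta>) * (E1 h + r1 * h) = E1 (l \<alpha> \<beta>) * (E2 h + r2 * h)" if "Q \<alpha> \<beta> \<noteq> 0" for \<alpha> \<beta>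
  proof -
    have "W * (W * Q \<alpha> \<beta> * (E2 (l \<alpha> \<beta>) * (E1 h + r1 * h) - E1 (l \<alpha> \<beta>) * (E2 h + r2 * h))) = 0"
      using transport_key[OF a l_def[of \<alpha> \<beta>], of h, folded W_def Q_def] tr[of \<beta> \<alpha>]
      unfolding H by simp
    moreover have "W \<noteq> 0" using VW by auto
    ultimately show ?thesis using that by simp
  qed
  \<comment> \<open>\<open>v s t\<close> is the constant covector with values \<open>s\<close> and
    \<open>t\<close> on \<open>e1\<close> and \<open>e2\<close> at the base point. For
    \<open>(1, 2)\<close> and \<open>(1, 3)\<close> the factors \<open>s\<close>, \<open>t\<close>,
    \<open>s - t\<close> are nonzero, and the determinant is minus one.\<close>
  define v where "v s t = (s * jet 0 0 A1 + t * jet 0 0 A2, s * jet 0 0 B1 + t * jet 0 0 B2)" for s t :: complex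
  have lv: "jet 0 0 (E1 (l (fst (v s t)) (snd (v s t)))) = s" "jet 0 0 (E2 (l (fst (v s t)) (snd (v s t)))) = t" for s t
  proof -
    have d: "A1 * E1 x + B1 * E1 y = 1" "A1 * E2 x + B1 * E2 y = 0" "A2 * E1 x + B2 * E1 y = 0" "A2 * E2 x + B2 * E2 y = 1"
      unfolding E_xy using V by (simp_all add: algebra_simps)
    have "jet 0 0 (E1 (l (fst (v s t)) (snd (v s t)))) = s * jet 0 0 (A1 * E1 x + B1 * E1 y) + t * jet 0 0 (A2 * E1 x + B2 * E1 y)"
      "jet 0 0 (E2 (l (fst (v s t)) (snd (v s t)))) = s * jet 0 0 (A1 * E2 x + B1 * E2 y) + t * jet 0 0 (A2 * E2 x + B2 * E2 y)"
      by (simp_all add: l_def v_def E_deriv algebra_simps)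
    then show "jet 0 0 (E1 (l (fst (v s t)) (snd (v s t)))) = s" "jet 0 0 (E2 (l (fst (v s t)) (snd (v s t)))) = t"
      unfolding d by simp_all
  qed
  have Qne: "Q (fst (v 1 t)) (snd (v 1 t)) \<noteq> 0" if "t \<noteq> 0" "t \<noteq> 1" for t
  proof
    assume "Q (fst (v 1 t)) (snd (v 1 t)) = 0"
    then have "jet 0 0 (Q (fst (v 1 t)) (snd (v 1 t))) = 0" by simp
    then show False unfolding Q_def using that by (simp add: lv)
  qed
  define u1 u2 where "u1 = E1 h + r1 * h" and "u2 = E2 h + r2 * h"
  let ?l = "l (fst (v 1 2)) (snd (v 1 2))" and ?m = "l (fst (v 1 3)) (snd (v 1 3))"
  have k2: "E2 ?l * u1 = E1 ?l * u2" and k3: "E2 ?m * u1 = E1 ?m * u2"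
    using key[OF Qne[of 2]] key[OF Qne[of 3]] by (simp_all add: u1_def u2_def)
  define det where "det = E2 ?l * E1 ?m - E1 ?l * E2 ?m"
  have "jet 0 0 det = - 1" unfolding det_def by (simp add: lv)
  then have dne: "det \<noteq> 0" by auto
  have "det * u1 = E1 ?m * (E2 ?l * u1 - E1 ?l * u2) - E1 ?l * (E2 ?m * u1 - E1 ?m * u2)"
    "det * u2 = E2 ?m * (E2 ?l * u1 - E1 ?l * u2) - E2 ?l * (E2 ?m * u1 - E1 ?m * u2)"
    by (simp_all add: det_def algebra_simps)
  then have "u1 = 0" "u2 = 0" unfolding k2 k3 using dne by simp_all
  then have u: "E1 h = - (r1 * h)" "E2 h = - (r2 * h)"
    by (simp_all add: u1_def u2_def eq_neg_iff_add_eq_0)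
  have "(E1 r2 - E2 r1) * h = - (E1 (E2 h) - E2 (E1 h)) + (r1 * E2 h - r2 * E1 h)"
    unfolding u by (simp add: E_deriv E_minus u algebra_simps)
  then have "3 * (k * h) = 0" unfolding E_comm curv by simp
  then have "k * h = 0" by (rule three)
  moreover have "h \<noteq> 0"
  proof
    assume h0: "h = 0"
    have "h0 + cst t * h1 + cst (t^2) * h2 + cst (t^3) * h3 + cst (t^4) * 0 = 0" for t
      using H[of 1 t] by (simp add: h0 form3_def cst_mult power2_eq_square power3_eq_cube algebra_simps)
    from quartic_form_eq_0[OF this] ne show False by simp
  qed
  ultimately have "k = 0" by simp
  then have "cst 3 * (cst (1/3) * K) = 0" by (simp add: k_def)
  then show ?thesis by (simp add: mult.assoc[symmetric] flip: cst_mult)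
qed

text \<open>These are the Killing equations of a cubic tensor in the flat plane. Differentiating
  them makes \<open>Tx w0\<close> constant, and integrating back yields ten constants, as many as a
  ternary cubic has. The line with conormal \<open>(A, B)\<close> has coordinates \<open>A\<close>,
  \<open>B\<close> and \<open>A * X + B * Y\<close>.\<close>

lemma transported_polynomial:
  assumes t: "transported h0 h1 h2 h3"
  defines "X \<equiv> x - cst (jet 0 0 x)" and "Y \<equiv> y - cst (jet 0 0 y)"
  obtains C D0 D1 b0 b1 b2 e0 e1 e2 e3 where
    "\<forall>A B. form3 h0 h1 h2 h3 A B = cst C * (A * X + B * Y)^3 + (A * X + B * Y)^2 * (cst D0 * A + cst D1 * B)
      + (A * X + B * Y) * (cst b0 * A^2 + cst b1 * A * B + cst b2 * B^2)
      + cst e0 * A^3 + cst e1 * A^2 * B + cst e2 * A * B^2 + cst e3 * B^3"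
proof -
  note t = t[unfolded transported_def]
  have dXY: "Tx X = 1" "Ty X = 0" "Tx Y = 0" "Ty Y = 1"
    by (simp_all add: X_def Y_def Tx_simps Ty_simps xy)
  have XY0: "jet 0 0 X = 0" "jet 0 0 Y = 0" by (simp_all add: X_def Y_def)
  define u0 u1 u2 where "u0 = Tx h0" and "u1 = Tx h1" and "u2 = Tx h2"
  have u: "Ty u0 = 0" "Tx u0 = Ty u1" "Tx u1 = Ty u2" "Tx u2 = 0"
    unfolding u0_def u1_def u2_def using t
    by (metis Txy_commute Tx_simps(6) Ty_simps(6))+
  define w0 w1 where "w0 = Tx u0" and "w1 = Tx u1"
  have w: "Ty w0 = 0" "Tx w0 = Ty w1" "Tx w1 = 0"
    unfolding w0_def w1_def using u by (metis Txy_commute Tx_simps(6) Ty_simps(6))+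
  have "Tx (Tx w0) = 0" "Ty (Tx w0) = 0"
    using w by (metis Txy_commute Tx_simps(6) Ty_simps(6))+
  then obtain c where c: "Tx w0 = cst c" using Txy_const by blast
  define C D0 D1 where "C = c / 6" and "D0 = jet 0 0 w0 / 2" and "D1 = jet 0 0 w1 / 2"
  have "w0 = cst (6 * C) * X + cst (2 * D0)"
    by (rule Txy_eq) (simp_all add: c w Tx_simps Ty_simps dXY XY0 C_def D0_def)
  then have w0: "w0 = 6 * cst C * X + 2 * cst D0" by (simp add: cst_mult cst_numeral)
  have "w1 = cst (6 * C) * Y + cst (2 * D1)"
    by (rule Txy_eq) (use c w in \<open>simp_all add: Tx_simps Ty_simps dXY XY0 C_def D1_def\<close>)
  then have w1: "w1 = 6 * cst C * Y + 2 * cst D1" by (simp add: cst_mult cst_numeral)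
  have num: "Tx (numeral n) = 0" "Ty (numeral n) = 0" for n
    using Tx_simps(5)[of "numeral n"] Ty_simps(5)[of "numeral n"] by (simp_all add: cst_numeral)
  note ds = Tx_simps Ty_simps dXY num power2_eq_square power3_eq_cube
  define b0 b1 b2 where "b0 = jet 0 0 u0" and "b1 = jet 0 0 u1" and "b2 = jet 0 0 u2"
  have u0: "u0 = 3 * cst C * X^2 + 2 * cst D0 * X + cst b0"
    by (rule Txy_eq, unfold w0_def[symmetric] w0 u) (simp_all add: ds XY0 b0_def algebra_simps)
  have u1: "u1 = 6 * cst C * X * Y + 2 * cst D1 * X + 2 * cst D0 * Y + cst b1"
    by (rule Txy_eq, unfold w1_def[symmetric] u(2)[symmetric], unfold w0_def[symmetric] w1 w0) (simp_all add: ds XY0 b1_def algebra_simps)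
  have u2: "u2 = 3 * cst C * Y^2 + 2 * cst D1 * Y + cst b2"
    by (rule Txy_eq, unfold u(3)[symmetric] u(4), unfold w1_def[symmetric] w1) (simp_all add: ds XY0 b2_def algebra_simps)
  define e0 e1 e2 e3 where "e0 = jet 0 0 h0" and "e1 = jet 0 0 h1" and "e2 = jet 0 0 h2" and "e3 = jet 0 0 h3"
  have T: "Ty h0 = 0" "Ty h1 = u0" "Ty h2 = u1" "Ty h3 = u2" "Tx h3 = 0"
    using t by (simp_all add: u0_def u1_def u2_def)
  have H0: "h0 = cst C * X^3 + cst D0 * X^2 + cst b0 * X + cst e0"
    by (rule Txy_eq, unfold u0_def[symmetric] T u0) (simp_all add: ds XY0 e0_def algebra_simps)
  have H1: "h1 = 3 * cst C * X^2 * Y + cst D1 * X^2 + 2 * cst D0 * X * Y + cst b1 * X + cst b0 * Y + cst e1"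
    by (rule Txy_eq, unfold u1_def[symmetric] T u0 u1) (simp_all add: ds XY0 e1_def algebra_simps)
  have H2: "h2 = 3 * cst C * X * Y^2 + 2 * cst D1 * X * Y + cst D0 * Y^2 + cst b2 * X + cst b1 * Y + cst e2"
    by (rule Txy_eq, unfold u2_def[symmetric] T u1 u2) (simp_all add: ds XY0 e2_def algebra_simps)
  have H3: "h3 = cst C * Y^3 + cst D1 * Y^2 + cst b2 * Y + cst e3"
    by (rule Txy_eq, unfold T u2) (simp_all add: ds XY0 e3_def algebra_simps)
  show ?thesis
    by (rule that[of C D0 D1 b0 b1 b2 e0 e1 e2 e3])
      (simp add: form3_def H0 H1 H2 H3 power2_eq_square power3_eq_cube algebra_simps)
qed

end

section \<open>The projective plane\<close>

lemma proj_set_in: "v \<noteq> 0 \<Longrightarrow> {c *s v | c. c \<noteq> 0} \<in> {S :: (complex^3) set. \<exists>v. v \<noteq> 0 \<and> S = {c *s v | c. c \<noteq> 0}}"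
  by blast

lemma proj_eq_iff:
  assumes v: "v \<noteq> 0" and w: "w \<noteq> 0"
  shows "proj v = proj w \<longleftrightarrow> (\<exists>c. c \<noteq> 0 \<and> v = c *s w)"
proof -
  have "proj v = proj w \<longleftrightarrow> {c *s v | c. c \<noteq> 0} = {c *s w | c. c \<noteq> 0}"
    unfolding proj_def by (rule Abs_P2_inject[OF proj_set_in[OF v] proj_set_in[OF w]])
  also have "\<dots> \<longleftrightarrow> (\<exists>c. c \<noteq> 0 \<and> v = c *s w)"
  proof
    assume e: "{c *s v | c. c \<noteq> 0} = {c *s w | c. c \<noteq> 0}"
    have "v \<in> {c *s v | c. c \<noteq> 0}" by (auto intro!: exI[of _ 1])
    then show "\<exists>c. c \<noteq> 0 \<and> v = c *s w" unfolding e by blast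
  next
    assume "\<exists>c. c \<noteq> 0 \<and> v = c *s w"
    then obtain c where c: "c \<noteq> 0" "v = c *s w" by blast
    show "{c *s v | c. c \<noteq> 0} = {c *s w | c. c \<noteq> 0}"
    proof (intro equalityI subsetI)
      fix u assume "u \<in> {c *s v | c. c \<noteq> 0}"
      then obtain d where d: "d \<noteq> 0" "u = d *s v" by blast
      then have "u = (d * c) *s w" "d * c \<noteq> 0" using c by (simp_all add: vector_smult_assoc)
      then show "u \<in> {c *s w | c. c \<noteq> 0}" by blast
    next
      fix u assume "u \<in> {c *s w | c. c \<noteq> 0}"
      then obtain d where d: "d \<noteq> 0" "u = d *s w" by blast
      then have "u = (d / c) *s v" "d / c \<noteq> 0" using c by (simp_all add: vector_smult_assoc)
      then show "u \<in> {c *s v | c. c \<noteq> 0}" by blast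
    qed
  qed
  finally show ?thesis .
qed

text \<open>Equality of points becomes the vanishing of minors, the polynomial form in which it can
  be continued analytically.\<close>

lemma proj_eq_iff_cross:
  fixes v w :: "complex^3"
  assumes v: "v \<noteq> 0" and w: "w \<noteq> 0"
  shows "proj v = proj w \<longleftrightarrow> (\<forall>i j. v $ i * w $ j = v $ j * w $ i)"
proof
  assume "proj v = proj w"
  then obtain c where "v = c *s w" using proj_eq_iff[OF v w] by blast
  then show "\<forall>i j. v $ i * w $ j = v $ j * w $ i" by simp
next
  assume c: "\<forall>i j. v $ i * w $ j = v $ j * w $ i"
  obtain i where i: "w $ i \<noteq> 0" using w by (auto simp: vec_eq_iff)
  have e: "v = (v $ i / w $ i) *s w" using i c by (auto simp: vec_eq_iff field_simps)
  moreover from this have "v $ i / w $ i \<noteq> 0" using v by (metis vector_smult_lzero)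
  ultimately show "proj v = proj w" using proj_eq_iff[OF v w] by blast
qed

lemma proj_smult: "c \<noteq> 0 \<Longrightarrow> v \<noteq> 0 \<Longrightarrow> proj (c *s v) = proj v"
  by (subst proj_eq_iff) (auto simp: vector_mul_eq_0)

lemma rep_proj_id: "rep p \<noteq> 0" "proj (rep p) = p"
proof -
  obtain v where "v \<noteq> 0" "Rep_P2 p = {c *s v | c. c \<noteq> 0}" using Rep_P2[of p] by blast
  then have "v \<noteq> 0 \<and> proj v = p" unfolding proj_def by (metis Rep_P2_inverse)
  then have "rep p \<noteq> 0 \<and> proj (rep p) = p" unfolding rep_def by (rule someI)
  then show "rep p \<noteq> 0" "proj (rep p) = p" by auto
qed

lemma rep_proj:
  assumes "v \<noteq> 0"
  obtains c where "c \<noteq> 0" "rep (proj v) = c *s v"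
  using proj_eq_iff[OF rep_proj_id(1)[of "proj v"] assms] rep_proj_id(2)[of "proj v"] by blast

lemma bil_3: "bil v w = v $ 1 * w $ 1 + v $ 2 * w $ 2 + v $ 3 * w $ 3"
  by (simp add: bil_def sum_3)

lemma bil_simps: "bil (c *s v) w = c * bil v w" "bil v (c *s w) = c * bil v w" "bil v w = bil w v"
  "bil (v + u) w = bil v w + bil u w" "bil v (w + u) = bil v w + bil v u"
  by (simp_all add: bil_3 algebra_simps)

lemma incid_proj: "v \<noteq> 0 \<Longrightarrow> w \<noteq> 0 \<Longrightarrow> incid (proj v) (proj w) \<longleftrightarrow> bil v w = 0"
proof -
  assume "v \<noteq> 0" "w \<noteq> 0"
  then obtain c d where "c \<noteq> 0" "rep (proj v) = c *s v" "d \<noteq> 0" "rep (proj w) = d *s w" using rep_proj by metis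
  then show ?thesis by (simp add: incid_def bil_simps(1,2))
qed

lemma incid_rep: "v \<noteq> 0 \<Longrightarrow> incid (proj v) l \<longleftrightarrow> bil v (rep l) = 0"
  using incid_proj[of v "rep l"] rep_proj_id[of l] by simp

text \<open>The position of the homogeneous coordinate that chart \<open>k\<close> sets to one.
  Together with \<open>lgrad k\<close>, which returns the other two, it allows all charts to be
  treated alike.\<close>

definition chart_idx :: "nat \<Rightarrow> 3" where
  "chart_idx k = (if k = 0 then 1 else if k = 1 then 2 else 3)"

lemma chartvec_nth:
  "chartvec k z $ chart_idx k = 1" "lgrad k (chartvec k z) = z"
  by (auto simp: chartvec_def chart_idx_def lgrad_def)

lemma chartvec_nz [simp]: "chartvec k z \<noteq> 0"
  using chartvec_nth(1)[of k z] by (metis zero_index zero_neq_one)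

lemma bil_chartvec: "bil (chartvec k z) v = v $ chart_idx k + fst z * fst (lgrad k v) + snd z * snd (lgrad k v)"
  by (auto simp: bil_3 chartvec_def chart_idx_def lgrad_def)

lemma vec3_eq_iff: "(v :: complex^3) = w \<longleftrightarrow> v $ chart_idx k = w $ chart_idx k \<and> lgrad k v = lgrad k w"
  by (auto simp: vec_eq_iff forall_3 chart_idx_def lgrad_def)

lemma lgrad_smult: "lgrad k (c *s v) = (c * fst (lgrad k v), c * snd (lgrad k v))"
  by (auto simp: lgrad_def)

definition affcoord :: "nat \<Rightarrow> complex^3 \<Rightarrow> complex \<times> complex" where
  "affcoord k v = (fst (lgrad k v) / v $ chart_idx k, snd (lgrad k v) / v $ chart_idx k)"

lemma proj_chart: "v $ chart_idx k \<noteq> 0 \<Longrightarrow> proj v = chart k (affcoord k v)"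
proof -
  assume a: "v $ chart_idx k \<noteq> 0"
  then have "v = v $ chart_idx k *s chartvec k (affcoord k v)"
    by (subst vec3_eq_iff[of _ _ k]) (auto simp: lgrad_smult chartvec_nth affcoord_def)
  then have "proj v = proj (v $ chart_idx k *s chartvec k (affcoord k v))" by simp
  then show ?thesis unfolding chart_def using proj_smult[OF a chartvec_nz] by simp
qed

lemma chart_inj: "chart k z = chart k w \<longleftrightarrow> z = w"
proof
  assume "chart k z = chart k w"
  then obtain c where c: "c \<noteq> 0" "chartvec k z = c *s chartvec k w"
    unfolding chart_def by (auto simp: proj_eq_iff)
  then have "chartvec k z $ chart_idx k = c * (chartvec k w $ chart_idx k)" by simp
  then have "c = 1" by (simp add: chartvec_nth)
  then have "chartvec k z = chartvec k w" using c by simp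
  then show "z = w" using chartvec_nth(2) by metis
qed simp

lemma chartinv_chart [simp]: "chartinv k (chart k z) = z"
  unfolding chartinv_def by (rule some_equality) (auto simp: chart_inj)

lemma chart_chartinv: "p \<in> range (chart k) \<Longrightarrow> chart k (chartinv k p) = p"
  by auto

lemma range_chart_ex: "\<exists>k\<in>{0,1,2}. p \<in> range (chart k)"
proof -
  have "rep p $ 1 \<noteq> 0 \<or> rep p $ 2 \<noteq> 0 \<or> rep p $ 3 \<noteq> 0"
    using rep_proj_id(1)[of p] by (auto simp: vec_eq_iff forall_3)
  then have "\<exists>k\<in>{0,1,2}. rep p $ chart_idx k \<noteq> 0" by (auto simp: chart_idx_def)
  then show ?thesis using proj_chart[of "rep p"] rep_proj_id(2)[of p] by (metis rangeI)
qed

lemma chart_eq_iff_nz: "chart k z \<in> range (chart k') \<longleftrightarrow> chartvec k z $ chart_idx k' \<noteq> 0"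
proof
  assume "chart k z \<in> range (chart k')"
  then obtain w where "chart k z = chart k' w" by blast
  then obtain c where "c \<noteq> 0" "chartvec k z = c *s chartvec k' w"
    unfolding chart_def by (auto simp: proj_eq_iff)
  then show "chartvec k z $ chart_idx k' \<noteq> 0" by (simp add: chartvec_nth)
next
  assume "chartvec k z $ chart_idx k' \<noteq> 0"
  then show "chart k z \<in> range (chart k')" using proj_chart[of "chartvec k z" k'] by (auto simp: chart_def)
qed

section \<open>Transition maps, open sets and connectedness\<close>

definition chart_change :: "nat \<Rightarrow> nat \<Rightarrow> complex \<times> complex \<Rightarrow> complex \<times> complex" where
  "chart_change k k' z = affcoord k' (chartvec k z)"

definition overlap :: "nat \<Rightarrow> nat \<Rightarrow> (complex \<times> complex) set" where
  "overlap k k' = {z. chartvec k z $ chart_idx k' \<noteq> 0}"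

lemma chart_trans: "z \<in> overlap k k' \<Longrightarrow> chart k z = chart k' (chart_change k k' z)"
  unfolding overlap_def chart_change_def chart_def[of k] by (simp add: proj_chart)

lemma holo2_chartvec: "open U \<Longrightarrow> holo2 (\<lambda>z. chartvec k z $ i) U"
  using exhaust_3[of i] by (cases "k = 0"; cases "k = 1") (auto simp: chartvec_def)

lemma open_overlap: "open (overlap k k')"
proof -
  have "overlap k k' = (\<lambda>z. chartvec k z $ chart_idx k') -` (- {0})" by (auto simp: overlap_def)
  moreover have "continuous_on UNIV (\<lambda>z. chartvec k z $ chart_idx k')"
    by (rule holo2_continuous[OF holo2_chartvec]) simp
  ultimately show ?thesis by (metis open_vimage open_delete open_UNIV Compl_eq_Diff_UNIV)
qed

lemma holo2_lgrad:
  fixes v :: "complex \<times> complex \<Rightarrow> complex^3"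
  assumes "\<And>i. holo2 (\<lambda>z. v z $ i) U"
  shows "holo2 (\<lambda>z. fst (lgrad k (v z))) U" "holo2 (\<lambda>z. snd (lgrad k (v z))) U"
  using assms by (cases "k = 0"; cases "k = 1"; simp add: lgrad_def)+

lemma holo2_trans: "holo2 (\<lambda>z. fst (chart_change k k' z)) (overlap k k')" "holo2 (\<lambda>z. snd (chart_change k k' z)) (overlap k k')"
  unfolding chart_change_def affcoord_def fst_conv snd_conv
  by (intro holo2_divide holo2_lgrad holo2_chartvec open_overlap; simp add: overlap_def)+

lemma trans_inverse:
  assumes z: "z \<in> overlap k k'"
  shows "chart_change k k' z \<in> overlap k' k" "chart_change k' k (chart_change k k' z) = z"
proof -
  have "chart k' (chart_change k k' z) = chart k z" using chart_trans[OF z] by simp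
  then have "chart k' (chart_change k k' z) \<in> range (chart k)" by simp
  then show o: "chart_change k k' z \<in> overlap k' k" unfolding chart_eq_iff_nz by (simp add: overlap_def)
  show "chart_change k' k (chart_change k k' z) = z"
    using chart_trans[OF o] chart_trans[OF z] by (simp add: chart_inj)
qed

text \<open>The reverse transition is an inverse, so by the chain rule the product of the two
  Jacobians is one.\<close>

lemma trans_jacobian:
  assumes z: "z \<in> overlap k k'"
  defines "u \<equiv> \<lambda>z. fst (chart_change k k' z)" and "v \<equiv> \<lambda>z. snd (chart_change k k' z)"
  shows "pdx u z * pdy v z - pdy u z * pdx v z \<noteq> 0"
proof -
  note hu = holo2_trans[of k k', folded u_def v_def]
  define f g where "f = (\<lambda>z. fst (chart_change k' k z))" and "g = (\<lambda>z. snd (chart_change k' k z))"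
  note hf = holo2_trans[of k' k, folded f_def g_def]
  have uv: "(u z, v z) \<in> overlap k' k" if "z \<in> overlap k k'" for z
    using trans_inverse(1)[OF that] by (simp add: u_def v_def)
  note cf = holo2_compose_pd(2,3)[OF hf(1) hu uv z] and cg = holo2_compose_pd(2,3)[OF hf(2) hu uv z]
  have id: "f (u w, v w) = fst w" "g (u w, v w) = snd w" if "w \<in> overlap k k'" for w
    using trans_inverse(2)[OF that] by (simp_all add: f_def g_def u_def v_def)
  have "pdx (\<lambda>z. f (u z, v z)) z = 1" "pdy (\<lambda>z. f (u z, v z)) z = 0"
    "pdx (\<lambda>z. g (u z, v z)) z = 0" "pdy (\<lambda>z. g (u z, v z)) z = 1"
    using pd_cong[OF open_overlap z, of "\<lambda>z. f (u z, v z)" fst] pd_cong[OF open_overlap z, of "\<lambda>z. g (u z, v z)" snd] id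
    by simp_all
  then have e: "pdx f (u z, v z) * pdx u z + pdy f (u z, v z) * pdx v z = 1"
    "pdx f (u z, v z) * pdy u z + pdy f (u z, v z) * pdy v z = 0"
    "pdx g (u z, v z) * pdx u z + pdy g (u z, v z) * pdx v z = 0"
    "pdx g (u z, v z) * pdy u z + pdy g (u z, v z) * pdy v z = 1"
    using cf cg by simp_all
  show ?thesis
  proof
    assume d: "pdx u z * pdy v z - pdy u z * pdx v z = 0"
    have "(pdx f (u z, v z) * pdx u z + pdy f (u z, v z) * pdx v z) * (pdx g (u z, v z) * pdy u z + pdy g (u z, v z) * pdy v z)
       - (pdx f (u z, v z) * pdy u z + pdy f (u z, v z) * pdy v z) * (pdx g (u z, v z) * pdx u z + pdy g (u z, v z) * pdx v z)
       = (pdx f (u z, v z) * pdy g (u z, v z) - pdy f (u z, v z) * pdx g (u z, v z)) * (pdx u z * pdy v z - pdy u z * pdx v z)"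
      by (simp add: algebra_simps)
    then show False unfolding e d by simp
  qed
qed

lemma P2open_chart_image:
  assumes "open U" shows "P2open (chart k ` U)"
  unfolding P2open_def
proof
  fix k' :: nat
  have "chart k' -` chart k ` U = {z \<in> overlap k' k. chart_change k' k z \<in> U}"
  proof (intro equalityI subsetI)
    fix z assume "z \<in> chart k' -` chart k ` U"
    then obtain w where w: "chart k' z = chart k w" "w \<in> U" by auto
    then have "z \<in> overlap k' k" using chart_eq_iff_nz[of k' z k] by (auto simp: overlap_def)
    then show "z \<in> {z \<in> overlap k' k. chart_change k' k z \<in> U}"
      using chart_trans[of z k' k] w by (simp add: chart_inj)
  next
    fix z assume "z \<in> {z \<in> overlap k' k. chart_change k' k z \<in> U}"
    then show "z \<in> chart k' -` chart k ` U" using chart_trans[of z k' k] by auto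
  qed
  also have "\<dots> = {z \<in> overlap k' k. (fst (chart_change k' k z), snd (chart_change k' k z)) \<in> U}" by simp
  also have "open \<dots>"
  proof -
    have "continuous_on (overlap k' k) (\<lambda>z. (fst (chart_change k' k z), snd (chart_change k' k z)))"
      by (intro continuous_on_Pair holo2_continuous holo2_trans)
    from continuous_open_preimage[OF this open_overlap assms]
    show ?thesis by (simp add: vimage_def Int_def)
  qed
  finally show "open (chart k' -` chart k ` U)" .
qed

text \<open>\<open>P2open\<close> speaks of the charts 0, 1 and 2, and any larger \<open>k\<close>
  denotes chart 2 again.\<close>

lemma P2open_vimage: "P2open N \<Longrightarrow> open (chart k -` N)"
proof -
  assume N: "P2open N"
  have "chart k = chart (if k = 0 then 0 else if k = 1 then 1 else 2)"
    by (rule ext) (simp add: chart_def chartvec_def)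
  then show ?thesis using N unfolding P2open_def by (metis insertCI)
qed

lemma P2open_Union: "(\<And>A. A \<in> \<A> \<Longrightarrow> P2open A) \<Longrightarrow> P2open (\<Union>\<A>)"
  unfolding P2open_def vimage_Union by blast

text \<open>The neighbourhoods where \<open>P\<close> is constant fall into those meeting
  \<open>M\<close> in a point with \<open>P\<close> and those meeting it in a point without. The two
  unions are open, cover \<open>M\<close> and are disjoint on it.\<close>

lemma P2connected_propagate:
  assumes conn: "P2connected M" and x0: "x0 \<in> M" "P x0"
    and loc: "\<And>p. p \<in> M \<Longrightarrow> \<exists>N. P2open N \<and> p \<in> N \<and> (\<forall>q\<in>N \<inter> M. \<forall>q'\<in>N \<inter> M. P q \<longrightarrow> P q')"
    and p: "p \<in> M"
  shows "P p"
proof (rule ccontr)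
  assume np: "\<not> P p"
  define \<N> where "\<N> = {N. P2open N \<and> (\<forall>q\<in>N \<inter> M. \<forall>q'\<in>N \<inter> M. P q \<longrightarrow> P q')}"
  define A where "A = \<Union>{N \<in> \<N>. \<exists>q\<in>N \<inter> M. P q}"
  define B where "B = \<Union>{N \<in> \<N>. \<exists>q\<in>N \<inter> M. \<not> P q}"
  have "P2open A" "P2open B" unfolding A_def B_def by (rule P2open_Union, auto simp: \<N>_def)+
  moreover have cov: "\<exists>N\<in>\<N>. q \<in> N" if "q \<in> M" for q using loc[OF that] by (auto simp: \<N>_def)
  have "A \<inter> M \<noteq> {}" using cov[OF x0(1)] x0 unfolding A_def by blast
  moreover have "B \<inter> M \<noteq> {}" using cov[OF p] p np unfolding B_def by blast
  moreover have "M \<subseteq> A \<union> B" using cov unfolding A_def B_def by blast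
  moreover have "A \<inter> B \<inter> M = {}"
  proof -
    have "P q" if "q \<in> A" "q \<in> M" for q using that unfolding A_def \<N>_def by blast
    moreover have "\<not> P q" if "q \<in> B" "q \<in> M" for q using that unfolding B_def \<N>_def by blast
    ultimately show ?thesis by blast
  qed
  ultimately show False using conn unfolding P2connected_def by blast
qed

text \<open>Holomorphy is given in some source chart at each point; composition with a transition
  map moves it to the prescribed chart \<open>k\<close>, the one in which the web forms are
  written.\<close>

lemma holo_map_chart:
  assumes "holo_map_on M \<psi>" "chart k z0 \<in> M"
  obtains k' U F G where "open U" "z0 \<in> U" "chart k ` U \<subseteq> M" "holo2 F U" "holo2 G U"
    "\<And>z. z \<in> U \<Longrightarrow> \<psi> (chart k z) = chart k' (F z, G z)"
proof -
  obtain k0 k' U0 where k: "chart k z0 \<in> chart k0 ` U0" "chart k0 ` U0 \<subseteq> M" "\<psi> ` chart k0 ` U0 \<subseteq> range (chart k')"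
    "holo2 (fst \<circ> local_rep k0 k' \<psi>) U0" "holo2 (snd \<circ> local_rep k0 k' \<psi>) U0"
    using bspec[OF assms(1)[unfolded holo_map_on_def] assms(2)] by (elim bexE exE conjE) (rule that; assumption)
  define U where "U = {z \<in> overlap k k0. chart_change k k0 z \<in> U0}"
  have o: "open U"
  proof -
    have "continuous_on (overlap k k0) (\<lambda>z. (fst (chart_change k k0 z), snd (chart_change k k0 z)))"
      by (intro continuous_on_Pair holo2_continuous holo2_trans)
    from continuous_open_preimage[OF this open_overlap holo2_open[OF k(4)]]
    show ?thesis by (simp add: U_def vimage_def Int_def)
  qed
  obtain w where w: "w \<in> U0" "chart k z0 = chart k0 w" using k(1) by blast
  have z0o: "z0 \<in> overlap k k0" using w chart_eq_iff_nz[of k z0 k0] by (auto simp: overlap_def)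
  have z0: "z0 \<in> U" using chart_trans[OF z0o] w z0o by (auto simp: U_def chart_inj)
  have tU: "chart_change k k0 z \<in> U0" "z \<in> overlap k k0" "chart k z = chart k0 (chart_change k k0 z)" if "z \<in> U" for z
    using that chart_trans by (auto simp: U_def)
  have t: "holo2 (\<lambda>z. fst (chart_change k k0 z)) U" "holo2 (\<lambda>z. snd (chart_change k k0 z)) U"
    using holo2_subset[OF holo2_trans(1) o] holo2_subset[OF holo2_trans(2) o] by (auto simp: U_def)
  show ?thesis
  proof (rule that[of U _ _ k'])
    show "open U" "z0 \<in> U" by fact+
    show "chart k ` U \<subseteq> M" using tU k(2) by fastforce
    show "holo2 (\<lambda>z. (fst \<circ> local_rep k0 k' \<psi>) (fst (chart_change k k0 z), snd (chart_change k k0 z))) U"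
      by (rule holo2_compose_pd(1)[OF k(4) t]) (simp add: tU)
    show "holo2 (\<lambda>z. (snd \<circ> local_rep k0 k' \<psi>) (fst (chart_change k k0 z), snd (chart_change k k0 z))) U"
      by (rule holo2_compose_pd(1)[OF k(5) t]) (simp add: tU)
    fix z assume z: "z \<in> U"
    have "\<psi> (chart k0 (chart_change k k0 z)) \<in> range (chart k')" using k(3) tU(1)[OF z] by blast
    from chart_chartinv[OF this]
    show "\<psi> (chart k z) = chart k' ((fst \<circ> local_rep k0 k' \<psi>) (fst (chart_change k k0 z), snd (chart_change k k0 z)),
       (snd \<circ> local_rep k0 k' \<psi>) (fst (chart_change k k0 z), snd (chart_change k k0 z)))"
      by (simp add: local_rep_def tU(3)[OF z])
  qed
qed

lemma holo_immersion_chart: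
  assumes "holo_immersion_on M \<psi>" "chart k z0 \<in> M"
  obtains k' U F G where "open U" "z0 \<in> U" "chart k ` U \<subseteq> M" "holo2 F U" "holo2 G U"
    "\<And>z. z \<in> U \<Longrightarrow> \<psi> (chart k z) = chart k' (F z, G z)"
    "\<And>z. z \<in> U \<Longrightarrow> pdx F z * pdy G z - pdy F z * pdx G z \<noteq> 0"
proof -
  obtain k0 k' U0 where k: "chart k z0 \<in> chart k0 ` U0" "chart k0 ` U0 \<subseteq> M" "\<psi> ` chart k0 ` U0 \<subseteq> range (chart k')"
    "holo2 (fst \<circ> local_rep k0 k' \<psi>) U0" "holo2 (snd \<circ> local_rep k0 k' \<psi>) U0"
    "\<forall>z\<in>U0. pdx (fst \<circ> local_rep k0 k' \<psi>) z * pdy (snd \<circ> local_rep k0 k' \<psi>) z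
               - pdy (fst \<circ> local_rep k0 k' \<psi>) z * pdx (snd \<circ> local_rep k0 k' \<psi>) z \<noteq> 0"
    using bspec[OF assms(1)[unfolded holo_immersion_on_def] assms(2)] by (elim bexE exE conjE) (rule that; assumption)
  define f g where "f = fst \<circ> local_rep k0 k' \<psi>" and "g = snd \<circ> local_rep k0 k' \<psi>"
  note k = k[folded f_def g_def]
  define u v where "u = (\<lambda>z. fst (chart_change k k0 z))" and "v = (\<lambda>z. snd (chart_change k k0 z))"
  define U where "U = {z \<in> overlap k k0. chart_change k k0 z \<in> U0}"
  have o: "open U"
  proof -
    have "continuous_on (overlap k k0) (\<lambda>z. (fst (chart_change k k0 z), snd (chart_change k k0 z)))"
      by (intro continuous_on_Pair holo2_continuous holo2_trans)
    from continuous_open_preimage[OF this open_overlap holo2_open[OF k(4)]]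
    show ?thesis by (simp add: U_def vimage_def Int_def)
  qed
  obtain w where w: "w \<in> U0" "chart k z0 = chart k0 w" using k(1) by blast
  have z0o: "z0 \<in> overlap k k0" using w chart_eq_iff_nz[of k z0 k0] by (auto simp: overlap_def)
  have z0: "z0 \<in> U" using chart_trans[OF z0o] w z0o by (auto simp: U_def chart_inj)
  have tU: "(u z, v z) \<in> U0" "z \<in> overlap k k0" "chart k z = chart k0 (u z, v z)" if "z \<in> U" for z
    using that chart_trans by (auto simp: U_def u_def v_def)
  have t: "holo2 u U" "holo2 v U"
    using holo2_subset[OF holo2_trans(1) o] holo2_subset[OF holo2_trans(2) o] by (auto simp: U_def u_def v_def)
  note cf = holo2_compose_pd[OF k(4) t tU(1)] and cg = holo2_compose_pd[OF k(5) t tU(1)]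
  show ?thesis
  proof (rule that[of U "\<lambda>z. f (u z, v z)" "\<lambda>z. g (u z, v z)" k'])
    show "open U" "z0 \<in> U" by fact+
    show "chart k ` U \<subseteq> M" using tU k(2) by fastforce
    show "holo2 (\<lambda>z. f (u z, v z)) U" "holo2 (\<lambda>z. g (u z, v z)) U" using cf(1) cg(1) by simp_all
    fix z assume z: "z \<in> U"
    have "\<psi> (chart k0 (u z, v z)) \<in> range (chart k')" using k(3) tU(1)[OF z] by blast
    from chart_chartinv[OF this]
    show "\<psi> (chart k z) = chart k' (f (u z, v z), g (u z, v z))"
      by (simp add: local_rep_def tU(3)[OF z] f_def g_def)
    have "pdx (\<lambda>z. f (u z, v z)) z * pdy (\<lambda>z. g (u z, v z)) z - pdy (\<lambda>z. f (u z, v z)) z * pdx (\<lambda>z. g (u z, v z)) z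
       = (pdx f (u z, v z) * pdy g (u z, v z) - pdy f (u z, v z) * pdx g (u z, v z)) * (pdx u z * pdy v z - pdy u z * pdx v z)"
      unfolding cf(2)[OF _ z, simplified] cf(3)[OF _ z, simplified] cg(2)[OF _ z, simplified] cg(3)[OF _ z, simplified] by (simp add: algebra_simps)
    also have "\<dots> \<noteq> 0" using k(6) tU(1)[OF z] trans_jacobian[OF tU(2)[OF z]] by (simp add: u_def v_def)
    finally show "pdx (\<lambda>z. f (u z, v z)) z * pdy (\<lambda>z. g (u z, v z)) z - pdy (\<lambda>z. f (u z, v z)) z * pdx (\<lambda>z. g (u z, v z)) z \<noteq> 0" .
  qed
qed

section \<open>Foliations by lines\<close>

text \<open>The line through \<open>z\<close> in the direction \<open>(b, - a)\<close>, which spans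
  the kernel of the form with coefficients \<open>a\<close>, \<open>b\<close>.\<close>

definition on_leaf :: "complex \<Rightarrow> complex \<Rightarrow> complex \<times> complex \<Rightarrow> complex \<Rightarrow> complex \<times> complex" where
  "on_leaf a b z t = (fst z + t * b, snd z - t * a)"

lemma on_leaf_0 [simp]: "on_leaf a b z 0 = z"
  by (simp add: on_leaf_def)

lemma continuous_on_leaf: "continuous_on UNIV (on_leaf a b z)"
  unfolding on_leaf_def by (intro continuous_intros)

lemma deriv_on_leaf:
  assumes f: "holo2 f U" and t: "on_leaf a b z t \<in> U"
  shows "((\<lambda>t. f (on_leaf a b z t)) has_field_derivative (b * pdx f (on_leaf a b z t) - a * pdy f (on_leaf a b z t))) (at t)"
proof -
  have d: "(on_leaf a b z has_derivative (\<lambda>h. (h * b, - (h * a)))) (at t)"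
    unfolding on_leaf_def by (auto intro!: derivative_eq_intros)
  have "((\<lambda>t. f (on_leaf a b z t)) has_derivative (\<lambda>h. fst (h * b, - (h * a)) * pdx f (on_leaf a b z t)
      + snd (h * b, - (h * a)) * pdy f (on_leaf a b z t))) (at t)"
    by (rule has_derivative_compose[OF d holo2_cderiv2[OF f t]])
  also have "(\<lambda>h. fst (h * b, - (h * a)) * pdx f (on_leaf a b z t) + snd (h * b, - (h * a)) * pdy f (on_leaf a b z t))
      = (*) (b * pdx f (on_leaf a b z t) - a * pdy f (on_leaf a b z t))"
    by (rule ext) (simp add: algebra_simps)
  finally show ?thesis unfolding has_field_derivative_def .
qed

lemma zero_deriv_near:
  assumes "(f has_field_derivative d) (at t)" "open S" "t \<in> S" "\<And>s. s \<in> S \<Longrightarrow> f s = c"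
  shows "d = 0"
proof -
  have "((\<lambda>s. c) has_field_derivative d) (at t)"
    by (rule has_field_derivative_transform_within_open[OF assms(1-3)]) (simp add: assms(4))
  then show ?thesis using DERIV_const DERIV_unique by blast
qed

lemma incid_chart: "incid (chart k z) l \<longleftrightarrow> rep l $ chart_idx k + fst z * fst (lgrad k (rep l)) + snd z * snd (lgrad k (rep l)) = 0"
  unfolding chart_def by (simp add: incid_rep bil_chartvec)

lemma lgrad_rep_nz:
  assumes "incid (chart k z) l" shows "lgrad k (rep l) \<noteq> (0, 0)"
proof
  assume "lgrad k (rep l) = (0, 0)"
  moreover from this have "rep l $ chart_idx k = 0" using assms by (simp add: incid_chart)
  ultimately have "rep l = 0" by (subst vec3_eq_iff[of _ _ k]) (simp add: lgrad_def)
  then show False using rep_proj_id(1) by simp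
qed

lemma defines_fol_smult:
  assumes d: "defines_fol k l U a b" and z: "z \<in> U" and i: "incid (chart k z) (l (chart k z))"
  obtains c where "c \<noteq> 0" "fst (lgrad k (rep (l (chart k z)))) = c * a z" "snd (lgrad k (rep (l (chart k z)))) = c * b z"
proof -
  define g where "g = lgrad k (rep (l (chart k z)))"
  have g: "g \<noteq> (0, 0)" using lgrad_rep_nz[OF i] by (simp add: g_def)
  have e: "a z * snd g = b z * fst g" and n: "(a z, b z) \<noteq> (0, 0)"
    using d z unfolding defines_fol_def g_def by auto
  show ?thesis
  proof (cases "a z = 0")
    case True
    then have b: "b z \<noteq> 0" and f: "fst g = 0" using n e by auto
    then have "snd g \<noteq> 0" using g by (cases g) auto
    then show ?thesis
      by (intro that[of "snd g / b z"]) (simp_all add: g_def[symmetric] True b f)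
  next
    case False
    then have s: "snd g = fst g / a z * b z" using e by (simp add: field_simps)
    then have "fst g \<noteq> 0" using g by (cases g) auto
    then show ?thesis
      by (intro that[of "fst g / a z"]) (simp_all add: g_def[symmetric] False s)
  qed
qed

lemma incid_on_leaf:
  assumes d: "defines_fol k l U a b" and z: "z \<in> U" and i: "incid (chart k z) (l (chart k z))"
  shows "incid (chart k (on_leaf (a z) (b z) z t)) (l (chart k z))"
proof -
  obtain c where c: "fst (lgrad k (rep (l (chart k z)))) = c * a z" "snd (lgrad k (rep (l (chart k z)))) = c * b z"
    using defines_fol_smult[OF assms] by metis
  show ?thesis using i unfolding incid_chart c on_leaf_def by (simp add: algebra_simps)
qed

lemma leaf_neighbourhood:
  assumes "P2open N" "chart k z \<in> N" "open U" "z \<in> U"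
  obtains S where "open S" "0 \<in> S" "\<And>t. t \<in> S \<Longrightarrow> on_leaf a b z t \<in> U \<and> chart k (on_leaf a b z t) \<in> N"
proof -
  define S where "S = on_leaf a b z -` (U \<inter> chart k -` N)"
  have "open S" unfolding S_def
    by (intro open_vimage continuous_on_leaf open_Int assms P2open_vimage)
  moreover have "0 \<in> S" using assms by (simp add: S_def)
  ultimately show ?thesis by (rule that) (simp add: S_def)
qed

text \<open>Near \<open>z\<close> the map \<open>l\<close> is constant on the line through
  \<open>z\<close>, so the form stays proportional to its value at \<open>z\<close> there.
  Differentiating the vanishing determinant at parameter 0 gives the equation.\<close>

lemma defines_fol_straight:
  assumes l: "lin_fol M l" and d: "defines_fol k l U a b" and sub: "chart k ` U \<subseteq> M" and z: "z \<in> U"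
  shows "a z * (b z * pdx b z - a z * pdy b z) = b z * (b z * pdx a z - a z * pdy a z)"
proof -
  have h: "holo2 a U" "holo2 b U" using d by (auto simp: defines_fol_def)
  have zM: "chart k z \<in> M" using sub z by auto
  have inc: "incid p (l p)" if "p \<in> M" for p using l that by (auto simp: lin_fol_def)
  obtain N where N: "P2open N" "chart k z \<in> N" "N \<subseteq> M" "\<And>q. q \<in> N \<Longrightarrow> incid q (l (chart k z)) \<Longrightarrow> l q = l (chart k z)"
    using l zM unfolding lin_fol_def by blast
  define w where "w = on_leaf (a z) (b z) z"
  obtain S where S: "open S" "0 \<in> S" "\<And>t. t \<in> S \<Longrightarrow> w t \<in> U \<and> chart k (w t) \<in> N"
    unfolding w_def using leaf_neighbourhood[OF N(1,2) holo2_open[OF h(1)] z] by metis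
  have cross: "a (w t) * b z - b (w t) * a z = 0" if t: "t \<in> S" for t
  proof -
    have leq: "l (chart k (w t)) = l (chart k z)"
      using N(4) S(3)[OF t] incid_on_leaf[OF d z inc[OF zM]] by (simp add: w_def)
    obtain c where c: "c \<noteq> 0" "fst (lgrad k (rep (l (chart k z)))) = c * a z" "snd (lgrad k (rep (l (chart k z)))) = c * b z"
      using defines_fol_smult[OF d z inc[OF zM]] .
    have "a (w t) * (c * b z) - b (w t) * (c * a z) = 0"
      using d S(3)[OF t] unfolding defines_fol_def leq[symmetric] c(2,3)[symmetric] by (auto simp: leq)
    then have "c * (a (w t) * b z - b (w t) * a z) = 0" by (simp add: algebra_simps)
    then show ?thesis using c(1) by simp
  qed
  have wU: "w 0 \<in> U" using z by (simp add: w_def)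
  have "((\<lambda>t. a (w t) * b z - b (w t) * a z) has_field_derivative
      (b z * pdx a (w 0) - a z * pdy a (w 0)) * b z - (b z * pdx b (w 0) - a z * pdy b (w 0)) * a z) (at 0)"
    unfolding w_def
    by (intro DERIV_diff DERIV_cmult_right deriv_on_leaf[OF h(1)] deriv_on_leaf[OF h(2)]) (use wU in \<open>simp_all add: w_def\<close>)
  from zero_deriv_near[OF this S(1,2) cross] show ?thesis by (simp add: w_def algebra_simps)
qed

text \<open>Along a leaf \<open>\<alpha> * F + \<beta> * G\<close> is constant. Its first two
  derivatives are linear equations with the nonzero solution \<open>(\<alpha>, \<beta>)\<close>, so
  their determinant vanishes.\<close>

lemma leaf_image_cubic:
  assumes l: "lin_fol M l" and d: "defines_fol k l U a b" and sub: "chart k ` U \<subseteq> M" and z: "z \<in> U"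
    and m: "maps_leaves_to_lines M l \<phi>" and F: "holo2 F U" and G: "holo2 G U"
    and \<phi>: "\<And>z. z \<in> U \<Longrightarrow> \<phi> (chart k z) = chart k' (F z, G z)"
  shows "(b z * pdx F z - a z * pdy F z) * (b z * b z * pdx (pdx G) z - 2 * a z * b z * pdx (pdy G) z + a z * a z * pdy (pdy G) z)
    = (b z * pdx G z - a z * pdy G z) * (b z * b z * pdx (pdx F) z - 2 * a z * b z * pdx (pdy F) z + a z * a z * pdy (pdy F) z)"
proof -
  have zM: "chart k z \<in> M" using sub z by auto
  have inc: "incid (chart k z) (l (chart k z))" using l zM by (auto simp: lin_fol_def)
  obtain N L where N: "P2open N" "chart k z \<in> N" "N \<subseteq> M" "\<And>q. q \<in> N \<Longrightarrow> incid q (l (chart k z)) \<Longrightarrow> incid (\<phi> q) L"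
    using m zM unfolding maps_leaves_to_lines_def by blast
  define w where "w = on_leaf (a z) (b z) z"
  obtain S where S: "open S" "0 \<in> S" "\<And>t. t \<in> S \<Longrightarrow> w t \<in> U \<and> chart k (w t) \<in> N"
    unfolding w_def using leaf_neighbourhood[OF N(1,2) holo2_open[OF F] z] by metis
  define \<alpha> \<beta> \<gamma> where "\<alpha> = fst (lgrad k' (rep L))" and "\<beta> = snd (lgrad k' (rep L))" and "\<gamma> = rep L $ chart_idx k'"
  have line: "incid (chart k' (F (w t), G (w t))) L" if t: "t \<in> S" for t
    using N(4)[of "chart k (w t)"] S(3)[OF t] incid_on_leaf[OF d z inc] \<phi>[of "w t"] by (simp add: w_def)
  have ne: "\<alpha> \<noteq> 0 \<or> \<beta> \<noteq> 0" using lgrad_rep_nz[OF line[OF S(2)]] by (auto simp: \<alpha>_def \<beta>_def prod_eq_iff)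
  have e0: "\<alpha> * F (w t) + \<beta> * G (w t) = - \<gamma>" if t: "t \<in> S" for t
    using line[OF t] unfolding incid_chart by (simp add: \<alpha>_def \<beta>_def \<gamma>_def algebra_simps eq_neg_iff_add_eq_0)
  define f1 where "f1 H v = b z * pdx H v - a z * pdy H v" for H v
  have h1: "holo2 (f1 H) U" if "holo2 H U" for H
    unfolding f1_def[abs_def] using that
    by (intro holo2_diff holo2_mult holo2_const holo2_pdx holo2_pdy) (auto dest: holo2_open)
  have d1: "((\<lambda>t. \<alpha> * A (w t) + \<beta> * B (w t)) has_field_derivative \<alpha> * f1 A (w t) + \<beta> * f1 B (w t)) (at t)"
    if "holo2 A U" "holo2 B U" "t \<in> S" for A B t
    unfolding w_def f1_def
    by (intro DERIV_add DERIV_cmult deriv_on_leaf[OF that(1)] deriv_on_leaf[OF that(2)]) (use S(3)[OF that(3)] in \<open>simp_all add: w_def\<close>)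
  have e1: "\<alpha> * f1 F (w t) + \<beta> * f1 G (w t) = 0" if t: "t \<in> S" for t
    by (rule zero_deriv_near[OF d1[OF F G t] S(1) t e0])
  have e2: "\<alpha> * f1 (f1 F) (w 0) + \<beta> * f1 (f1 G) (w 0) = 0"
    by (rule zero_deriv_near[OF d1[OF h1[OF F] h1[OF G] S(2)] S(1,2) e1])
  have w0: "w 0 = z" by (simp add: w_def)
  have f2: "f1 (f1 H) z = b z * b z * pdx (pdx H) z - 2 * a z * b z * pdx (pdy H) z + a z * a z * pdy (pdy H) z" if H: "holo2 H U" for H
  proof -
    have o: "open U" using H by (rule holo2_open)
    have p: "pdx (f1 H) z = b z * pdx (pdx H) z - a z * pdx (pdy H) z" "pdy (f1 H) z = b z * pdy (pdx H) z - a z * pdy (pdy H) z"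
      unfolding f1_def[abs_def]
      using z o H by (simp_all add: pd_diff[of _ U] holo2_pd_mult[of _ U] holo2_mult holo2_pdx holo2_pdy)
    show ?thesis unfolding f1_def[of "f1 H"] p pdxy_commute[OF H z] by (simp add: algebra_simps)
  qed
  have E: "\<alpha> * f1 F z + \<beta> * f1 G z = 0" "\<alpha> * f1 (f1 F) z + \<beta> * f1 (f1 G) z = 0"
    using e1[OF S(2)] e2 by (simp_all add: w0)
  have "\<alpha> * (f1 F z * f1 (f1 G) z - f1 G z * f1 (f1 F) z) = f1 (f1 G) z * (\<alpha> * f1 F z + \<beta> * f1 G z) - f1 G z * (\<alpha> * f1 (f1 F) z + \<beta> * f1 (f1 G) z)"
    "\<beta> * (f1 F z * f1 (f1 G) z - f1 G z * f1 (f1 F) z) = f1 F z * (\<alpha> * f1 (f1 F) z + \<beta> * f1 (f1 G) z) - f1 (f1 F) z * (\<alpha> * f1 F z + \<beta> * f1 G z)"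
    by (simp_all add: algebra_simps)
  then have "f1 F z * f1 (f1 G) z = f1 G z * f1 (f1 F) z" unfolding E using ne by auto
  then show ?thesis unfolding f2[OF F] f2[OF G] by (simp add: f1_def)
qed

text \<open>The general ternary cubic in \<open>A\<close>, \<open>B\<close>, \<open>g\<close>, with
  its ten coefficients arranged as in \<open>transported_polynomial\<close>.\<close>

definition cub :: "complex \<Rightarrow> complex \<Rightarrow> complex \<Rightarrow> complex \<Rightarrow> complex \<Rightarrow> complex \<Rightarrow> complex \<Rightarrow> complex \<Rightarrow> complex \<Rightarrow> complex
    \<Rightarrow> complex \<Rightarrow> complex \<Rightarrow> complex \<Rightarrow> complex" where
  "cub C p0 p1 f0 f1 f2 e0 e1 e2 e3 A B g = C * g^3 + g^2 * (p0 * A + p1 * B) + g * (f0 * A^2 + f1 * A * B + f2 * B^2)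
      + e0 * A^3 + e1 * A^2 * B + e2 * A * B^2 + e3 * B^3"

locale web_fun =
  fixes z0 :: "complex \<times> complex" and U :: "(complex \<times> complex) set"
    and a1 b1 a2 b2 r s K :: "complex \<times> complex \<Rightarrow> complex"
  assumes z0U: "z0 \<in> U"
    and holo: "holo2 a1 U" "holo2 b1 U" "holo2 a2 U" "holo2 b2 U" "holo2 r U" "holo2 s U" "holo2 K U"
    and W_nz: "\<And>z. z \<in> U \<Longrightarrow> a1 z * b2 z - b1 z * a2 z \<noteq> 0"
    and str: "structure_eq U a1 b1 r s" "structure_eq U a2 b2 r s"
    and curvature: "\<And>z. z \<in> U \<Longrightarrow> pdx s z - pdy r z = K z * (a1 z * b2 z - b1 z * a2 z)"
    and straight:
      "\<And>z. z \<in> U \<Longrightarrow> a1 z * (b1 z * pdx b1 z - a1 z * pdy b1 z) = b1 z * (b1 z * pdx a1 z - a1 z * pdy a1 z)"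
      "\<And>z. z \<in> U \<Longrightarrow> a2 z * (b2 z * pdx b2 z - a2 z * pdy b2 z) = b2 z * (b2 z * pdx a2 z - a2 z * pdy a2 z)"
      "\<And>z. z \<in> U \<Longrightarrow> (a1 z + a2 z) * ((b1 z + b2 z) * (pdx b1 z + pdx b2 z) - (a1 z + a2 z) * (pdy b1 z + pdy b2 z))
         = (b1 z + b2 z) * ((b1 z + b2 z) * (pdx a1 z + pdx a2 z) - (a1 z + a2 z) * (pdy a1 z + pdy a2 z))"
begin

definition "W z = a1 z * b2 z - b1 z * a2 z"
definition "iW z = 1 / W z"
text \<open>The components at \<open>z0\<close> of the dual frame; the Taylor expansion is taken
  along these frozen vectors, so that leading parts of \<open>E1\<close>, \<open>E2\<close> are
  \<open>dX\<close>, \<open>dY\<close>.\<close>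

definition "fc1 = b2 z0 / W z0"
definition "fd1 = - a2 z0 / W z0"
definition "fc2 = - b1 z0 / W z0"
definition "fd2 = a1 z0 / W z0"

lemma openU: "open U" using holo2_open[OF holo(1)] .

lemma holoW: "holo2 iW U"
  unfolding iW_def[abs_def] W_def by (intro holo2_divide holo2_diff holo2_mult holo holo2_const openU W_nz)

sublocale taylor z0 U fc1 fd1 fc2 fd2 "a1 z0" "a2 z0" "b1 z0" "b2 z0"
proof
  have w: "W z0 \<noteq> 0" using W_nz[OF z0U] by (simp add: W_def)
  show "open U" by (rule openU)
  show "z0 \<in> U" by (rule z0U)
  show "a1 z0 * fc1 + a2 z0 * fc2 = 1" "b1 z0 * fd1 + b2 z0 * fd2 = 1"
    unfolding fc1_def fc2_def fd1_def fd2_def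
    using w by (simp_all add: field_simps) (simp_all add: W_def algebra_simps)
  show "a1 z0 * fd1 + a2 z0 * fd2 = 0" "b1 z0 * fc1 + b2 z0 * fc2 = 0"
    unfolding fc1_def fc2_def fd1_def fd2_def by (simp_all add: field_simps)
qed

lemmas holo_rules = holo2_add holo2_diff holo2_minus holo2_mult holo2_pdx holo2_pdy holo2_const holo2_fst holo2_snd holo2_power openU holo holoW

sublocale web_data z0 U fc1 fd1 fc2 fd2 "a1 z0" "a2 z0" "b1 z0" "b2 z0"
  "T a1" "T b1" "T a2" "T b2" "T r" "T s" "T K" "T iW" "T fst" "T snd"
proof
  have "T (\<lambda>z. iW z * (a1 z * b2 z - b1 z * a2 z)) = T (\<lambda>z. 1)"
    by (rule T_cong) (use W_nz in \<open>simp add: W_def iW_def\<close>)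
  then show "T iW * (T a1 * T b2 - T b1 * T a2) = 1"
    by (simp add: T_mult T_diff T_const holo_rules)
  have e: "T (\<lambda>z. pdx b z - pdy a z + (r z * b z - s z * a z)) = T (\<lambda>z. 0)" if "structure_eq U a b r s" for a b
    by (rule T_cong) (use that in \<open>simp add: structure_eq_def\<close>)
  show "Tx (T b1) - Ty (T a1) + (T r * T b1 - T s * T a1) = 0" "Tx (T b2) - Ty (T a2) + (T r * T b2 - T s * T a2) = 0"
    using e[OF str(1)] e[OF str(2)] by (simp_all add: T_add T_mult T_diff T_const T_pdx T_pdy holo_rules)
  have "T (\<lambda>z. pdx s z - pdy r z) = T (\<lambda>z. K z * (a1 z * b2 z - b1 z * a2 z))"
    by (rule T_cong) (rule curvature)
  then show "Tx (T s) - Ty (T r) = T K * (T a1 * T b2 - T b1 * T a2)"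
    by (simp add: T_mult T_diff T_pdx T_pdy holo_rules)
  have st: "T a * (T b * Tx (T b) - T a * Ty (T b)) = T b * (T b * Tx (T a) - T a * Ty (T a))"
    if "holo2 a U" "holo2 b U" "\<And>z. z \<in> U \<Longrightarrow> a z * (b z * pdx b z - a z * pdy b z) = b z * (b z * pdx a z - a z * pdy a z)" for a b
  proof -
    have "T (\<lambda>z. a z * (b z * pdx b z - a z * pdy b z)) = T (\<lambda>z. b z * (b z * pdx a z - a z * pdy a z))"
      by (rule T_cong) (rule that(3))
    then show ?thesis using that(1,2) by (simp add: T_mult T_diff T_pdx T_pdy holo_rules)
  qed
  show "T a1 * (T b1 * Tx (T b1) - T a1 * Ty (T b1)) = T b1 * (T b1 * Tx (T a1) - T a1 * Ty (T a1))"
    "T a2 * (T b2 * Tx (T b2) - T a2 * Ty (T b2)) = T b2 * (T b2 * Tx (T a2) - T a2 * Ty (T a2))"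
    by (rule st[OF holo(1,2) straight(1)] st[OF holo(3,4) straight(2)]; assumption)+
  have "T (\<lambda>z. (a1 z + a2 z) * ((b1 z + b2 z) * (pdx b1 z + pdx b2 z) - (a1 z + a2 z) * (pdy b1 z + pdy b2 z)))
     = T (\<lambda>z. (b1 z + b2 z) * ((b1 z + b2 z) * (pdx a1 z + pdx a2 z) - (a1 z + a2 z) * (pdy a1 z + pdy a2 z)))"
    by (rule T_cong) (rule straight(3))
  then show "(T a1 + T a2) * ((T b1 + T b2) * Tx (T b1 + T b2) - (T a1 + T a2) * Ty (T b1 + T b2))
     = (T b1 + T b2) * ((T b1 + T b2) * Tx (T a1 + T a2) - (T a1 + T a2) * Ty (T a1 + T a2))"
    by (simp add: T_add T_mult T_diff T_pdx T_pdy Tx_simps Ty_simps holo_rules)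
  show "jet 0 0 (T iW * T b2) = fc1" "jet 0 0 (T iW * T a2) = - fd1"
    "jet 0 0 (T iW * T b1) = - fc2" "jet 0 0 (T iW * T a1) = fd2"
    unfolding jet_00_mult T_00 by (simp_all add: iW_def fc1_def fd1_def fc2_def fd2_def)
  have "pdx fst = (\<lambda>z. 1)" "pdy fst = (\<lambda>z. 0)" "pdx snd = (\<lambda>z. 0)" "pdy snd = (\<lambda>z. 1)" by (auto simp: fun_eq_iff)
  then show "Tx (T fst) = 1" "Ty (T fst) = 0" "Tx (T snd) = 0" "Ty (T snd) = 1"
    by (simp_all add: T_const openU flip: T_pdx T_pdy)
qed

definition leaf_cubic where
  "leaf_cubic a b F G \<longleftrightarrow> (\<forall>z\<in>U.
     (b z * pdx F z - a z * pdy F z) * (b z * b z * pdx (pdx G) z - 2 * a z * b z * pdx (pdy G) z + a z * a z * pdy (pdy G) z)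
    = (b z * pdx G z - a z * pdy G z) * (b z * b z * pdx (pdx F) z - 2 * a z * b z * pdx (pdy F) z + a z * a z * pdy (pdy F) z))"

lemma leaf_cubic_maps_lines:
  assumes h: "holo2 a U" "holo2 b U" "holo2 F U" "holo2 G U" and c: "leaf_cubic a b F G"
  shows "maps_lines (T a) (T b) (T F) (T G)"
proof -
  have "T (\<lambda>z. (b z * pdx F z - a z * pdy F z) * (b z * b z * pdx (pdx G) z - 2 * a z * b z * pdx (pdy G) z + a z * a z * pdy (pdy G) z))
    = T (\<lambda>z. (b z * pdx G z - a z * pdy G z) * (b z * b z * pdx (pdx F) z - 2 * a z * b z * pdx (pdy F) z + a z * a z * pdy (pdy F) z))"
    by (rule T_cong) (use c in \<open>simp add: leaf_cubic_def\<close>)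
  then show ?thesis unfolding maps_lines_def
    using h by (simp add: T_add T_mult T_diff T_pdx T_pdy T_const cst_numeral holo_rules)
qed

lemma T_vanish:
  assumes "holo2 f U" "T f = 0"
  shows "\<exists>V. open V \<and> z0 \<in> V \<and> V \<subseteq> U \<and> (\<forall>z\<in>V. f z = 0)"
  using T_eq_0_imp[OF assms] by metis

text \<open>If the invariants \<open>a\<close>, \<open>b\<close> of the inclusion and of
  \<open>(F, G)\<close> differ, the jets force zero curvature. If they agree, the fractional linear
  formulas for the Taylor series become identities of functions near \<open>z0\<close>.\<close>

lemma flat_or_projective:
  assumes h: "holo2 F U" "holo2 G U" and J: "\<And>z. z \<in> U \<Longrightarrow> pdx F z * pdy G z - pdy F z * pdx G z \<noteq> 0"
    and c: "leaf_cubic a1 b1 F G" "leaf_cubic a2 b2 F G" "leaf_cubic (\<lambda>z. a1 z + a2 z) (\<lambda>z. b1 z + b2 z) F G"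
    and van: "\<And>i j. i + j \<le> n \<Longrightarrow> pd i j K z0 = 0"
    and cases: "n = 3
      \<or> n = 2 \<and> (\<exists>p0 p1 p2. (p0 \<noteq> 0 \<or> p1 \<noteq> 0 \<or> p2 \<noteq> 0) \<and> (\<forall>z\<in>U. a1 z * (p1 - p0 * fst z) + b1 z * (p2 - p0 * snd z) = 0))
      \<or> n = 1 \<and> (\<exists>p0 p1 p2. (p0 \<noteq> 0 \<or> p1 \<noteq> 0 \<or> p2 \<noteq> 0) \<and> (\<forall>z\<in>U. a1 z * (p1 - p0 * fst z) + b1 z * (p2 - p0 * snd z) = 0))
         \<and> (\<exists>p0 p1 p2. (p0 \<noteq> 0 \<or> p1 \<noteq> 0 \<or> p2 \<noteq> 0) \<and> (\<forall>z\<in>U. a2 z * (p1 - p0 * fst z) + b2 z * (p2 - p0 * snd z) = 0))"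
  shows "T K = 0 \<or> (\<exists>V p q u1 u2 u3 v1 v2 v3. open V \<and> z0 \<in> V \<and> V \<subseteq> U \<and> (\<forall>z\<in>V.
      (1 - p * (fst z - fst z0) - q * (snd z - snd z0)) * F z = u1 + u2 * (fst z - fst z0) + u3 * (snd z - snd z0) \<and>
      (1 - p * (fst z - fst z0) - q * (snd z - snd z0)) * G z = v1 + v2 * (fst z - fst z0) + v3 * (snd z - snd z0)))"
proof -
  obtain a t1 t2 where a: "affine_sol a t1 t2 (T fst)" "affine_sol a t1 t2 (T snd)" by (rule coords_affine_sol)
  define iJ where "iJ z = 1 / (pdx F z * pdy G z - pdy F z * pdx G z)" for z
  have hJ: "holo2 iJ U"
    unfolding iJ_def[abs_def] by (intro holo2_divide holo_rules h J)
  have "T (\<lambda>z. iJ z * (pdx F z * pdy G z - pdy F z * pdx G z)) = T (\<lambda>z. 1)"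
    by (rule T_cong) (use J in \<open>simp add: iJ_def\<close>)
  then have TJ: "T iJ * (Tx (T F) * Ty (T G) - Ty (T F) * Tx (T G)) = 1"
    using h hJ by (simp add: T_mult T_diff T_pdx T_pdy T_const holo_rules)
  have ml: "maps_lines (T a1) (T b1) (T F) (T G)" "maps_lines (T a2) (T b2) (T F) (T G)" "maps_lines (T a1 + T a2) (T b1 + T b2) (T F) (T G)"
    using leaf_cubic_maps_lines[OF holo(1,2) h c(1)] leaf_cubic_maps_lines[OF holo(3,4) h c(2)]
      leaf_cubic_maps_lines[OF _ _ h c(3)] by (simp_all add: T_add holo_rules)
  obtain b s1 s2 where b: "affine_sol b s1 s2 (T F)" "affine_sol b s1 s2 (T G)"
    by (rule maps_lines_affine_sol[OF TJ ml])
  have la: "lin_sol a" by (rule affine_sol_lin_sol[OF a coords_wronskian])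
  have lb: "lin_sol b" by (rule affine_sol_lin_sol[OF b unit_wronskian_E[OF TJ]])
  show ?thesis
  proof (cases "a = b")
    case True
    obtain p q u1 u2 u3 v1 v2 v3 where e:
      "(1 - cst p * (T fst - cst (jet 0 0 (T fst))) - cst q * (T snd - cst (jet 0 0 (T snd)))) * T F
        = cst u1 + cst u2 * (T fst - cst (jet 0 0 (T fst))) + cst u3 * (T snd - cst (jet 0 0 (T snd)))"
      "(1 - cst p * (T fst - cst (jet 0 0 (T fst))) - cst q * (T snd - cst (jet 0 0 (T snd)))) * T G
        = cst v1 + cst v2 * (T fst - cst (jet 0 0 (T fst))) + cst v3 * (T snd - cst (jet 0 0 (T snd)))"
      by (rule equal_invariant_projective[OF a b[folded True] TJ])
    define f where "f H w1 w2 w3 = (\<lambda>z. (1 - p * (fst z - fst z0) - q * (snd z - snd z0)) * H z - (w1 + w2 * (fst z - fst z0) + w3 * (snd z - snd z0)))" for H :: "complex \<times> complex \<Rightarrow> complex" and w1 w2 w3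
    have hf: "holo2 (f H w1 w2 w3) U" if "holo2 H U" for H w1 w2 w3
      unfolding f_def by (intro holo_rules that)
    have Tf: "T (f H w1 w2 w3) = (1 - cst p * (T fst - cst (fst z0)) - cst q * (T snd - cst (snd z0))) * T H
        - (cst w1 + cst w2 * (T fst - cst (fst z0)) + cst w3 * (T snd - cst (snd z0)))" if "holo2 H U" for H w1 w2 w3
      unfolding f_def using that by (simp add: T_add T_mult T_diff T_const holo_rules)
    have "T (f F u1 u2 u3) = 0" "T (f G v1 v2 v3) = 0"
      using e by (simp_all add: Tf h T_00)
    then obtain V1 V2 where V: "open V1" "z0 \<in> V1" "V1 \<subseteq> U" "\<forall>z\<in>V1. f F u1 u2 u3 z = 0"
      "open V2" "z0 \<in> V2" "V2 \<subseteq> U" "\<forall>z\<in>V2. f G v1 v2 v3 z = 0"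
      using T_vanish[OF hf[OF h(1)]] T_vanish[OF hf[OF h(2)]] by metis
    have "open (V1 \<inter> V2) \<and> z0 \<in> V1 \<inter> V2 \<and> V1 \<inter> V2 \<subseteq> U \<and> (\<forall>z\<in>V1 \<inter> V2.
      (1 - p * (fst z - fst z0) - q * (snd z - snd z0)) * F z = u1 + u2 * (fst z - fst z0) + u3 * (snd z - snd z0) \<and>
      (1 - p * (fst z - fst z0) - q * (snd z - snd z0)) * G z = v1 + v2 * (fst z - fst z0) + v3 * (snd z - snd z0))"
      using V by (auto simp: f_def)
    then show ?thesis by blast
  next
    case False
    have o: "ord (Suc n) k"
      unfolding k_def by (rule ord_mult_left) (rule pd_zero_ord[OF holo(7) van])
    have pen: "T a * (cst p1 - cst p0 * T fst) + T b * (cst p2 - cst p0 * T snd) = 0"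
      if "\<forall>z\<in>U. a z * (p1 - p0 * fst z) + b z * (p2 - p0 * snd z) = 0" "holo2 a U" "holo2 b U" for a b p0 p1 p2
    proof -
      have "T (\<lambda>z. a z * (p1 - p0 * fst z) + b z * (p2 - p0 * snd z)) = T (\<lambda>z. 0)"
        by (rule T_cong) (use that(1) in simp)
      then show ?thesis using that(2,3) by (simp add: T_add T_mult T_diff T_const holo_rules)
    qed
    have p1: "k + D2 1 a - 2 * D1 1 a = 0"
      if "\<exists>p0 p1 p2. (p0 \<noteq> 0 \<or> p1 \<noteq> 0 \<or> p2 \<noteq> 0) \<and> (\<forall>z\<in>U. a1 z * (p1 - p0 * fst z) + b1 z * (p2 - p0 * snd z) = 0)"
      using that first_pencil[OF a pen[OF _ holo(1,2)] refl refl] by blast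
    have p2: "k + D1 1 a - 2 * D2 1 a = 0"
      if "\<exists>p0 p1 p2. (p0 \<noteq> 0 \<or> p1 \<noteq> 0 \<or> p2 \<noteq> 0) \<and> (\<forall>z\<in>U. a2 z * (p1 - p0 * fst z) + b2 z * (p2 - p0 * snd z) = 0)"
      using that second_pencil[OF a pen[OF _ holo(3,4)] refl refl] by blast
    have "ord 4 k \<or> (ord 3 k \<and> k + D2 1 a - 2 * D1 1 a = 0)
       \<or> (ord 2 k \<and> k + D2 1 a - 2 * D1 1 a = 0 \<and> k + D1 1 a - 2 * D2 1 a = 0)"
      using cases
    proof (elim disjE conjE)
      assume "n = 3"
      then show ?thesis using o by (simp add: eval_nat_numeral)
    next
      assume "n = 2" and "\<exists>p0 p1 p2. (p0 \<noteq> 0 \<or> p1 \<noteq> 0 \<or> p2 \<noteq> 0) \<and> (\<forall>z\<in>U. a1 z * (p1 - p0 * fst z) + b1 z * (p2 - p0 * snd z) = 0)"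
      then show ?thesis using o p1 by (simp add: eval_nat_numeral)
    next
      assume "n = 1" and "\<exists>p0 p1 p2. (p0 \<noteq> 0 \<or> p1 \<noteq> 0 \<or> p2 \<noteq> 0) \<and> (\<forall>z\<in>U. a1 z * (p1 - p0 * fst z) + b1 z * (p2 - p0 * snd z) = 0)"
        and "\<exists>p0 p1 p2. (p0 \<noteq> 0 \<or> p1 \<noteq> 0 \<or> p2 \<noteq> 0) \<and> (\<forall>z\<in>U. a2 z * (p1 - p0 * fst z) + b2 z * (p2 - p0 * snd z) = 0)"
      then show ?thesis using o p1 p2 by (simp add: eval_nat_numeral)
    qed
    from curvature_eq_0[OF la lb False this] have "cst 3 * (cst (1/3) * T K) = 0" by (simp add: k_def)
    then have "T K = 0" by (simp add: mult.assoc[symmetric] flip: cst_mult)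
    then show ?thesis ..
  qed
qed

lemma T_power: "holo2 f U \<Longrightarrow> T (\<lambda>z. f z ^ n) = T f ^ n"
  by (induction n) (simp_all add: T_const T_mult holo2_power openU)

lemma flat_cubic_fun:
  assumes "T K = 0"
  obtains V C p0 p1 f0 f1 f2 e0 e1 e2 e3 \<alpha> \<beta> where "open V" "z0 \<in> V" "V \<subseteq> U"
    "\<And>z A B. z \<in> V \<Longrightarrow> (A, B) \<in> {(a1 z, b1 z), (a2 z, b2 z), (- a1 z - a2 z, - b1 z - b2 z)} \<Longrightarrow>
       cub C p0 p1 f0 f1 f2 e0 e1 e2 e3 A B (A * (fst z - fst z0) + B * (snd z - snd z0)) = 0"
    "cub C p0 p1 f0 f1 f2 e0 e1 e2 e3 \<alpha> \<beta> 0 \<noteq> 0"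
proof -
  obtain h0 h1 h2 h3 \<alpha> \<beta> where t: "transported h0 h1 h2 h3"
    and z: "form3 h0 h1 h2 h3 (T a1) (T b1) = 0" "form3 h0 h1 h2 h3 (T a2) (T b2) = 0"
      "form3 h0 h1 h2 h3 (- T a1 - T a2) (- T b1 - T b2) = 0"
    and nz: "jet 0 0 (form3 h0 h1 h2 h3 (cst \<alpha>) (cst \<beta>)) \<noteq> 0"
    by (rule flat_cubic[OF assms])
  obtain C p0 p1 f0 f1 f2 e0 e1 e2 e3 where P:
    "\<forall>A B. form3 h0 h1 h2 h3 A B = cst C * (A * (T fst - cst (jet 0 0 (T fst))) + B * (T snd - cst (jet 0 0 (T snd))))^3
      + (A * (T fst - cst (jet 0 0 (T fst))) + B * (T snd - cst (jet 0 0 (T snd))))^2 * (cst p0 * A + cst p1 * B)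
      + (A * (T fst - cst (jet 0 0 (T fst))) + B * (T snd - cst (jet 0 0 (T snd)))) * (cst f0 * A^2 + cst f1 * A * B + cst f2 * B^2)
      + cst e0 * A^3 + cst e1 * A^2 * B + cst e2 * A * B^2 + cst e3 * B^3"
    by (rule transported_polynomial[OF t])
  define Q where "Q a b z = cub C p0 p1 f0 f1 f2 e0 e1 e2 e3 (a z) (b z) (a z * (fst z - fst z0) + b z * (snd z - snd z0))" for a b and z :: "complex \<times> complex"
  have hQ: "holo2 (Q a b) U" if "holo2 a U" "holo2 b U" for a b
    unfolding Q_def[abs_def] cub_def by (intro holo_rules that)
  have TQ: "T (Q a b) = form3 h0 h1 h2 h3 (T a) (T b)" if "holo2 a U" "holo2 b U" for a b
    unfolding Q_def[abs_def] cub_def P[rule_format] T_00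
    using that by (simp add: T_add T_mult T_diff T_const T_power holo_rules)
  have "\<exists>V. open V \<and> z0 \<in> V \<and> V \<subseteq> U \<and> (\<forall>z\<in>V. Q a1 b1 z = 0)"
    by (rule T_vanish) (simp_all add: hQ TQ z holo)
  moreover have "\<exists>V. open V \<and> z0 \<in> V \<and> V \<subseteq> U \<and> (\<forall>z\<in>V. Q a2 b2 z = 0)"
    by (rule T_vanish) (simp_all add: hQ TQ z holo)
  moreover have "\<exists>V. open V \<and> z0 \<in> V \<and> V \<subseteq> U \<and> (\<forall>z\<in>V. Q (\<lambda>z. - a1 z - a2 z) (\<lambda>z. - b1 z - b2 z) z = 0)"
    by (rule T_vanish) (simp_all add: hQ TQ z holo_rules T_diff T_minus)
  ultimately obtain V1 V2 V3 where V: "open V1" "z0 \<in> V1" "V1 \<subseteq> U" "\<forall>z\<in>V1. Q a1 b1 z = 0"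
     "open V2" "z0 \<in> V2" "V2 \<subseteq> U" "\<forall>z\<in>V2. Q a2 b2 z = 0"
     "open V3" "z0 \<in> V3" "V3 \<subseteq> U" "\<forall>z\<in>V3. Q (\<lambda>z. - a1 z - a2 z) (\<lambda>z. - b1 z - b2 z) z = 0"
    by (elim exE conjE) (rule that)
  show ?thesis
  proof (rule that[of "V1 \<inter> V2 \<inter> V3" C p0 p1 f0 f1 f2 e0 e1 e2 e3 \<alpha> \<beta>])
    show "open (V1 \<inter> V2 \<inter> V3)" "z0 \<in> V1 \<inter> V2 \<inter> V3" "V1 \<inter> V2 \<inter> V3 \<subseteq> U" using V by auto
    show "cub C p0 p1 f0 f1 f2 e0 e1 e2 e3 A B (A * (fst z - fst z0) + B * (snd z - snd z0)) = 0"
      if "z \<in> V1 \<inter> V2 \<inter> V3" "(A, B) \<in> {(a1 z, b1 z), (a2 z, b2 z), (- a1 z - a2 z, - b1 z - b2 z)}" for z A B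
      using that V(4,8,12) by (auto simp: Q_def)
    show "cub C p0 p1 f0 f1 f2 e0 e1 e2 e3 \<alpha> \<beta> 0 \<noteq> 0"
    proof -
      have "T (Q (\<lambda>z. \<alpha>) (\<lambda>z. \<beta>)) = form3 h0 h1 h2 h3 (cst \<alpha>) (cst \<beta>)"
        by (simp add: TQ holo_rules T_const)
      then have "jet 0 0 (T (Q (\<lambda>z. \<alpha>) (\<lambda>z. \<beta>))) \<noteq> 0" using nz by simp
      then show ?thesis unfolding T_00 by (simp add: Q_def)
    qed
  qed
qed

lemma cubic_flat_fun:
  assumes h: "holo2 h0 U" "holo2 h1 U" "holo2 h2 U" "holo2 h3 U"
    and tr: "\<And>\<alpha> \<beta> z. z \<in> U \<Longrightarrow> \<beta> * pdx (\<lambda>z. h0 z * \<alpha>^3 + h1 z * \<alpha>^2 * \<beta> + h2 z * \<alpha> * \<beta>^2 + h3 z * \<beta>^3) z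
        = \<alpha> * pdy (\<lambda>z. h0 z * \<alpha>^3 + h1 z * \<alpha>^2 * \<beta> + h2 z * \<alpha> * \<beta>^2 + h3 z * \<beta>^3) z"
    and van: "\<And>z A B. z \<in> U \<Longrightarrow> (A, B) \<in> {(a1 z, b1 z), (a2 z, b2 z), (- a1 z - a2 z, - b1 z - b2 z)} \<Longrightarrow>
       h0 z * A^3 + h1 z * A^2 * B + h2 z * A * B^2 + h3 z * B^3 = 0"
  shows "T K = 0 \<or> (\<exists>V. open V \<and> z0 \<in> V \<and> V \<subseteq> U \<and> (\<forall>z\<in>V. h0 z = 0 \<and> h1 z = 0 \<and> h2 z = 0 \<and> h3 z = 0))"
proof (cases "T h0 \<noteq> 0 \<or> T h1 \<noteq> 0 \<or> T h2 \<noteq> 0 \<or> T h3 \<noteq> 0")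
  case True
  have fm: "T (\<lambda>z. h0 z * a z^3 + h1 z * a z^2 * b z + h2 z * a z * b z^2 + h3 z * b z^3) = form3 (T h0) (T h1) (T h2) (T h3) (T a) (T b)"
    if "holo2 a U" "holo2 b U" for a b
    unfolding form3_def using that h by (simp add: T_add T_mult T_power holo_rules)
  have v: "form3 (T h0) (T h1) (T h2) (T h3) (T a) (T b) = 0"
    if "holo2 a U" "holo2 b U" "\<And>z. z \<in> U \<Longrightarrow> (a z, b z) \<in> {(a1 z, b1 z), (a2 z, b2 z), (- a1 z - a2 z, - b1 z - b2 z)}" for a b
  proof -
    have "T (\<lambda>z. h0 z * a z^3 + h1 z * a z^2 * b z + h2 z * a z * b z^2 + h3 z * b z^3) = T (\<lambda>z. 0)"
      by (rule T_cong) (rule van[OF _ that(3)])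
    then show ?thesis unfolding fm[OF that(1,2)] by (simp add: T_const)
  qed
  have "transported (T h0) (T h1) (T h2) (T h3)"
  proof -
    have "- Ty (T h0) + cst t * (Tx (T h0) - Ty (T h1)) + cst (t^2) * (Tx (T h1) - Ty (T h2)) + cst (t^3) * (Tx (T h2) - Ty (T h3)) + cst (t^4) * Tx (T h3) = 0" for t
    proof -
      define H where "H = (\<lambda>z. h0 z * 1^3 + h1 z * 1^2 * t + h2 z * 1 * t^2 + h3 z * t^3)"
      have hH: "holo2 H U" unfolding H_def by (intro holo_rules h)
      have "T (\<lambda>z. t * pdx H z) = T (\<lambda>z. 1 * pdy H z)"
        unfolding H_def by (rule T_cong) (rule tr)
      then have "cst t * Tx (T H) = Ty (T H)"
        using hH by (simp add: T_mult T_const T_pdx T_pdy holo_rules)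
      moreover have "T H = T h0 + T h1 * cst t + T h2 * cst (t^2) + T h3 * cst (t^3)"
        unfolding H_def using h by (simp add: T_add T_mult T_const holo_rules)
      ultimately show ?thesis
        by (simp add: Tx_simps Ty_simps cst_mult power2_eq_square power3_eq_cube power4_eq_xxxx algebra_simps)
    qed
    from quartic_form_eq_0[OF this] show ?thesis by (simp add: transported_def)
  qed
  moreover have "form3 (T h0) (T h1) (T h2) (T h3) (- T a1 - T a2) (- T b1 - T b2) = 0"
    using v[of "\<lambda>z. - a1 z - a2 z" "\<lambda>z. - b1 z - b2 z"] by (simp add: T_diff T_minus holo_rules)
  ultimately show ?thesis using cubic_flat[OF _ v[OF holo(1,2)] v[OF holo(3,4)] _ True] by simp
next
  case False
  then have T0: "T h0 = 0" "T h1 = 0" "T h2 = 0" "T h3 = 0" by auto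
  obtain V0 V1 V2 V3 where V: "open V0" "z0 \<in> V0" "V0 \<subseteq> U" "\<forall>z\<in>V0. h0 z = 0"
     "open V1" "z0 \<in> V1" "V1 \<subseteq> U" "\<forall>z\<in>V1. h1 z = 0"
     "open V2" "z0 \<in> V2" "V2 \<subseteq> U" "\<forall>z\<in>V2. h2 z = 0"
     "open V3" "z0 \<in> V3" "V3 \<subseteq> U" "\<forall>z\<in>V3. h3 z = 0"
    using T_vanish[OF h(1) T0(1)] T_vanish[OF h(2) T0(2)] T_vanish[OF h(3) T0(3)] T_vanish[OF h(4) T0(4)]
    by (elim exE conjE) (rule that)
  show ?thesis by (rule disjI2, rule exI[of _ "V0 \<inter> V1 \<inter> V2 \<inter> V3"]) (use V in auto)
qed

end

section \<open>Cubic forms\<close>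

text \<open>The inverse of \<open>v \<mapsto> (v $ chart_idx k, lgrad k v)\<close>.\<close>

definition vecof :: "nat \<Rightarrow> complex \<Rightarrow> complex \<Rightarrow> complex \<Rightarrow> complex^3" where
  "vecof k \<gamma> \<alpha> \<beta> = (if k = 0 then vector [\<gamma>, \<alpha>, \<beta>] else if k = 1 then vector [\<alpha>, \<gamma>, \<beta>] else vector [\<alpha>, \<beta>, \<gamma>])"

lemma vecof_nth [simp]: "vecof k \<gamma> \<alpha> \<beta> $ chart_idx k = \<gamma>" "lgrad k (vecof k \<gamma> \<alpha> \<beta>) = (\<alpha>, \<beta>)"
  by (auto simp: vecof_def chart_idx_def lgrad_def)

lemma vecof_eq: "v = vecof k (v $ chart_idx k) (fst (lgrad k v)) (snd (lgrad k v))"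
  by (subst vec3_eq_iff[of _ _ k]) simp

lemma chartvec_vecof: "chartvec k z = vecof k 1 (fst z) (snd z)"
  by (simp add: chartvec_def vecof_def)

lemma bil_vecof: "bil (vecof k \<gamma> \<alpha> \<beta>) v = \<gamma> * v $ chart_idx k + \<alpha> * fst (lgrad k v) + \<beta> * snd (lgrad k v)"
  by (auto simp: bil_3 vecof_def chart_idx_def lgrad_def)

lemma vecof_add: "vecof k \<gamma> \<alpha> \<beta> + vecof k \<gamma>' \<alpha>' \<beta>' = vecof k (\<gamma> + \<gamma>') (\<alpha> + \<alpha>') (\<beta> + \<beta>')"
  by (auto simp: vecof_def vec_eq_iff forall_3)
lemma vecof_smult: "c *s vecof k \<gamma> \<alpha> \<beta> = vecof k (c * \<gamma>) (c * \<alpha>) (c * \<beta>)"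
  by (auto simp: vecof_def vec_eq_iff forall_3)

lemma holo2_vecof:
  assumes "holo2 c U" "holo2 a U" "holo2 b U"
  shows "holo2 (\<lambda>z. vecof k (c z) (a z) (b z) $ i) U"
  using exhaust_3[of i] assms by (cases "k = 0"; cases "k = 1") (auto simp: vecof_def)

lemma cubic_form_mono: "cubic_form (\<lambda>v. bil p v * bil q v * bil r v)"
  unfolding cubic_form_def
proof (intro exI allI)
  fix v
  show "bil p v * bil q v * bil r v = (\<Sum>i\<in>UNIV. \<Sum>j\<in>UNIV. \<Sum>k\<in>UNIV. p $ i * q $ j * r $ k * v $ i * v $ j * v $ k)"
    by (simp add: bil_3 sum_3 algebra_simps)
qed

lemma cubic_form_add:
  assumes "cubic_form F" "cubic_form G" shows "cubic_form (\<lambda>v. F v + G v)"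
proof -
  obtain c d where "\<forall>v. F v = (\<Sum>i\<in>UNIV. \<Sum>j\<in>UNIV. \<Sum>k\<in>UNIV. c i j k * v $ i * v $ j * v $ k)"
    "\<forall>v. G v = (\<Sum>i\<in>UNIV. \<Sum>j\<in>UNIV. \<Sum>k\<in>UNIV. d i j k * v $ i * v $ j * v $ k)"
    using assms unfolding cubic_form_def by blast
  then show ?thesis unfolding cubic_form_def
    by (intro exI[of _ "\<lambda>i j k. c i j k + d i j k"]) (simp add: sum.distrib algebra_simps)
qed

lemma cubic_form_smult:
  assumes "cubic_form F" shows "cubic_form (\<lambda>v. c * F v)"
proof -
  obtain d where "\<forall>v. F v = (\<Sum>i\<in>UNIV. \<Sum>j\<in>UNIV. \<Sum>k\<in>UNIV. d i j k * v $ i * v $ j * v $ k)"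
    using assms unfolding cubic_form_def by blast
  then show ?thesis unfolding cubic_form_def
    by (intro exI[of _ "\<lambda>i j k. c * d i j k"]) (simp add: sum_distrib_left mult_ac)
qed

lemma cubic_form_scale:
  assumes "cubic_form F" shows "F (c *s v) = c^3 * F v"
proof -
  obtain d where d: "\<And>v. F v = (\<Sum>i\<in>UNIV. \<Sum>j\<in>UNIV. \<Sum>k\<in>UNIV. d i j k * v $ i * v $ j * v $ k)"
    using assms unfolding cubic_form_def by blast
  show ?thesis unfolding d by (simp add: sum_distrib_left power3_eq_cube mult_ac)
qed

lemma cubic_form_holo2:
  fixes v :: "complex \<times> complex \<Rightarrow> complex^3"
  assumes "cubic_form F" "\<And>i. holo2 (\<lambda>z. v z $ i) U"
  shows "holo2 (\<lambda>z. F (v z)) U"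
proof -
  obtain d where d: "\<And>v. F v = (\<Sum>i\<in>UNIV. \<Sum>j\<in>UNIV. \<Sum>k\<in>UNIV. d i j k * v $ i * v $ j * v $ k)"
    using assms(1) unfolding cubic_form_def by blast
  have "open U" using assms(2) holo2_open by blast
  then show ?thesis unfolding d by (intro holo2_sum holo2_mult holo2_const assms(2)) auto
qed

text \<open>The mixed coefficients are recovered from the values at \<open>u + w\<close> and
  \<open>u - w\<close>. All coefficients of the restriction are thus built from values of
  \<open>F\<close> and inherit holomorphy in \<open>u\<close> and \<open>w\<close>.\<close>

lemma cubic_form_line:
  assumes "cubic_form F"
  shows "F (\<alpha> *s u + \<beta> *s w) = F u * \<alpha>^3 + ((F (u + w) - F (u - w)) / 2 - F w) * \<alpha>^2 * \<beta>
     + ((F (u + w) + F (u - w)) / 2 - F u) * \<alpha> * \<beta>^2 + F w * \<beta>^3"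
proof -
  obtain d where d: "\<And>v. F v = (\<Sum>i\<in>UNIV. \<Sum>j\<in>UNIV. \<Sum>k\<in>UNIV. d i j k * v $ i * v $ j * v $ k)"
    using assms unfolding cubic_form_def by blast
  define p where "p = (\<Sum>i\<in>UNIV. \<Sum>j\<in>UNIV. \<Sum>k\<in>UNIV. d i j k * (u $ i * u $ j * w $ k + u $ i * w $ j * u $ k + w $ i * u $ j * u $ k))"
  define q where "q = (\<Sum>i\<in>UNIV. \<Sum>j\<in>UNIV. \<Sum>k\<in>UNIV. d i j k * (u $ i * w $ j * w $ k + w $ i * w $ j * u $ k + w $ i * u $ j * w $ k))"
  have e: "F (\<alpha> *s u + \<beta> *s w) = F u * \<alpha>^3 + p * \<alpha>^2 * \<beta> + q * \<alpha> * \<beta>^2 + F w * \<beta>^3" for \<alpha> \<beta>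
    unfolding d p_def q_def sum_distrib_right sum.distrib[symmetric]
    by (intro sum.cong refl) (simp add: power2_eq_square power3_eq_cube algebra_simps)
  have "F (u + w) = F u + p + q + F w" "F (u - w) = F u - p + q - F w"
    using e[of 1 1] e[of 1 "-1"] by (simp_all add: vector_sneg_minus1[symmetric])
  then have "p = (F (u + w) - F (u - w)) / 2 - F w" "q = (F (u + w) + F (u - w)) / 2 - F u"
    by (simp_all add: field_simps)
  then show ?thesis using e[of \<alpha> \<beta>] by simp
qed

text \<open>Lines close to a line \<open>u\<close> through \<open>z0\<close> still meet
  \<open>V\<close>, so \<open>F (u + t *s w)\<close> vanishes for small \<open>t\<close>. It is a
  polynomial in \<open>t\<close> with leading coefficient \<open>F w\<close>.\<close>

lemma cubic_form_zero_near:
  assumes F: "cubic_form F" and V: "open V" "z0 \<in> V"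
    and 0: "\<And>z v. z \<in> V \<Longrightarrow> bil (chartvec k z) v = 0 \<Longrightarrow> F v = 0"
  shows "F w = 0"
proof -
  define u where "u = vecof k (- fst z0) 1 0"
  define B where "B = bil (chartvec k z0) w"
  define S where "S = {t :: complex. 1 + t * fst (lgrad k w) \<noteq> 0}"
  \<comment> \<open>The point of the line \<open>u + t *s w\<close> whose second coordinate is
    \<open>snd z0\<close>; solving for the first coordinate divides by
    \<open>1 + t * fst (lgrad k w)\<close>.\<close>
  define g where "g t = (fst z0 - t * B / (1 + t * fst (lgrad k w)), snd z0)" for t
  have S: "open S" "0 \<in> S"
  proof -
    have "S = (\<lambda>t. 1 + t * fst (lgrad k w)) -` (- {0})" by (auto simp: S_def)
    then show "open S" by (simp add: open_vimage continuous_intros open_Compl)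
  qed (simp add: S_def)
  have "continuous_on S g" unfolding g_def S_def by (intro continuous_intros) auto
  from continuous_open_preimage[OF this S(1) V(1)] have o: "open (S \<inter> g -` V)" .
  have "0 \<in> S \<inter> g -` V" using S V by (simp add: g_def)
  then obtain e where e: "e > 0" "ball 0 e \<subseteq> S \<inter> g -` V" using o openE by blast
  have z: "F (u + t *s w) = 0" if t: "t \<in> ball 0 e" for t
  proof -
    have tS: "t \<in> S" "g t \<in> V" using t e by auto
    have n: "1 + t * fst (lgrad k w) \<noteq> 0" using tS by (simp add: S_def)
    have "bil (chartvec k (g t)) (u + t *s w) = (fst (g t) - fst z0) * (1 + t * fst (lgrad k w)) + t * B"
    proof -
      have "snd (g t) = snd z0" by (simp add: g_def)
      then show ?thesis unfolding bil_3 u_def B_def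
        by (simp add: chartvec_def vecof_def lgrad_def algebra_simps)
    qed
    also have "\<dots> = 0" using n by (simp add: g_def)
    finally show ?thesis using 0[OF tS(2)] by blast
  qed
  define P where "P = [:F u, (F (u + w) - F (u - w)) / 2 - F w, (F (u + w) + F (u - w)) / 2 - F u, F w:]"
  have "poly P t = 0" if "t \<in> ball 0 e" for t
    using z[OF that] cubic_form_line[OF F, of 1 u t w] by (simp add: P_def algebra_simps power2_eq_square power3_eq_cube)
  then have "ball 0 e \<subseteq> {t. poly P t = 0}" by auto
  moreover have "infinite (ball (0::complex) e)" using e(1) uncountable_ball[of e 0] countable_finite by blast
  ultimately have "P = 0" using poly_roots_finite[of P] finite_subset by blast
  then show ?thesis by (simp add: P_def)
qed

text \<open>If \<open>F\<close> contains the square of \<open>L\<close>, each web line at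
  \<open>p\<close> passes through \<open>proj L\<close> or \<open>proj G\<close>. Two of the three
  lines pass through the same one of these points, and distinct lines share only \<open>p\<close>. A
  nonempty open set is infinite, hence the contradiction.\<close>

lemma reduced_cubicI:
  assumes F: "cubic_form F" and nz: "F v0 \<noteq> 0" and web: "linear_3web M l1 l2 l3" and x0: "x0 \<in> M"
    and z: "\<And>p. p \<in> M \<Longrightarrow> F (rep (l1 p)) = 0 \<and> F (rep (l2 p)) = 0 \<and> F (rep (l3 p)) = 0"
  shows "reduced_cubic F"
  unfolding reduced_cubic_def
proof (intro conjI F exI[of _ v0] nz notI)
  assume "\<exists>L G. L \<noteq> 0 \<and> (\<forall>v. F v = (bil L v)^2 * bil G v)"
  then obtain L G where L: "L \<noteq> 0" and LG: "\<And>v. F v = (bil L v)^2 * bil G v" by blast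
  have G: "G \<noteq> 0" using nz by (auto simp: LG bil_3)
  have two: "p = proj Q" if "Q \<noteq> 0" "incid p l" "incid p l'" "l \<noteq> l'" "bil Q (rep l) = 0" "bil Q (rep l') = 0" for p l l' Q
  proof -
    define u w :: "complex^3" where "u = rep l" and "w = rep l'"
    \<comment> \<open>The cross product of the two lines, representing their intersection
      point.\<close>
    define n :: "complex^3" where "n = vector [u$2*w$3 - u$3*w$2, u$3*w$1 - u$1*w$3, u$1*w$2 - u$2*w$1]"
    have un: "u \<noteq> 0" "w \<noteq> 0" using rep_proj_id(1) by (auto simp: u_def w_def)
    have n0: "n \<noteq> 0"
    proof
      assume "n = 0"
      then have c: "u$2*w$3 = u$3*w$2" "u$3*w$1 = u$1*w$3" "u$1*w$2 = u$2*w$1"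
        by (auto simp: n_def vec_eq_iff forall_3)
      have "u $ i * w $ j = u $ j * w $ i" for i j
        using exhaust_3[of i] exhaust_3[of j] c by (auto simp: mult.commute)
      then have "proj u = proj w" using proj_eq_iff_cross[OF un] by blast
      then show False using that(4) rep_proj_id(2) by (metis u_def w_def)
    qed
    have par: "proj v = proj n" if "v \<noteq> 0" "bil v u = 0" "bil v w = 0" for v
    proof -
      have b: "v$1*u$1 + v$2*u$2 + v$3*u$3 = 0" "v$1*w$1 + v$2*w$2 + v$3*w$3 = 0" using that by (auto simp: bil_3)
      have c12: "v$1 * n$2 = v$2 * n$1" "v$1 * n$3 = v$3 * n$1" "v$2 * n$3 = v$3 * n$2"
        using b by (simp_all add: n_def) algebra+
      have "v $ i * n $ j = v $ j * n $ i" for i j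
        using exhaust_3[of i] exhaust_3[of j] c12 by (auto simp: mult.commute)
      then show ?thesis using proj_eq_iff_cross[OF that(1) n0] by blast
    qed
    have "proj (rep p) = proj n"
      using that(2,3) par[of "rep p"] rep_proj_id(1)[of p] by (simp add: incid_def u_def w_def)
    moreover have "proj Q = proj n" using that(1,5,6) par[of Q] by (simp add: u_def w_def)
    ultimately show ?thesis using rep_proj_id(2)[of p] by simp
  qed
  have sub: "M \<subseteq> {proj L, proj G}"
  proof
    fix p assume p: "p \<in> M"
    have inc: "incid p (l1 p)" "incid p (l2 p)" "incid p (l3 p)" and ne: "l1 p \<noteq> l2 p" "l1 p \<noteq> l3 p" "l2 p \<noteq> l3 p"
      using web p by (auto simp: linear_3web_def lin_fol_def)
    have "bil L (rep (l1 p)) = 0 \<or> bil G (rep (l1 p)) = 0" "bil L (rep (l2 p)) = 0 \<or> bil G (rep (l2 p)) = 0"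
      "bil L (rep (l3 p)) = 0 \<or> bil G (rep (l3 p)) = 0"
      using z[OF p] by (auto simp: LG)
    then show "p \<in> {proj L, proj G}"
      using two[OF L inc(1,2) ne(1)] two[OF L inc(1,3) ne(2)] two[OF L inc(2,3) ne(3)]
        two[OF G inc(1,2) ne(1)] two[OF G inc(1,3) ne(2)] two[OF G inc(2,3) ne(3)] by blast
  qed
  obtain k where k: "x0 \<in> range (chart k)" using range_chart_ex by blast
  then obtain z0 where z0: "x0 = chart k z0" by blast
  have "open (chart k -` M)" using web P2open_vimage by (auto simp: linear_3web_def)
  moreover have "z0 \<in> chart k -` M" using x0 z0 by simp
  ultimately obtain e where e: "e > 0" "ball z0 e \<subseteq> chart k -` M" by (rule openE)
  have "infinite (chart k -` M)"
    using infinite_super[OF e(2)] e(1) uncountable_ball[of e z0] countable_finite by blast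
  moreover have "inj (chart k)" by (simp add: inj_def chart_inj)
  ultimately have "infinite M" by (meson finite_vimageI)
  then show False using sub finite_subset by blast
qed

section \<open>Passing between linear foliations and their holomorphic forms\<close>

lemma defines_fol_subset:
  assumes "defines_fol k l U a b" "open V" "V \<subseteq> U" shows "defines_fol k l V a b"
  using assms holo2_subset unfolding defines_fol_def by blast

lemma structure_eq_subset: "structure_eq U a b r s \<Longrightarrow> V \<subseteq> U \<Longrightarrow> structure_eq V a b r s"
  unfolding structure_eq_def by blast

lemma defines_fol_transversal:
  assumes d1: "defines_fol k l1 U a1 b1" and d2: "defines_fol k l2 U a2 b2" and z: "z \<in> U"
    and i: "incid (chart k z) (l1 (chart k z))" "incid (chart k z) (l2 (chart k z))"
    and ne: "l1 (chart k z) \<noteq> l2 (chart k z)"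
  shows "a1 z * b2 z - b1 z * a2 z \<noteq> 0"
proof
  assume W: "a1 z * b2 z - b1 z * a2 z = 0"
  define u w :: "complex^3" where "u = rep (l1 (chart k z))" and "w = rep (l2 (chart k z))"
  obtain c where c: "c \<noteq> 0" "fst (lgrad k u) = c * a1 z" "snd (lgrad k u) = c * b1 z"
    unfolding u_def by (rule defines_fol_smult[OF d1 z i(1)])
  obtain d where d: "d \<noteq> 0" "fst (lgrad k w) = d * a2 z" "snd (lgrad k w) = d * b2 z"
    unfolding w_def by (rule defines_fol_smult[OF d2 z i(2)])
  have n: "a1 z \<noteq> 0 \<or> b1 z \<noteq> 0" "a2 z \<noteq> 0 \<or> b2 z \<noteq> 0"
    using d1 d2 z by (auto simp: defines_fol_def)
  have "\<exists>e. e \<noteq> 0 \<and> a1 z = e * a2 z \<and> b1 z = e * b2 z"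
  proof (cases "a2 z = 0")
    case True
    then have b: "b2 z \<noteq> 0" using n by simp
    then have "a1 z = 0" using W True by simp
    then show ?thesis using b n True by (intro exI[of _ "b1 z / b2 z"]) auto
  next
    case False
    then have b: "b1 z = a1 z / a2 z * b2 z" using W by (simp add: field_simps)
    then have "a1 z \<noteq> 0" using n by auto
    then show ?thesis using b False by (intro exI[of _ "a1 z / a2 z"]) auto
  qed
  then obtain e where e: "e \<noteq> 0" "a1 z = e * a2 z" "b1 z = e * b2 z" by blast
  define f where "f = c * e / d"
  have f: "f \<noteq> 0" using c d e by (simp add: f_def)
  have l: "fst (lgrad k u) = f * fst (lgrad k w)" "snd (lgrad k u) = f * snd (lgrad k w)"
    unfolding c d e f_def using d(1) by auto
  have "u $ chart_idx k + fst z * fst (lgrad k u) + snd z * snd (lgrad k u) = 0"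
    "w $ chart_idx k + fst z * fst (lgrad k w) + snd z * snd (lgrad k w) = 0"
    using i unfolding incid_chart u_def w_def by auto
  then have "u $ chart_idx k = - (fst z * fst (lgrad k u) + snd z * snd (lgrad k u))"
    "w $ chart_idx k = - (fst z * fst (lgrad k w) + snd z * snd (lgrad k w))"
    by (simp_all only: eq_neg_iff_add_eq_0 add.assoc)
  then have "u $ chart_idx k = f * w $ chart_idx k" unfolding l by (simp only: algebra_simps mult_minus_right minus_add_distrib)
  then have "u = f *s w" using l by (subst vec3_eq_iff[of _ _ k]) (auto simp: lgrad_smult prod_eq_iff)
  then have "proj u = proj w" using proj_smult[OF f] rep_proj_id(1) by (auto simp: w_def)
  then show False using ne rep_proj_id(2) by (simp add: u_def w_def)
qed

lemma web_fun_of_forms: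
  assumes web: "linear_3web M l1 l2 l3" and sub: "chart k ` U \<subseteq> M" and z0: "z0 \<in> U"
    and d: "defines_fol k l1 U a1 b1" "defines_fol k l2 U a2 b2" "defines_fol k l3 U a3 b3"
    and sum: "\<forall>z\<in>U. a1 z + a2 z + a3 z = 0 \<and> b1 z + b2 z + b3 z = 0"
    and h: "holo2 r U" "holo2 s U" "holo2 K U"
    and str: "structure_eq U a1 b1 r s" "structure_eq U a2 b2 r s"
    and curv: "\<forall>z\<in>U. pdx s z - pdy r z = K z * (a1 z * b2 z - b1 z * a2 z)"
  shows "web_fun z0 U a1 b1 a2 b2 r s K"
proof
  have lf: "lin_fol M l1" "lin_fol M l2" "lin_fol M l3" using web by (auto simp: linear_3web_def)
  show h1: "holo2 a1 U" "holo2 b1 U" "holo2 a2 U" "holo2 b2 U" using d by (auto simp: defines_fol_def)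
  have o: "open U" using holo2_open[OF h1(1)] .
  show "a1 z * b2 z - b1 z * a2 z \<noteq> 0" if z: "z \<in> U" for z
    by (rule defines_fol_transversal[OF d(1,2) z]) (use z sub web in \<open>auto simp: linear_3web_def lin_fol_def\<close>)
  show "a1 z * (b1 z * pdx b1 z - a1 z * pdy b1 z) = b1 z * (b1 z * pdx a1 z - a1 z * pdy a1 z)"
    "a2 z * (b2 z * pdx b2 z - a2 z * pdy b2 z) = b2 z * (b2 z * pdx a2 z - a2 z * pdy a2 z)" if "z \<in> U" for z
    using defines_fol_straight[OF lf(1) d(1) sub that] defines_fol_straight[OF lf(2) d(2) sub that] by auto
  show "(a1 z + a2 z) * ((b1 z + b2 z) * (pdx b1 z + pdx b2 z) - (a1 z + a2 z) * (pdy b1 z + pdy b2 z))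
         = (b1 z + b2 z) * ((b1 z + b2 z) * (pdx a1 z + pdx a2 z) - (a1 z + a2 z) * (pdy a1 z + pdy a2 z))" if z: "z \<in> U" for z
  proof -
    have e: "a3 w = - (a1 w + a2 w)" "b3 w = - (b1 w + b2 w)" if "w \<in> U" for w
      using bspec[OF sum that] by (simp_all only: eq_neg_iff_add_eq_0 add.commute[of _ "_ + _"])
    have p: "pdx a3 z = - (pdx a1 z + pdx a2 z)" "pdx b3 z = - (pdx b1 z + pdx b2 z)"
      "pdy a3 z = - (pdy a1 z + pdy a2 z)" "pdy b3 z = - (pdy b1 z + pdy b2 z)"
      using pd_cong[of U z a3 "\<lambda>w. - (a1 w + a2 w)", OF o z e(1)] pd_cong[of U z b3 "\<lambda>w. - (b1 w + b2 w)", OF o z e(2)]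
      by (simp_all only: pd_minus[OF holo2_pd_add(1)[OF h1(1,3)] z] pd_minus[OF holo2_pd_add(1)[OF h1(2,4)] z]
        holo2_pd_add(2,3)[OF h1(1,3) z] holo2_pd_add(2,3)[OF h1(2,4) z])
    show ?thesis using defines_fol_straight[OF lf(3) d(3) sub z] unfolding p e(1)[OF z] e(2)[OF z]
      by (simp add: algebra_simps)
  qed
qed (use assms in auto)

lemma pencil_form:
  assumes l: "lin_fol M l" and d: "defines_fol k l U a b" and sub: "chart k ` U \<subseteq> M" and p: "is_pencil M l"
  shows "\<exists>p0 p1 p2. (p0 \<noteq> 0 \<or> p1 \<noteq> 0 \<or> p2 \<noteq> 0) \<and> (\<forall>z\<in>U. a z * (p1 - p0 * fst z) + b z * (p2 - p0 * snd z) = 0)"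
proof -
  obtain c where c: "\<And>p. p \<in> M \<Longrightarrow> incid c (l p)" using p by (auto simp: is_pencil_def)
  define p0 p1 p2 where "p0 = rep c $ chart_idx k" and "p1 = fst (lgrad k (rep c))" and "p2 = snd (lgrad k (rep c))"
  have rc: "rep c = vecof k p0 p1 p2" unfolding p0_def p1_def p2_def by (rule vecof_eq)
  have "rep c \<noteq> 0" by (rule rep_proj_id)
  then have nz: "p0 \<noteq> 0 \<or> p1 \<noteq> 0 \<or> p2 \<noteq> 0" unfolding rc by (auto simp: vecof_def vec_eq_iff forall_3 split: if_splits)
  have "a z * (p1 - p0 * fst z) + b z * (p2 - p0 * snd z) = 0" if z: "z \<in> U" for z
  proof -
    have zM: "chart k z \<in> M" using z sub by auto
    define w :: "complex^3" where "w = rep (l (chart k z))"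
    have i: "incid (chart k z) (l (chart k z))" using l zM by (auto simp: lin_fol_def)
    obtain e where e: "e \<noteq> 0" "fst (lgrad k w) = e * a z" "snd (lgrad k w) = e * b z"
      unfolding w_def by (rule defines_fol_smult[OF d z i])
    have 1: "w $ chart_idx k + fst z * (e * a z) + snd z * (e * b z) = 0"
      using i unfolding incid_chart w_def[symmetric] e .
    have 2: "p0 * w $ chart_idx k + p1 * (e * a z) + p2 * (e * b z) = 0"
      using c[OF zM] unfolding incid_def rc w_def[symmetric] bil_vecof e .
    have "e * (a z * (p1 - p0 * fst z) + b z * (p2 - p0 * snd z))
       = (p0 * w $ chart_idx k + p1 * (e * a z) + p2 * (e * b z)) - p0 * (w $ chart_idx k + fst z * (e * a z) + snd z * (e * b z))"
      by (simp add: algebra_simps)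
    then show ?thesis unfolding 1 2 using e(1) by simp
  qed
  then show ?thesis using nz by blast
qed

lemma cubic_form_cub: "cubic_form (\<lambda>v. cub C p0 p1 f0 f1 f2 e0 e1 e2 e3 (bil p v) (bil q v) (bil r v))"
proof -
  have "cub C p0 p1 f0 f1 f2 e0 e1 e2 e3 A B g = C * (g * g * g) + p0 * (g * g * A) + p1 * (g * g * B)
     + f0 * (g * A * A) + f1 * (g * A * B) + f2 * (g * B * B) + e0 * (A * A * A) + e1 * (A * A * B) + e2 * (A * B * B) + e3 * (B * B * B)" for A B g
    by (simp add: cub_def power2_eq_square power3_eq_cube algebra_simps)
  then show ?thesis by (simp only:) (intro cubic_form_add cubic_form_smult cubic_form_mono)
qed

lemma cub_scale: "cub C p0 p1 f0 f1 f2 e0 e1 e2 e3 (c * A) (c * B) (c * g) = c^3 * cub C p0 p1 f0 f1 f2 e0 e1 e2 e3 A B g"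
  by (simp add: cub_def power2_eq_square power3_eq_cube algebra_simps)

text \<open>The form at \<open>z\<close> is proportional to the first-order part of the line, and
  \<open>cub\<close> is homogeneous. The third linear form is minus the value of the line's equation
  at \<open>(x, y)\<close>, which for a line through \<open>z\<close> is its gradient applied to
  \<open>z - (x, y)\<close>.\<close>

lemma cub_line_zero:
  assumes d: "defines_fol k l U a b" and z: "z \<in> U" and i: "incid (chart k z) (l (chart k z))"
    and 0: "cub C p0 p1 f0 f1 f2 e0 e1 e2 e3 (a z) (b z) (a z * (fst z - x) + b z * (snd z - y)) = 0"
  shows "cub C p0 p1 f0 f1 f2 e0 e1 e2 e3 (bil (vecof k 0 1 0) (rep (l (chart k z)))) (bil (vecof k 0 0 1) (rep (l (chart k z))))
     (bil (vecof k (-1) (-x) (-y)) (rep (l (chart k z)))) = 0"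
proof -
  define w :: "complex^3" where "w = rep (l (chart k z))"
  obtain e where e: "e \<noteq> 0" "fst (lgrad k w) = e * a z" "snd (lgrad k w) = e * b z"
    unfolding w_def by (rule defines_fol_smult[OF d z i])
  have "w $ chart_idx k + fst z * (e * a z) + snd z * (e * b z) = 0"
    using i unfolding incid_chart w_def[symmetric] e .
  then have w0: "w $ chart_idx k = - (fst z * (e * a z) + snd z * (e * b z))"
    by (simp only: eq_neg_iff_add_eq_0 add.assoc)
  have "bil (vecof k 0 1 0) w = e * a z" "bil (vecof k 0 0 1) w = e * b z"
    "bil (vecof k (-1) (-x) (-y)) w = e * (a z * (fst z - x) + b z * (snd z - y))"
    unfolding bil_vecof e w0 by (simp_all add: algebra_simps)
  then show ?thesis unfolding w_def[symmetric] using 0 by (simp add: cub_scale)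
qed

lemma projective_near:
  assumes V: "open V" "z0 \<in> V" and h: "holo2 F V" "holo2 G V"
    and J: "pdx F z0 * pdy G z0 - pdy F z0 * pdx G z0 \<noteq> 0"
    and \<phi>: "\<And>z. z \<in> V \<Longrightarrow> \<phi> (chart k z) = chart k' (F z, G z)"
    and e: "\<And>z. z \<in> V \<Longrightarrow> (1 - p * (fst z - fst z0) - q * (snd z - snd z0)) * F z = u1 + u2 * (fst z - fst z0) + u3 * (snd z - snd z0)"
      "\<And>z. z \<in> V \<Longrightarrow> (1 - p * (fst z - fst z0) - q * (snd z - snd z0)) * G z = v1 + v2 * (fst z - fst z0) + v3 * (snd z - snd z0)"
  shows "\<exists>A. invertible A \<and> (\<forall>z\<in>V. \<phi> (chart k z) = ptrans A (chart k z))"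
proof -
  define x y where "x = fst z0" and "y = snd z0"
  \<comment> \<open>Rows of the projective matrix: denominator and numerators, with their constant
    terms converted from coordinates centred at \<open>z0\<close> to those of chart
    \<open>k\<close>.\<close>
  define r0 r1 r2 where "r0 = vecof k (1 + p * x + q * y) (-p) (-q)" and "r1 = vecof k (u1 - u2 * x - u3 * y) u2 u3"
    and "r2 = vecof k (v1 - v2 * x - v3 * y) v2 v3"
  define A :: "complex^3^3" where "A = (\<chi> i j. vec_nth (vecof k' (vec_nth r0 j) (vec_nth r1 j) (vec_nth r2 j)) i)"
  have A: "A *v w = vecof k' (bil r0 w) (bil r1 w) (bil r2 w)" for w
    by (auto simp: A_def matrix_vector_mult_def vec_eq_iff forall_3 sum_3 bil_3 vecof_def)
  have val: "F z0 = u1" "G z0 = v1" using e[OF V(2)] by auto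
  have lin: "holo2 (\<lambda>z. c + d * (fst z - x) + f * (snd z - y)) V"
    "z \<in> V \<Longrightarrow> pdx (\<lambda>z. c + d * (fst z - x) + f * (snd z - y)) z = d"
    "z \<in> V \<Longrightarrow> pdy (\<lambda>z. c + d * (fst z - x) + f * (snd z - y)) z = f" for c d f z
    using V(1) by (simp_all add: pd_diff[of _ V] holo2_pd_mult[of _ V] holo2_pd_add[of _ V] holo2_add holo2_mult holo2_diff)
  have dd: "pdx H z0 - p * H z0 = w2 \<and> pdy H z0 - q * H z0 = w3"
    if H: "holo2 H V" and eH: "\<And>z. z \<in> V \<Longrightarrow> (1 - p * (fst z - fst z0) - q * (snd z - snd z0)) * H z = w1 + w2 * (fst z - fst z0) + w3 * (snd z - snd z0)" for H w1 w2 w3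
  proof -
    have "(1 + (-p) * (fst z - x) + (-q) * (snd z - y)) * H z = w1 + w2 * (fst z - x) + w3 * (snd z - y)" if "z \<in> V" for z
      using eH[OF that] by (simp add: x_def y_def)
    from pd_cong[of V z0 "\<lambda>z. (1 + (-p) * (fst z - x) + (-q) * (snd z - y)) * H z" "\<lambda>z. w1 + w2 * (fst z - x) + w3 * (snd z - y)", OF V this]
    have "- p * H z0 + (1 + (-p) * (fst z0 - x) + (-q) * (snd z0 - y)) * pdx H z0 = w2"
      "- q * H z0 + (1 + (-p) * (fst z0 - x) + (-q) * (snd z0 - y)) * pdy H z0 = w3"
      by (simp_all only: holo2_pd_mult(2,3)[OF lin(1) H V(2)] lin(2,3)[OF V(2)])
    then show ?thesis by (simp add: x_def y_def)
  qed
  have D: "pdx F z0 = u2 + p * u1" "pdy F z0 = u3 + q * u1" "pdx G z0 = v2 + p * v1" "pdy G z0 = v3 + q * v1"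
    using dd[OF h(1) e(1)] dd[OF h(2) e(2)] by (auto simp: val algebra_simps)
  have ker: "w = 0" if "A *v w = 0" for w
  proof -
    define w0 where "w0 = vec_nth w (chart_idx k)"
    define \<alpha> \<beta> where "\<alpha> = fst (lgrad k w) - x * w0" and "\<beta> = snd (lgrad k w) - y * w0"
    have "bil r0 w = 0" "bil r1 w = 0" "bil r2 w = 0"
      using that unfolding A by (auto simp: vecof_def vec_eq_iff forall_3 split: if_splits)
    then have e: "w0 = p * \<alpha> + q * \<beta>" "u1 * w0 + u2 * \<alpha> + u3 * \<beta> = 0" "v1 * w0 + v2 * \<alpha> + v3 * \<beta> = 0"
      unfolding r0_def r1_def r2_def bil_vecof \<alpha>_def \<beta>_def w0_def[symmetric]
      by (simp_all add: algebra_simps)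
    have e2: "(u2 + p * u1) * \<alpha> + (u3 + q * u1) * \<beta> = 0" "(v2 + p * v1) * \<alpha> + (v3 + q * v1) * \<beta> = 0"
      using e(2,3) unfolding e(1) by (simp_all add: algebra_simps)
    have "(pdx F z0 * pdy G z0 - pdy F z0 * pdx G z0) * \<alpha> = (v3 + q * v1) * ((u2 + p * u1) * \<alpha> + (u3 + q * u1) * \<beta>) - (u3 + q * u1) * ((v2 + p * v1) * \<alpha> + (v3 + q * v1) * \<beta>)"
      "(pdx F z0 * pdy G z0 - pdy F z0 * pdx G z0) * \<beta> = (u2 + p * u1) * ((v2 + p * v1) * \<alpha> + (v3 + q * v1) * \<beta>) - (v2 + p * v1) * ((u2 + p * u1) * \<alpha> + (u3 + q * u1) * \<beta>)"
      unfolding D by (simp_all add: algebra_simps)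
    then have ab: "\<alpha> = 0" "\<beta> = 0" unfolding e2 using J by auto
    have w: "w0 = 0" unfolding e(1) ab by simp
    have "fst (lgrad k w) = 0" "snd (lgrad k w) = 0" using ab unfolding \<alpha>_def \<beta>_def w by simp_all
    then show ?thesis using w by (subst vec3_eq_iff[of _ _ k]) (auto simp: w0_def prod_eq_iff lgrad_def)
  qed
  have inv: "invertible A" unfolding invertible_left_inverse matrix_left_invertible_ker using ker by blast
  have "\<phi> (chart k z) = ptrans A (chart k z)" if z: "z \<in> V" for z
  proof -
    define g where "g = bil r0 (chartvec k z)"
    have g: "g = 1 - p * (fst z - fst z0) - q * (snd z - snd z0)"
      unfolding g_def r0_def bil_vecof chartvec_nth by (simp add: x_def y_def algebra_simps)
    have "bil r1 (chartvec k z) = g * F z" "bil r2 (chartvec k z) = g * G z"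
      unfolding g e[OF z] r1_def r2_def bil_vecof chartvec_nth by (simp_all add: x_def y_def algebra_simps)
    then have Az: "A *v chartvec k z = g *s chartvec k' (F z, G z)"
      unfolding A g_def[symmetric] chartvec_vecof[of k' "(F z, G z)"] vecof_smult by simp
    \<comment> \<open>A zero of the denominator would put \<open>chartvec k z\<close> into the
      kernel of the invertible matrix, so the formula is valid on all of \<open>V\<close>.\<close>
    have gn: "g \<noteq> 0" using ker[of "chartvec k z"] Az by auto
    obtain c where c: "c \<noteq> 0" "rep (chart k z) = c *s chartvec k z"
      unfolding chart_def by (rule rep_proj[OF chartvec_nz])
    have "A *v rep (chart k z) = (c * g) *s chartvec k' (F z, G z)"
      unfolding c(2) vector_scalar_commute Az by (simp add: vector_smult_assoc)
    then show ?thesis unfolding \<phi>[OF z] ptrans_def using c(1) gn by (simp add: proj_smult chart_def)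
  qed
  then show ?thesis using inv by blast
qed

section \<open>From local to global\<close>

lemma local_dichotomy:
  assumes web: "linear_3web M l1 l2 l3" and lin: "linearization M l1 l2 l3 \<phi>" and wc: "wc_vanish M l1 l2 l3 x0 n"
    and cases: "n = 3 \<or> n = 2 \<and> is_pencil M l1 \<or> n = 1 \<and> is_pencil M l1 \<and> is_pencil M l2"
  shows "\<exists>N. P2open N \<and> x0 \<in> N \<and> ((\<exists>A. invertible A \<and> (\<forall>p\<in>N. \<phi> p = ptrans A p))
     \<or> (\<exists>F. cubic_form F \<and> (\<exists>v. F v \<noteq> 0) \<and> (\<forall>p\<in>N. F (rep (l1 p)) = 0 \<and> F (rep (l2 p)) = 0 \<and> F (rep (l3 p)) = 0)))"
proof -
  have lf: "lin_fol M l1" "lin_fol M l2" "lin_fol M l3" using web by (auto simp: linear_3web_def)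
  have ml: "maps_leaves_to_lines M l1 \<phi>" "maps_leaves_to_lines M l2 \<phi>" "maps_leaves_to_lines M l3 \<phi>"
    and imm: "holo_immersion_on M \<phi>" using lin by (auto simp: linearization_def)
  obtain k U1 a1 b1 a2 b2 a3 b3 r s K where w:
    "x0 \<in> chart k ` U1" "chart k ` U1 \<subseteq> M"
    "defines_fol k l1 U1 a1 b1" "defines_fol k l2 U1 a2 b2" "defines_fol k l3 U1 a3 b3"
    "\<forall>z\<in>U1. a1 z + a2 z + a3 z = 0 \<and> b1 z + b2 z + b3 z = 0"
    "holo2 r U1" "holo2 s U1" "holo2 K U1"
    "structure_eq U1 a1 b1 r s" "structure_eq U1 a2 b2 r s" "structure_eq U1 a3 b3 r s"
    "\<forall>z\<in>U1. pdx s z - pdy r z = K z * (a1 z * b2 z - b1 z * a2 z)"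
    "\<forall>i j. i + j \<le> n \<longrightarrow> pd i j K (chartinv k x0) = 0"
    using wc unfolding wc_vanish_def by (elim bexE exE conjE) (rule that; assumption)
  obtain z0 where x0z: "z0 \<in> U1" "x0 = chart k z0" using w(1) by blast
  have zM: "chart k z0 \<in> M" using x0z w(2) by blast
  obtain k' U2 F G where f: "open U2" "z0 \<in> U2" "chart k ` U2 \<subseteq> M" "holo2 F U2" "holo2 G U2"
    "\<And>z. z \<in> U2 \<Longrightarrow> \<phi> (chart k z) = chart k' (F z, G z)"
    "\<And>z. z \<in> U2 \<Longrightarrow> pdx F z * pdy G z - pdy F z * pdx G z \<noteq> 0"
    by (rule holo_immersion_chart[OF imm zM]) (rule that; assumption | simp)
  define U where "U = U1 \<inter> U2"
  have U: "open U" "U \<subseteq> U1" "U \<subseteq> U2" "z0 \<in> U" using f(1,2) x0z holo2_open[OF w(7)] by (auto simp: U_def)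
  have sub: "chart k ` U \<subseteq> M" using U w(2) by blast
  note d = w(3-5)[THEN defines_fol_subset[OF _ U(1,2)]]
  have h: "holo2 F U" "holo2 G U" "holo2 r U" "holo2 s U" "holo2 K U"
    using f(4,5) w(7-9) U by (auto intro: holo2_subset)
  have \<phi>: "\<phi> (chart k z) = chart k' (F z, G z)" if "z \<in> U" for z using f(6) that U by blast
  have J: "pdx F z * pdy G z - pdy F z * pdx G z \<noteq> 0" if "z \<in> U" for z using f(7) that U by blast
  have sum: "\<forall>z\<in>U. a1 z + a2 z + a3 z = 0 \<and> b1 z + b2 z + b3 z = 0" using w(6) U by blast
  have curv: "\<forall>z\<in>U. pdx s z - pdy r z = K z * (a1 z * b2 z - b1 z * a2 z)" using w(13) U by blast
  interpret web_fun z0 U a1 b1 a2 b2 r s K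
    by (rule web_fun_of_forms[OF web sub U(4) d sum h(3-5) structure_eq_subset[OF w(10) U(2)] structure_eq_subset[OF w(11) U(2)] curv])
  have a3: "a3 z = - a1 z - a2 z" "b3 z = - b1 z - b2 z" if "z \<in> U" for z
  proof -
    have "a3 z + (a1 z + a2 z) = 0" "b3 z + (b1 z + b2 z) = 0" using bspec[OF sum that] by (simp_all only: add.commute[of _ "_ + _"])
    then show "a3 z = - a1 z - a2 z" "b3 z = - b1 z - b2 z" unfolding eq_neg_iff_add_eq_0[symmetric] by simp_all
  qed
  have c: "leaf_cubic a1 b1 F G" "leaf_cubic a2 b2 F G" "leaf_cubic a3 b3 F G"
    unfolding leaf_cubic_def
    using leaf_image_cubic[OF lf(1) d(1) sub _ ml(1) h(1,2) \<phi>] leaf_image_cubic[OF lf(2) d(2) sub _ ml(2) h(1,2) \<phi>]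
      leaf_image_cubic[OF lf(3) d(3) sub _ ml(3) h(1,2) \<phi>] by blast+
  \<comment> \<open>The identity is homogeneous of odd degree three in the form, so it passes from
    the third form to its negative, the sum of the first two.\<close>
  have c3: "leaf_cubic (\<lambda>z. a1 z + a2 z) (\<lambda>z. b1 z + b2 z) F G"
    unfolding leaf_cubic_def
  proof
    fix z assume z: "z \<in> U"
    have "a3 z = - (a1 z + a2 z)" "b3 z = - (b1 z + b2 z)" using a3[OF z] by simp_all
    then have "(- (b1 z + b2 z) * pdx F z - - (a1 z + a2 z) * pdy F z) * (- (b1 z + b2 z) * - (b1 z + b2 z) * pdx (pdx G) z - 2 * - (a1 z + a2 z) * - (b1 z + b2 z) * pdx (pdy G) z + - (a1 z + a2 z) * - (a1 z + a2 z) * pdy (pdy G) z)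
    = (- (b1 z + b2 z) * pdx G z - - (a1 z + a2 z) * pdy G z) * (- (b1 z + b2 z) * - (b1 z + b2 z) * pdx (pdx F) z - 2 * - (a1 z + a2 z) * - (b1 z + b2 z) * pdx (pdy F) z + - (a1 z + a2 z) * - (a1 z + a2 z) * pdy (pdy F) z)"
      using bspec[OF c(3)[unfolded leaf_cubic_def] z] by (simp only:)
    moreover have "(- B * x - - A * y) * (- B * - B * u - 2 * - A * - B * v + - A * - A * w) = (- B * x' - - A * y') * (- B * - B * u' - 2 * - A * - B * v' + - A * - A * w')
      \<Longrightarrow> (B * x - A * y) * (B * B * u - 2 * A * B * v + A * A * w) = (B * x' - A * y') * (B * B * u' - 2 * A * B * v' + A * A * w')" for A B x y u v w x' y' u' v' w' :: complex
    proof -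
      have "(- B * x - - A * y) * (- B * - B * u - 2 * - A * - B * v + - A * - A * w) = - ((B * x - A * y) * (B * B * u - 2 * A * B * v + A * A * w))" for x y u v w
        by (simp add: algebra_simps)
      then show "(- B * x - - A * y) * (- B * - B * u - 2 * - A * - B * v + - A * - A * w) = (- B * x' - - A * y') * (- B * - B * u' - 2 * - A * - B * v' + - A * - A * w')
      \<Longrightarrow> ?thesis" by (simp only: neg_equal_iff_equal)
    qed
    ultimately show "((b1 z + b2 z) * pdx F z - (a1 z + a2 z) * pdy F z) * ((b1 z + b2 z) * (b1 z + b2 z) * pdx (pdx G) z - 2 * (a1 z + a2 z) * (b1 z + b2 z) * pdx (pdy G) z + (a1 z + a2 z) * (a1 z + a2 z) * pdy (pdy G) z)
    = ((b1 z + b2 z) * pdx G z - (a1 z + a2 z) * pdy G z) * ((b1 z + b2 z) * (b1 z + b2 z) * pdx (pdx F) z - 2 * (a1 z + a2 z) * (b1 z + b2 z) * pdx (pdy F) z + (a1 z + a2 z) * (a1 z + a2 z) * pdy (pdy F) z)"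
      by blast
  qed
  have van: "pd i j K z0 = 0" if "i + j \<le> n" for i j using w(14) that x0z(2) by simp
  have pen: "\<exists>p0 p1 p2. (p0 \<noteq> 0 \<or> p1 \<noteq> 0 \<or> p2 \<noteq> 0) \<and> (\<forall>z\<in>U. a1 z * (p1 - p0 * fst z) + b1 z * (p2 - p0 * snd z) = 0)" if "is_pencil M l1"
    by (rule pencil_form[OF lf(1) d(1) sub that])
  have pen2: "\<exists>p0 p1 p2. (p0 \<noteq> 0 \<or> p1 \<noteq> 0 \<or> p2 \<noteq> 0) \<and> (\<forall>z\<in>U. a2 z * (p1 - p0 * fst z) + b2 z * (p2 - p0 * snd z) = 0)" if "is_pencil M l2"
    by (rule pencil_form[OF lf(2) d(2) sub that])
  have cases': "n = 3
      \<or> n = 2 \<and> (\<exists>p0 p1 p2. (p0 \<noteq> 0 \<or> p1 \<noteq> 0 \<or> p2 \<noteq> 0) \<and> (\<forall>z\<in>U. a1 z * (p1 - p0 * fst z) + b1 z * (p2 - p0 * snd z) = 0))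
      \<or> n = 1 \<and> (\<exists>p0 p1 p2. (p0 \<noteq> 0 \<or> p1 \<noteq> 0 \<or> p2 \<noteq> 0) \<and> (\<forall>z\<in>U. a1 z * (p1 - p0 * fst z) + b1 z * (p2 - p0 * snd z) = 0))
         \<and> (\<exists>p0 p1 p2. (p0 \<noteq> 0 \<or> p1 \<noteq> 0 \<or> p2 \<noteq> 0) \<and> (\<forall>z\<in>U. a2 z * (p1 - p0 * fst z) + b2 z * (p2 - p0 * snd z) = 0))"
    using cases pen pen2 by argo
  have inc: "incid (chart k z) (l1 (chart k z))" "incid (chart k z) (l2 (chart k z))" "incid (chart k z) (l3 (chart k z))" if "z \<in> U" for z
    using lf that sub by (auto simp: lin_fol_def)
  show ?thesis
    using flat_or_projective[OF h(1,2) J c(1,2) c3 van cases']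
  proof
    assume "T K = 0"
    then obtain V C p0 p1 f0 f1 f2 e0 e1 e2 e3 \<alpha> \<beta> where V: "open V" "z0 \<in> V" "V \<subseteq> U"
      "\<And>z A B. z \<in> V \<Longrightarrow> (A, B) \<in> {(a1 z, b1 z), (a2 z, b2 z), (- a1 z - a2 z, - b1 z - b2 z)} \<Longrightarrow>
         cub C p0 p1 f0 f1 f2 e0 e1 e2 e3 A B (A * (fst z - fst z0) + B * (snd z - snd z0)) = 0"
      "cub C p0 p1 f0 f1 f2 e0 e1 e2 e3 \<alpha> \<beta> 0 \<noteq> 0"
      by (rule flat_cubic_fun) (rule that; assumption | simp)
    define Fc where "Fc v = cub C p0 p1 f0 f1 f2 e0 e1 e2 e3 (bil (vecof k 0 1 0) v) (bil (vecof k 0 0 1) v) (bil (vecof k (-1) (- fst z0) (- snd z0)) v)" for v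
    have cf: "cubic_form Fc" unfolding Fc_def[abs_def] by (rule cubic_form_cub)
    have nz: "Fc (vecof k (- fst z0 * \<alpha> - snd z0 * \<beta>) \<alpha> \<beta>) \<noteq> 0"
      using V(5) unfolding Fc_def bil_vecof by simp
    have "Fc (rep (l1 (chart k z))) = 0 \<and> Fc (rep (l2 (chart k z))) = 0 \<and> Fc (rep (l3 (chart k z))) = 0" if z: "z \<in> V" for z
    proof (intro conjI)
      have zU: "z \<in> U" using z V(3) by blast
      show "Fc (rep (l1 (chart k z))) = 0" unfolding Fc_def
        by (rule cub_line_zero[OF d(1) zU inc(1)[OF zU]]) (rule V(4)[OF z], simp)
      show "Fc (rep (l2 (chart k z))) = 0" unfolding Fc_def
        by (rule cub_line_zero[OF d(2) zU inc(2)[OF zU]]) (rule V(4)[OF z], simp)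
      show "Fc (rep (l3 (chart k z))) = 0" unfolding Fc_def
        by (rule cub_line_zero[OF d(3) zU inc(3)[OF zU]]) (rule V(4)[OF z], simp add: a3[OF zU])
    qed
    then have "\<forall>p\<in>chart k ` V. Fc (rep (l1 p)) = 0 \<and> Fc (rep (l2 p)) = 0 \<and> Fc (rep (l3 p)) = 0" by blast
    moreover have "P2open (chart k ` V)" "x0 \<in> chart k ` V" using V x0z(2) P2open_chart_image by auto
    ultimately show ?thesis using cf nz by blast
  next
    assume "\<exists>V p q u1 u2 u3 v1 v2 v3. open V \<and> z0 \<in> V \<and> V \<subseteq> U \<and> (\<forall>z\<in>V.
      (1 - p * (fst z - fst z0) - q * (snd z - snd z0)) * F z = u1 + u2 * (fst z - fst z0) + u3 * (snd z - snd z0) \<and>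
      (1 - p * (fst z - fst z0) - q * (snd z - snd z0)) * G z = v1 + v2 * (fst z - fst z0) + v3 * (snd z - snd z0))"
    then obtain V p q u1 u2 u3 v1 v2 v3 where V: "open V" "z0 \<in> V" "V \<subseteq> U"
      and e: "\<forall>z\<in>V. (1 - p * (fst z - fst z0) - q * (snd z - snd z0)) * F z = u1 + u2 * (fst z - fst z0) + u3 * (snd z - snd z0) \<and>
      (1 - p * (fst z - fst z0) - q * (snd z - snd z0)) * G z = v1 + v2 * (fst z - fst z0) + v3 * (snd z - snd z0)"
      by (elim exE conjE) (rule that; assumption)
    have "\<exists>A. invertible A \<and> (\<forall>z\<in>V. \<phi> (chart k z) = ptrans A (chart k z))"
      by (rule projective_near[OF V(1,2) holo2_subset[OF h(1) V(1,3)] holo2_subset[OF h(2) V(1,3)] J[OF z0U], of \<phi> k k' p q u1 u2 u3 v1 v2 v3])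
        (use e V(3) \<phi> in blast)+
    then have "\<exists>A. invertible A \<and> (\<forall>p\<in>chart k ` V. \<phi> p = ptrans A p)" by blast
    moreover have "P2open (chart k ` V)" "x0 \<in> chart k ` V" using V x0z(2) P2open_chart_image by auto
    ultimately show ?thesis by blast
  qed
qed

text \<open>On a convex chart ball \<open>Q\<close> is the common vanishing of holomorphic
  functions, so it spreads from any open subset to the whole ball. Holding near a point is therefore
  locally constant. The index type \<open>3 \<times> 3\<close> accommodates the minors of two
  vectors.\<close>

lemma P2connected_identity:
  assumes conn: "P2connected M" and M: "P2open M" and N: "P2open N" "x0 \<in> N" "x0 \<in> M" "\<And>p. p \<in> N \<Longrightarrow> p \<in> M \<Longrightarrow> Q p"
    and loc: "\<And>k z. chart k z \<in> M \<Longrightarrow> \<exists>U (I :: (3 \<times> 3) set) f. open U \<and> z \<in> U \<and> (\<forall>i\<in>I. holo2 (f i) U) \<and> (\<forall>w\<in>U. Q (chart k w) \<longleftrightarrow> (\<forall>i\<in>I. f i w = (0::complex)))"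
    and p: "p \<in> M"
  shows "Q p"
proof -
  define P where "P p \<longleftrightarrow> (\<exists>N. P2open N \<and> p \<in> N \<and> (\<forall>q\<in>N. q \<in> M \<longrightarrow> Q q))" for p
  have "P p"
  proof (rule P2connected_propagate[OF conn N(3) _ _ p])
    show "P x0" unfolding P_def using N by blast
    fix p assume p: "p \<in> M"
    obtain k z where z: "p = chart k z" using range_chart_ex by blast
    obtain U f and I :: "(3 \<times> 3) set" where U: "open U" "z \<in> U" "\<forall>i\<in>I. holo2 (f i) U" "\<forall>w\<in>U. Q (chart k w) \<longleftrightarrow> (\<forall>i\<in>I. f i w = (0::complex))"
      using loc[OF p[unfolded z]] by (elim exE conjE) (rule that; assumption)
    have "open (U \<inter> chart k -` M)" using U(1) P2open_vimage[OF M] by blast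
    then obtain e where e: "e > 0" "ball z e \<subseteq> U \<inter> chart k -` M" using openE[of "U \<inter> chart k -` M" z] U(2) p z by auto
    define B where "B = ball z e"
    have B: "open B" "convex B" "z \<in> B" "B \<subseteq> U" "chart k ` B \<subseteq> M" using e by (auto simp: B_def)
    have "P q'" if q: "q \<in> chart k ` B" "q' \<in> chart k ` B" "P q" for q q'
    proof -
      obtain v where v: "v \<in> B" "q = chart k v" using q(1) by blast
      obtain N' where N': "P2open N'" "q \<in> N'" "\<And>q. q \<in> N' \<Longrightarrow> q \<in> M \<Longrightarrow> Q q" using q(3) unfolding P_def by blast
      define V where "V = B \<inter> chart k -` N'"
      have V: "open V" "V \<subseteq> B" "v \<in> V" using B(1) P2open_vimage[OF N'(1)] N'(2) v by (auto simp: V_def)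
      have fV: "f i w = 0" if "w \<in> V" "i \<in> I" for i w
      proof -
        have "Q (chart k w)" using N'(3)[of "chart k w"] that(1) B(5) by (auto simp: V_def)
        then show ?thesis using U(4) that V(2) B(4) by blast
      qed
      have "f i w = 0" if "w \<in> B" "i \<in> I" for i w
        by (rule holo2_identity[OF holo2_subset[OF bspec[OF U(3) that(2)] B(1,4)] B(2) V fV[OF _ that(2)] that(1)])
      then have "\<forall>q\<in>chart k ` B. Q q" using U(4) B(4) by blast
      then show ?thesis unfolding P_def using q(2) P2open_chart_image[OF B(1)] by blast
    qed
    then show "\<exists>N. P2open N \<and> p \<in> N \<and> (\<forall>q\<in>N \<inter> M. \<forall>q'\<in>N \<inter> M. P q \<longrightarrow> P q')"
      by (intro exI[of _ "chart k ` B"]) (use B z P2open_chart_image in auto)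
  qed
  then show ?thesis unfolding P_def using p by blast
qed

lemma cubic_rep_chart:
  assumes "cubic_form F" shows "F (rep (chart k z)) = 0 \<longleftrightarrow> F (chartvec k z) = 0"
proof -
  obtain c where "c \<noteq> 0" "rep (chart k z) = c *s chartvec k z"
    unfolding chart_def by (rule rep_proj[OF chartvec_nz])
  then show ?thesis by (simp add: cubic_form_scale[OF assms])
qed

lemma holo2_chartvec_comp:
  assumes "holo2 F U" "holo2 G U" shows "holo2 (\<lambda>z. chartvec k (F z, G z) $ i) U"
  unfolding chartvec_vecof fst_conv snd_conv using holo2_open[OF assms(1)] by (intro holo2_vecof holo2_const assms)

lemma foliation_on_cubic:
  assumes conn: "P2connected M" and M: "P2open M" and N: "P2open N" "x0 \<in> N" "x0 \<in> M"
    and l: "lin_fol M l" and F: "cubic_form F" and 0: "\<And>p. p \<in> N \<Longrightarrow> F (rep (l p)) = 0" and p: "p \<in> M"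
  shows "F (rep (l p)) = 0"
proof (rule P2connected_identity[OF conn M N _ _ p, where Q = "\<lambda>p. F (rep (l p)) = 0"])
  show "p \<in> N \<Longrightarrow> F (rep (l p)) = 0" for p by (rule 0)
  fix k z assume kz: "chart k z \<in> M"
  have hm: "holo_map_on M l" using l by (simp add: lin_fol_def)
  obtain k' U A B where U: "open U" "z \<in> U" "chart k ` U \<subseteq> M" "holo2 A U" "holo2 B U"
    "\<And>z. z \<in> U \<Longrightarrow> l (chart k z) = chart k' (A z, B z)"
    by (rule holo_map_chart[OF hm kz]) (rule that; assumption | simp)
  show "\<exists>U (I :: (3 \<times> 3) set) f. open U \<and> z \<in> U \<and> (\<forall>i\<in>I. holo2 (f i) U) \<and> (\<forall>w\<in>U. F (rep (l (chart k w))) = 0 \<longleftrightarrow> (\<forall>i\<in>I. f i w = (0::complex)))"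
    by (intro exI[of _ U] exI[of _ "{(1, 1)}"] exI[of _ "\<lambda>i z. F (chartvec k' (A z, B z))"])
      (use U cubic_form_holo2[OF F holo2_chartvec_comp[OF U(4,5)]] in \<open>simp add: cubic_rep_chart[OF F]\<close>)
qed

lemma ptrans_proj:
  assumes "invertible A" "v \<noteq> 0"
  shows "A *v v \<noteq> 0" "ptrans A (proj v) = proj (A *v v)"
proof -
  show n: "A *v v \<noteq> 0"
    using assms unfolding invertible_left_inverse matrix_left_invertible_ker by blast
  obtain c where c: "c \<noteq> 0" "rep (proj v) = c *s v" by (rule rep_proj[OF assms(2)])
  show "ptrans A (proj v) = proj (A *v v)"
    unfolding ptrans_def c(2) vector_scalar_commute by (rule proj_smult[OF c(1) n])
qed

lemma projective_everywhere:
  assumes conn: "P2connected M" and M: "P2open M" and N: "P2open N" "x0 \<in> N" "x0 \<in> M"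
    and imm: "holo_immersion_on M \<phi>" and A: "invertible A" and eq: "\<And>p. p \<in> N \<Longrightarrow> \<phi> p = ptrans A p" and p: "p \<in> M"
  shows "\<phi> p = ptrans A p"
proof (rule P2connected_identity[OF conn M N _ _ p, where Q = "\<lambda>p. \<phi> p = ptrans A p"])
  show "p \<in> N \<Longrightarrow> \<phi> p = ptrans A p" for p by (rule eq)
  fix k z assume kz: "chart k z \<in> M"
  obtain k' U F G where U: "open U" "z \<in> U" "chart k ` U \<subseteq> M" "holo2 F U" "holo2 G U"
    "\<And>z. z \<in> U \<Longrightarrow> \<phi> (chart k z) = chart k' (F z, G z)"
    by (rule holo_immersion_chart[OF imm kz]) (rule that; assumption | simp)
  define f where "f ij w = vec_nth (chartvec k' (F w, G w)) (fst ij) * vec_nth (A *v chartvec k w) (snd ij)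
     - vec_nth (chartvec k' (F w, G w)) (snd ij) * vec_nth (A *v chartvec k w) (fst ij)" for ij :: "3 \<times> 3" and w
  have hA: "holo2 (\<lambda>w. (A *v chartvec k w) $ i) U" for i
    unfolding matrix_vector_mult_def vec_lambda_beta
    by (intro holo2_sum holo2_mult holo2_const holo2_chartvec U(1)) simp
  have "holo2 (f ij) U" for ij
    unfolding f_def by (intro holo2_diff holo2_mult hA holo2_chartvec_comp U(4,5))
  moreover have "\<phi> (chart k w) = ptrans A (chart k w) \<longleftrightarrow> (\<forall>ij\<in>UNIV. f ij w = 0)" if "w \<in> U" for w
    unfolding U(6)[OF that] unfolding chart_def ptrans_proj(2)[OF A chartvec_nz]
      proj_eq_iff_cross[OF chartvec_nz ptrans_proj(1)[OF A chartvec_nz]]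
    by (simp add: f_def)
  ultimately show "\<exists>U (I :: (3 \<times> 3) set) f. open U \<and> z \<in> U \<and> (\<forall>i\<in>I. holo2 (f i) U) \<and> (\<forall>w\<in>U. \<phi> (chart k w) = ptrans A (chart k w) \<longleftrightarrow> (\<forall>i\<in>I. f i w = (0::complex)))"
    by (intro exI[of _ U] exI[of _ UNIV] exI[of _ f]) (use U(1,2) in blast)
qed

section \<open>Normalized forms and connection of a given web\<close>

lemma lin_fol_form:
  assumes l: "lin_fol M l" and z0: "chart k z0 \<in> M"
  obtains U \<alpha> \<beta> where "open U" "z0 \<in> U" "chart k ` U \<subseteq> M" "defines_fol k l U \<alpha> \<beta>"
proof -
  have hm: "holo_map_on M l" using l by (simp add: lin_fol_def)
  obtain k' U A B where U: "open U" "z0 \<in> U" "chart k ` U \<subseteq> M" "holo2 A U" "holo2 B U"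
    "\<And>z. z \<in> U \<Longrightarrow> l (chart k z) = chart k' (A z, B z)"
    by (rule holo_map_chart[OF hm z0]) (rule that; assumption | simp)
  define v where "v z = chartvec k' (A z, B z)" for z
  define \<alpha> \<beta> where "\<alpha> z = fst (lgrad k (v z))" and "\<beta> z = snd (lgrad k (v z))" for z
  have "holo2 \<alpha> U" "holo2 \<beta> U"
    unfolding \<alpha>_def[abs_def] \<beta>_def[abs_def] v_def by (rule holo2_lgrad; rule holo2_chartvec_comp[OF U(4,5)])+
  moreover have "(\<alpha> z, \<beta> z) \<noteq> (0, 0) \<and> \<alpha> z * snd (lgrad k (rep (l (chart k z)))) - \<beta> z * fst (lgrad k (rep (l (chart k z)))) = 0" if z: "z \<in> U" for z
  proof -
    obtain c where c: "c \<noteq> 0" "rep (l (chart k z)) = c *s v z"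
    proof -
      have "l (chart k z) = proj (v z)" using U(6)[OF z] by (simp add: chart_def v_def)
      moreover have "v z \<noteq> 0" by (simp add: v_def)
      ultimately show ?thesis using rep_proj[of "v z"] that by metis
    qed
    have "incid (chart k z) (l (chart k z))" using l z U(3) by (auto simp: lin_fol_def)
    from lgrad_rep_nz[OF this] show ?thesis unfolding c(2) lgrad_smult by (auto simp: \<alpha>_def \<beta>_def)
  qed
  ultimately have "defines_fol k l U \<alpha> \<beta>" unfolding defines_fol_def by blast
  then show ?thesis by (rule that[OF U(1-3)])
qed

lemma defines_fol_mult:
  assumes d: "defines_fol k l U a b" and c: "holo2 c U" "\<And>z. z \<in> U \<Longrightarrow> c z \<noteq> 0"
  shows "defines_fol k l U (\<lambda>z. c z * a z) (\<lambda>z. c z * b z)"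
  unfolding defines_fol_def
proof (intro conjI ballI)
  show "holo2 (\<lambda>z. c z * a z) U" "holo2 (\<lambda>z. c z * b z) U"
    using d by (auto simp: defines_fol_def intro: holo2_mult c(1))
  fix z assume z: "z \<in> U"
  show "(c z * a z, c z * b z) \<noteq> (0, 0)" using d z c(2) by (auto simp: defines_fol_def)
  have "a z * snd (lgrad k (rep (l (chart k z)))) - b z * fst (lgrad k (rep (l (chart k z)))) = 0"
    using d z by (auto simp: defines_fol_def)
  then have "c z * (a z * snd (lgrad k (rep (l (chart k z)))) - b z * fst (lgrad k (rep (l (chart k z))))) = 0" by simp
  then show "c z * a z * snd (lgrad k (rep (l (chart k z)))) - c z * b z * fst (lgrad k (rep (l (chart k z)))) = 0"
    by (simp only: right_diff_distrib mult.assoc)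
qed

lemma normalized_forms:
  assumes web: "linear_3web M l1 l2 l3" and z0: "chart k z0 \<in> M"
  obtains U a1 b1 a2 b2 a3 b3 where "open U" "z0 \<in> U" "chart k ` U \<subseteq> M"
    "defines_fol k l1 U a1 b1" "defines_fol k l2 U a2 b2" "defines_fol k l3 U a3 b3"
    "\<forall>z\<in>U. a1 z + a2 z + a3 z = 0 \<and> b1 z + b2 z + b3 z = 0"
proof -
  have lf: "lin_fol M l1" "lin_fol M l2" "lin_fol M l3" using web by (auto simp: linear_3web_def)
  obtain U1 \<alpha>1 \<beta>1 where 1: "open U1" "z0 \<in> U1" "chart k ` U1 \<subseteq> M" "defines_fol k l1 U1 \<alpha>1 \<beta>1" by (rule lin_fol_form[OF lf(1) z0])
  obtain U2 \<alpha>2 \<beta>2 where 2: "open U2" "z0 \<in> U2" "chart k ` U2 \<subseteq> M" "defines_fol k l2 U2 \<alpha>2 \<beta>2" by (rule lin_fol_form[OF lf(2) z0])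
  obtain U3 \<alpha>3 \<beta>3 where 3: "open U3" "z0 \<in> U3" "chart k ` U3 \<subseteq> M" "defines_fol k l3 U3 \<alpha>3 \<beta>3" by (rule lin_fol_form[OF lf(3) z0])
  define U where "U = U1 \<inter> U2 \<inter> U3"
  have U: "open U" "z0 \<in> U" "chart k ` U \<subseteq> M" "U \<subseteq> U1" "U \<subseteq> U2" "U \<subseteq> U3" using 1 2 3 by (auto simp: U_def)
  note d = defines_fol_subset[OF 1(4) U(1,4)] defines_fol_subset[OF 2(4) U(1,5)] defines_fol_subset[OF 3(4) U(1,6)]
  have h: "holo2 \<alpha>1 U" "holo2 \<beta>1 U" "holo2 \<alpha>2 U" "holo2 \<beta>2 U" "holo2 \<alpha>3 U" "holo2 \<beta>3 U" using d by (auto simp: defines_fol_def)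
  have inc: "incid (chart k z) (l1 (chart k z))" "incid (chart k z) (l2 (chart k z))" "incid (chart k z) (l3 (chart k z))"
    "l1 (chart k z) \<noteq> l2 (chart k z)" "l3 (chart k z) \<noteq> l1 (chart k z)" "l2 (chart k z) \<noteq> l3 (chart k z)" if "z \<in> U" for z
  proof -
    have "chart k z \<in> M" using that U(3) by blast
    with web show "incid (chart k z) (l1 (chart k z))" "incid (chart k z) (l2 (chart k z))" "incid (chart k z) (l3 (chart k z))"
      "l1 (chart k z) \<noteq> l2 (chart k z)" "l3 (chart k z) \<noteq> l1 (chart k z)" "l2 (chart k z) \<noteq> l3 (chart k z)"
      unfolding linear_3web_def lin_fol_def by metis+
  qed
  \<comment> \<open>Each factor is the determinant of the other two forms; with these weights any
    three covectors of the plane add up to zero.\<close>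
  define c1 c2 c3 where "c1 z = \<alpha>2 z * \<beta>3 z - \<beta>2 z * \<alpha>3 z" and "c2 z = \<alpha>3 z * \<beta>1 z - \<beta>3 z * \<alpha>1 z"
    and "c3 z = \<alpha>1 z * \<beta>2 z - \<beta>1 z * \<alpha>2 z" for z
  have nz: "c1 z \<noteq> 0" "c2 z \<noteq> 0" "c3 z \<noteq> 0" if z: "z \<in> U" for z
    unfolding c1_def c2_def c3_def
    by (rule defines_fol_transversal[OF d(2,3) z inc(2,3)[OF z] inc(6)[OF z]]
        defines_fol_transversal[OF d(3,1) z inc(3,1)[OF z] inc(5)[OF z]] defines_fol_transversal[OF d(1,2) z inc(1,2)[OF z] inc(4)[OF z]])+
  have hc: "holo2 c1 U" "holo2 c2 U" "holo2 c3 U"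
    unfolding c1_def[abs_def] c2_def[abs_def] c3_def[abs_def] by (intro holo2_diff holo2_mult h)+
  show ?thesis
  proof (rule that[OF U(1-3) defines_fol_mult[OF d(1) hc(1) nz(1)] defines_fol_mult[OF d(2) hc(2) nz(2)] defines_fol_mult[OF d(3) hc(3) nz(3)]])
    show "\<forall>z\<in>U. c1 z * \<alpha>1 z + c2 z * \<alpha>2 z + c3 z * \<alpha>3 z = 0 \<and> c1 z * \<beta>1 z + c2 z * \<beta>2 z + c3 z * \<beta>3 z = 0"
      by (simp add: c1_def c2_def c3_def algebra_simps)
  qed
qed

text \<open>The first two structure equations are a linear system for \<open>r\<close>,
  \<open>s\<close> whose determinant is the Wronskian. The third follows, since the equation is
  linear in the form and the three forms add up to zero.\<close>

lemma web_connection: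
  assumes h: "holo2 a1 U" "holo2 b1 U" "holo2 a2 U" "holo2 b2 U" and W: "\<And>z. z \<in> U \<Longrightarrow> a1 z * b2 z - b1 z * a2 z \<noteq> 0"
    and sum: "\<forall>z\<in>U. a1 z + a2 z + a3 z = 0 \<and> b1 z + b2 z + b3 z = 0"
  obtains r s K where "holo2 r U" "holo2 s U" "holo2 K U"
    "structure_eq U a1 b1 r s" "structure_eq U a2 b2 r s" "structure_eq U a3 b3 r s"
    "\<forall>z\<in>U. pdx s z - pdy r z = K z * (a1 z * b2 z - b1 z * a2 z)"
proof -
  have o: "open U" using h(1) by (rule holo2_open)
  define w where "w z = a1 z * b2 z - b1 z * a2 z" for z
  define d1 d2 where "d1 z = pdx b1 z - pdy a1 z" and "d2 z = pdx b2 z - pdy a2 z" for z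
  define r s where "r z = (d1 z * a2 z - d2 z * a1 z) / w z" and "s z = (d1 z * b2 z - d2 z * b1 z) / w z" for z
  define K where "K z = (pdx s z - pdy r z) / w z" for z
  have wn: "w z \<noteq> 0" if "z \<in> U" for z using W[OF that] by (simp add: w_def)
  have hw: "holo2 w U" unfolding w_def[abs_def] by (intro holo2_diff holo2_mult h)
  have hr: "holo2 r U" "holo2 s U"
    unfolding r_def[abs_def] s_def[abs_def] d1_def d2_def
    by (rule holo2_divide; (intro holo2_diff holo2_mult holo2_pdx holo2_pdy h hw wn)?; assumption?)+
  have hK: "holo2 K U"
    unfolding K_def[abs_def] by (intro holo2_divide holo2_diff holo2_pdx holo2_pdy hr hw wn)
  have st: "structure_eq U a1 b1 r s" "structure_eq U a2 b2 r s"
    unfolding structure_eq_def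
  proof (safe)
    fix x y assume "(x, y) \<in> U"
    define z where "z = (x, y)"
    have z: "z \<in> U" using \<open>(x, y) \<in> U\<close> by (simp add: z_def)
    have "(r z * b1 z - s z * a1 z) * w z = - d1 z * w z" "(r z * b2 z - s z * a2 z) * w z = - d2 z * w z"
    proof -
      have rw: "r z * w z = d1 z * a2 z - d2 z * a1 z" "s z * w z = d1 z * b2 z - d2 z * b1 z"
        using wn[OF z] by (simp_all add: r_def s_def)
      have "(r z * b1 z - s z * a1 z) * w z = (r z * w z) * b1 z - (s z * w z) * a1 z"
        "(r z * b2 z - s z * a2 z) * w z = (r z * w z) * b2 z - (s z * w z) * a2 z" by (simp_all add: algebra_simps)
      then show "(r z * b1 z - s z * a1 z) * w z = - d1 z * w z" "(r z * b2 z - s z * a2 z) * w z = - d2 z * w z"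
        unfolding rw by (simp_all add: w_def algebra_simps)
    qed
    then have "r z * b1 z - s z * a1 z = - d1 z" "r z * b2 z - s z * a2 z = - d2 z" using wn[OF z] by (simp_all only: mult_right_cancel[OF wn[OF z]])
    then have "pdx b1 z - pdy a1 z + (r z * b1 z - s z * a1 z) = 0" "pdx b2 z - pdy a2 z + (r z * b2 z - s z * a2 z) = 0"
      by (simp_all add: d1_def d2_def)
    then show "pdx b1 (x, y) - pdy a1 (x, y) + (r (x, y) * b1 (x, y) - s (x, y) * a1 (x, y)) = 0"
      "pdx b2 (x, y) - pdy a2 (x, y) + (r (x, y) * b2 (x, y) - s (x, y) * a2 (x, y)) = 0" by (simp_all only: z_def)
  qed
  have "structure_eq U a3 b3 r s" unfolding structure_eq_def
  proof
    fix z assume z: "z \<in> U"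
    have e: "a3 w = - (a1 w + a2 w)" "b3 w = - (b1 w + b2 w)" if "w \<in> U" for w
      using bspec[OF sum that] by (simp_all only: eq_neg_iff_add_eq_0 add.commute[of _ "_ + _"])
    have p: "pdx b3 z = - (pdx b1 z + pdx b2 z)" "pdy a3 z = - (pdy a1 z + pdy a2 z)"
      using pd_cong[of U z a3 "\<lambda>w. - (a1 w + a2 w)", OF o z e(1)] pd_cong[of U z b3 "\<lambda>w. - (b1 w + b2 w)", OF o z e(2)]
      by (simp_all only: pd_minus[OF holo2_pd_add(1)[OF h(1,3)] z] pd_minus[OF holo2_pd_add(1)[OF h(2,4)] z]
        holo2_pd_add(2,3)[OF h(1,3) z] holo2_pd_add(2,3)[OF h(2,4) z])
    have "pdx b3 z - pdy a3 z + (r z * b3 z - s z * a3 z)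
      = - (pdx b1 z - pdy a1 z + (r z * b1 z - s z * a1 z)) - (pdx b2 z - pdy a2 z + (r z * b2 z - s z * a2 z))"
      unfolding p e[OF z] by (simp add: algebra_simps)
    also have "\<dots> = 0" using st z by (simp add: structure_eq_def)
    finally show "pdx b3 z - pdy a3 z + (r z * b3 z - s z * a3 z) = 0" .
  qed
  moreover have "\<forall>z\<in>U. pdx s z - pdy r z = K z * (a1 z * b2 z - b1 z * a2 z)"
    using wn by (simp add: K_def flip: w_def)
  ultimately show ?thesis by (rule that[OF hr hK st])
qed

text \<open>\<open>H z\<close> is the value of \<open>F\<close> at the line through \<open>z\<close>
  with conormal \<open>(\<alpha>, \<beta>)\<close>, and moving \<open>z\<close> along that line does
  not change the line.\<close>

lemma cubic_form_leafwise_constant: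
  fixes \<alpha> \<beta> :: complex and k :: nat
  assumes F: "cubic_form F"
  defines "H \<equiv> \<lambda>z. F (vecof k (- (\<alpha> * fst z) - \<beta> * snd z) \<alpha> \<beta>)"
  shows "\<beta> * pdx H z = \<alpha> * pdy H z"
proof -
  have h: "holo2 H UNIV" unfolding H_def
    by (rule cubic_form_holo2[OF F], rule holo2_vecof) (intro holo2_diff holo2_minus holo2_mult holo2_const holo2_fst holo2_snd open_UNIV)+
  have "H (on_leaf \<alpha> \<beta> z t) = H z" for t by (simp add: H_def on_leaf_def algebra_simps)
  then have "\<beta> * pdx H (on_leaf \<alpha> \<beta> z 0) - \<alpha> * pdy H (on_leaf \<alpha> \<beta> z 0) = 0"
    by (intro zero_deriv_near[OF deriv_on_leaf[OF h], where S = UNIV]) auto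
  then show ?thesis by simp
qed

text \<open>Restricted to the lines through a moving point, \<open>F\<close> is a binary cubic in
  the conormal that is constant along lines and vanishes on the three forms. It cannot vanish for
  all points near \<open>z0\<close>, since \<open>F\<close> would then vanish on an open set of
  lines. So the curvature is zero at \<open>p\<close>, and order 0 is enough as \<open>p\<close> is
  arbitrary.\<close>

lemma cubic_web_flat:
  assumes web: "linear_3web M l1 l2 l3" and F: "cubic_form F" and nz: "F v0 \<noteq> 0"
    and z: "\<And>p. p \<in> M \<Longrightarrow> F (rep (l1 p)) = 0 \<and> F (rep (l2 p)) = 0 \<and> F (rep (l3 p)) = 0" and p: "p \<in> M"
  shows "wc_vanish M l1 l2 l3 p 0"
proof -
  obtain k z0 where k: "k \<in> {0,1,2}" and pz: "p = chart k z0" using range_chart_ex by blast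
  obtain U a1 b1 a2 b2 a3 b3 where nbh: "open U" "z0 \<in> U" "chart k ` U \<subseteq> M"
    and d: "defines_fol k l1 U a1 b1" "defines_fol k l2 U a2 b2" "defines_fol k l3 U a3 b3"
    and sum: "\<forall>z\<in>U. a1 z + a2 z + a3 z = 0 \<and> b1 z + b2 z + b3 z = 0"
    by (rule normalized_forms[OF web p[unfolded pz]])
  have inc: "incid (chart k z) (l1 (chart k z))" "incid (chart k z) (l2 (chart k z))" "incid (chart k z) (l3 (chart k z))"
    "l1 (chart k z) \<noteq> l2 (chart k z)" if "z \<in> U" for z
    using web that nbh(3) by (auto simp: linear_3web_def lin_fol_def)
  have h: "holo2 a1 U" "holo2 b1 U" "holo2 a2 U" "holo2 b2 U" using d by (auto simp: defines_fol_def)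
  obtain r s K where rs: "holo2 r U" "holo2 s U" "holo2 K U"
    "structure_eq U a1 b1 r s" "structure_eq U a2 b2 r s" "structure_eq U a3 b3 r s"
    "\<forall>z\<in>U. pdx s z - pdy r z = K z * (a1 z * b2 z - b1 z * a2 z)"
    by (rule web_connection[OF h defines_fol_transversal[OF d(1,2) _ inc(1,2,4)] sum])
  interpret web_fun z0 U a1 b1 a2 b2 r s K
    by (rule web_fun_of_forms[OF web nbh(3,2) d sum rs(1-5,7)])
  define u1 u2 where "u1 z = vecof k (- fst z) 1 0" and "u2 z = vecof k (- snd z) 0 1" for z :: "complex \<times> complex"
  define h0 h1 h2 h3 where "h0 z = F (u1 z)" and "h1 z = (F (u1 z + u2 z) - F (u1 z - u2 z)) / 2 - F (u2 z)"
    and "h2 z = (F (u1 z + u2 z) + F (u1 z - u2 z)) / 2 - F (u1 z)" and "h3 z = F (u2 z)" for z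
  have u: "\<alpha> *s u1 z + \<beta> *s u2 z = vecof k (- (\<alpha> * fst z) - \<beta> * snd z) \<alpha> \<beta>" for \<alpha> \<beta> z
    unfolding u1_def u2_def vecof_smult vecof_add by simp
  have H: "h0 z * \<alpha>^3 + h1 z * \<alpha>^2 * \<beta> + h2 z * \<alpha> * \<beta>^2 + h3 z * \<beta>^3 = F (vecof k (- (\<alpha> * fst z) - \<beta> * snd z) \<alpha> \<beta>)" for \<alpha> \<beta> z
    unfolding u[symmetric] cubic_form_line[OF F] by (simp add: h0_def h1_def h2_def h3_def)
  have hF: "holo2 (\<lambda>z. F (vecof k (- (\<alpha> * fst z) - \<beta> * snd z) \<alpha> \<beta>)) U" for \<alpha> \<beta>
    by (rule cubic_form_holo2[OF F], rule holo2_vecof) (intro holo_rules)+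
  have us: "u1 z = vecof k (- (1 * fst z) - 0 * snd z) 1 0" "u2 z = vecof k (- (0 * fst z) - 1 * snd z) 0 1"
    "u1 z + u2 z = vecof k (- (1 * fst z) - 1 * snd z) 1 1" "u1 z - u2 z = vecof k (- (1 * fst z) - (-1) * snd z) 1 (-1)" for z
    using u[where z = z] u[of 1 z "-1"] by (simp_all add: u1_def u2_def vecof_add)
  have hu: "holo2 (\<lambda>z. F (u1 z)) U" "holo2 (\<lambda>z. F (u2 z)) U" "holo2 (\<lambda>z. F (u1 z + u2 z)) U" "holo2 (\<lambda>z. F (u1 z - u2 z)) U"
    unfolding us(3,4) unfolding us(1,2) by (rule hF)+
  have hh: "holo2 h0 U" "holo2 h1 U" "holo2 h2 U" "holo2 h3 U"
    unfolding h0_def[abs_def] h1_def[abs_def] h2_def[abs_def] h3_def[abs_def]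
    using hu openU by (simp_all add: holo2_divide holo2_diff holo2_add)
  have van: "h0 z * A^3 + h1 z * A^2 * B + h2 z * A * B^2 + h3 z * B^3 = 0"
    if zU: "z \<in> U" and AB: "(A, B) \<in> {(a1 z, b1 z), (a2 z, b2 z), (- a1 z - a2 z, - b1 z - b2 z)}" for z A B
  proof -
    have zM: "chart k z \<in> M" using zU nbh(3) by blast
    have e: "F (vecof k (- (a z * fst z) - b z * snd z) (a z) (b z)) = 0"
      if dl: "defines_fol k l U a b" and i: "incid (chart k z) (l (chart k z))" and 0: "F (rep (l (chart k z))) = 0" for l a b
    proof -
      define w :: "complex^3" where "w = rep (l (chart k z))"
      obtain e where e: "e \<noteq> 0" "fst (lgrad k w) = e * a z" "snd (lgrad k w) = e * b z"
        unfolding w_def by (rule defines_fol_smult[OF dl zU i])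
      have "w $ chart_idx k + fst z * (e * a z) + snd z * (e * b z) = 0"
        using i unfolding incid_chart w_def[symmetric] e .
      then have w0: "w $ chart_idx k = - (fst z * (e * a z) + snd z * (e * b z))"
        by (simp only: eq_neg_iff_add_eq_0 add.assoc)
      have "w = vecof k (w $ chart_idx k) (fst (lgrad k w)) (snd (lgrad k w))" by (rule vecof_eq)
      also have "\<dots> = e *s vecof k (- (a z * fst z) - b z * snd z) (a z) (b z)"
        unfolding vecof_smult e w0 by (simp add: algebra_simps)
      finally have "F (e *s vecof k (- (a z * fst z) - b z * snd z) (a z) (b z)) = 0" using 0 by (simp add: w_def)
      then show ?thesis using e(1) by (simp add: cubic_form_scale[OF F])
    qed
    have "a3 z + (a1 z + a2 z) = 0" "b3 z + (b1 z + b2 z) = 0" using bspec[OF sum zU] by (simp_all only: add.commute[of _ "_ + _"])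
    then have "a3 z = - a1 z - a2 z" "b3 z = - b1 z - b2 z" unfolding eq_neg_iff_add_eq_0[symmetric] by simp_all
    then have "(A, B) \<in> {(a1 z, b1 z), (a2 z, b2 z), (a3 z, b3 z)}" using AB by (simp only:)
    then show ?thesis unfolding H
      using e[OF d(1) inc(1)[OF zU]] e[OF d(2) inc(2)[OF zU]] e[OF d(3) inc(3)[OF zU]] z[OF zM] by blast
  qed
  have tr: "\<beta> * pdx (\<lambda>z. h0 z * \<alpha>^3 + h1 z * \<alpha>^2 * \<beta> + h2 z * \<alpha> * \<beta>^2 + h3 z * \<beta>^3) z
        = \<alpha> * pdy (\<lambda>z. h0 z * \<alpha>^3 + h1 z * \<alpha>^2 * \<beta> + h2 z * \<alpha> * \<beta>^2 + h3 z * \<beta>^3) z" for \<alpha> \<beta> z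
    unfolding H by (rule cubic_form_leafwise_constant[OF F])
  have "\<not> (\<exists>V. open V \<and> z0 \<in> V \<and> V \<subseteq> U \<and> (\<forall>z\<in>V. h0 z = 0 \<and> h1 z = 0 \<and> h2 z = 0 \<and> h3 z = 0))"
  proof
    assume "\<exists>V. open V \<and> z0 \<in> V \<and> V \<subseteq> U \<and> (\<forall>z\<in>V. h0 z = 0 \<and> h1 z = 0 \<and> h2 z = 0 \<and> h3 z = 0)"
    then obtain V where V: "open V" "z0 \<in> V" "\<forall>z\<in>V. h0 z = 0 \<and> h1 z = 0 \<and> h2 z = 0 \<and> h3 z = 0" by blast
    have "F v0 = 0"
    proof (rule cubic_form_zero_near[OF F V(1,2)])
      fix z and v :: "complex^3" assume zV: "z \<in> V" and b: "bil (chartvec k z) v = 0"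
      define \<alpha> \<beta> where "\<alpha> = fst (lgrad k v)" and "\<beta> = snd (lgrad k v)"
      have "v $ chart_idx k + (fst z * \<alpha> + snd z * \<beta>) = 0" using b by (simp add: bil_chartvec \<alpha>_def \<beta>_def add.assoc)
      then have "v $ chart_idx k = - (\<alpha> * fst z) - \<beta> * snd z" unfolding eq_neg_iff_add_eq_0[symmetric] by (simp add: mult.commute)
      then have "v = vecof k (- (\<alpha> * fst z) - \<beta> * snd z) \<alpha> \<beta>" using vecof_eq[of v k] by (simp add: \<alpha>_def \<beta>_def)
      then have "F v = h0 z * \<alpha>^3 + h1 z * \<alpha>^2 * \<beta> + h2 z * \<alpha> * \<beta>^2 + h3 z * \<beta>^3" by (simp only: H)
      then show "F v = 0" using V(3) zV by simp
    qed
    then show False using nz by simp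
  qed
  moreover have "T K = 0 \<or> (\<exists>V. open V \<and> z0 \<in> V \<and> V \<subseteq> U \<and> (\<forall>z\<in>V. h0 z = 0 \<and> h1 z = 0 \<and> h2 z = 0 \<and> h3 z = 0))"
    by (rule cubic_flat_fun[OF hh]; (rule tr | rule van; assumption))
  ultimately have "T K = 0" by argo
  then have K0: "K z0 = 0" using T_00[of K] by (simp flip: cst_0)
  have "p \<in> chart k ` U" "\<forall>i j. i + j \<le> 0 \<longrightarrow> pd i j K (chartinv k p) = 0"
    using z0U K0 by (simp_all add: pz pd_def)
  with k d sum rs nbh(3) show ?thesis unfolding wc_vanish_def by (intro bexI[of _ k] exI conjI)
qed

section \<open>Cyclic symmetry of the three foliations\<close>

lemma linear_3web_rotate: "linear_3web M l1 l2 l3 \<Longrightarrow> linear_3web M l2 l3 l1"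
  unfolding linear_3web_def by metis

text \<open>As the forms add up to zero,
  \<open>\<omega>2 \<and> \<omega>3 = \<omega>1 \<and> \<omega>2\<close>, so the same connection and
  curvature serve the rotated web.\<close>

lemma wc_vanish_rotate:
  assumes "wc_vanish M l1 l2 l3 p n" shows "wc_vanish M l2 l3 l1 p n"
proof -
  obtain k U a1 b1 a2 b2 a3 b3 r s K where k: "k \<in> {0,1,2}" and w:
    "p \<in> chart k ` U" "chart k ` U \<subseteq> M"
    "defines_fol k l1 U a1 b1" "defines_fol k l2 U a2 b2" "defines_fol k l3 U a3 b3"
    "\<forall>z\<in>U. a1 z + a2 z + a3 z = 0 \<and> b1 z + b2 z + b3 z = 0"
    "holo2 r U" "holo2 s U" "holo2 K U"
    "structure_eq U a1 b1 r s" "structure_eq U a2 b2 r s" "structure_eq U a3 b3 r s"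
    "\<forall>z\<in>U. pdx s z - pdy r z = K z * (a1 z * b2 z - b1 z * a2 z)"
    "\<forall>i j. i + j \<le> n \<longrightarrow> pd i j K (chartinv k p) = 0"
    using assms unfolding wc_vanish_def by (elim bexE exE conjE) (rule that; assumption)
  have s: "\<forall>z\<in>U. a2 z + a3 z + a1 z = 0 \<and> b2 z + b3 z + b1 z = 0" using w(6) by (simp add: add_ac)
  have c: "\<forall>z\<in>U. pdx s z - pdy r z = K z * (a2 z * b3 z - b2 z * a3 z)"
  proof
    fix z assume z: "z \<in> U"
    have "a3 z + (a1 z + a2 z) = 0" "b3 z + (b1 z + b2 z) = 0" using bspec[OF w(6) z] by (simp_all only: add.commute[of _ "_ + _"])
    then have e: "a3 z = - (a1 z + a2 z)" "b3 z = - (b1 z + b2 z)" unfolding eq_neg_iff_add_eq_0 by simp_all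
    have "a2 z * b3 z - b2 z * a3 z = a1 z * b2 z - b1 z * a2 z" unfolding e by (simp add: algebra_simps)
    then show "pdx s z - pdy r z = K z * (a2 z * b3 z - b2 z * a3 z)" using w(13) z by simp
  qed
  show ?thesis unfolding wc_vanish_def using k w(1-5,7-12,14) s c by (intro bexI[of _ k] exI conjI)
qed

text \<open>Both local alternatives extend over the connected set \<open>M\<close> by analytic
  continuation. The projective one contradicts distinctness; the cubic one yields algebraicity and,
  through it, zero curvature at every point.\<close>

lemma vanishing_curvature_algebraic:
  assumes web: "linear_3web M l1 l2 l3" and conn: "P2connected M" and x0: "x0 \<in> M" and lin: "linearization M l1 l2 l3 \<phi>"
    and distinct: "\<not> (\<exists>A :: complex^3^3. invertible A \<and> (\<forall>p\<in>M. \<phi> p = ptrans A p))"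
    and wc: "wc_vanish M l1 l2 l3 x0 n"
    and cases: "n = 3 \<or> n = 2 \<and> is_pencil M l1 \<or> n = 1 \<and> is_pencil M l1 \<and> is_pencil M l2"
  shows "(\<forall>p\<in>M. wc_vanish M l1 l2 l3 p 0) \<and> algebraic_web M l1 l2 l3"
proof -
  have M: "P2open M" and lf: "lin_fol M l1" "lin_fol M l2" "lin_fol M l3" using web by (auto simp: linear_3web_def)
  have imm: "holo_immersion_on M \<phi>" using lin by (simp add: linearization_def)
  obtain N where N: "P2open N" "x0 \<in> N" "(\<exists>A. invertible A \<and> (\<forall>p\<in>N. \<phi> p = ptrans A p))
     \<or> (\<exists>F. cubic_form F \<and> (\<exists>v. F v \<noteq> 0) \<and> (\<forall>p\<in>N. F (rep (l1 p)) = 0 \<and> F (rep (l2 p)) = 0 \<and> F (rep (l3 p)) = 0))"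
    using local_dichotomy[OF web lin wc cases] by (elim exE conjE) (rule that; assumption)
  from N(3) show ?thesis
  proof
    assume "\<exists>A. invertible A \<and> (\<forall>p\<in>N. \<phi> p = ptrans A p)"
    then obtain A where A: "invertible A" "\<forall>p\<in>N. \<phi> p = ptrans A p" by blast
    have "\<phi> p = ptrans A p" if "p \<in> M" for p
      by (rule projective_everywhere[OF conn M N(1,2) x0 imm A(1) bspec[OF A(2)] that])
    then show ?thesis using distinct A(1) by blast
  next
    assume "\<exists>F. cubic_form F \<and> (\<exists>v. F v \<noteq> 0) \<and> (\<forall>p\<in>N. F (rep (l1 p)) = 0 \<and> F (rep (l2 p)) = 0 \<and> F (rep (l3 p)) = 0)"
    then obtain F v where F: "cubic_form F" "F v \<noteq> 0" "\<forall>p\<in>N. F (rep (l1 p)) = 0 \<and> F (rep (l2 p)) = 0 \<and> F (rep (l3 p)) = 0" by blast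
    have z: "F (rep (l1 p)) = 0 \<and> F (rep (l2 p)) = 0 \<and> F (rep (l3 p)) = 0" if p: "p \<in> M" for p
    proof (intro conjI)
      show "F (rep (l1 p)) = 0" by (rule foliation_on_cubic[OF conn M N(1,2) x0 lf(1) F(1) _ p]) (use F(3) in blast)
      show "F (rep (l2 p)) = 0" by (rule foliation_on_cubic[OF conn M N(1,2) x0 lf(2) F(1) _ p]) (use F(3) in blast)
      show "F (rep (l3 p)) = 0" by (rule foliation_on_cubic[OF conn M N(1,2) x0 lf(3) F(1) _ p]) (use F(3) in blast)
    qed
    have "algebraic_web M l1 l2 l3" unfolding algebraic_web_def
      using reduced_cubicI[OF F(1,2) web x0 z] z by blast
    moreover have "wc_vanish M l1 l2 l3 p 0" if "p \<in> M" for p by (rule cubic_web_flat[OF web F(1,2) z that])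
    ultimately show ?thesis by blast
  qed
qed

theorem theorem4p1:
  fixes M :: "P2 set" and l1 l2 l3 \<phi> :: "P2 \<Rightarrow> P2" and x0 :: P2
  assumes web: "linear_3web M l1 l2 l3"
    and conn: "P2connected M"
    and x0: "x0 \<in> M"
    and lin: "linearization M l1 l2 l3 \<phi>"
    and distinct: "\<not> (\<exists>A :: complex^3^3. invertible A \<and> (\<forall>p\<in>M. \<phi> p = ptrans A p))"
  shows "(wc_vanish M l1 l2 l3 x0 3 \<longrightarrow>
            (\<forall>p\<in>M. wc_vanish M l1 l2 l3 p 0) \<and> algebraic_web M l1 l2 l3)
       \<and> ((is_pencil M l1 \<or> is_pencil M l2 \<or> is_pencil M l3) \<and> wc_vanish M l1 l2 l3 x0 2 \<longrightarrow>
            (\<forall>p\<in>M. wc_vanish M l1 l2 l3 p 0) \<and> algebraic_web M l1 l2 l3)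
       \<and> (((is_pencil M l1 \<and> is_pencil M l2) \<or> (is_pencil M l1 \<and> is_pencil M l3)
              \<or> (is_pencil M l2 \<and> is_pencil M l3)) \<and> wc_vanish M l1 l2 l3 x0 1 \<longrightarrow>
            (\<forall>p\<in>M. wc_vanish M l1 l2 l3 p 0) \<and> algebraic_web M l1 l2 l3)"
proof -
  define C where "C \<longleftrightarrow> (\<forall>p\<in>M. wc_vanish M l1 l2 l3 p 0) \<and> algebraic_web M l1 l2 l3"
  have alg: "algebraic_web M l1 l2 l3 \<longleftrightarrow> algebraic_web M l2 l3 l1" "algebraic_web M l1 l2 l3 \<longleftrightarrow> algebraic_web M l3 l1 l2"
    unfolding algebraic_web_def by metis+
  have lin2: "linearization M l2 l3 l1 \<phi>" and lin3: "linearization M l3 l1 l2 \<phi>" using lin by (auto simp: linearization_def)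
  have web2: "linear_3web M l2 l3 l1" using web by (rule linear_3web_rotate)
  have web3: "linear_3web M l3 l1 l2" using web2 by (rule linear_3web_rotate)
  \<comment> \<open>The three rotations cover each choice of one pencil and, as the pairs (1,2),
    (2,3), (3,1), each choice of two.\<close>
  have 1: C if "wc_vanish M l1 l2 l3 x0 n" "n = 3 \<or> n = 2 \<and> is_pencil M l1 \<or> n = 1 \<and> is_pencil M l1 \<and> is_pencil M l2" for n
    unfolding C_def by (rule vanishing_curvature_algebraic[OF web conn x0 lin distinct that])
  have 2: C if "wc_vanish M l1 l2 l3 x0 n" "n = 3 \<or> n = 2 \<and> is_pencil M l2 \<or> n = 1 \<and> is_pencil M l2 \<and> is_pencil M l3" for n
    unfolding C_def alg(1)
    using vanishing_curvature_algebraic[OF web2 conn x0 lin2 distinct wc_vanish_rotate[OF that(1)] that(2)]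
      wc_vanish_rotate[OF wc_vanish_rotate, of M l2 l3 l1] by blast
  have 3: C if "wc_vanish M l1 l2 l3 x0 n" "n = 3 \<or> n = 2 \<and> is_pencil M l3 \<or> n = 1 \<and> is_pencil M l3 \<and> is_pencil M l1" for n
    unfolding C_def alg(2)
    using vanishing_curvature_algebraic[OF web3 conn x0 lin3 distinct wc_vanish_rotate[OF wc_vanish_rotate[OF that(1)]] that(2)]
      wc_vanish_rotate[of M l3 l1 l2] by blast
  show ?thesis unfolding C_def[symmetric]
  proof (intro conjI impI)
    show C if "wc_vanish M l1 l2 l3 x0 3" using 1[OF that] by simp
    show C if "(is_pencil M l1 \<or> is_pencil M l2 \<or> is_pencil M l3) \<and> wc_vanish M l1 l2 l3 x0 2"
      using that 1[of 2] 2[of 2] 3[of 2] by auto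
    show C if "((is_pencil M l1 \<and> is_pencil M l2) \<or> (is_pencil M l1 \<and> is_pencil M l3)
              \<or> (is_pencil M l2 \<and> is_pencil M l3)) \<and> wc_vanish M l1 l2 l3 x0 1"
      using that 1[of 1] 2[of 1] 3[of 1] by auto
  qed
qed

end
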